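(* Let $(M,H)$ be an $n$-dimensional Carnot manifold, $a\in M$, and $(X_1,\ldots,X_n)$ an $H$-frame near $a$. The systems of Carnot coordinates at $a$ adapted to $(X_1,\ldots,X_n)$ are exactly the coordinate systems defined by local charts of the form $(\mathrm{id}+\Theta)\circ\varepsilon_{\kappa(a)}\circ\kappa$, where $\kappa$ is a local chart near $a$ such that $\kappa(a)=0$, $\varepsilon_{\kappa(a)}$ is the $\varepsilon$-Carnot coordinate map at $a$ associated with the coordinates defined by $\kappa$ and the $H$-frame, and $\Theta$ is a smooth $\mathrm{O}_w(\|x\|^{w+1})$-map near the origin $0\in\mathbb{R}^n$.
   Context: A Carnot manifold of step $r$ is a smooth manifold $M$ ($\dim M=n$) with a filtration by subbundles $H_1\subset\cdots\subset H_r=TM$ such that the Lie bracket of local sections of $H_w$ and $H_{w'}$ is a section of $H_{w+w'}$ whenever $w+w'\le r$. Its weights are $w_j=\min\{w:\ j\le \mathrm{rk}\,H_w\}$, $1\le j\le n$. An $H$-frame near $a$ is a tangent frame $(X_1,\ldots,X_n)$ near $a$ with each $X_j$ a section of $H_{w_j}$; then $[X_i,X_j]=\sum_{w_k\le w_i+w_j}L_{ij}^k X_k$ with smooth functions $L_{ij}^k$ near $a$. For $\alpha\in\mathbb{N}_0^n$: $|\alpha|=\sum\alpha_j$, $\langle\alpha\rangle=\sum w_j\alpha_j$. Coordinate systems are considered near $a$, up to shrinking their domains. Dilations on $\mathbb{R}^n$: $\delta_t(x)=t\cdot x=(t^{w_1}x_1,\ldots,t^{w_n}x_n)$. For a vector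 field $X=\sum a_j(x)\partial_j$, $\delta_t^*X=\sum_j t^{-w_j}a_j(t\cdot x)\partial_j$. $\|\cdot\|$ is a pseudo-norm, i.e. a continuous function on $\mathbb{R}^n$, positive off $0$, with $\|t\cdot x\|=|t|\,\|x\|$, e.g. $\|x\|=\sum_j|x_j|^{1/w_j}$. A smooth map $\Theta=(\Theta_1,\ldots,\Theta_n)$ near $0$ is $\mathrm{O}_w(\|x\|^{w+m})$ if $\Theta_k(x)=\mathrm{O}(\|x\|^{w_k+m})$ near $x=0$ for every $k$. Order and privileged coordinates: for $I=(i_1,\ldots,i_k)$, $k\ge 0$, put $X_I=X_{i_1}\cdots X_{i_k}$, $\langle I\rangle=w_{i_1}+\cdots+w_{i_k}$. A smooth $f$ near $a$ has order $N$ at $a$ if $X_If(a)=0$ whenever $\langle I\rangle<N$ and $X_If(a)\ne0$ for some $I$ with $\langle I\rangle=N$. Local coordinates centered at $a$ are linearly adapted to the $H$-frame if $X_j(0)=\partial_j$ for all $j$; they are privileged coordinates at $a$ adapted to $(X_1,\ldots,X_n)$ if moreover each coordinate $x_j$ has order $w_j$ at $a$. In privileged coordinates, $t^{w_j}\delta_t^*X_j$ converges as $t\to0$ ($C^\infty$ uniformly on compact sets) to a polynomial vector field $X_j^{(a)}$ on $\mathbb{R}^n$, the model vector field of $X_j$. The group $G(a)$: equip $\mathbb{R}^n$, with canonical basis $(\epsilon_j)$, with the nilpotent Lie bracket $[\epsilon_i,\epsilon_j]=\sum_{w_k=w_i+w_j}L_{ij}^k(a)\epsilon_k$ (zero if $w_i+w_j>r$).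 $G(a)$ is $\mathbb{R}^n$ with the Dynkin (Baker-Campbell-Hausdorff) product $x\cdot y=x+y+\frac12[x,y]+\frac1{12}([x,[x,y]]+[y,[y,x]])+\cdots$ (finite sum). $X_j^a$ is the left-invariant vector field on $G(a)$ with $X_j^a(0)=\partial_j$. Carnot coordinates at $a$ adapted to $(X_1,\ldots,X_n)$ are privileged coordinates at $a$ adapted to $(X_1,\ldots,X_n)$ in which the model vector field of $X_j$ is $X_j^a$ for every $j$. The $\varepsilon$-Carnot coordinate map: given local coordinates near $a$, $T_a$ is the unique affine map such that $x\mapsto T_a(x)$ gives coordinates centered at $a$ and linearly adapted to the $H$-frame. Starting from the latter coordinates there is (known fact) a unique polynomial change of coordinates $\hat\psi_a$ with components $\hat\psi_{a}(y)_k=y_k+\sum_{\langle\alpha\rangle<w_k,\,|\alpha|\ge2}a_{k\alpha}y^\alpha$, $a_{k\alpha}\in\mathbb{R}$, which produces privileged coordinates at $a$ adapted to the $H$-frame. Put $\psi_a=\hat\psi_a\circ T_a$; let $X_j^{(a)}$ be the model vector fields in the privileged coordinates given by $\psi_a$, and let $\exp_{X^{(a)}}(x)$ be the time-one flow of $x_1X_1^{(a)}+\cdots+x_nX_n^{(a)}$ starting at $0$ (a polynomial diffeomorphism of $\mathbb{R}^n$). Then $\varepsilon_a=\exp_{X^{(a)}}^{-1}\circ\psi_a$. When the coordinates are given by a chart $\kappa$, the base point $a$ is represented by $\kappa(a)$ and the map is written $\varepsilon_{\kappa(a)}$.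
   Formalization: Since an O_w(‖x‖^{w+1}) map may have linear terms that destroy linear adaptedness, the equivalence is proved with Θ'(0)=0 added; for arbitrary such Θ it is proved with the condition X_j(0)=∂_j dropped from the definition of Carnot coordinates. *)

theory Defs
  imports "HOL-Analysis.Analysis"
begin

text \<open>Only used on open sets \<open>S\<close>.  In finite dimensions this is the usual notion, since the
  functions \<open>x \<mapsto> Df(x)v\<close>, \<open>v\<close> fixed, determine the derivative.\<close>

primrec Ck_on :: "nat \<Rightarrow> 'a::real_normed_vector set \<Rightarrow> ('a \<Rightarrow> 'b::real_normed_vector) \<Rightarrow> bool" where
  "Ck_on 0 S f \<longleftrightarrow> continuous_on S f"
| "Ck_on (Suc k) S f \<longleftrightarrow>
     (\<forall>x\<in>S. f differentiable (at x)) \<and> (\<forall>v. Ck_on k S (\<lambda>x. frechet_derivative f (at x) v))"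

definition smooth_on :: "'a::real_normed_vector set \<Rightarrow> ('a \<Rightarrow> 'b::real_normed_vector) \<Rightarrow> bool" where
  "smooth_on S f \<longleftrightarrow> (\<forall>k. Ck_on k S f)"

definition smooth_around :: "'a::real_normed_vector \<Rightarrow> ('a \<Rightarrow> 'b::real_normed_vector) \<Rightarrow> bool" where
  "smooth_around x f \<longleftrightarrow> (\<exists>W. open W \<and> x \<in> W \<and> smooth_on W f)"

fun iterated_derivative ::
    "'a list \<Rightarrow> ('a::real_normed_vector \<Rightarrow> 'b::real_normed_vector) \<Rightarrow> 'a \<Rightarrow> 'b" where
  "iterated_derivative [] f = f"
| "iterated_derivative (v # vs) f =
     (\<lambda>x. frechet_derivative (iterated_derivative vs f) (at x) v)"

text \<open>The manifold is a whole (Hausdorff, second countable) type \<open>'m\<close>, its dimension is the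
  number of elements of \<open>'n\<close>.  A chart is a pair \<open>(U, \<kappa>)\<close>; only the values of \<open>\<kappa>\<close> on \<open>U\<close> matter.
  The smooth structure is given by an atlas \<open>A\<close>, not necessarily maximal.\<close>

type_synonym ('m, 'n) chart = "'m set \<times> ('m \<Rightarrow> real ^ 'n)"

definition topological_chart :: "('m::topological_space, 'n::finite) chart \<Rightarrow> bool" where
  "topological_chart = (\<lambda>(U, \<kappa>).
     open U \<and> open (\<kappa> ` U) \<and> homeomorphism U (\<kappa> ` U) \<kappa> (inv_into U \<kappa>))"

definition smoothly_compatible ::
    "('m::topological_space, 'n::finite) chart \<Rightarrow> ('m, 'n) chart \<Rightarrow> bool" where
  "smoothly_compatible = (\<lambda>(U, \<kappa>) (V, \<mu>).
     smooth_on (\<kappa> ` (U \<inter> V)) (\<mu> \<circ> inv_into U \<kappa>) \<and>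
     smooth_on (\<mu> ` (U \<inter> V)) (\<kappa> \<circ> inv_into V \<mu>))"

definition smooth_atlas :: "('m::topological_space, 'n::finite) chart set \<Rightarrow> bool" where
  "smooth_atlas A \<longleftrightarrow>
     (\<forall>c\<in>A. topological_chart c) \<and> (\<Union>c\<in>A. fst c) = UNIV \<and>
     (\<forall>c\<in>A. \<forall>d\<in>A. smoothly_compatible c d)"

text \<open>The maximal atlas generated by \<open>A\<close>.\<close>

definition charts ::
    "('m::topological_space, 'n::finite) chart set \<Rightarrow> ('m, 'n) chart set" where
  "charts A = {c. topological_chart c \<and> (\<forall>d\<in>A. smoothly_compatible c d)}"

text \<open>Coordinate systems near \<open>a\<close> are taken up to shrinking of their domain, so \<open>\<phi>\<close> is only
  required to restrict to a chart on some neighbourhood of \<open>a\<close>.\<close>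

definition local_chart ::
    "('m::topological_space, 'n::finite) chart set \<Rightarrow> 'm \<Rightarrow> ('m \<Rightarrow> real ^ 'n) \<Rightarrow> bool" where
  "local_chart A a \<phi> \<longleftrightarrow> (\<exists>U. a \<in> U \<and> (U, \<phi>) \<in> charts A)"

definition smooth_near ::
    "('m::topological_space, 'n::finite) chart set \<Rightarrow> 'm \<Rightarrow> ('m \<Rightarrow> real) \<Rightarrow> bool" where
  "smooth_near A p f \<longleftrightarrow>
     (\<exists>(U, \<kappa>)\<in>charts A. p \<in> U \<and> smooth_on (\<kappa> ` U) (f \<circ> inv_into U \<kappa>))"

text \<open>A tangent vector at \<open>p\<close> is a directional derivative operator on the functions that are
  smooth near \<open>p\<close>.  It is set to \<open>0\<close> on all other functions, so that tangent vectors
  which agree on smooth functions are equal.\<close>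

type_synonym 'm tangent_vector = "('m \<Rightarrow> real) \<Rightarrow> real"

type_synonym 'm vfield = "'m \<Rightarrow> 'm tangent_vector"

definition tangent_space ::
    "('m::topological_space, 'n::finite) chart set \<Rightarrow> 'm \<Rightarrow> 'm tangent_vector set" where
  "tangent_space A p =
     {v. \<exists>(U, \<kappa>)\<in>charts A. p \<in> U \<and>
        (\<exists>u. \<forall>f. v f = (if smooth_near A p f
                       then frechet_derivative (f \<circ> inv_into U \<kappa>) (at (\<kappa> p)) u else 0))}"

definition is_basis ::
    "'i set \<Rightarrow> ('i \<Rightarrow> 'm tangent_vector) \<Rightarrow> 'm tangent_vector set \<Rightarrow> bool" where
  "is_basis I v E \<longleftrightarrow>
     E = {\<lambda>f. \<Sum>i\<in>I. c i * v i f |c. True} \<and>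
     (\<forall>c. (\<forall>f. (\<Sum>i\<in>I. c i * v i f) = 0) \<longrightarrow> (\<forall>i\<in>I. c i = 0))"

definition smooth_vfield ::
    "('m::topological_space, 'n::finite) chart set \<Rightarrow> 'm set \<Rightarrow> 'm vfield \<Rightarrow> bool" where
  "smooth_vfield A V X \<longleftrightarrow>
     (\<forall>p\<in>V. X p \<in> tangent_space A p) \<and>
     (\<forall>p\<in>V. \<forall>f. smooth_near A p f \<longrightarrow> smooth_near A p (\<lambda>q. X q f))"

definition local_section ::
    "('m::topological_space, 'n::finite) chart set \<Rightarrow> ('m \<Rightarrow> 'm tangent_vector set) \<Rightarrow>
     'm set \<Rightarrow> 'm vfield \<Rightarrow> bool" where
  "local_section A E V X \<longleftrightarrow> smooth_vfield A V X \<and> (\<forall>p\<in>V. X p \<in> E p)"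

definition lie_bracket ::
    "('m::topological_space, 'n::finite) chart set \<Rightarrow> 'm vfield \<Rightarrow> 'm vfield \<Rightarrow> 'm vfield" where
  "lie_bracket A X Y = (\<lambda>p f.
     if smooth_near A p f then X p (\<lambda>q. Y q f) - Y p (\<lambda>q. X q f) else 0)"

definition subbundle ::
    "('m::topological_space, 'n::finite) chart set \<Rightarrow> ('m \<Rightarrow> 'm tangent_vector set) \<Rightarrow>
     nat \<Rightarrow> bool" where
  "subbundle A E d \<longleftrightarrow>
     (\<forall>p. \<exists>V Y. open V \<and> p \<in> V \<and> (\<forall>i<d. smooth_vfield A V (Y i)) \<and>
        (\<forall>q\<in>V. is_basis {..<d} (\<lambda>i. Y i q) (E q)))"

definition bundle_rank ::
    "('m::topological_space, 'n::finite) chart set \<Rightarrow> ('m \<Rightarrow> 'm tangent_vector set) \<Rightarrow> nat" where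
  "bundle_rank A E = (THE d. subbundle A E d)"

text \<open>Only \<open>H w\<close> with \<open>1 \<le> w \<le> r\<close> is relevant.\<close>

definition carnot_manifold ::
    "('m::{t2_space, second_countable_topology}, 'n::{finite, linorder}) chart set \<Rightarrow> nat \<Rightarrow>
     (nat \<Rightarrow> 'm \<Rightarrow> 'm tangent_vector set) \<Rightarrow> bool" where
  "carnot_manifold A r H \<longleftrightarrow>
     smooth_atlas A \<and> 1 \<le> r \<and>
     (\<forall>w\<in>{1..r}. \<exists>d. subbundle A (H w) d) \<and>
     (\<forall>w\<in>{1..<r}. \<forall>p. H w p \<subseteq> H (Suc w) p) \<and>
     (\<forall>p. H r p = tangent_space A p) \<and>
     (\<forall>w\<in>{1..r}. \<forall>w'\<in>{1..r}. w + w' \<le> r \<longrightarrow>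
        (\<forall>V X Y. open V \<and> local_section A (H w) V X \<and> local_section A (H w') V Y \<longrightarrow>
           local_section A (H (w + w')) V (lie_bracket A X Y)))"

text \<open>The index type \<open>'n\<close> plays the role of \<open>{1, \<dots>, n}\<close>: the position of the index \<open>j\<close> is
  \<open>card {..j}\<close>.\<close>

definition weight ::
    "('m::{t2_space, second_countable_topology}, 'n::{finite, linorder}) chart set \<Rightarrow>
     (nat \<Rightarrow> 'm \<Rightarrow> 'm tangent_vector set) \<Rightarrow> 'n \<Rightarrow> nat" where
  "weight A H j = (LEAST w. 1 \<le> w \<and> card {..j} \<le> bundle_rank A (H w))"

definition H_frame ::
    "('m::{t2_space, second_countable_topology}, 'n::{finite, linorder}) chart set \<Rightarrow>
     (nat \<Rightarrow> 'm \<Rightarrow> 'm tangent_vector set) \<Rightarrow> 'm \<Rightarrow> ('n \<Rightarrow> 'm vfield) \<Rightarrow> bool" where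
  "H_frame A H a X \<longleftrightarrow>
     (\<exists>V. open V \<and> a \<in> V \<and>
        (\<forall>j. local_section A (H (weight A H j)) V (X j)) \<and>
        (\<forall>q\<in>V. is_basis UNIV (\<lambda>j. X j q) (tangent_space A q)))"

text \<open>\<open>structure_function A X i j p $ k\<close> is the coefficient of \<open>X k\<close> in the bracket of \<open>X i\<close> and
  \<open>X j\<close> at \<open>p\<close>.  For an \<open>H\<close>-frame it vanishes automatically when \<open>w_k > w_i + w_j\<close>.\<close>

definition structure_function ::
    "('m::topological_space, 'n::finite) chart set \<Rightarrow> ('n \<Rightarrow> 'm vfield) \<Rightarrow> 'n \<Rightarrow> 'n \<Rightarrow>
     'm \<Rightarrow> real ^ 'n" where
  "structure_function A X i j p =
     (THE c. \<forall>f. lie_bracket A (X i) (X j) p f = (\<Sum>k\<in>UNIV. c $ k * X k p f))"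

definition dilation :: "('n \<Rightarrow> nat) \<Rightarrow> real \<Rightarrow> real ^ 'n \<Rightarrow> real ^ 'n::finite" where
  "dilation w t x = (\<chi> j. t ^ w j * x $ j)"

definition dilation_pullback ::
    "('n \<Rightarrow> nat) \<Rightarrow> real \<Rightarrow> (real ^ 'n \<Rightarrow> real ^ 'n::finite) \<Rightarrow> real ^ 'n \<Rightarrow> real ^ 'n" where
  "dilation_pullback w t F x = (\<chi> j. inverse (t ^ w j) * F (dilation w t x) $ j)"

definition pseudo_norm :: "('n::finite \<Rightarrow> nat) \<Rightarrow> (real ^ 'n \<Rightarrow> real) \<Rightarrow> bool" where
  "pseudo_norm w N \<longleftrightarrow>
     continuous_on UNIV N \<and> (\<forall>x. x \<noteq> 0 \<longrightarrow> 0 < N x) \<and>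
     (\<forall>t x. N (dilation w t x) = \<bar>t\<bar> * N x)"

text \<open>Being \<open>weighted_O w N 1\<close> does not force the linear part of \<open>\<Theta>\<close> to vanish: since \<open>x_j\<close> is
  \<open>O(N x ^ w_j)\<close>, the component \<open>\<Theta>_k\<close> may contain \<open>x_j\<close> whenever \<open>w_j > w_k\<close>.  Composition with
  \<open>id + \<Theta>\<close> then destroys linear adaptedness to a frame.\<close>

definition weighted_O ::
    "('n::finite \<Rightarrow> nat) \<Rightarrow> (real ^ 'n \<Rightarrow> real) \<Rightarrow> nat \<Rightarrow> (real ^ 'n \<Rightarrow> real ^ 'n) \<Rightarrow> bool" where
  "weighted_O w N m \<Theta> \<longleftrightarrow> (\<forall>k. (\<lambda>x. \<Theta> x $ k) \<in> O[nhds 0](\<lambda>x. N x ^ (w k + m)))"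

definition frame_word :: "('n \<Rightarrow> 'm vfield) \<Rightarrow> 'n list \<Rightarrow> ('m \<Rightarrow> real) \<Rightarrow> 'm \<Rightarrow> real" where
  "frame_word X I f = foldr (\<lambda>i g. \<lambda>p. X i p g) I f"

definition has_order ::
    "('n \<Rightarrow> nat) \<Rightarrow> ('n \<Rightarrow> 'm vfield) \<Rightarrow> 'm \<Rightarrow> ('m \<Rightarrow> real) \<Rightarrow> nat \<Rightarrow> bool" where
  "has_order w X a f N \<longleftrightarrow>
     (\<forall>I. sum_list (map w I) < N \<longrightarrow> frame_word X I f a = 0) \<and>
     (\<exists>I. sum_list (map w I) = N \<and> frame_word X I f a \<noteq> 0)"

definition components :: "('m \<Rightarrow> real ^ 'n) \<Rightarrow> 'm tangent_vector \<Rightarrow> real ^ 'n::finite" where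
  "components \<phi> v = (\<chi> i. v (\<lambda>p. \<phi> p $ i))"

definition field_in_chart ::
    "('m, 'n::finite) chart \<Rightarrow> 'm vfield \<Rightarrow> real ^ 'n \<Rightarrow> real ^ 'n" where
  "field_in_chart = (\<lambda>(U, \<phi>) X x. components \<phi> (X (inv_into U \<phi> x)))"

definition linearly_adapted ::
    "('m::topological_space, 'n::finite) chart set \<Rightarrow> ('n \<Rightarrow> 'm vfield) \<Rightarrow> 'm \<Rightarrow>
     ('m \<Rightarrow> real ^ 'n) \<Rightarrow> bool" where
  "linearly_adapted A X a \<phi> \<longleftrightarrow>
     local_chart A a \<phi> \<and> \<phi> a = 0 \<and> (\<forall>j. components \<phi> (X j a) = axis j 1)"

definition privileged_coordinates ::
    "('m::{t2_space, second_countable_topology}, 'n::{finite, linorder}) chart set \<Rightarrow>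
     (nat \<Rightarrow> 'm \<Rightarrow> 'm tangent_vector set) \<Rightarrow> ('n \<Rightarrow> 'm vfield) \<Rightarrow> 'm \<Rightarrow>
     ('m \<Rightarrow> (real, 'n) vec) \<Rightarrow> bool" where
  "privileged_coordinates A H X a \<phi> \<longleftrightarrow>
     linearly_adapted A X a \<phi> \<and>
     (\<forall>j. has_order (weight A H) X a (\<lambda>p. \<phi> p $ j) (weight A H j))"

text \<open>\<open>Y\<close> is the limit of \<open>t ^ m\<close> times the dilation pullback of the vector field \<open>Z\<close>, read in the
  coordinates \<open>\<phi>\<close>, where \<open>m\<close> is the weight of \<open>Z\<close>; the convergence is uniform on compact sets for
  all derivatives.\<close>

definition is_model_field ::
    "('m::topological_space, 'n::finite) chart set \<Rightarrow> ('n \<Rightarrow> nat) \<Rightarrow> 'm \<Rightarrow> ('m \<Rightarrow> real ^ 'n) \<Rightarrow>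
     nat \<Rightarrow> 'm vfield \<Rightarrow> (real ^ 'n \<Rightarrow> real ^ 'n) \<Rightarrow> bool" where
  "is_model_field A w a \<phi> m Z Y \<longleftrightarrow>
     smooth_on UNIV Y \<and>
     (\<exists>U. a \<in> U \<and> (U, \<phi>) \<in> charts A \<and>
        (\<forall>vs K. compact K \<longrightarrow>
           uniform_limit K
             (\<lambda>t. iterated_derivative vs
                (\<lambda>x. t ^ m *\<^sub>R dilation_pullback w t (field_in_chart (U, \<phi>) Z) x))
             (iterated_derivative vs Y) (at 0)))"

definition model_field ::
    "('m::{t2_space, second_countable_topology}, 'n::{finite, linorder}) chart set \<Rightarrow>
     (nat \<Rightarrow> 'm \<Rightarrow> 'm tangent_vector set) \<Rightarrow> ('n \<Rightarrow> 'm vfield) \<Rightarrow> 'm \<Rightarrow>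
     ('m \<Rightarrow> (real, 'n) vec) \<Rightarrow> 'n \<Rightarrow> (real, 'n) vec \<Rightarrow> (real, 'n) vec" where
  "model_field A H X a \<phi> j =
     (THE Y. is_model_field A (weight A H) a \<phi> (weight A H j) (X j) Y)"

definition G_bracket ::
    "('m::{t2_space, second_countable_topology}, 'n::{finite, linorder}) chart set \<Rightarrow>
     (nat \<Rightarrow> 'm \<Rightarrow> 'm tangent_vector set) \<Rightarrow> ('n \<Rightarrow> 'm vfield) \<Rightarrow> 'm \<Rightarrow>
     (real, 'n) vec \<Rightarrow> (real, 'n) vec \<Rightarrow> (real, 'n) vec" where
  "G_bracket A H X a x y =
     (\<chi> k. \<Sum>i\<in>UNIV. \<Sum>j\<in>UNIV.
        if weight A H k = weight A H i + weight A H j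
        then x $ i * y $ j * structure_function A X i j a $ k else 0)"

fun iterated_bracket :: "('v \<Rightarrow> 'v \<Rightarrow> 'v) \<Rightarrow> 'v list \<Rightarrow> 'v::zero" where
  "iterated_bracket br [] = 0"
| "iterated_bracket br [x] = x"
| "iterated_bracket br (x # y # zs) = br x (iterated_bracket br (y # zs))"

text \<open>Dynkin's explicit form of the Baker-Campbell-Hausdorff series: the sum over
  \<open>(p_1, q_1), \<dots>, (p_l, q_l)\<close>, \<open>p_i + q_i > 0\<close>, of
  \<open>(-1)^(l-1) / l\<close> times \<open>1 / ((\<Sum> p_i + q_i) \<Prod> p_i! q_i!)\<close> times the right-nested bracket of the
  word \<open>x^p_1 y^q_1 \<dots> x^p_l y^q_l\<close>.  For a bracket that is nilpotent of step \<open>r\<close> all words of length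
  greater than \<open>r\<close> contribute \<open>0\<close>, hence the truncation.\<close>

definition dynkin_product ::
    "('v \<Rightarrow> 'v \<Rightarrow> 'v) \<Rightarrow> nat \<Rightarrow> 'v \<Rightarrow> 'v \<Rightarrow> 'v::real_vector" where
  "dynkin_product br r x y =
     (\<Sum>s | s \<noteq> [] \<and> (\<forall>(p, q)\<in>set s. 0 < p + q) \<and> (\<Sum>(p, q)\<leftarrow>s. p + q) \<le> r.
        ((-1) ^ (length s - 1) /
          (real (length s) * real (\<Sum>(p, q)\<leftarrow>s. p + q) * (\<Prod>(p, q)\<leftarrow>s. fact p * fact q))) *\<^sub>R
        iterated_bracket br (concat (map (\<lambda>(p, q). replicate p x @ replicate q y) s)))"

text \<open>The left-invariant vector field on \<open>G(a)\<close> generated by \<open>\<epsilon>_j\<close>: its value at \<open>x\<close> is the image of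
  \<open>\<epsilon>_j\<close> under the differential at \<open>0\<close> (the unit) of the left translation by \<open>x\<close>.\<close>

definition left_invariant_field ::
    "('m::{t2_space, second_countable_topology}, 'n::{finite, linorder}) chart set \<Rightarrow> nat \<Rightarrow>
     (nat \<Rightarrow> 'm \<Rightarrow> 'm tangent_vector set) \<Rightarrow> ('n \<Rightarrow> 'm vfield) \<Rightarrow> 'm \<Rightarrow>
     'n \<Rightarrow> (real, 'n) vec \<Rightarrow> (real, 'n) vec" where
  "left_invariant_field A r H X a j x =
     frechet_derivative (\<lambda>y. dynkin_product (G_bracket A H X a) r x y) (at 0) (axis j 1)"

definition carnot_coordinates ::
    "('m::{t2_space, second_countable_topology}, 'n::{finite, linorder}) chart set \<Rightarrow> nat \<Rightarrow>
     (nat \<Rightarrow> 'm \<Rightarrow> 'm tangent_vector set) \<Rightarrow> ('n \<Rightarrow> 'm vfield) \<Rightarrow> 'm \<Rightarrow>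
     ('m \<Rightarrow> (real, 'n) vec) \<Rightarrow> bool" where
  "carnot_coordinates A r H X a \<phi> \<longleftrightarrow>
     privileged_coordinates A H X a \<phi> \<and>
     (\<forall>j. is_model_field A (weight A H) a \<phi> (weight A H j) (X j)
            (left_invariant_field A r H X a j))"

definition adapting_affine_map ::
    "('m::topological_space, 'n::finite) chart set \<Rightarrow> ('n \<Rightarrow> 'm vfield) \<Rightarrow> 'm \<Rightarrow>
     ('m \<Rightarrow> real ^ 'n) \<Rightarrow> real ^ 'n \<Rightarrow> real ^ 'n" where
  "adapting_affine_map A X a \<kappa> =
     (THE T. (\<exists>B c. linear B \<and> T = (\<lambda>x. B x + c)) \<and> linearly_adapted A X a (T \<circ> \<kappa>))"

definition psi_hat_form :: "('n \<Rightarrow> nat) \<Rightarrow> (real ^ 'n \<Rightarrow> real ^ 'n::finite) \<Rightarrow> bool" where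
  "psi_hat_form w P \<longleftrightarrow>
     (\<exists>c :: 'n \<Rightarrow> ('n \<Rightarrow> nat) \<Rightarrow> real. \<forall>y k.
        P y $ k = y $ k +
          (\<Sum>\<alpha> | (\<Sum>j\<in>UNIV. w j * \<alpha> j) < w k \<and> 2 \<le> (\<Sum>j\<in>UNIV. \<alpha> j).
             c k \<alpha> * (\<Prod>j\<in>UNIV. y $ j ^ \<alpha> j)))"

definition psi_hat ::
    "('m::{t2_space, second_countable_topology}, 'n::{finite, linorder}) chart set \<Rightarrow>
     (nat \<Rightarrow> 'm \<Rightarrow> 'm tangent_vector set) \<Rightarrow> ('n \<Rightarrow> 'm vfield) \<Rightarrow> 'm \<Rightarrow>
     ('m \<Rightarrow> (real, 'n) vec) \<Rightarrow> (real, 'n) vec \<Rightarrow> (real, 'n) vec" where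
  "psi_hat A H X a \<phi> =
     (THE P. psi_hat_form (weight A H) P \<and> privileged_coordinates A H X a (P \<circ> \<phi>))"

definition psi_map ::
    "('m::{t2_space, second_countable_topology}, 'n::{finite, linorder}) chart set \<Rightarrow>
     (nat \<Rightarrow> 'm \<Rightarrow> 'm tangent_vector set) \<Rightarrow> ('n \<Rightarrow> 'm vfield) \<Rightarrow> 'm \<Rightarrow>
     ('m \<Rightarrow> (real, 'n) vec) \<Rightarrow> (real, 'n) vec \<Rightarrow> (real, 'n) vec" where
  "psi_map A H X a \<kappa> =
     (let T = adapting_affine_map A X a \<kappa> in psi_hat A H X a (T \<circ> \<kappa>) \<circ> T)"

definition exp_map ::
    "('n \<Rightarrow> real ^ 'n \<Rightarrow> real ^ 'n) \<Rightarrow> real ^ 'n \<Rightarrow> real ^ 'n::finite" where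
  "exp_map Y x =
     (THE z. \<exists>\<gamma>. \<gamma> 0 = 0 \<and> \<gamma> 1 = z \<and>
        (\<forall>t\<in>{0..1}. (\<gamma> has_vector_derivative (\<Sum>j\<in>UNIV. x $ j *\<^sub>R Y j (\<gamma> t)))
                       (at t within {0..1})))"

definition eps_map ::
    "('m::{t2_space, second_countable_topology}, 'n::{finite, linorder}) chart set \<Rightarrow>
     (nat \<Rightarrow> 'm \<Rightarrow> 'm tangent_vector set) \<Rightarrow> ('n \<Rightarrow> 'm vfield) \<Rightarrow> 'm \<Rightarrow>
     ('m \<Rightarrow> (real, 'n) vec) \<Rightarrow> (real, 'n) vec \<Rightarrow> (real, 'n) vec" where
  "eps_map A H X a \<kappa> =
     (let \<psi> = psi_map A H X a \<kappa>
      in inv (exp_map (model_field A H X a (\<psi> \<circ> \<kappa>))) \<circ> \<psi>)"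

end

theory Submission
  imports Defs "HOL-Library.Multiset" "HOL-Computational_Algebra.Formal_Power_Series"
begin

text \<open>In privileged coordinates \<open>t^{w_j} \<delta>_t\<^sup>* X_j\<close> converges to the model field as \<open>t \<rightarrow> 0\<close>.
  A change between two systems of privileged coordinates therefore has
  the form \<open>\<delta>_t \<circ> G(t, \<cdot>) \<circ> \<delta>_t^{-1}\<close> with \<open>G\<close> smooth across \<open>t = 0\<close>, and \<open>G(0, \<cdot>)\<close> intertwines the
  model fields.  If both models are the left-invariant fields \<open>X_j^a\<close>, then \<open>G(0, \<cdot>)\<close> fixes \<open>0\<close>
  and maps the integral curve \<open>s x\<close> of \<open>\<Sum> x_j X_j^a\<close> to an integral curve of the same field, so it
  is the identity: the change is \<open>id\<close> plus an \<open>O_w(\<parallel>x\<parallel>^{w+1})\<close> map.  Conversely such a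
  change does not affect the models.  That \<open>\<epsilon>_a\<close> gives Carnot coordinates amounts to the formula
  \<open>d exp_x (X_j^a(x)) = X_j^{(a)}(exp x)\<close>, where \<open>X_j^a(x)\<close>, computed from Dynkin's
  series, is \<open>\<phi>(ad x) \<epsilon>_j\<close> with \<open>\<phi>(z) = z / (1 - e^{-z})\<close>, the reciprocal of the series that
  describes the differential of the exponential map.\<close>

subsection \<open>Smooth functions\<close>

text \<open>Coordinates are germs at \<open>0\<close>, so \<open>f (\<delta>_t x)\<close> makes
  sense only for \<open>t\<close> small depending on \<open>x\<close>. Hence all families
  \<open>G (t, x)\<close> are studied near the slice \<open>t = 0\<close>, and identities valid for
  \<open>t \<noteq> 0\<close> pass to the slice by continuity. The obstacle behind the quoted form
  of a coordinate change is that order is defined by words in the frame, whereas dilations see the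
  weights of the coordinates; \<open>frame_order_imp_worder\<close> bridges the two. Homogeneity
  supplies the analysis: a component of weight \<open>m\<close> of a model field involves only
  variables of weight below \<open>m\<close>, so existence, uniqueness and differentiation of the
  flow are inductions on the weight, and local inverses become global through dilations. The
  function \<open>z / (1 - e^{-z})\<close> comes out of Dynkin's series because only the words
  \<open>x^m y\<close> and \<open>x^m y x\<close> contribute to first order in \<open>y\<close>;
  their coefficients are summed with formal power series.\<close>

lemma has_derivative_cong_nhds:
  assumes "\<forall>\<^sub>F y in nhds x. f y = g y"
  shows "(f has_derivative f') (at x) \<longleftrightarrow> (g has_derivative f') (at x)"
proof -
  have *: "f x = g x" using eventually_nhds_x_imp_x[OF assms] .
  moreover have ev: "\<forall>\<^sub>F y in at x. f y = g y"
    using assms by (auto simp: eventually_at_filter elim: eventually_mono)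
  moreover have ev': "\<forall>\<^sub>F y in at x. g y = f y" using ev by (rule eventually_mono) simp
  ultimately show ?thesis
    using has_derivative_transform_eventually[OF _ ev *, of f'] has_derivative_transform_eventually[OF _ ev' *[symmetric], of f']
    by auto
qed

lemma frechet_derivative_cong_nhds:
  assumes "\<forall>\<^sub>F y in nhds x. f y = g y"
  shows "frechet_derivative f (at x) = frechet_derivative g (at x)"
  unfolding frechet_derivative_def using has_derivative_cong_nhds[OF assms] by simp

lemma differentiable_cong_nhds:
  assumes "\<forall>\<^sub>F y in nhds x. f y = g y" "f differentiable (at x)"
  shows "g differentiable (at x)"
  using assms has_derivative_cong_nhds[OF assms(1)] unfolding differentiable_def by blast

lemma frechet_derivativeI: "(f has_derivative f') (at x) \<Longrightarrow> frechet_derivative f (at x) = f'"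
  by (metis frechet_derivative_at)

lemma Ck_on_cong:
  assumes "open S" "\<And>x. x \<in> S \<Longrightarrow> f x = g x" "Ck_on k S f"
  shows "Ck_on k S g"
  using assms(2,3)
proof (induction k arbitrary: f g)
  case 0 then show ?case using continuous_on_cong by fastforce
next
  case (Suc k)
  have ev: "\<forall>\<^sub>F y in nhds x. f y = g y" if "x \<in> S" for x
    using assms(1) that Suc.prems(1) by (auto simp: eventually_nhds)
  show ?case unfolding Ck_on.simps
  proof (intro conjI ballI allI)
    fix x assume "x \<in> S"
    then show "g differentiable at x" using Suc.prems(2) differentiable_cong_nhds[OF ev] by auto
  next
    fix v
    show "Ck_on k S (\<lambda>x. frechet_derivative g (at x) v)"
      by (rule Suc.IH[of "\<lambda>x. frechet_derivative f (at x) v"])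
         (use Suc.prems frechet_derivative_cong_nhds[OF ev] in auto)
  qed
qed

lemma Ck_on_SucI:
  assumes "open S" "\<And>x. x \<in> S \<Longrightarrow> (f has_derivative f' x) (at x)"
    "\<And>v. Ck_on k S (\<lambda>x. f' x v)"
  shows "Ck_on (Suc k) S f"
  unfolding Ck_on.simps
proof (intro conjI ballI allI)
  fix v show "Ck_on k S (\<lambda>x. frechet_derivative f (at x) v)"
    by (rule Ck_on_cong[OF assms(1) _ assms(3)[of v]]) (use frechet_derivativeI[OF assms(2)] in simp)
qed (use assms(2) in \<open>auto simp: differentiable_def\<close>)

lemma Ck_on_SucD:
  assumes "Ck_on (Suc k) S f"
  shows "x \<in> S \<Longrightarrow> (f has_derivative frechet_derivative f (at x)) (at x)"
    "Ck_on k S (\<lambda>x. frechet_derivative f (at x) v)"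
  using assms by (auto simp: frechet_derivative_works)

lemma Ck_on_Suc_imp: "Ck_on (Suc k) S f \<Longrightarrow> Ck_on k S f"
proof (induction k arbitrary: f)
  case 0 then show ?case
    by (auto intro!: continuous_at_imp_continuous_on differentiable_imp_continuous_within)
next
  case (Suc k) then show ?case by (metis Ck_on.simps(2))
qed

lemma Ck_on_subset: "Ck_on k S f \<Longrightarrow> T \<subseteq> S \<Longrightarrow> Ck_on k T f"
  by (induction k arbitrary: f) (auto intro: continuous_on_subset)

lemma Ck_on_open_cover:
  assumes "\<And>x. x \<in> S \<Longrightarrow> \<exists>W. open W \<and> x \<in> W \<and> Ck_on k W f"
  shows "Ck_on k S f"
  using assms
proof (induction k arbitrary: f)
  case 0
  show ?case unfolding Ck_on.simps
  proof (rule continuous_at_imp_continuous_on, rule ballI)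
    fix x assume "x \<in> S"
    then obtain W where W: "open W" "x \<in> W" "continuous_on W f" using 0 by auto
    then show "isCont f x" using continuous_on_eq_continuous_at by blast
  qed
next
  case (Suc k)
  have "Ck_on k S (\<lambda>x. frechet_derivative f (at x) v)" for v
    using Suc.prems by (intro Suc.IH) (metis Ck_on.simps(2))
  then show ?case using Suc.prems by fastforce
qed

lemma Ck_on_const: "open S \<Longrightarrow> Ck_on k S (\<lambda>x. c)"
  by (induction k arbitrary: c) (auto intro!: Ck_on_SucI[where f'="\<lambda>_ _. 0"] simp del: Ck_on.simps(2))

lemma Ck_on_bounded_linear_comp:
  assumes "bounded_linear L" "open S" "Ck_on k S f"
  shows "Ck_on k S (\<lambda>x. L (f x))"
  using assms(3)
proof (induction k arbitrary: f)
  case 0 then show ?case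
    by (auto intro: bounded_linear.continuous_on[OF assms(1)])
next
  case (Suc k)
  show ?case
    by (rule Ck_on_SucI[OF assms(2), where f'="\<lambda>x v. L (frechet_derivative f (at x) v)"])
       (auto intro!: Suc.IH bounded_linear.has_derivative[OF assms(1)] Ck_on_SucD[OF Suc.prems])
qed

lemma Ck_on_ident: "open S \<Longrightarrow> Ck_on k S (\<lambda>x. x)"
  by (cases k) (auto intro!: Ck_on_SucI[where f'="\<lambda>_ v. v"] Ck_on_const simp del: Ck_on.simps(2))

lemma Ck_on_add:
  assumes "open S" "Ck_on k S f" "Ck_on k S g"
  shows "Ck_on k S (\<lambda>x. f x + g x)"
  using assms(2,3)
proof (induction k arbitrary: f g)
  case (Suc k)
  show ?case
    by (rule Ck_on_SucI[OF assms(1), where f'="\<lambda>x v. frechet_derivative f (at x) v + frechet_derivative g (at x) v"])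
       (auto intro!: Suc.IH has_derivative_add Ck_on_SucD[OF Suc.prems(1)] Ck_on_SucD[OF Suc.prems(2)])
qed (auto intro: continuous_on_add)

lemma Ck_on_bilinear:
  assumes "bounded_bilinear p" "open S" "Ck_on k S f" "Ck_on k S g"
  shows "Ck_on k S (\<lambda>x. p (f x) (g x))"
  using assms(3,4)
proof (induction k arbitrary: f g)
  case 0 then show ?case by (auto intro: bounded_bilinear.continuous_on[OF assms(1)])
next
  case (Suc k)
  show ?case
    by (rule Ck_on_SucI[OF assms(2), where f'="\<lambda>x v. p (f x) (frechet_derivative g (at x) v) + p (frechet_derivative f (at x) v) (g x)"])
       (auto intro!: Ck_on_add[OF assms(2)] Suc.IH bounded_bilinear.FDERIV[OF assms(1)] Ck_on_SucD[OF Suc.prems(1)] Ck_on_SucD[OF Suc.prems(2)] Ck_on_Suc_imp[OF Suc.prems(1)] Ck_on_Suc_imp[OF Suc.prems(2)])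
qed

lemma Ck_on_sum:
  assumes "open S" "\<And>i. i \<in> I \<Longrightarrow> Ck_on k S (f i)"
  shows "Ck_on k S (\<lambda>x. \<Sum>i\<in>I. f i x)"
  using assms(2)
  by (induction I rule: infinite_finite_induct) (auto intro!: Ck_on_const Ck_on_add assms(1))

lemma Ck_on_inverse:
  fixes f :: "'a::real_normed_vector \<Rightarrow> real"
  assumes "open S" "\<And>x. x \<in> S \<Longrightarrow> f x \<noteq> 0" "Ck_on k S f"
  shows "Ck_on k S (\<lambda>x. inverse (f x))"
  using assms(3)
proof (induction k)
  case 0 then show ?case using assms(2) by (auto intro: continuous_on_inverse)
next
  case (Suc k)
  note IH = Suc.IH[OF Ck_on_Suc_imp[OF Suc.prems]]
  note mlt = Ck_on_bilinear[OF bounded_bilinear_mult assms(1)]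
  show ?case
  proof (rule Ck_on_SucI[OF assms(1), where f'="\<lambda>x v. (-1) * (inverse (f x) * (frechet_derivative f (at x) v * inverse (f x)))"])
    fix x assume "x \<in> S"
    from Deriv.has_derivative_inverse[OF assms(2)[OF this] Ck_on_SucD(1)[OF Suc.prems this]]
    show "((\<lambda>x. inverse (f x)) has_derivative (\<lambda>v. (-1) * (inverse (f x) * (frechet_derivative f (at x) v * inverse (f x))))) (at x)"
      by (simp add: mult.assoc)
  qed (intro mlt Ck_on_const[OF assms(1)] IH Ck_on_SucD(2)[OF Suc.prems])
qed

lemma linear_euclidean_expand:
  fixes L :: "'b::euclidean_space \<Rightarrow> 'c::real_vector"
  assumes "linear L" shows "L u = (\<Sum>b\<in>Basis. (u \<bullet> b) *\<^sub>R L b)"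
  using linear_sum[OF assms, of "\<lambda>b. (u \<bullet> b) *\<^sub>R b" Basis] linear_scale[OF assms]
  by (simp add: euclidean_representation)

text \<open>The chain rule applies the derivative of \<open>g\<close> at \<open>f x\<close> to a
  vector that varies with \<open>x\<close>. Expanding that vector in the basis of the middle space
  leaves derivatives of \<open>g\<close> in fixed directions, to which the induction hypothesis
  applies.\<close>

lemma Ck_on_compose:
  fixes f :: "'a::real_normed_vector \<Rightarrow> 'b::euclidean_space" and g :: "'b \<Rightarrow> 'c::real_normed_vector"
  assumes "open S" "open T" "\<And>x. x \<in> S \<Longrightarrow> f x \<in> T" "Ck_on k S f" "Ck_on k T g"
  shows "Ck_on k S (\<lambda>x. g (f x))"
  using assms(4,5)
proof (induction k arbitrary: g)
  case 0 then show ?case using assms(3) by (auto intro: continuous_on_compose2)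
next
  case (Suc k)
  show ?case
  proof (rule Ck_on_SucI[OF assms(1), where f'="\<lambda>x v. \<Sum>b\<in>Basis. (frechet_derivative f (at x) v \<bullet> b) *\<^sub>R frechet_derivative g (at (f x)) b"])
    fix x assume x: "x \<in> S"
    note dg = Ck_on_SucD(1)[OF Suc.prems(2) assms(3)[OF x]]
    have lg: "linear (frechet_derivative g (at (f x)))" using dg has_derivative_linear by blast
    have "((\<lambda>x. g (f x)) has_derivative (\<lambda>v. frechet_derivative g (at (f x)) (frechet_derivative f (at x) v))) (at x)"
      by (rule has_derivative_compose[OF Ck_on_SucD(1)[OF Suc.prems(1) x] dg])
    then show "((\<lambda>x. g (f x)) has_derivative (\<lambda>v. \<Sum>b\<in>Basis. (frechet_derivative f (at x) v \<bullet> b) *\<^sub>R frechet_derivative g (at (f x)) b)) (at x)"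
      by (rule has_derivative_eq_rhs) (intro ext linear_euclidean_expand[OF lg])
  next
    fix v
    show "Ck_on k S (\<lambda>x. \<Sum>b\<in>Basis. (frechet_derivative f (at x) v \<bullet> b) *\<^sub>R frechet_derivative g (at (f x)) b)"
      by (intro Ck_on_sum assms(1) Ck_on_bilinear[OF bounded_bilinear_scaleR]
          Ck_on_bounded_linear_comp[OF bounded_linear_inner_left] Suc.IH Ck_on_Suc_imp[OF Suc.prems(1)]
          Ck_on_SucD(2)[OF Suc.prems(1)] Ck_on_SucD(2)[OF Suc.prems(2)])
  qed
qed

lemma smooth_aroundE:
  assumes "smooth_around x f"
  obtains W where "open W" "x \<in> W" "\<And>k. Ck_on k W f"
  using assms unfolding smooth_around_def smooth_on_def by blast

lemma smooth_aroundI: "open W \<Longrightarrow> x \<in> W \<Longrightarrow> (\<And>k. Ck_on k W f) \<Longrightarrow> smooth_around x f"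
  unfolding smooth_around_def smooth_on_def by blast

lemma smooth_on_iff: "open S \<Longrightarrow> smooth_on S f \<longleftrightarrow> (\<forall>x\<in>S. smooth_around x f)"
proof
  assume *: "\<forall>x\<in>S. smooth_around x f"
  show "smooth_on S f" unfolding smooth_on_def
  proof (intro allI Ck_on_open_cover)
    fix k x assume "x \<in> S"
    with * have "smooth_around x f" by blast
    then show "\<exists>W. open W \<and> x \<in> W \<and> Ck_on k W f"
      unfolding smooth_around_def smooth_on_def by blast
  qed
qed (unfold smooth_around_def, blast)

lemma smooth_around_eventually: "smooth_around x f \<Longrightarrow> \<forall>\<^sub>F y in nhds x. smooth_around y f"
  unfolding eventually_nhds smooth_around_def by blast

lemma smooth_around_cong:
  assumes "\<forall>\<^sub>F y in nhds x. f y = g y" "smooth_around x f"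
  shows "smooth_around x g"
proof -
  obtain V where V: "open V" "x \<in> V" "\<And>y. y \<in> V \<Longrightarrow> f y = g y"
    using assms(1) unfolding eventually_nhds by blast
  obtain W where W: "open W" "x \<in> W" "\<And>k. Ck_on k W f" by (rule smooth_aroundE[OF assms(2)]) auto
  show ?thesis
  proof (rule smooth_aroundI[of "V \<inter> W"])
    fix k
    show "Ck_on k (V \<inter> W) g"
      by (rule Ck_on_cong[OF _ _ Ck_on_subset[OF W(3)]]) (use V W in auto)
  qed (use V W in auto)
qed

lemma smooth_around_const [simp]: "smooth_around x (\<lambda>x. c)"
  by (rule smooth_aroundI[of UNIV]) (auto intro: Ck_on_const)

lemma smooth_around_ident [simp]: "smooth_around x (\<lambda>x. x)"
  by (rule smooth_aroundI[of UNIV]) (auto intro: Ck_on_ident)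

lemma smooth_around_bounded_linear:
  assumes "bounded_linear L" "smooth_around x f"
  shows "smooth_around x (\<lambda>x. L (f x))"
  by (rule smooth_aroundE[OF assms(2)], rule smooth_aroundI)
     (auto intro: Ck_on_bounded_linear_comp[OF assms(1)])

lemma smooth_around_bilinear:
  assumes "bounded_bilinear p" "smooth_around x f" "smooth_around x g"
  shows "smooth_around x (\<lambda>x. p (f x) (g x))"
proof -
  obtain V where V: "open V" "x \<in> V" "\<And>k. Ck_on k V f" by (rule smooth_aroundE[OF assms(2)]) auto
  obtain W where W: "open W" "x \<in> W" "\<And>k. Ck_on k W g" by (rule smooth_aroundE[OF assms(3)]) auto
  show ?thesis
    by (rule smooth_aroundI[of "V \<inter> W"])
       (use V W in \<open>auto intro!: Ck_on_bilinear[OF assms(1)] intro: Ck_on_subset\<close>)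
qed

lemma smooth_around_add:
  assumes "smooth_around x f" "smooth_around x g"
  shows "smooth_around x (\<lambda>x. f x + g x)"
proof -
  obtain V where V: "open V" "x \<in> V" "\<And>k. Ck_on k V f" by (rule smooth_aroundE[OF assms(1)]) auto
  obtain W where W: "open W" "x \<in> W" "\<And>k. Ck_on k W g" by (rule smooth_aroundE[OF assms(2)]) auto
  show ?thesis
    by (rule smooth_aroundI[of "V \<inter> W"])
       (use V W in \<open>auto intro!: Ck_on_add intro: Ck_on_subset\<close>)
qed

lemmas smooth_around_scaleR = smooth_around_bilinear[OF bounded_bilinear_scaleR]

lemma smooth_around_mult:
  fixes f g :: "'a::real_normed_vector \<Rightarrow> real"
  shows "smooth_around x f \<Longrightarrow> smooth_around x g \<Longrightarrow> smooth_around x (\<lambda>x. f x * g x)"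
  by (rule smooth_around_bilinear[OF bounded_bilinear_mult])

lemma smooth_around_minus: "smooth_around x f \<Longrightarrow> smooth_around x (\<lambda>x. - f x)"
  by (rule smooth_around_bounded_linear[OF bounded_linear_minus[OF bounded_linear_ident]])

lemma smooth_around_diff:
  "smooth_around x f \<Longrightarrow> smooth_around x g \<Longrightarrow> smooth_around x (\<lambda>x. f x - g x)"
  using smooth_around_add[OF _ smooth_around_minus, of x f g] by simp

lemma smooth_around_sum:
  "(\<And>i. i \<in> I \<Longrightarrow> smooth_around x (f i)) \<Longrightarrow> smooth_around x (\<lambda>x. \<Sum>i\<in>I. f i x)"
  by (induction I rule: infinite_finite_induct) (auto intro!: smooth_around_add)

lemma smooth_around_prod:
  fixes f :: "'i \<Rightarrow> 'a::real_normed_vector \<Rightarrow> real"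
  shows "(\<And>i. i \<in> I \<Longrightarrow> smooth_around x (f i)) \<Longrightarrow> smooth_around x (\<lambda>x. \<Prod>i\<in>I. f i x)"
  by (induction I rule: infinite_finite_induct) (auto intro!: smooth_around_mult)

lemma smooth_around_power:
  fixes f :: "'a::real_normed_vector \<Rightarrow> real"
  shows "smooth_around x f \<Longrightarrow> smooth_around x (\<lambda>x. f x ^ n)"
  by (induction n) (auto intro!: smooth_around_mult)

lemma smooth_around_vec_nth: "smooth_around x f \<Longrightarrow> smooth_around x (\<lambda>x. f x $ k)"
  by (rule smooth_around_bounded_linear[OF bounded_linear_vec_nth])

lemma smooth_around_fst: "smooth_around x f \<Longrightarrow> smooth_around x (\<lambda>x. fst (f x))"
  by (rule smooth_around_bounded_linear[OF bounded_linear_fst])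

lemma smooth_around_snd: "smooth_around x f \<Longrightarrow> smooth_around x (\<lambda>x. snd (f x))"
  by (rule smooth_around_bounded_linear[OF bounded_linear_snd])

lemma smooth_around_Pair:
  assumes "smooth_around x f" "smooth_around x g"
  shows "smooth_around x (\<lambda>x. (f x, g x))"
proof -
  have "smooth_around x (\<lambda>x. (f x, 0) + (0, g x))"
    by (intro smooth_around_add smooth_around_bounded_linear[OF _ assms(1)] smooth_around_bounded_linear[OF _ assms(2)])
       (auto intro: bounded_linear_Pair bounded_linear_ident bounded_linear_zero)
  then show ?thesis by simp
qed

lemma smooth_around_vec:
  fixes f :: "'a::real_normed_vector \<Rightarrow> real ^ 'n::finite"
  assumes "\<And>k. smooth_around x (\<lambda>x. f x $ k)"
  shows "smooth_around x f"
proof -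
  have "smooth_around x (\<lambda>x. \<Sum>k\<in>UNIV. (f x $ k) *\<^sub>R (axis k 1 :: real ^ 'n))"
    by (intro smooth_around_sum smooth_around_scaleR assms smooth_around_const)
  moreover have "(\<lambda>x. \<Sum>k\<in>UNIV. (f x $ k) *\<^sub>R (axis k 1 :: real ^ 'n)) = f"
    by (auto simp: vec_eq_iff axis_def if_distrib cong: if_cong)
  ultimately show ?thesis by simp
qed

lemma smooth_around_imp_continuous:
  assumes "smooth_around x f" shows "isCont f x"
proof -
  obtain W where W: "open W" "x \<in> W" "\<And>k. Ck_on k W f" by (rule smooth_aroundE[OF assms]) auto
  from W(3)[of 0] W(1,2) show ?thesis by (simp add: continuous_on_eq_continuous_at)
qed

lemma smooth_around_compose:
  fixes f :: "'a::real_normed_vector \<Rightarrow> 'b::euclidean_space" and g :: "'b \<Rightarrow> 'c::real_normed_vector"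
  assumes "smooth_around x f" "smooth_around (f x) g"
  shows "smooth_around x (\<lambda>x. g (f x))"
proof -
  obtain V where V: "open V" "x \<in> V" "\<And>k. Ck_on k V f" by (rule smooth_aroundE[OF assms(1)]) auto
  obtain W where W: "open W" "f x \<in> W" "\<And>k. Ck_on k W g" by (rule smooth_aroundE[OF assms(2)]) auto
  have c: "continuous_on V f" using V(3)[of 0] by simp
  have o: "open (V \<inter> f -` W)" using continuous_open_preimage[OF c V(1) W(1)] .
  show ?thesis
  proof (rule smooth_aroundI[OF o])
    fix k
    show "Ck_on k (V \<inter> f -` W) (\<lambda>x. g (f x))"
      by (rule Ck_on_compose[OF o W(1) _ Ck_on_subset[OF V(3)] W(3)]) auto
  qed (use V W in auto)
qed

lemma smooth_around_inverse:
  fixes f :: "'a::real_normed_vector \<Rightarrow> real"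
  assumes "smooth_around x f" "f x \<noteq> 0"
  shows "smooth_around x (\<lambda>x. inverse (f x))"
proof -
  obtain V where V: "open V" "x \<in> V" "\<And>k. Ck_on k V f" by (rule smooth_aroundE[OF assms(1)]) auto
  have c: "continuous_on V f" using V(3)[of 0] by simp
  have o: "open (V \<inter> f -` (- {0}))" using continuous_open_preimage[OF c V(1)] by auto
  show ?thesis
  proof (rule smooth_aroundI[OF o])
    fix k
    show "Ck_on k (V \<inter> f -` (- {0})) (\<lambda>x. inverse (f x))"
      by (rule Ck_on_inverse[OF o _ Ck_on_subset[OF V(3)]]) auto
  qed (use V assms(2) in auto)
qed

lemma smooth_around_divide:
  fixes f g :: "'a::real_normed_vector \<Rightarrow> real"
  assumes "smooth_around x f" "smooth_around x g" "g x \<noteq> 0"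
  shows "smooth_around x (\<lambda>x. f x / g x)"
  unfolding divide_inverse by (intro smooth_around_mult smooth_around_inverse assms)

lemma smooth_around_has_derivative:
  assumes "smooth_around x f"
  shows "(f has_derivative frechet_derivative f (at x)) (at x)"
proof -
  obtain W where W: "open W" "x \<in> W" "\<And>k. Ck_on k W f" by (rule smooth_aroundE[OF assms]) auto
  from Ck_on_SucD(1)[OF W(3) W(2)] show ?thesis .
qed

lemma smooth_around_frechet:
  assumes "smooth_around x f"
  shows "smooth_around x (\<lambda>x. frechet_derivative f (at x) v)"
proof -
  obtain W where W: "open W" "x \<in> W" "\<And>k. Ck_on k W f" by (rule smooth_aroundE[OF assms]) auto
  show ?thesis using W Ck_on_SucD(2)[OF W(3)] by (intro smooth_aroundI[of W]) auto
qed

lemma smooth_around_linear_frechet: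
  "smooth_around x f \<Longrightarrow> linear (frechet_derivative f (at x))"
  using smooth_around_has_derivative has_derivative_linear by blast

lemma smooth_around_frechet_compose:
  fixes f :: "'a::real_normed_vector \<Rightarrow> 'b::euclidean_space" and g :: "'b \<Rightarrow> 'c::real_normed_vector"
  assumes "smooth_around x f" "smooth_around (f x) g" "smooth_around x u"
  shows "smooth_around x (\<lambda>x. frechet_derivative g (at (f x)) (u x))"
proof -
  have "smooth_around x (\<lambda>x. \<Sum>b\<in>Basis. (u x \<bullet> b) *\<^sub>R frechet_derivative g (at (f x)) b)"
    by (intro smooth_around_sum smooth_around_scaleR smooth_around_bounded_linear[OF bounded_linear_inner_left]
        assms(3) smooth_around_compose[OF assms(1)] smooth_around_frechet assms(2))
  moreover have "\<forall>\<^sub>F y in nhds x. smooth_around (f y) g"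
    using eventually_compose_filterlim[OF smooth_around_eventually[OF assms(2)]]
      smooth_around_imp_continuous[OF assms(1)] by (auto simp: isCont_def tendsto_at_iff_tendsto_nhds)
  then have "\<forall>\<^sub>F y in nhds x. (\<Sum>b\<in>Basis. (u y \<bullet> b) *\<^sub>R frechet_derivative g (at (f y)) b) = frechet_derivative g (at (f y)) (u y)"
    by (rule eventually_mono) (metis linear_euclidean_expand smooth_around_linear_frechet)
  ultimately show ?thesis by (rule smooth_around_cong[rotated])
qed

lemma frechet_derivative_compose_smooth:
  assumes "smooth_around x f" "smooth_around (f x) g"
  shows "frechet_derivative (\<lambda>x. g (f x)) (at x) v = frechet_derivative g (at (f x)) (frechet_derivative f (at x) v)"
  by (subst frechet_derivativeI[OF has_derivative_compose[OF smooth_around_has_derivative[OF assms(1)] smooth_around_has_derivative[OF assms(2)]]]) simp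

lemmas smooth_intros = smooth_around_const smooth_around_ident smooth_around_add smooth_around_diff
  smooth_around_minus smooth_around_scaleR smooth_around_mult smooth_around_power smooth_around_sum
  smooth_around_prod smooth_around_Pair smooth_around_fst smooth_around_snd smooth_around_vec_nth

section \<open>Cramer's rule and smoothness of local inverses\<close>

lemma smooth_around_det:
  fixes A :: "'a::real_normed_vector \<Rightarrow> real ^ 'n ^ 'n"
  assumes "\<And>i j. smooth_around x (\<lambda>y. A y $ i $ j)"
  shows "smooth_around x (\<lambda>y. det (A y))"
  unfolding det_def
  by (rule smooth_intros assms)+

text \<open>As a quotient of determinants the solution of a linear system is visibly smooth in its
  entries; this serves the derivative of an inverse map and the structure functions of a frame
  alike.\<close>

definition cramer_solution :: "real ^ 'n ^ 'n \<Rightarrow> real ^ 'n \<Rightarrow> real ^ 'n" where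
  "cramer_solution A b = (\<chi> k. det (\<chi> i j. if j = k then b $ i else A $ i $ j) / det A)"

lemma cramer_solution_iff: "det A \<noteq> 0 \<Longrightarrow> A *v x = b \<longleftrightarrow> x = cramer_solution A b"
  unfolding cramer_solution_def by (rule cramer)

lemma smooth_around_cramer_solution:
  fixes A :: "'a::real_normed_vector \<Rightarrow> real ^ 'n ^ 'n"
  assumes "\<And>i j. smooth_around x (\<lambda>y. A y $ i $ j)" "\<And>i. smooth_around x (\<lambda>y. b y $ i)"
    "det (A x) \<noteq> 0"
  shows "smooth_around x (\<lambda>y. cramer_solution (A y) (b y))"
proof (rule smooth_around_vec)
  fix k
  have 1: "smooth_around x (\<lambda>y. if j = k then b y $ i else A y $ i $ j)" for i j
    using assms(1,2) by (cases "j = k") simp_all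
  have 2: "smooth_around x (\<lambda>y. (\<chi> i j. if j = k then b y $ i else A y $ i $ j) $ i $ j)" for i j
    unfolding vec_lambda_beta by (rule 1)
  show "smooth_around x (\<lambda>y. cramer_solution (A y) (b y) $ k)"
    unfolding cramer_solution_def vec_lambda_beta
    by (rule smooth_around_divide[OF smooth_around_det[OF 2] smooth_around_det[OF assms(1)] assms(3)])
qed

text \<open>The inverse function theorem asks for a derivative that is continuous as a map into
  bounded linear operators; in finite dimensions continuity of each directional derivative is
  enough.\<close>

lemma isCont_Blinfun_frechet:
  fixes f :: "'a::euclidean_space \<Rightarrow> 'b::real_normed_vector"
  assumes "smooth_around x f"
  shows "isCont (\<lambda>y. Blinfun (frechet_derivative f (at y))) x"
proof (rule continuous_blinfun_componentwiseI1)
  fix i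
  have "\<forall>\<^sub>F y in nhds x. smooth_around y f" using assms by (rule smooth_around_eventually)
  then have ev: "\<forall>\<^sub>F y in nhds x. frechet_derivative f (at y) i = blinfun_apply (Blinfun (frechet_derivative f (at y))) i"
    by (rule eventually_mono)
       (metis bounded_linear_Blinfun_apply has_derivative_bounded_linear smooth_around_has_derivative)
  show "isCont (\<lambda>y. blinfun_apply (Blinfun (frechet_derivative f (at y))) i) x"
    using smooth_around_imp_continuous[OF smooth_around_cong[OF ev smooth_around_frechet[OF assms]]] .
qed

lemma bounded_linear_frechet:
  "smooth_around x f \<Longrightarrow> bounded_linear (frechet_derivative f (at x))"
  using has_derivative_bounded_linear smooth_around_has_derivative by blast

text \<open>The \<open>C^1\<close> inverse function theorem gives \<open>g\<close> with derivative
  \<open>(Df (g y))^{-1}\<close>. By Cramer's rule \<open>Dg (y) v\<close> is a smooth function of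
  \<open>g y\<close>, so each degree of differentiability of \<open>g\<close> yields the next
  one.\<close>

theorem smooth_inverse_function:
  fixes f :: "real ^ 'n \<Rightarrow> real ^ 'n"
  assumes f: "smooth_around x0 f" and inj: "inj (frechet_derivative f (at x0))"
  obtains U V g where "open U" "x0 \<in> U" "open V" "f x0 \<in> V" "homeomorphism U V f g"
    "\<And>x. x \<in> U \<Longrightarrow> smooth_around x f" "\<And>y. y \<in> V \<Longrightarrow> smooth_around y g"
    "\<And>x. x \<in> U \<Longrightarrow> bij (frechet_derivative f (at x))"
proof -
  obtain W where W: "open W" "x0 \<in> W" "\<And>x. x \<in> W \<Longrightarrow> smooth_around x f"
    using smooth_around_eventually[OF f] unfolding eventually_nhds by blast
  let ?f' = "\<lambda>x. Blinfun (frechet_derivative f (at x))"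
  have app: "blinfun_apply (?f' x) = frechet_derivative f (at x)" if "x \<in> W" for x
    using bounded_linear_Blinfun_apply[OF bounded_linear_frechet[OF W(3)[OF that]]] .
  have der: "(f has_derivative blinfun_apply (?f' x)) (at x)" if "x \<in> W" for x
    using smooth_around_has_derivative[OF W(3)[OF that]] app[OF that] by simp
  have cont: "continuous_on W ?f'"
    by (intro continuous_at_imp_continuous_on ballI isCont_Blinfun_frechet W(3))
  obtain l where l: "linear l" "l \<circ> frechet_derivative f (at x0) = id"
    using linear_injective_left_inverse[OF smooth_around_linear_frechet[OF f] inj] by blast
  have il: "Blinfun l o\<^sub>L ?f' x0 = id_blinfun"
    using l W(2) by (intro blinfun_eqI)
      (simp add: app bounded_linear_Blinfun_apply linear_conv_bounded_linear[symmetric] fun_eq_iff)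
  show thesis
  proof (rule inverse_function_theorem[OF W(1) der cont W(2) il])
  fix U V g g'
  assume UV: "open U" "U \<subseteq> W" "x0 \<in> U" "open V" "f x0 \<in> V" "homeomorphism U V f g"
    and g': "\<And>y. y \<in> V \<Longrightarrow> (g has_derivative (g' y)) (at y)"
      "\<And>y. y \<in> V \<Longrightarrow> g' y = inv (blinfun_apply (?f' (g y)))"
      "\<And>y. y \<in> V \<Longrightarrow> bij (blinfun_apply (?f' (g y)))"
  have gV: "g y \<in> U" if "y \<in> V" for y using UV(6) that unfolding homeomorphism_def by blast
  have bijU: "bij (frechet_derivative f (at x))" if "x \<in> U" for x
  proof -
    have "f x \<in> V" "g (f x) = x" using UV(6) that unfolding homeomorphism_def by auto
    then show ?thesis using g'(3)[of "f x"] app[of x] that UV(2) by auto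
  qed
  let ?A = "\<lambda>x. matrix (frechet_derivative f (at x))"
  have A: "?A x *v u = frechet_derivative f (at x) u" if "x \<in> U" for x u
    using matrix_works[OF smooth_around_linear_frechet[OF W(3), folded linear_matrix_vector_mul_eq]] UV(2) that by auto
  have dA: "det (?A x) \<noteq> 0" if "x \<in> U" for x
  proof -
    have "(*v) (?A x) = frechet_derivative f (at x)" using A[OF that] by auto
    then have "inj ((*v) (?A x))" using bijU[OF that] by (simp add: bij_is_inj)
    then show ?thesis using matrix_left_invertible_injective invertible_left_inverse invertible_det_nz by metis
  qed
  have sol: "g' y v = cramer_solution (?A (g y)) v" if "y \<in> V" for y v
  proof -
    have gy: "g y \<in> U" using gV that .
    have "?A (g y) *v (g' y v) = v"
      using A[OF gy] g'(2)[OF that] app[of "g y"] gy UV(2) bijU[OF gy]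
      by (auto simp: bij_is_surj surj_f_inv_f)
    then show ?thesis using cramer_solution_iff[OF dA[OF gy]] by blast
  qed
  have sm: "smooth_around x (\<lambda>x. cramer_solution (?A x) v)" if "x \<in> U" for x v
    unfolding matrix_def
    by (intro smooth_around_cramer_solution)
       (use dA[OF that] W(3) UV(2) that in \<open>auto simp: matrix_def intro!: smooth_around_frechet smooth_around_vec_nth\<close>)
  have "Ck_on k V g" for k
  proof (induction k)
    case 0 then show ?case using UV(6) unfolding homeomorphism_def by simp
  next
    case (Suc k)
    show ?case
    proof (rule Ck_on_SucI[OF UV(4) g'(1)])
      fix v
      have "smooth_on U (\<lambda>x. cramer_solution (?A x) v)" using sm smooth_on_iff[OF UV(1)] by blast
      then have c: "Ck_on k V (\<lambda>y. cramer_solution (?A (g y)) v)"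
        using Ck_on_compose[OF UV(4,1) gV Suc] unfolding smooth_on_def by blast
      show "Ck_on k V (\<lambda>y. g' y v)" by (rule Ck_on_cong[OF UV(4) sol[symmetric] c])
    qed
  qed
  then have sg: "\<And>y. y \<in> V \<Longrightarrow> smooth_around y g" using smooth_aroundI[OF UV(4)] by blast
  show thesis by (rule that[OF UV(1,3,4,5,6) W(3) sg bijU]) (use UV(2) in auto)
  qed
qed

section \<open>Parameter integrals, Hadamard's quotient and symmetry of second derivatives\<close>

lemma Ck_on_integral:
  fixes h :: "'a::euclidean_space \<times> real \<Rightarrow> 'b::euclidean_space"
  assumes W: "open W" "convex W" and h: "\<And>z u. z \<in> W \<Longrightarrow> u \<in> {0..1} \<Longrightarrow> smooth_around (z, u) h"
  shows "Ck_on k W (\<lambda>z. integral {0..1} (\<lambda>u. h (z, u)))"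
  using h
proof (induction k arbitrary: h)
  case 0
  have "continuous_on (W \<times> cbox 0 1) (\<lambda>(z, u). h (z, u))"
    by (intro continuous_at_imp_continuous_on ballI) (use smooth_around_imp_continuous 0 in fastforce)
  from integral_continuous_on_param[OF this] show ?case by (simp add: cbox_interval)
next
  case (Suc k)
  let ?d = "\<lambda>z u. Blinfun (\<lambda>v. frechet_derivative h (at (z, u)) (v, 0))"
  have bl: "bounded_linear (\<lambda>v. frechet_derivative h (at (z, u)) (v, 0))" if "z \<in> W" "u \<in> {0..1}" for z u
    using bounded_linear_compose[OF bounded_linear_frechet[OF Suc.prems[OF that]]
        bounded_linear_Pair[OF bounded_linear_ident bounded_linear_zero]] .
  have app: "blinfun_apply (?d z u) v = frechet_derivative h (at (z, u)) (v, 0)" if "z \<in> W" "u \<in> {0..1}" for z u v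
    using bounded_linear_Blinfun_apply[OF bl[OF that]] by simp
  have sd: "smooth_around (z, u) (\<lambda>p. frechet_derivative h (at p) (v, 0))" if "z \<in> W" "u \<in> {0..1}" for z u v
    by (rule smooth_around_frechet[OF Suc.prems[OF that]])
  have ct: "continuous_on (W \<times> cbox 0 1) (\<lambda>(z, u). ?d z u)"
  proof -
    have "continuous_on (W \<times> cbox 0 1) (\<lambda>p. ?d (fst p) (snd p))"
    proof (rule continuous_on_blinfun_componentwise)
      fix i :: 'a
      have "continuous_on (W \<times> cbox 0 1) (\<lambda>p. frechet_derivative h (at p) (i, 0))"
      proof (intro continuous_at_imp_continuous_on ballI)
        fix p :: "'a \<times> real" assume "p \<in> W \<times> cbox 0 1"
        then show "isCont (\<lambda>p. frechet_derivative h (at p) (i, 0)) p"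
          using smooth_around_imp_continuous[OF sd[of "fst p" "snd p" i]] by (auto simp: cbox_interval)
      qed
      then show "continuous_on (W \<times> cbox 0 1) (\<lambda>p. blinfun_apply (?d (fst p) (snd p)) i)"
        by (rule continuous_on_eq) (auto simp: cbox_interval app)
    qed
    then show ?thesis by (simp add: split_beta)
  qed
  have int: "(\<lambda>u. h (z, u)) integrable_on cbox 0 1" if "z \<in> W" for z
  proof (rule integrable_continuous, intro continuous_at_imp_continuous_on ballI)
    fix u :: real assume "u \<in> cbox 0 1"
    then have "smooth_around (z, u) h" using Suc.prems[OF that] by (simp add: cbox_interval)
    then have "isCont h (z, u)" by (rule smooth_around_imp_continuous)
    then show "isCont (\<lambda>u. h (z, u)) u"
      by (rule isCont_o2[rotated]) (rule continuous_Pair[OF continuous_const continuous_ident])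
  qed
  show ?case
  proof (rule Ck_on_SucI[OF W(1)])
    fix z0 assume z0: "z0 \<in> W"
    \<comment> \<open>Differentiation under the integral sign; it uses the partial derivative as a
      jointly continuous operator-valued family, which is \<open>ct\<close>, and the convexity of
      \<open>W\<close>. The derivative is again a parameter integral, so the induction
      continues.\<close>
    have "((\<lambda>z. integral (cbox 0 1) (\<lambda>u. h (z, u))) has_derivative integral (cbox 0 1) (?d z0)) (at z0 within W)"
    proof (rule leibniz_rule[OF _ int ct z0 W(2)])
      fix z u assume zu: "z \<in> W" "u \<in> cbox (0::real) 1"
      then have "u \<in> {0..1}" by (simp add: cbox_interval)
      have "((\<lambda>z. h (z, u)) has_derivative (\<lambda>v. frechet_derivative h (at (z, u)) (v, 0))) (at z)"
        by (rule has_derivative_compose[OF has_derivative_Pair[OF has_derivative_ident has_derivative_const]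
              smooth_around_has_derivative[OF Suc.prems]]) (use zu in \<open>auto simp: cbox_interval\<close>)
      then show "((\<lambda>z. h (z, u)) has_derivative blinfun_apply (?d z u)) (at z within W)"
        using app[OF zu(1) \<open>u \<in> {0..1}\<close>, abs_def] by (simp add: has_derivative_at_withinI)
    qed
    moreover have "blinfun_apply (integral (cbox 0 1) (?d z0)) v
        = integral {0..1} (\<lambda>u. frechet_derivative h (at (z0, u)) (v, 0))" for v
    proof -
      have "continuous_on (cbox 0 1) (?d z0)"
        using continuous_on_compose2[OF ct, of "cbox 0 1" "\<lambda>u. (z0, u)"] z0
        by (auto simp: continuous_on_Pair)
      then have "blinfun_apply (integral (cbox 0 1) (?d z0)) v = integral (cbox 0 1) (\<lambda>u. blinfun_apply (?d z0 u) v)"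
        by (intro blinfun_apply_integral integrable_continuous)
      also have "\<dots> = integral {0..1} (\<lambda>u. frechet_derivative h (at (z0, u)) (v, 0))"
        unfolding cbox_interval by (rule integral_cong) (simp add: app[OF z0])
      finally show ?thesis .
    qed
    ultimately show "((\<lambda>z. integral {0..1} (\<lambda>u. h (z, u))) has_derivative
        (\<lambda>v. integral {0..1} (\<lambda>u. frechet_derivative h (at (z0, u)) (v, 0)))) (at z0)"
      using at_within_open[OF z0 W(1)] by (simp add: cbox_interval has_derivative_eq_rhs fun_eq_iff)
  next
    fix v
    show "Ck_on k W (\<lambda>z. integral {0..1} (\<lambda>u. frechet_derivative h (at (z, u)) (v, 0)))"
      by (rule Suc.IH[where h="\<lambda>p. frechet_derivative h (at p) (v, 0)"]) (rule sd)
  qed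
qed

lemma eventually_nhds_PairE:
  assumes "\<forall>\<^sub>F p in nhds (x, y). P p"
  obtains A B where "open A" "x \<in> A" "open B" "y \<in> B" "\<And>a b. a \<in> A \<Longrightarrow> b \<in> B \<Longrightarrow> P (a, b)"
proof -
  obtain S where S: "open S" "(x, y) \<in> S" "\<And>p. p \<in> S \<Longrightarrow> P p"
    using assms unfolding eventually_nhds by blast
  obtain A B where "open A" "open B" "(x, y) \<in> A \<times> B" "A \<times> B \<subseteq> S"
    using open_prod_elim[OF S(1,2)] by blast
  then show thesis using that[of A B] S(3) by auto
qed

text \<open>Turns neighbourhoods of the single points of a compact slice into one radius. It is
  applied to the interval of integration, to the compact sets of uniform convergence and to a
  weighted unit sphere.\<close>

lemma tube_ball:
  fixes z0 :: "'a::real_normed_vector" and K :: "'b::real_normed_vector set"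
  assumes "compact K" "\<And>u. u \<in> K \<Longrightarrow> \<forall>\<^sub>F p in nhds (z0, u). P p"
  obtains e where "e > 0" "\<And>z u. z \<in> ball z0 e \<Longrightarrow> u \<in> K \<Longrightarrow> P (z, u)"
proof -
  let ?W = "interior {p. P p}"
  have "(z0, u) \<in> ?W" if "u \<in> K" for u
    using assms(2)[OF that] by (metis eventually_nhds interiorI mem_Collect_eq subsetI)
  then have sub: "{z0} \<times> K \<subseteq> ?W" by auto
  from Elementary_Topology.tube_lemma[OF assms(1) open_interior sub]
  obtain X0 where X0: "z0 \<in> X0" "open X0" "X0 \<times> K \<subseteq> ?W" by auto
  obtain e where e: "e > 0" "ball z0 e \<subseteq> X0" using X0 open_contains_ball by blast
  show thesis
  proof (rule that[OF e(1)])
    fix z u assume "z \<in> ball z0 e" "u \<in> K"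
    then have "(z, u) \<in> ?W" using e X0 by blast
    then show "P (z, u)" using interior_subset by blast
  qed
qed

lemma smooth_around_integral:
  fixes h :: "'a::euclidean_space \<times> real \<Rightarrow> 'b::euclidean_space"
  assumes "\<And>u. u \<in> {0..1} \<Longrightarrow> smooth_around (z0, u) h"
  shows "smooth_around z0 (\<lambda>z. integral {0..1} (\<lambda>u. h (z, u)))"
proof -
  obtain e where e: "e > 0" "\<And>z u. z \<in> ball z0 e \<Longrightarrow> u \<in> {0..1::real} \<Longrightarrow> smooth_around (z, u) h"
    using tube_ball[OF compact_Icc[of 0 "1::real"], where ?z0.0=z0 and P="\<lambda>p. smooth_around p h"] smooth_around_eventually[OF assms]
    by metis
  show ?thesis
    by (rule smooth_aroundI[of "ball z0 e"]) (use e in \<open>auto intro!: Ck_on_integral\<close>)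
qed

text \<open>Hadamard's quotient of \<open>G (t, x) - G (0, x)\<close> by \<open>t\<close>, smooth across \<open>t = 0\<close>.\<close>

definition hadamard_quotient :: "(real \<times> 'a::euclidean_space \<Rightarrow> 'b::euclidean_space) \<Rightarrow> real \<times> 'a \<Rightarrow> 'b" where
  "hadamard_quotient G = (\<lambda>z. integral {0..1} (\<lambda>u. frechet_derivative G (at (u * fst z, snd z)) (1, 0)))"

text \<open>At \<open>t = 0\<close> the segment of points \<open>u * t\<close> shrinks to
  \<open>0\<close>, so smoothness of \<open>G\<close> at the single point \<open>(0, x)\<close> is
  enough for the integral.\<close>

lemma smooth_around_hadamard_quotient:
  assumes "smooth_around (0, x) G"
  shows "smooth_around (0, x) (hadamard_quotient G)"
proof -
  have "smooth_around ((0, x), u) (\<lambda>p. frechet_derivative G (at (snd p * fst (fst p), snd (fst p))) (1, 0))" for u :: real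
    by (rule smooth_around_compose[where g="\<lambda>q. frechet_derivative G (at q) (1, 0)" and f="\<lambda>p. (snd p * fst (fst p), snd (fst p))"],
       (rule smooth_intros)+) (simp add: smooth_around_frechet assms)
  from smooth_around_integral[OF this] show ?thesis unfolding hadamard_quotient_def by simp
qed

lemma hadamard_quotient_eq:
  fixes G :: "real \<times> 'a::euclidean_space \<Rightarrow> 'b::euclidean_space"
  assumes "smooth_around (0, x) G"
  shows "\<forall>\<^sub>F p in nhds (0, x). G p = G (0, snd p) + fst p *\<^sub>R hadamard_quotient G p"
proof -
  obtain A B where AB: "open A" "0 \<in> A" "open B" "x \<in> B" and smAB: "\<And>t y. t \<in> A \<Longrightarrow> y \<in> B \<Longrightarrow> smooth_around (t, y) G"
    by (rule eventually_nhds_PairE[OF smooth_around_eventually[OF assms]]) blast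
  obtain e where e: "e > 0" "ball 0 e \<subseteq> A" using AB open_contains_ball by blast
  have eq: "G (t, y) = G (0, y) + t *\<^sub>R hadamard_quotient G (t, y)" if t: "t \<in> ball 0 e" and y: "y \<in> B" for t y
  proof -
    have sm: "smooth_around (u * t, y) G" if "u \<in> {0..1}" for u
    proof (rule smAB)
      have "\<bar>u * t\<bar> \<le> 1 * \<bar>t\<bar>" unfolding abs_mult using that by (intro mult_right_mono) auto
      then show "u * t \<in> A" using t e(2) by (auto simp: dist_norm)
      show "y \<in> B" by (rule y)
    qed
    have "((\<lambda>u. G (u * t, y)) has_vector_derivative (t *\<^sub>R frechet_derivative G (at (u * t, y)) (1, 0))) (at u within {0..1})"
      if "u \<in> {0..1}" for u
    proof -
      have "((\<lambda>u. (u * t, y)) has_derivative (\<lambda>h. (h * t, 0))) (at u)"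
        by (auto intro!: derivative_eq_intros)
      from has_derivative_compose[OF this smooth_around_has_derivative[OF sm[OF that]]]
      have "((\<lambda>u. G (u * t, y)) has_derivative (\<lambda>h. frechet_derivative G (at (u * t, y)) (h * t, 0))) (at u)" .
      moreover have "frechet_derivative G (at (u * t, y)) (h * t, 0) = h *\<^sub>R t *\<^sub>R frechet_derivative G (at (u * t, y)) (1, 0)" for h
        using linear_scale[OF smooth_around_linear_frechet[OF sm[OF that]], of "h * t" "(1, 0)"] by simp
      ultimately show ?thesis unfolding has_vector_derivative_def by (auto intro: has_derivative_at_withinI)
    qed
    from fundamental_theorem_of_calculus[OF _ this]
    have "((\<lambda>u. t *\<^sub>R frechet_derivative G (at (u * t, y)) (1, 0)) has_integral G (t, y) - G (0, y)) {0..1}" by simp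
    from integral_unique[OF this] show ?thesis unfolding hadamard_quotient_def by (simp add: algebra_simps)
  qed
  show ?thesis unfolding eventually_nhds
  proof (intro exI conjI ballI)
    show "open (ball 0 e \<times> B)" using AB(3) by (intro open_Times open_ball)
    show "(0, x) \<in> ball 0 e \<times> B" using AB(4) e(1) by simp
    fix p :: "real \<times> 'a" assume "p \<in> ball 0 e \<times> B"
    then show "G p = G (0, snd p) + fst p *\<^sub>R hadamard_quotient G p"
      using eq[of "fst p" "snd p"] by (simp add: mem_Times_iff)
  qed
qed

lemma frechet_derivative_line:
  assumes "smooth_around (c 0) f" "(c has_vector_derivative v) (at (0::real))"
  shows "frechet_derivative (\<lambda>t. f (c t)) (at 0) 1 = frechet_derivative f (at (c 0)) v"
  using frechet_derivativeI[OF has_derivative_compose[OF assms(2)[unfolded has_vector_derivative_def]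
        smooth_around_has_derivative[OF assms(1)]]] by simp

lemma frechet_derivative_along:
  assumes "smooth_around c f"
  shows "frechet_derivative (\<lambda>t. f (c + t *\<^sub>R v)) (at 0) 1 = frechet_derivative f (at c) v"
proof -
  have "((\<lambda>t. c + t *\<^sub>R v) has_vector_derivative v) (at 0)"
    unfolding has_vector_derivative_def
    by (rule has_derivative_eq_rhs[OF has_derivative_add[OF has_derivative_const
        has_derivative_scaleR_left[OF has_derivative_ident]]]) auto
  from frechet_derivative_line[OF _ this, of f] assms show ?thesis by simp
qed

text \<open>Symmetry of second derivatives: write \<open>f (x + s u + t v) = f (x + s u) + t K (t, s)\<close> with \<open>K\<close>
  smooth and differentiate in \<open>s\<close> and in \<open>t\<close>.\<close>

lemma frechet_derivative_commute:
  fixes f :: "'a::euclidean_space \<Rightarrow> 'b::euclidean_space"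
  assumes f: "smooth_around x f"
  shows "frechet_derivative (\<lambda>y. frechet_derivative f (at y) u) (at x) v
       = frechet_derivative (\<lambda>y. frechet_derivative f (at y) v) (at x) u"
proof -
  define G where "G = (\<lambda>p. f (x + snd p *\<^sub>R u + fst p *\<^sub>R v))"
  have sG: "smooth_around (0, 0) G"
    unfolding G_def by (rule smooth_around_compose[where g=f], (rule smooth_intros)+) (simp add: f)
  define K where "K = hadamard_quotient G"
  have sK: "smooth_around (0, 0) K" unfolding K_def by (rule smooth_around_hadamard_quotient[OF sG])
  have ev: "\<forall>\<^sub>F p in nhds (0, 0). G p = G (0, snd p) + fst p *\<^sub>R K p \<and> smooth_around p K \<and> smooth_around p G"
    unfolding K_def by (intro eventually_conj hadamard_quotient_eq sG smooth_around_eventually sK[unfolded K_def])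
  obtain A B where AB: "open A" "0 \<in> A" "open B" "0 \<in> B"
    and GK: "\<And>t s. t \<in> A \<Longrightarrow> s \<in> B \<Longrightarrow> G (t, s) = G (0, s) + t *\<^sub>R K (t, s) \<and> smooth_around (t, s) K \<and> smooth_around (t, s) G"
    using eventually_nhds_PairE[OF ev, simplified fst_conv snd_conv] by metis
  let ?k = "\<lambda>t. frechet_derivative K (at (t, 0)) (0, 1)"
  have line_s: "frechet_derivative (\<lambda>s. Q (t, s)) (at 0) 1 = frechet_derivative Q (at (t, 0)) (0, 1)"
    if "smooth_around (t, 0) Q" for Q :: "real \<times> real \<Rightarrow> 'b" and t
  proof -
    have "((\<lambda>s. (t, s)) has_vector_derivative (0, 1)) (at 0)"
      unfolding has_vector_derivative_def
      by (rule has_derivative_eq_rhs[OF has_derivative_Pair[OF has_derivative_const has_derivative_ident]]) auto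
    from frechet_derivative_line[OF _ this, of Q] that show ?thesis by simp
  qed
  have evf: "\<forall>\<^sub>F t in nhds 0. smooth_around (x + t *\<^sub>R v) f"
  proof -
    have "((\<lambda>t. x + t *\<^sub>R v) \<longlongrightarrow> x + 0 *\<^sub>R v) (nhds 0)" by (intro tendsto_intros filterlim_ident)
    then show ?thesis using eventually_compose_filterlim[OF smooth_around_eventually[OF f], of "\<lambda>t. x + t *\<^sub>R v"] by simp
  qed
  have 1: "\<forall>\<^sub>F t in nhds 0. frechet_derivative f (at (x + t *\<^sub>R v)) u = frechet_derivative f (at x) u + t *\<^sub>R ?k t"
  proof -
    have "\<forall>\<^sub>F t in nhds 0. t \<in> A" using AB by (auto simp: eventually_nhds)
    with evf show ?thesis
    proof eventually_elim
      case (elim t)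
      have GKt: "smooth_around (t, 0) K" "smooth_around (t, 0) G" using GK[of t 0] AB elim by auto
      have "frechet_derivative f (at (x + t *\<^sub>R v)) u = frechet_derivative (\<lambda>s. G (t, s)) (at 0) 1"
        unfolding G_def using frechet_derivative_along[OF elim(1), of u] by (simp add: add_ac)
      also have "\<dots> = frechet_derivative (\<lambda>s. G (0, s) + t *\<^sub>R K (t, s)) (at 0) 1"
      proof -
        have "\<forall>\<^sub>F s in nhds 0. G (t, s) = G (0, s) + t *\<^sub>R K (t, s)"
          by (rule eventually_mono[OF eventually_nhds_in_open[OF AB(3,4)]]) (use GK elim in blast)
        from fun_cong[OF frechet_derivative_cong_nhds[OF this]] show ?thesis .
      qed
      also have "\<dots> = frechet_derivative (\<lambda>s. G (0, s)) (at 0) 1 + t *\<^sub>R frechet_derivative (\<lambda>s. K (t, s)) (at 0) 1"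
      proof -
        have s1: "smooth_around 0 (\<lambda>s. G (0, s))"
          by (rule smooth_around_compose[where g=G]) (auto intro!: smooth_around_Pair sG)
        have s2: "smooth_around 0 (\<lambda>s. K (t, s))"
          by (rule smooth_around_compose[where g=K]) (auto intro!: smooth_around_Pair GKt)
        show ?thesis
          by (subst frechet_derivativeI[OF has_derivative_add[OF smooth_around_has_derivative[OF s1]
             has_derivative_scaleR_right[OF smooth_around_has_derivative[OF s2]]]]) simp
      qed
      also have "frechet_derivative (\<lambda>s. G (0, s)) (at 0) 1 = frechet_derivative f (at x) u"
        unfolding G_def using frechet_derivative_along[OF f, of u] by simp
      also have "frechet_derivative (\<lambda>s. K (t, s)) (at 0) 1 = ?k t" by (rule line_s[OF GKt(1)])
      finally show ?case .
    qed
  qed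
  have sk: "smooth_around 0 ?k"
    by (rule smooth_around_compose[where g="\<lambda>p. frechet_derivative K (at p) (0, 1)"])
       (auto intro!: smooth_around_Pair smooth_around_frechet sK)
  have "frechet_derivative (\<lambda>y. frechet_derivative f (at y) u) (at x) v
      = frechet_derivative (\<lambda>t. frechet_derivative f (at (x + t *\<^sub>R v)) u) (at 0) 1"
    by (rule frechet_derivative_along[OF smooth_around_frechet[OF f], symmetric])
  also have "\<dots> = frechet_derivative (\<lambda>t. frechet_derivative f (at x) u + t *\<^sub>R ?k t) (at 0) 1"
    by (rule fun_cong[OF frechet_derivative_cong_nhds[OF 1]])
  also have "\<dots> = ?k 0"
    by (subst frechet_derivativeI[OF has_derivative_add[OF has_derivative_const
        has_derivative_scaleR[OF has_derivative_ident smooth_around_has_derivative[OF sk]]]]) simp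
  also have "\<dots> = frechet_derivative (\<lambda>s. K (0, s)) (at 0) 1" by (rule line_s[OF sK, symmetric])
  also have "\<dots> = frechet_derivative (\<lambda>s. frechet_derivative f (at (x + s *\<^sub>R u)) v) (at 0) 1"
  proof -
    have evf': "\<forall>\<^sub>F t in nhds 0. smooth_around (x + t *\<^sub>R u) f"
    proof -
      have "((\<lambda>t. x + t *\<^sub>R u) \<longlongrightarrow> x + 0 *\<^sub>R u) (nhds 0)" by (intro tendsto_intros filterlim_ident)
      then show ?thesis using eventually_compose_filterlim[OF smooth_around_eventually[OF f], of "\<lambda>t. x + t *\<^sub>R u"] by simp
    qed
    have "\<forall>\<^sub>F s in nhds 0. K (0, s) = frechet_derivative f (at (x + s *\<^sub>R u)) v"
      using evf'
    proof eventually_elim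
      case (elim s)
      have "frechet_derivative G (at (0, s)) (1, 0) = frechet_derivative f (at (x + s *\<^sub>R u)) v"
      proof -
        have h: "((\<lambda>p. x + snd p *\<^sub>R u + fst p *\<^sub>R v) has_derivative (\<lambda>h. snd h *\<^sub>R u + fst h *\<^sub>R v)) (at (0, s))"
          by (auto intro!: derivative_eq_intros)
        show ?thesis unfolding G_def
          by (subst frechet_derivativeI[OF has_derivative_compose[OF h]])
             (use smooth_around_has_derivative elim in \<open>auto\<close>)
      qed
      then show ?case unfolding K_def hadamard_quotient_def by simp
    qed
    from fun_cong[OF frechet_derivative_cong_nhds[OF this]] show ?thesis .
  qed
  also have "\<dots> = frechet_derivative (\<lambda>y. frechet_derivative f (at y) v) (at x) u"
    by (rule frechet_derivative_along[OF smooth_around_frechet[OF f]])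
  finally show ?thesis .
qed

subsection \<open>Weighted order\<close>

text \<open>Only the points with \<open>t = 0\<close> are asked for, but with all \<open>x\<close>:
  a function given near \<open>0\<close> can be evaluated at \<open>\<delta>_t x\<close> for any
  \<open>x\<close>, provided \<open>t\<close> is small, and how small depends on
  \<open>x\<close>.\<close>

definition slice_smooth :: "(real \<times> 'a::real_normed_vector \<Rightarrow> 'b::real_normed_vector) \<Rightarrow> bool" where
  "slice_smooth G \<longleftrightarrow> (\<forall>x. smooth_around (0, x) G)"

definition worder_witness :: "('n::finite \<Rightarrow> nat) \<Rightarrow> nat \<Rightarrow> (real ^ 'n \<Rightarrow> real) \<Rightarrow> (real \<times> (real ^ 'n) \<Rightarrow> real) \<Rightarrow> bool" where
  "worder_witness w N f G \<longleftrightarrow> smooth_around 0 f \<and> slice_smooth G \<and>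
     (\<forall>x. \<forall>\<^sub>F p in nhds (0, x). f (dilation w (fst p) (snd p)) = fst p ^ N * G p)"

text \<open>Asking for a smooth quotient \<open>f (\<delta>_t x) / t^N\<close> avoids Taylor expansions.\<close>

definition worder :: "('n::finite \<Rightarrow> nat) \<Rightarrow> nat \<Rightarrow> (real ^ 'n \<Rightarrow> real) \<Rightarrow> bool" where
  "worder w N f \<longleftrightarrow> (\<exists>G. worder_witness w N f G)"

lemma dilation_nth [simp]: "dilation w t x $ k = t ^ w k * x $ k"
  by (simp add: dilation_def)

lemma dilation_dilation: "dilation w s (dilation w t x) = dilation w (s * t) x"
  by (simp add: vec_eq_iff power_mult_distrib mult.assoc)

lemma dilation_1 [simp]: "dilation w 1 x = x"
  by (simp add: vec_eq_iff)

lemma dilation_0_right [simp]: "dilation w t 0 = 0"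
  by (simp add: vec_eq_iff)

lemma dilation_cancel: "t \<noteq> 0 \<Longrightarrow> dilation w t x = dilation w t y \<Longrightarrow> x = y"
  by (simp add: vec_eq_iff)

lemma bounded_linear_dilation: "bounded_linear (dilation w t)"
  unfolding linear_conv_bounded_linear[symmetric]
  by (rule linearI) (simp_all add: vec_eq_iff algebra_simps)

lemma dilation_sum: "dilation w t (\<Sum>i\<in>I. f i) = (\<Sum>i\<in>I. dilation w t (f i))"
  by (rule linear_sum[OF bounded_linear.linear[OF bounded_linear_dilation]])

lemma dilation_axis: "dilation w t (axis j c) = t ^ w j *\<^sub>R axis j c"
  by (simp add: vec_eq_iff axis_def)

lemma smooth_around_dilation:
  assumes "smooth_around z f" "smooth_around z g"
  shows "smooth_around z (\<lambda>p. dilation w (f p) (g p))"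
  by (rule smooth_around_vec) (simp, (rule assms smooth_intros)+)

lemma frechet_vec_nth_vec:
  fixes f :: "'a::real_normed_vector \<Rightarrow> real ^ 'm"
  assumes "smooth_around x f"
  shows "frechet_derivative (\<lambda>y. f y $ k) (at x) v = frechet_derivative f (at x) v $ k"
  using frechet_derivativeI[OF bounded_linear.has_derivative[OF bounded_linear_vec_nth smooth_around_has_derivative[OF assms]]]
  by simp

lemma frechet_vec_nth: "frechet_derivative (\<lambda>x::real ^ 'n. x $ k) (at x) v = v $ k"
  by (subst frechet_derivativeI[OF bounded_linear.has_derivative[OF bounded_linear_vec_nth has_derivative_ident]]) simp

lemma vec_axis_expand: "(v :: real ^ 'n) = (\<Sum>k\<in>UNIV. v $ k *\<^sub>R axis k 1)"
  by (auto simp: vec_eq_iff axis_def if_distrib cong: if_cong)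

lemma linear_axis_expand:
  fixes L :: "real ^ 'n \<Rightarrow> 'c::real_vector"
  assumes "linear L" shows "L v = (\<Sum>k\<in>UNIV. v $ k *\<^sub>R L (axis k 1))"
  using linear_sum[OF assms, of "\<lambda>k. v $ k *\<^sub>R axis k 1" UNIV] linear_scale[OF assms]
    vec_axis_expand[of v] by simp

lemma slice_smoothD: "slice_smooth G \<Longrightarrow> smooth_around (0, x) G"
  by (simp add: slice_smooth_def)

lemma smooth_around_slice:
  fixes G :: "real \<times> 'b::euclidean_space \<Rightarrow> 'c::real_normed_vector"
  assumes "smooth_around (t, x) G"
  shows "smooth_around x (\<lambda>y. G (t, y))"
  by (rule smooth_around_compose[where g=G and f="\<lambda>y. (t, y)"]) (rule assms smooth_intros)+

lemma frechet_slice: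
  fixes G :: "real \<times> 'b::euclidean_space \<Rightarrow> 'c::real_normed_vector"
  assumes "smooth_around (t, x) G"
  shows "frechet_derivative (\<lambda>y. G (t, y)) (at x) v = frechet_derivative G (at (t, x)) (0, v)"
  using frechet_derivativeI[OF has_derivative_compose[OF has_derivative_Pair[OF has_derivative_const has_derivative_ident]
     smooth_around_has_derivative[OF assms]]] by simp

lemma filterlim_slice: "filterlim (\<lambda>t. (t, x)) (nhds (0, x)) (at (0::real))"
  by (intro tendsto_Pair tendsto_const tendsto_ident_at)

lemma tendsto_slice:
  assumes "smooth_around (0, x) G"
  shows "((\<lambda>t. G (t, x)) \<longlongrightarrow> G (0::real, x)) (at 0)"
  by (rule isCont_tendsto_compose[OF smooth_around_imp_continuous[OF assms] filterlim_slice])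

lemma eventually_slice:
  assumes "\<forall>\<^sub>F p in nhds (0, x). P p" shows "\<forall>\<^sub>F t in at (0::real). P (t, x)"
  by (rule eventually_compose_filterlim[OF assms filterlim_slice])

lemma eventually_at_neq_0: "\<forall>\<^sub>F t in at (0::real). t \<noteq> 0"
  by (simp add: eventually_at_filter)

text \<open>The device by which limits as \<open>t\<close> tends to \<open>0\<close> become
  identities: the relation is proved where powers of \<open>t\<close> can be cancelled, and both
  sides are continuous at the slice.\<close>

lemma eq_at_slice:
  fixes F F' :: "real \<times> 'a::real_normed_vector \<Rightarrow> 'b::real_normed_vector"
  assumes "smooth_around (0, x) F" "smooth_around (0, x) F'"
    "\<forall>\<^sub>F p in nhds (0, x). fst p \<noteq> 0 \<longrightarrow> F p = F' p"
  shows "F (0, x) = F' (0, x)"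
proof (rule tendsto_unique[OF _ tendsto_slice[OF assms(1)]])
  have "\<forall>\<^sub>F t in at 0. F' (t, x) = F (t, x)"
    using eventually_slice[OF assms(3)] eventually_at_neq_0 by eventually_elim simp
  then show "((\<lambda>t. F (t, x)) \<longlongrightarrow> F' (0, x)) (at 0)"
    using tendsto_slice[OF assms(2)] tendsto_cong by fast
qed simp

lemma eventually_eq_at_slice:
  fixes F F' :: "real \<times> 'a::real_normed_vector \<Rightarrow> 'b::real_normed_vector"
  assumes "smooth_around (0, x) F" "smooth_around (0, x) F'"
    "\<forall>\<^sub>F p in nhds (0, x). fst p \<noteq> 0 \<longrightarrow> F p = F' p"
  shows "\<forall>\<^sub>F p in nhds (0, x). F p = F' p"
proof -
  have "\<forall>\<^sub>F p in nhds (0, x). smooth_around p F \<and> smooth_around p F' \<and>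
      (\<forall>\<^sub>F q in nhds p. fst q \<noteq> 0 \<longrightarrow> F q = F' q)"
    using assms by (intro eventually_conj smooth_around_eventually) (simp_all add: eventually_eventually)
  then show ?thesis
  proof (rule eventually_mono)
    fix p :: "real \<times> 'a"
    assume p: "smooth_around p F \<and> smooth_around p F' \<and> (\<forall>\<^sub>F q in nhds p. fst q \<noteq> 0 \<longrightarrow> F q = F' q)"
    show "F p = F' p"
    proof (cases "fst p = 0")
      case True
      then have "p = (0, snd p)" by (simp add: prod_eq_iff)
      then show ?thesis using eq_at_slice[of "snd p" F F'] p by metis
    next
      case False then show ?thesis using p eventually_nhds_x_imp_x by fastforce
    qed
  qed
qed

locale weights =
  fixes w :: "'n::finite \<Rightarrow> nat"
  assumes w_pos: "1 \<le> w j"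
begin

lemma dilation_0 [simp]: "dilation w 0 x = 0"
proof -
  have "0 < w j" for j using w_pos[of j] by simp
  then show ?thesis by (simp add: vec_eq_iff zero_power)
qed

lemma tendsto_dilation: "((\<lambda>p. dilation w (fst p) (snd p)) \<longlongrightarrow> 0) (nhds (0::real, x))"
proof -
  have "smooth_around (0, x) (\<lambda>p. dilation w (fst p) (snd p))"
    by (rule smooth_around_dilation smooth_intros)+
  from smooth_around_imp_continuous[OF this, unfolded isCont_def, THEN tendsto_at_iff_tendsto_nhds[THEN iffD1]]
  show ?thesis by simp
qed

lemma eventually_dilation:
  assumes "\<forall>\<^sub>F y in nhds 0. P y"
  shows "\<forall>\<^sub>F p in nhds (0::real, x). P (dilation w (fst p) (snd p))"
  by (rule eventually_compose_filterlim[OF assms tendsto_dilation])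

lemma tendsto_dilation_at: "((\<lambda>t. dilation w t x) \<longlongrightarrow> 0) (at (0::real))"
  using filterlim_compose[OF tendsto_dilation filterlim_slice] by simp

lemma tendsto_compose_dilation:
  assumes "smooth_around 0 f" shows "((\<lambda>t. f (dilation w t x)) \<longlongrightarrow> f 0) (at (0::real))"
  by (rule isCont_tendsto_compose[OF smooth_around_imp_continuous[OF assms] tendsto_dilation_at])

lemma slice_smooth_dilation:
  fixes f :: "real ^ 'n \<Rightarrow> 'b::real_normed_vector"
  assumes "smooth_around 0 f" shows "slice_smooth (\<lambda>p. f (dilation w (fst p) (snd p)))"
  unfolding slice_smooth_def
proof
  fix x
  show "smooth_around (0, x) (\<lambda>p. f (dilation w (fst p) (snd p)))"
    by (rule smooth_around_compose[where g=f], (rule smooth_around_dilation smooth_intros)+) (simp add: assms)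
qed

lemma worder_witness_0: "smooth_around 0 f \<Longrightarrow> worder_witness w 0 f (\<lambda>p. f (dilation w (fst p) (snd p)))"
  unfolding worder_witness_def using slice_smooth_dilation by auto

lemma worder_0: "smooth_around 0 f \<Longrightarrow> worder w 0 f"
  unfolding worder_def using worder_witness_0 by blast

lemma worder_smooth: "worder w N f \<Longrightarrow> smooth_around 0 f"
  by (auto simp: worder_def worder_witness_def)

lemma worderE:
  assumes "worder w N f"
  obtains G where "slice_smooth G"
    "\<And>x. \<forall>\<^sub>F p in nhds (0, x). f (dilation w (fst p) (snd p)) = fst p ^ N * G p"
  using assms unfolding worder_def worder_witness_def by blast

lemma worderI:
  assumes "smooth_around 0 f" "\<And>x. smooth_around (0, x) G"
    "\<And>x. \<forall>\<^sub>F p in nhds (0, x). f (dilation w (fst p) (snd p)) = fst p ^ N * G p"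
  shows "worder w N f"
  using assms unfolding worder_def worder_witness_def slice_smooth_def by blast

lemma worder_add:
  assumes "worder w N f" "worder w N g" shows "worder w N (\<lambda>x. f x + g x)"
proof -
  obtain F where F: "slice_smooth F" "\<And>x. \<forall>\<^sub>F p in nhds (0, x). f (dilation w (fst p) (snd p)) = fst p ^ N * F p"
    by (rule worderE[OF assms(1)]) blast
  obtain G where G: "slice_smooth G" "\<And>x. \<forall>\<^sub>F p in nhds (0, x). g (dilation w (fst p) (snd p)) = fst p ^ N * G p"
    by (rule worderE[OF assms(2)]) blast
  show ?thesis
  proof (rule worderI)
    show "smooth_around 0 (\<lambda>x. f x + g x)" by (rule smooth_around_add worder_smooth assms)+
    show "smooth_around (0, x) (\<lambda>p. F p + G p)" for x by (rule smooth_around_add slice_smoothD F G)+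
    show "\<forall>\<^sub>F p in nhds (0, x). f (dilation w (fst p) (snd p)) + g (dilation w (fst p) (snd p)) = fst p ^ N * (F p + G p)" for x
      using F(2)[of x] G(2)[of x] by eventually_elim (simp add: algebra_simps)
  qed
qed

lemma worder_mult:
  assumes "worder w N f" "worder w M g" shows "worder w (N + M) (\<lambda>x. f x * g x)"
proof -
  obtain F where F: "slice_smooth F" "\<And>x. \<forall>\<^sub>F p in nhds (0, x). f (dilation w (fst p) (snd p)) = fst p ^ N * F p"
    by (rule worderE[OF assms(1)]) blast
  obtain G where G: "slice_smooth G" "\<And>x. \<forall>\<^sub>F p in nhds (0, x). g (dilation w (fst p) (snd p)) = fst p ^ M * G p"
    by (rule worderE[OF assms(2)]) blast
  show ?thesis
  proof (rule worderI)
    show "smooth_around 0 (\<lambda>x. f x * g x)" by (rule smooth_around_mult worder_smooth assms)+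
    show "smooth_around (0, x) (\<lambda>p. F p * G p)" for x by (rule smooth_around_mult slice_smoothD F G)+
    show "\<forall>\<^sub>F p in nhds (0, x). f (dilation w (fst p) (snd p)) * g (dilation w (fst p) (snd p)) = fst p ^ (N + M) * (F p * G p)" for x
      using F(2)[of x] G(2)[of x] by eventually_elim (simp add: power_add)
  qed
qed

lemma worder_mono:
  assumes "worder w M f" "N \<le> M" shows "worder w N f"
proof -
  obtain F where F: "slice_smooth F" "\<And>x. \<forall>\<^sub>F p in nhds (0, x). f (dilation w (fst p) (snd p)) = fst p ^ M * F p"
    by (rule worderE[OF assms(1)]) blast
  show ?thesis
  proof (rule worderI)
    show "smooth_around 0 f" by (rule worder_smooth assms)+
    show "smooth_around (0, x) (\<lambda>p. fst p ^ (M - N) * F p)" for x by (rule slice_smoothD F smooth_intros)+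
    show "\<forall>\<^sub>F p in nhds (0, x). f (dilation w (fst p) (snd p)) = fst p ^ N * (fst p ^ (M - N) * F p)" for x
      using F(2)[of x] by eventually_elim (simp add: assms(2) power_add[symmetric] mult.assoc[symmetric])
  qed
qed

lemma worder_zero_fun: "worder w N (\<lambda>x. 0)"
  by (rule worderI[where G="\<lambda>_. 0"]) simp_all

lemma worder_sum:
  "(\<And>i. i \<in> I \<Longrightarrow> worder w N (f i)) \<Longrightarrow> worder w N (\<lambda>x. \<Sum>i\<in>I. f i x)"
  by (induction I rule: infinite_finite_induct) (simp_all add: worder_zero_fun worder_add)

lemma worder_cong:
  assumes "\<forall>\<^sub>F x in nhds 0. f x = g x" "worder w N f" shows "worder w N g"
proof -
  obtain F where F: "slice_smooth F" "\<And>x. \<forall>\<^sub>F p in nhds (0, x). f (dilation w (fst p) (snd p)) = fst p ^ N * F p"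
    by (rule worderE[OF assms(2)]) blast
  show ?thesis
  proof (rule worderI)
    show "smooth_around 0 g" by (rule smooth_around_cong[OF assms(1) worder_smooth[OF assms(2)]])
    show "smooth_around (0, x) F" for x by (rule slice_smoothD F)+
    show "\<forall>\<^sub>F p in nhds (0, x). g (dilation w (fst p) (snd p)) = fst p ^ N * F p" for x
      using F(2)[of x] eventually_dilation[OF assms(1)] by eventually_elim simp
  qed
qed

lemma worder_coord: "worder w (w k) (\<lambda>x. x $ k)"
proof (rule worderI[where G="\<lambda>p. snd p $ k"])
  show "smooth_around 0 (\<lambda>x::real ^ 'n. x $ k)" by (rule smooth_intros)+
  show "smooth_around (0, x) (\<lambda>p. snd p $ k)" for x :: "real ^ 'n" by (rule smooth_intros)+
qed simp

lemma worder_at_0: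
  assumes "worder w N f" "0 < N" shows "f 0 = 0"
proof -
  obtain F where "\<And>x. \<forall>\<^sub>F p in nhds (0, x). f (dilation w (fst p) (snd p)) = fst p ^ N * F p"
    by (rule worderE[OF assms(1)]) blast
  from eventually_nhds_x_imp_x[OF this[of 0]] show ?thesis using assms(2) by simp
qed

lemma frechet_compose_dilation:
  fixes f :: "real ^ 'n \<Rightarrow> 'b::real_normed_vector"
  assumes "smooth_around (dilation w t x) f"
  shows "frechet_derivative (\<lambda>y. f (dilation w t y)) (at x) v = frechet_derivative f (at (dilation w t x)) (dilation w t v)"
  using frechet_derivativeI[OF has_derivative_compose[OF bounded_linear_imp_has_derivative[OF bounded_linear_dilation]
      smooth_around_has_derivative[OF assms]]] by simp

text \<open>Differentiating the relation between \<open>f\<close> and \<open>G\<close> in the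
  direction \<open>x_j\<close> brings out \<open>t ^ w j\<close> by the chain rule. The relation
  must hold near \<open>y\<close> at fixed \<open>t\<close>, hence the nested eventuality in the
  proof.\<close>

lemma witness_partial:
  assumes "smooth_around 0 f" "slice_smooth G"
    "\<And>x. \<forall>\<^sub>F p in nhds (0, x). f (dilation w (fst p) (snd p)) = fst p ^ N * G p"
  shows "\<forall>\<^sub>F p in nhds (0, x). fst p ^ w j * frechet_derivative f (at (dilation w (fst p) (snd p))) (axis j 1)
     = fst p ^ N * frechet_derivative G (at p) (0, axis j 1)"
proof -
  have ev: "\<forall>\<^sub>F p in nhds (0, x). \<forall>\<^sub>F q in nhds p. f (dilation w (fst q) (snd q)) = fst q ^ N * G q"
    using assms(3) by (simp add: eventually_eventually)
  have "\<forall>\<^sub>F p in nhds (0, x). smooth_around (dilation w (fst p) (snd p)) f"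
    by (rule eventually_dilation[OF smooth_around_eventually[OF assms(1)]])
  with ev smooth_around_eventually[OF slice_smoothD[OF assms(2), of x]] show ?thesis
  proof eventually_elim
    case (elim p)
    obtain t y where p: "p = (t, y)" by (cases p)
    have "((\<lambda>z. (t, z)) \<longlongrightarrow> (t, y)) (nhds y)" by (intro tendsto_Pair tendsto_const filterlim_ident)
    then have e: "\<forall>\<^sub>F z in nhds y. f (dilation w t z) = t ^ N * G (t, z)"
      using eventually_compose_filterlim[OF elim(1)[unfolded p]] by force
    have sm: "smooth_around (t, y) G" using elim(2) p by simp
    have "t ^ w j * frechet_derivative f (at (dilation w t y)) (axis j 1) = frechet_derivative f (at (dilation w t y)) (dilation w t (axis j 1))"
      using linear_scale[OF smooth_around_linear_frechet, of "dilation w t y" f "t ^ w j" "axis j 1"] elim(3) p by (simp add: dilation_axis)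
    also have "\<dots> = frechet_derivative (\<lambda>y. f (dilation w t y)) (at y) (axis j 1)"
      using frechet_compose_dilation[of t y f] elim(3) p by simp
    also have "\<dots> = frechet_derivative (\<lambda>z. t ^ N * G (t, z)) (at y) (axis j 1)"
      by (rule fun_cong[OF frechet_derivative_cong_nhds[OF e]])
    also have "\<dots> = t ^ N * frechet_derivative (\<lambda>z. G (t, z)) (at y) (axis j 1)"
      by (subst frechet_derivativeI[OF has_derivative_mult_right[OF smooth_around_has_derivative[OF smooth_around_slice[OF sm]]]]) simp
    finally show ?case using frechet_slice[OF sm] p by simp
  qed
qed

text \<open>Cancels \<open>t ^ w j\<close> in \<open>witness_partial\<close> off the slice and
  extends to it. If \<open>w j > N\<close>, the truncated \<open>N - w j\<close> is \<open>0\<close>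
  and only smoothness is claimed.\<close>

lemma worder_partial:
  assumes "worder w N f"
  shows "worder w (N - w j) (\<lambda>x. frechet_derivative f (at x) (axis j 1))"
proof (cases "w j \<le> N")
  case False
  then show ?thesis using worder_0[OF smooth_around_frechet[OF worder_smooth[OF assms]]] by simp
next
  case True
  obtain G where G: "slice_smooth G" "\<And>x. \<forall>\<^sub>F p in nhds (0, x). f (dilation w (fst p) (snd p)) = fst p ^ N * G p"
    by (rule worderE[OF assms]) blast
  note sf = worder_smooth[OF assms]
  let ?h = "\<lambda>x. frechet_derivative f (at x) (axis j 1)"
  have sh: "smooth_around 0 ?h" by (rule smooth_around_frechet[OF sf])
  show ?thesis
  proof (rule worderI[OF sh])
    show sG: "smooth_around (0, x) (\<lambda>p. frechet_derivative G (at p) (0, axis j 1))" for x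
      by (rule smooth_around_frechet slice_smoothD G(1))+
    show "\<forall>\<^sub>F p in nhds (0, x). ?h (dilation w (fst p) (snd p)) = fst p ^ (N - w j) * frechet_derivative G (at p) (0, axis j 1)" for x
    proof (rule eventually_eq_at_slice)
      show "smooth_around (0, x) (\<lambda>p. ?h (dilation w (fst p) (snd p)))"
        by (rule slice_smoothD[OF slice_smooth_dilation[OF sh]])
      show "smooth_around (0, x) (\<lambda>p. fst p ^ (N - w j) * frechet_derivative G (at p) (0, axis j 1))"
        by (rule smooth_intros sG)+
      show "\<forall>\<^sub>F p in nhds (0, x). fst p \<noteq> 0 \<longrightarrow> ?h (dilation w (fst p) (snd p)) = fst p ^ (N - w j) * frechet_derivative G (at p) (0, axis j 1)"
        using witness_partial[OF sf G, where x=x and j=j]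
      proof eventually_elim
        case (elim p)
        have "fst p ^ N = fst p ^ w j * fst p ^ (N - w j)" using True by (simp add: power_add[symmetric])
        then show ?case using elim by auto
      qed
    qed
  qed
qed

lemma witness_tendsto:
  assumes "slice_smooth G" "\<And>x. \<forall>\<^sub>F p in nhds (0, x). f (dilation w (fst p) (snd p)) = fst p ^ N * G p"
  shows "((\<lambda>t. f (dilation w t x) / t ^ N) \<longlongrightarrow> G (0, x)) (at 0)"
proof -
  have "\<forall>\<^sub>F t in at 0. G (t, x) = f (dilation w t x) / t ^ N"
    using eventually_slice[OF assms(2)[of x]] eventually_at_neq_0 by eventually_elim simp
  then show ?thesis using tendsto_slice[OF slice_smoothD[OF assms(1)]] tendsto_cong by fast
qed

lemma worder_tendsto:
  assumes "worder w N f" shows "\<exists>l. ((\<lambda>t. f (dilation w t x) / t ^ N) \<longlongrightarrow> l) (at 0)"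
  by (rule worderE[OF assms]) (use witness_tendsto in blast)

lemma worder_tendsto_0:
  assumes "worder w M f" "N < M" shows "((\<lambda>t. f (dilation w t x) / t ^ N) \<longlongrightarrow> 0) (at 0)"
proof -
  obtain l where l: "((\<lambda>t. f (dilation w t x) / t ^ M) \<longlongrightarrow> l) (at 0)" using worder_tendsto[OF assms(1)] by blast
  have "((\<lambda>t. t ^ (M - N) * (f (dilation w t x) / t ^ M)) \<longlongrightarrow> 0 ^ (M - N) * l) (at 0)"
    by (intro tendsto_intros l)
  moreover have "\<forall>\<^sub>F t in at 0. t ^ (M - N) * (f (dilation w t x) / t ^ M) = f (dilation w t x) / t ^ N"
    using eventually_at_neq_0
  proof eventually_elim
    case (elim t)
    have "t ^ M = t ^ N * t ^ (M - N)" using assms(2) by (simp add: power_add[symmetric])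
    then show ?case using elim by simp
  qed
  ultimately show ?thesis using assms(2) tendsto_cong by (force simp: power_0_left)
qed

text \<open>A vanishing limit means \<open>G (0, x) = 0\<close>; Hadamard's quotient of
  \<open>G\<close> then carries the next factor \<open>t\<close>. Raising the order one step at a
  time in this way does the work of Taylor's formula.\<close>

lemma worder_SucI:
  assumes "worder w N f" "\<And>x. ((\<lambda>t. f (dilation w t x) / t ^ N) \<longlongrightarrow> 0) (at 0)"
  shows "worder w (Suc N) f"
proof -
  obtain G where G: "slice_smooth G" "\<And>x. \<forall>\<^sub>F p in nhds (0, x). f (dilation w (fst p) (snd p)) = fst p ^ N * G p"
    by (rule worderE[OF assms(1)]) blast
  have G0: "G (0, x) = 0" for x
    using tendsto_unique[OF _ witness_tendsto[where f=f, OF G] assms(2)] by simp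
  show ?thesis
  proof (rule worderI)
    show "smooth_around 0 f" by (rule worder_smooth[OF assms(1)])
    show "smooth_around (0, x) (hadamard_quotient G)" for x
      by (rule smooth_around_hadamard_quotient[OF slice_smoothD[OF G(1)]])
    show "\<forall>\<^sub>F p in nhds (0, x). f (dilation w (fst p) (snd p)) = fst p ^ Suc N * hadamard_quotient G p" for x
      using G(2)[of x] hadamard_quotient_eq[OF slice_smoothD[OF G(1), of x]]
      by eventually_elim (simp add: G0)
  qed
qed

end

subsection \<open>Frames in privileged coordinates and their homogeneous limits\<close>

definition frame_op :: "('n \<Rightarrow> real ^ 'n \<Rightarrow> real ^ 'n) \<Rightarrow> 'n \<Rightarrow> (real ^ 'n \<Rightarrow> real) \<Rightarrow> real ^ 'n \<Rightarrow> real" where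
  "frame_op b j f x = frechet_derivative f (at x) (b j x)"

definition word_op :: "('n \<Rightarrow> real ^ 'n \<Rightarrow> real ^ 'n) \<Rightarrow> 'n list \<Rightarrow> (real ^ 'n \<Rightarrow> real) \<Rightarrow> real ^ 'n \<Rightarrow> real" where
  "word_op b I f = foldr (frame_op b) I f"

abbreviation wt :: "('n \<Rightarrow> nat) \<Rightarrow> 'n list \<Rightarrow> nat" where
  "wt w I \<equiv> sum_list (map w I)"

lemma word_op_Nil [simp]: "word_op b [] f = f"
  and word_op_Cons [simp]: "word_op b (j # I) f = frame_op b j (word_op b I f)"
  and word_op_append: "word_op b (I @ J) f = word_op b I (word_op b J f)"
  by (simp_all add: word_op_def)

lemma frame_op_coord: "frame_op b j (\<lambda>x. x $ k) = (\<lambda>x. b j x $ k)"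
  by (simp add: frame_op_def frechet_vec_nth fun_eq_iff)

lemma frame_op_expand:
  fixes b :: "'n::finite \<Rightarrow> real ^ 'n \<Rightarrow> real ^ 'n"
  assumes "smooth_around x f"
  shows "frame_op b j f x = (\<Sum>k\<in>UNIV. b j x $ k * frechet_derivative f (at x) (axis k 1))"
  unfolding frame_op_def using linear_axis_expand[OF smooth_around_linear_frechet[OF assms], of "b j x"] by simp

lemma smooth_around_frame_op:
  fixes b :: "'n::finite \<Rightarrow> real ^ 'n \<Rightarrow> real ^ 'n"
  assumes "smooth_around x (b j)" "smooth_around x f"
  shows "smooth_around x (frame_op b j f)"
  unfolding frame_op_def[abs_def]
  by (rule smooth_around_frechet_compose[where f="\<lambda>x. x"]) (simp_all add: assms)

lemma smooth_around_word_op: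
  fixes b :: "'n::finite \<Rightarrow> real ^ 'n \<Rightarrow> real ^ 'n"
  assumes "\<And>j. smooth_around x (b j)" "smooth_around x f"
  shows "smooth_around x (word_op b I f)"
  by (induction I) (simp_all add: assms smooth_around_frame_op)

lemma frame_op_cong:
  assumes "\<forall>\<^sub>F x in nhds a. f x = g x"
  shows "\<forall>\<^sub>F x in nhds a. frame_op b j f x = frame_op b j g x"
proof -
  have "\<forall>\<^sub>F x in nhds a. \<forall>\<^sub>F y in nhds x. f y = g y" using assms by (simp add: eventually_eventually)
  then show ?thesis
    unfolding frame_op_def by eventually_elim (rule fun_cong[OF frechet_derivative_cong_nhds])
qed

lemma word_op_cong:
  "\<forall>\<^sub>F x in nhds a. f x = g x \<Longrightarrow> \<forall>\<^sub>F x in nhds a. word_op b I f x = word_op b I g x"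
  by (induction I) (simp_all add: frame_op_cong)

lemma frame_op_transition:
  fixes b b' :: "'n::finite \<Rightarrow> real ^ 'n \<Rightarrow> real ^ 'n"
  assumes "smooth_around x \<Phi>" "smooth_around (\<Phi> x) f" "frechet_derivative \<Phi> (at x) (b j x) = b' j (\<Phi> x)"
  shows "frame_op b j (\<lambda>x. f (\<Phi> x)) x = frame_op b' j f (\<Phi> x)"
  unfolding frame_op_def using frechet_derivative_compose_smooth[OF assms(1,2)] assms(3) by simp

text \<open>Fields related by \<open>\<Phi>\<close> differentiate pulled back functions alike. The
  identity has to hold on a neighbourhood, since the next letter differentiates it.\<close>

lemma word_op_transition:
  fixes b b' :: "'n::finite \<Rightarrow> real ^ 'n \<Rightarrow> real ^ 'n"
  assumes \<Phi>: "smooth_around a \<Phi>" and b': "\<And>j. smooth_around (\<Phi> a) (b' j)" and f: "smooth_around (\<Phi> a) f"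
    and tr: "\<forall>\<^sub>F x in nhds a. \<forall>j. frechet_derivative \<Phi> (at x) (b j x) = b' j (\<Phi> x)"
  shows "\<forall>\<^sub>F x in nhds a. word_op b I (\<lambda>x. f (\<Phi> x)) x = word_op b' I f (\<Phi> x)"
proof (induction I)
  case (Cons j I)
  have "(\<Phi> \<longlongrightarrow> \<Phi> a) (nhds a)"
    using smooth_around_imp_continuous[OF \<Phi>] by (simp add: isCont_def tendsto_at_iff_tendsto_nhds)
  from eventually_compose_filterlim[OF smooth_around_eventually[OF smooth_around_word_op[OF b' f]] this]
  have "\<forall>\<^sub>F x in nhds a. smooth_around (\<Phi> x) (word_op b' I f)" .
  with frame_op_cong[OF Cons, of b j] tr smooth_around_eventually[OF \<Phi>] show ?case
  proof eventually_elim
    case (elim x)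
    show ?case unfolding word_op_Cons elim(1)
      by (rule frame_op_transition) (use elim in auto)
  qed
qed simp

lemma has_derivative_zero_imp_const:
  fixes g :: "real ^ 'n \<Rightarrow> real"
  assumes "\<And>x. smooth_around x g" "\<And>x k. frechet_derivative g (at x) (axis k 1) = 0"
  shows "g x = g 0"
proof -
  have "(g has_derivative (\<lambda>h. 0)) (at x)" for x
  proof -
    have "frechet_derivative g (at x) = (\<lambda>h. 0)"
      using linear_axis_expand[OF smooth_around_linear_frechet[OF assms(1)], of x] assms(2) by auto
    then show ?thesis using smooth_around_has_derivative[OF assms(1), of x] by simp
  qed
  then show ?thesis using has_derivative_zero_unique[of UNIV g 0 x] by (auto simp: )
qed

text \<open>Privileged coordinates read at \<open>0\<close>; linear adaptedness is weakened to the blocks of equal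
  weight because the second half of the theorem does not assume it.\<close>

definition (in weights) good_frame :: "('n \<Rightarrow> real ^ 'n \<Rightarrow> real ^ 'n) \<Rightarrow> bool" where
  "good_frame b \<longleftrightarrow> (\<forall>j. smooth_around 0 (b j)) \<and>
     (\<forall>k I. wt w I < w k \<longrightarrow> word_op b I (\<lambda>x. x $ k) 0 = 0) \<and>
     (\<forall>j k. w j = w k \<longrightarrow> b j 0 $ k = (if j = k then 1 else 0))"

context weights begin

lemma
  assumes "good_frame b"
  shows good_smooth: "smooth_around 0 (b j)"
    and good_order: "wt w I < w k \<Longrightarrow> word_op b I (\<lambda>x. x $ k) 0 = 0"
    and good_diag: "w j = w k \<Longrightarrow> b j 0 $ k = (if j = k then 1 else 0)"
  using assms unfolding good_frame_def by auto

text \<open>The coefficient \<open>b j x $ k\<close> is \<open>b j\<close> applied to the coordinate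
  \<open>x_k\<close>, so a word on it is a word on \<open>x_k\<close> with \<open>j\<close>
  appended. For \<open>w k \<le> w j\<close> the bound \<open>w k - w j\<close> is \<open>0\<close>
  and the claim is void.\<close>

lemma good_word_coefficient:
  "good_frame b \<Longrightarrow> wt w I < w k - w j \<Longrightarrow> word_op b I (\<lambda>x. b j x $ k) 0 = 0"
  using good_order[of b "I @ [j]" k] by (simp add: word_op_append frame_op_coord)

text \<open>Induction on \<open>N\<close>: if \<open>f (\<delta>_t x) = t^n G (t, x)\<close> and all words of weight \<open>n\<close> kill \<open>f\<close> at
  \<open>0\<close>, then \<open>G (0, \<cdot>)\<close> is constant, so another factor \<open>t\<close> splits off.\<close>

theorem frame_order_imp_worder:
  assumes b: "good_frame b" and f: "smooth_around 0 f"
    and "\<And>I. wt w I < N \<Longrightarrow> word_op b I f 0 = 0"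
  shows "worder w N f"
  using f assms(3)
proof (induction N arbitrary: f rule: less_induct)
  case (less N)
  note f = less.prems(1)
  show ?case
  proof (cases N)
    case 0 then show ?thesis using worder_0[OF f] by simp
  next
    case (Suc n)
    have Pn: "worder w n f" by (rule less.IH) (use Suc less.prems in auto)
    obtain G where G: "slice_smooth G" "\<And>x. \<forall>\<^sub>F p in nhds (0, x). f (dilation w (fst p) (snd p)) = fst p ^ n * G p"
      by (rule worderE[OF Pn]) blast
    define g where "g = (\<lambda>x. G (0, x))"
    have sg: "smooth_around x g" for x unfolding g_def by (rule smooth_around_slice slice_smoothD G)+
    \<comment> \<open>The frame coefficients satisfy the hypothesis with \<open>w k - w j\<close> in
      place of \<open>N\<close>, so the outer induction applies to them, but only up to order
      \<open>n\<close>; this is why there are two cases.\<close>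
    have coeff: "worder w (w k - w j) (\<lambda>x. b j x $ k)" if "w k - w j \<le> n" for j k
      by (rule less.IH) (use that Suc good_word_coefficient[OF b] good_smooth[OF b] in \<open>auto intro: smooth_around_vec_nth\<close>)
    have coeffn: "worder w n (\<lambda>x. b j x $ k)" if "w k - w j > n" for j k
      by (rule less.IH) (use that Suc good_word_coefficient[OF b] good_smooth[OF b] in \<open>auto intro: smooth_around_vec_nth\<close>)
    have "frechet_derivative g (at x) (axis k 1) = 0" for x k
    proof -
      \<comment> \<open>\<open>v k\<close> is the \<open>k\<close>-th partial derivative of
        \<open>g\<close> at \<open>x\<close>; \<open>a\<close> and \<open>c\<close> are the partial
        derivatives of \<open>f\<close> and the frame coefficients along the curve
        \<open>\<delta>_t x\<close>.\<close>
      define v where "v = (\<lambda>k. frechet_derivative G (at (0, x)) (0, axis k 1))"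
      define a where "a = (\<lambda>k t. frechet_derivative f (at (dilation w t x)) (axis k 1))"
      define c where "c = (\<lambda>j k t. b j (dilation w t x) $ k)"
      have lv: "((\<lambda>t. t ^ w k * a k t / t ^ n) \<longlongrightarrow> v k) (at 0)" for k
      proof -
        have "\<forall>\<^sub>F t in at 0. frechet_derivative G (at (t, x)) (0, axis k 1) = t ^ w k * a k t / t ^ n"
          using eventually_slice[OF witness_partial[OF f G, where x=x and j=k]] eventually_at_neq_0
          by eventually_elim (simp add: a_def)
        moreover have "((\<lambda>t. frechet_derivative G (at (t, x)) (0, axis k 1)) \<longlongrightarrow> v k) (at 0)"
          unfolding v_def by (rule tendsto_slice[where G="\<lambda>p. frechet_derivative G (at p) (0, axis k 1)", OF smooth_around_frechet[OF slice_smoothD[OF G(1)]]])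
        ultimately show ?thesis using tendsto_cong by fast
      qed
      have la: "(a k \<longlongrightarrow> a k 0) (at 0)" for k
        unfolding a_def using tendsto_compose_dilation[OF smooth_around_frechet[OF f, where v="axis k 1"], where x=x] by simp
      have lc: "(c j k \<longlongrightarrow> c j k 0) (at 0)" for j k
        unfolding c_def using tendsto_compose_dilation[OF smooth_around_vec_nth[OF good_smooth[OF b, of j], where k=k], where x=x] by simp
      \<comment> \<open>A word on \<open>frame_op b j f\<close> is a word on \<open>f\<close> with
        \<open>j\<close> appended, so the outer induction gives it order \<open>n + 1 - w j\<close>,
        one more than is needed for a finite limit. For \<open>w j > n\<close> a power of
        \<open>t\<close> is left over.\<close>
      have lhs: "((\<lambda>t. t ^ w j * frame_op b j f (dilation w t x) / t ^ n) \<longlongrightarrow> 0) (at 0)" for j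
      proof -
        have so: "smooth_around 0 (frame_op b j f)" by (rule smooth_around_frame_op[OF good_smooth[OF b] f])
        show ?thesis
        proof (cases "w j \<le> n")
          case True
          have "worder w (Suc n - w j) (frame_op b j f)"
          proof (rule less.IH[OF _ so])
            show "Suc n - w j < N" using Suc w_pos[of j] by simp
            fix I assume "wt w I < Suc n - w j"
            then have "wt w (I @ [j]) < N" using Suc by simp
            from less.prems(2)[OF this] show "word_op b I (frame_op b j f) 0 = 0" by (simp add: word_op_append)
          qed
          from worder_tendsto_0[OF this, of "n - w j" x] True
          have "((\<lambda>t. frame_op b j f (dilation w t x) / t ^ (n - w j)) \<longlongrightarrow> 0) (at 0)" by simp
          moreover have "\<forall>\<^sub>F t in at 0. frame_op b j f (dilation w t x) / t ^ (n - w j) = t ^ w j * frame_op b j f (dilation w t x) / t ^ n"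
            using eventually_at_neq_0
          proof eventually_elim
            case (elim t)
            have "t ^ n = t ^ w j * t ^ (n - w j)" using True by (simp add: power_add[symmetric])
            then show ?case using elim by simp
          qed
          ultimately show ?thesis using tendsto_cong by fast
        next
          case False
          have "((\<lambda>t. t ^ (w j - n) * frame_op b j f (dilation w t x)) \<longlongrightarrow> 0 ^ (w j - n) * frame_op b j f 0) (at 0)"
            by (intro tendsto_intros tendsto_compose_dilation so)
          moreover have "\<forall>\<^sub>F t in at 0. t ^ (w j - n) * frame_op b j f (dilation w t x) = t ^ w j * frame_op b j f (dilation w t x) / t ^ n"
            using eventually_at_neq_0
          proof eventually_elim
            case (elim t)
            have "t ^ w j = t ^ n * t ^ (w j - n)" using False by (simp add: power_add[symmetric])
            then show ?case using elim by simp
          qed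
          ultimately have "((\<lambda>t. t ^ w j * frame_op b j f (dilation w t x) / t ^ n) \<longlongrightarrow> 0 ^ (w j - n) * frame_op b j f 0) (at 0)"
            using tendsto_cong by fast
          then show ?thesis using False by (simp add: zero_power)
        qed
      qed
      have evs: "\<forall>\<^sub>F t in at 0. smooth_around (dilation w t x) f"
        using eventually_slice[OF eventually_dilation[OF smooth_around_eventually[OF f]], of x] by simp
      have sumlim: "((\<lambda>t. \<Sum>k\<in>UNIV. t ^ w j * c j k t * a k t / t ^ n) \<longlongrightarrow> 0) (at 0)" for j
      proof -
        have "\<forall>\<^sub>F t in at 0. t ^ w j * frame_op b j f (dilation w t x) / t ^ n = (\<Sum>k\<in>UNIV. t ^ w j * c j k t * a k t / t ^ n)"
          using evs by eventually_elim
            (simp add: frame_op_expand a_def c_def sum_distrib_left sum_divide_distrib mult.assoc)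
        then show ?thesis using lhs[of j] tendsto_cong by fast
      qed
      have big: "v k = 0" if "w k > n" for k
      proof -
        have "((\<lambda>t. t ^ (w k - n) * a k t) \<longlongrightarrow> 0 ^ (w k - n) * a k 0) (at 0)"
          by (intro tendsto_intros la)
        moreover have "\<forall>\<^sub>F t in at 0. t ^ (w k - n) * a k t = t ^ w k * a k t / t ^ n"
          using eventually_at_neq_0
        proof eventually_elim
          case (elim t)
          have "t ^ w k = t ^ n * t ^ (w k - n)" using that by (simp add: power_add[symmetric])
          then show ?case using elim by simp
        qed
        ultimately have "((\<lambda>t. t ^ w k * a k t / t ^ n) \<longlongrightarrow> 0 ^ (w k - n) * a k 0) (at 0)"
          using tendsto_cong by fast
        from tendsto_unique[OF _ lv this] show ?thesis using that by (simp add: zero_power)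
      qed
      \<comment> \<open>Descending induction on the weight, weights above \<open>n\<close> being
        settled by \<open>big\<close>. In the rescaled expansion of \<open>frame_op b j f\<close> a
        term with \<open>w k < w j\<close> keeps a positive power of \<open>t\<close>, the block
        \<open>w k = w j\<close> gives \<open>v j\<close> by the diagonal condition, and terms of
        higher weight are multiples of known zeros or, with coefficients of order only
        \<open>n\<close>, keep the factor \<open>t ^ w j\<close>.\<close>
      have all0: "v j = 0" for j
      proof (induction "n - w j" arbitrary: j rule: less_induct)
        case (less j)
        show ?case
        proof (cases "w j > n")
          case True then show ?thesis by (rule big)
        next
          case False
          have higher: "v k = 0" if "w k > w j" for k
          proof (cases "w k > n")
            case True then show ?thesis by (rule big)
          next
            case False then show ?thesis using less.hyps[of k] that by linarith
          qed
          have trm: "((\<lambda>t. t ^ w j * c j k t * a k t / t ^ n) \<longlongrightarrow> (if k = j then v j else 0)) (at 0)" for k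
          proof -
            consider "w k < w j" | "w k = w j" | "w k > w j" "w k - w j \<le> n" | "w k > w j" "w k - w j > n" by linarith
            then show ?thesis
            proof cases
              case 1
              have "((\<lambda>t. t ^ (w j - w k) * c j k t * (t ^ w k * a k t / t ^ n)) \<longlongrightarrow> 0 ^ (w j - w k) * c j k 0 * v k) (at 0)"
                by (intro tendsto_intros lc lv)
              moreover have "t ^ (w j - w k) * c j k t * (t ^ w k * a k t / t ^ n) = t ^ w j * c j k t * a k t / t ^ n" for t
              proof -
                have "t ^ w j = t ^ (w j - w k) * t ^ w k" using 1 by (simp add: power_add[symmetric])
                then show ?thesis by (simp add: mult_ac)
              qed
              ultimately have "((\<lambda>t. t ^ w j * c j k t * a k t / t ^ n) \<longlongrightarrow> 0 ^ (w j - w k) * c j k 0 * v k) (at 0)"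
                by (simp only:)
              then show ?thesis using 1 by (auto simp: zero_power)
            next
              case 2
              have "((\<lambda>t. c j k t * (t ^ w k * a k t / t ^ n)) \<longlongrightarrow> c j k 0 * v k) (at 0)"
                by (intro tendsto_intros lc lv)
              moreover have "c j k 0 = (if j = k then 1 else 0)" using good_diag[OF b, of j k] 2 by (simp add: c_def)
              ultimately show ?thesis using 2 by (auto simp: mult_ac)
            next
              case 3
              obtain l where l: "((\<lambda>t. c j k t / t ^ (w k - w j)) \<longlongrightarrow> l) (at 0)"
                using worder_tendsto[OF coeff[OF 3(2)], of x] unfolding c_def by blast
              have "((\<lambda>t. c j k t / t ^ (w k - w j) * (t ^ w k * a k t / t ^ n)) \<longlongrightarrow> l * v k) (at 0)"
                by (intro tendsto_intros l lv)
              moreover have "\<forall>\<^sub>F t in at 0. c j k t / t ^ (w k - w j) * (t ^ w k * a k t / t ^ n) = t ^ w j * c j k t * a k t / t ^ n"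
                using eventually_at_neq_0
              proof eventually_elim
                case (elim t)
                have "t ^ w k = t ^ (w k - w j) * t ^ w j" using 3 by (simp add: power_add[symmetric])
                then show ?case using elim by (simp add: field_simps)
              qed
              ultimately have "((\<lambda>t. t ^ w j * c j k t * a k t / t ^ n) \<longlongrightarrow> l * v k) (at 0)" using tendsto_cong by fast
              then show ?thesis using 3 higher[of k] by auto
            next
              case 4
              obtain l where l: "((\<lambda>t. c j k t / t ^ n) \<longlongrightarrow> l) (at 0)"
                using worder_tendsto[OF coeffn[OF 4(2)], of x] unfolding c_def by blast
              have "((\<lambda>t. t ^ w j * (c j k t / t ^ n) * a k t) \<longlongrightarrow> 0 ^ w j * l * a k 0) (at 0)"
                by (intro tendsto_intros l la)
              moreover have "(0::real) ^ w j = 0" using w_pos[of j] by (simp add: zero_power)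
              ultimately show ?thesis using 4 by (auto simp: mult_ac)
            qed
          qed
          have "((\<lambda>t. \<Sum>k\<in>UNIV. t ^ w j * c j k t * a k t / t ^ n) \<longlongrightarrow> (\<Sum>k\<in>UNIV. if k = j then v j else 0)) (at 0)"
            by (intro tendsto_sum trm)
          from tendsto_unique[OF _ this sumlim] show ?thesis by simp
        qed
      qed
      show ?thesis unfolding g_def using frechet_slice[OF slice_smoothD[OF G(1)], of x "axis k 1"] all0[of k] by (simp add: v_def)
    qed
    then have "g x = g 0" for x using has_derivative_zero_imp_const[OF sg] by blast
    moreover have "g 0 = 0"
    proof -
      have "f 0 = 0" using less.prems(2)[of "[]"] Suc by simp
      then show ?thesis unfolding g_def using tendsto_unique[OF _ witness_tendsto[where f=f, OF G, of 0], of 0] by simp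
    qed
    ultimately have "((\<lambda>t. f (dilation w t x) / t ^ n) \<longlongrightarrow> 0) (at 0)" for x
      using witness_tendsto[where f=f, OF G, of x] unfolding g_def by metis
    then show ?thesis using worder_SucI[OF Pn] Suc by simp
  qed
qed

lemma good_coefficient: "good_frame b \<Longrightarrow> worder w (w k - w j) (\<lambda>x. b j x $ k)"
  by (rule frame_order_imp_worder) (auto intro: smooth_around_vec_nth good_smooth good_word_coefficient)

text \<open>In the coordinate expansion term \<open>k\<close> has order
  \<open>(w k - w j) + (N - w k)\<close>, which is at least \<open>N - w j\<close> also for
  truncated subtraction.\<close>

lemma worder_frame_op:
  assumes b: "good_frame b" and f: "worder w N f"
  shows "worder w (N - w j) (frame_op b j f)"
proof (rule worder_cong)
  show "\<forall>\<^sub>F x in nhds 0. (\<Sum>k\<in>UNIV. b j x $ k * frechet_derivative f (at x) (axis k 1)) = frame_op b j f x"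
    using smooth_around_eventually[OF worder_smooth[OF f]] by eventually_elim (simp add: frame_op_expand)
  show "worder w (N - w j) (\<lambda>x. \<Sum>k\<in>UNIV. b j x $ k * frechet_derivative f (at x) (axis k 1))"
  proof (rule worder_sum)
    fix k
    show "worder w (N - w j) (\<lambda>x. b j x $ k * frechet_derivative f (at x) (axis k 1))"
      by (rule worder_mono[OF worder_mult[OF good_coefficient[OF b] worder_partial[OF f]]]) simp
  qed
qed

text \<open>The converse of \<open>frame_order_imp_worder\<close>: each letter lowers the order by
  at most its weight, so a positive order remains after the whole word.\<close>

lemma worder_imp_frame_order:
  assumes b: "good_frame b" and "worder w N f" "wt w I < N"
  shows "word_op b I f 0 = 0"
  using assms(2,3)
proof (induction I arbitrary: f N rule: rev_induct)
  case Nil then show ?case using worder_at_0 by auto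
next
  case (snoc j I)
  have "word_op b I (frame_op b j f) 0 = 0"
    by (rule snoc.IH[OF worder_frame_op[OF b snoc.prems(1)]]) (use snoc.prems in simp)
  then show ?case by (simp add: word_op_append)
qed

end

section \<open>Rescaled frames and their limits on the slice\<close>

context weights begin

text \<open>\<open>X j (0, x)\<close> is the model field of \<open>b j\<close>.\<close>

definition scaled_frame :: "('n \<Rightarrow> real ^ 'n \<Rightarrow> real ^ 'n) \<Rightarrow> ('n \<Rightarrow> real \<times> (real ^ 'n) \<Rightarrow> real ^ 'n) \<Rightarrow> bool" where
  "scaled_frame b X \<longleftrightarrow> (\<forall>j. slice_smooth (X j)) \<and>
     (\<forall>j x. \<forall>\<^sub>F p in nhds (0, x). fst p ^ w j *\<^sub>R b j (dilation w (fst p) (snd p)) = dilation w (fst p) (X j p))"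

text \<open>The properties of the limit fields on which the theory of the exponential map rests:
  they are smooth everywhere, homogeneous of degree \<open>- w j\<close>, and normalised at the
  origin. Homogeneity is written without inverses so that it includes \<open>s = 0\<close>.\<close>

definition homogeneous_frame :: "('n \<Rightarrow> real ^ 'n \<Rightarrow> real ^ 'n) \<Rightarrow> bool" where
  "homogeneous_frame Y \<longleftrightarrow> (\<forall>j x. smooth_around x (Y j)) \<and>
     (\<forall>j s x. s ^ w j *\<^sub>R Y j (dilation w s x) = dilation w s (Y j x)) \<and> (\<forall>j. Y j 0 = axis j 1)"

lemma scaled_frame_smooth: "scaled_frame b X \<Longrightarrow> smooth_around (0, x) (X j)"
  and scaled_frame_eq: "scaled_frame b X \<Longrightarrow> \<forall>\<^sub>F p in nhds (0, x). fst p ^ w j *\<^sub>R b j (dilation w (fst p) (snd p)) = dilation w (fst p) (X j p)"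
  by (auto simp: scaled_frame_def slice_smooth_def)

lemma slice_smooth_vec:
  fixes F :: "real \<times> (real ^ 'n) \<Rightarrow> real ^ 'n"
  assumes "\<And>k. \<exists>G. slice_smooth G \<and> (\<forall>x. \<forall>\<^sub>F p in nhds (0, x). F p $ k = fst p ^ w k * G p)"
  shows "\<exists>G. slice_smooth G \<and> (\<forall>x. \<forall>\<^sub>F p in nhds (0, x). F p = dilation w (fst p) (G p))"
proof -
  have "\<forall>k. \<exists>G. slice_smooth G \<and> (\<forall>x. \<forall>\<^sub>F p in nhds (0, x). F p $ k = fst p ^ w k * G p)"
    using assms by blast
  from choice[OF this]
  obtain G where G: "\<And>k. slice_smooth (G k)" "\<And>k x. \<forall>\<^sub>F p in nhds (0, x). F p $ k = fst p ^ w k * G k p"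
    by blast
  show ?thesis
  proof (intro exI[of _ "\<lambda>p. \<chi> k. G k p"] conjI allI)
    show "slice_smooth (\<lambda>p. \<chi> k. G k p)"
      unfolding slice_smooth_def by (intro allI smooth_around_vec) (simp add: slice_smoothD G)
    show "\<forall>\<^sub>F p in nhds (0, x). F p = dilation w (fst p) (\<chi> k. G k p)" for x
    proof -
      have "\<forall>\<^sub>F p in nhds (0, x). \<forall>k. F p $ k = fst p ^ w k * G k p"
        using G(2) by (intro eventually_all_finite) simp
      then show ?thesis by eventually_elim (simp add: vec_eq_iff)
    qed
  qed
qed

lemma worder_vec:
  assumes "\<And>k. worder w (w k) (\<lambda>x. \<Phi> x $ k)"
  obtains G where "slice_smooth G" "\<And>x. \<forall>\<^sub>F p in nhds (0, x). \<Phi> (dilation w (fst p) (snd p)) = dilation w (fst p) (G p)"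
proof -
  have "\<exists>G. slice_smooth G \<and> (\<forall>x. \<forall>\<^sub>F p in nhds (0, x). \<Phi> (dilation w (fst p) (snd p)) $ k = fst p ^ w k * G p)" for k
    by (rule worderE[OF assms]) blast
  from slice_smooth_vec[OF this] show thesis using that by blast
qed

text \<open>Component \<open>k\<close> has to contain \<open>t ^ w k\<close>: the prefactor supplies
  \<open>t ^ w j\<close> and the order of the coefficient the missing \<open>w k - w j\<close>; if
  \<open>w j\<close> exceeds \<open>w k\<close>, the surplus power goes into the quotient.\<close>

lemma good_scaled_frame:
  assumes b: "good_frame b" obtains X where "scaled_frame b X"
proof -
  have "\<exists>G. slice_smooth G \<and> (\<forall>x. \<forall>\<^sub>F p in nhds (0, x).
      (fst p ^ w j *\<^sub>R b j (dilation w (fst p) (snd p))) $ k = fst p ^ w k * G p)" for j k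
  proof (cases "w j \<le> w k")
    case True
    obtain G where G: "slice_smooth G" "\<And>x. \<forall>\<^sub>F p in nhds (0, x). b j (dilation w (fst p) (snd p)) $ k = fst p ^ (w k - w j) * G p"
      by (rule worderE[OF good_coefficient[OF b, of k j]]) blast
    have "\<forall>\<^sub>F p in nhds (0, x). (fst p ^ w j *\<^sub>R b j (dilation w (fst p) (snd p))) $ k = fst p ^ w k * G p" for x
      using G(2)[of x]
    proof eventually_elim
      case (elim p)
      have "fst p ^ w k = fst p ^ w j * fst p ^ (w k - w j)" using True by (simp add: power_add[symmetric])
      then show ?case using elim by simp
    qed
    with G(1) show ?thesis by blast
  next
    case False
    have "slice_smooth (\<lambda>p. b j (dilation w (fst p) (snd p)) $ k)"
      by (rule slice_smooth_dilation[OF smooth_around_vec_nth[OF good_smooth[OF b]]])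
    then have "slice_smooth (\<lambda>p. fst p ^ (w j - w k) * b j (dilation w (fst p) (snd p)) $ k)"
      unfolding slice_smooth_def
      by (intro allI smooth_around_mult[where f="\<lambda>p. fst p ^ (w j - w k)"] smooth_around_power smooth_around_fst) simp_all
    moreover have "(t ^ w j *\<^sub>R v) $ k = t ^ w k * (t ^ (w j - w k) * v $ k)" for t and v :: "real ^ 'n"
    proof -
      have "t ^ w j = t ^ w k * t ^ (w j - w k)" using False by (simp add: power_add[symmetric])
      then show ?thesis by simp
    qed
    ultimately show ?thesis by (intro exI conjI) (assumption, simp)
  qed
  from slice_smooth_vec[OF this]
  have "\<forall>j. \<exists>G. slice_smooth G \<and> (\<forall>x. \<forall>\<^sub>F p in nhds (0, x).
      fst p ^ w j *\<^sub>R b j (dilation w (fst p) (snd p)) = dilation w (fst p) (G p))" by blast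
  from choice[OF this] obtain X where
    "\<forall>j. slice_smooth (X j) \<and> (\<forall>x. \<forall>\<^sub>F p in nhds (0, x).
      fst p ^ w j *\<^sub>R b j (dilation w (fst p) (snd p)) = dilation w (fst p) (X j p))" by blast
  then show thesis by (intro that[of X]) (simp add: scaled_frame_def)
qed

lemma tendsto_nhds_dilation:
  "((\<lambda>p. (s * fst p, dilation w r (snd p))) \<longlongrightarrow> (0, dilation w r x)) (nhds (0::real, x))"
proof -
  have "smooth_around (0, x) (\<lambda>p. (s * fst p, dilation w r (snd p)))"
    by (rule smooth_around_dilation smooth_intros)+
  from smooth_around_imp_continuous[OF this, unfolded isCont_def, THEN tendsto_at_iff_tendsto_nhds[THEN iffD1]]
  show ?thesis by simp
qed

text \<open>Dilating by \<open>s\<close> and then by \<open>t\<close> can be charged either to the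
  point, which becomes \<open>\<delta>_s x\<close>, or to the parameter, which becomes
  \<open>s * t\<close>; on the slice the two readings have the same limit.\<close>

lemma scaled_homogeneous:
  assumes X: "scaled_frame b X"
  shows "s ^ w j *\<^sub>R X j (0, dilation w s x) = dilation w s (X j (0, x))"
proof -
  \<comment> \<open>The idle \<open>1 *\<close> and \<open>dilation w 1\<close> bring both sides
    into one shape, for which smoothness and the defining relation are derived once.\<close>
  let ?F = "\<lambda>p. s ^ w j *\<^sub>R X j (1 * fst p, dilation w s (snd p))"
  let ?F' = "\<lambda>p. dilation w s (X j (s * fst p, dilation w 1 (snd p)))"
  have "?F (0, x) = ?F' (0, x)"
  proof (rule eq_at_slice)
    have 1: "smooth_around (0, x) (\<lambda>p. X j (c * fst p, dilation w d (snd p)))" for c d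
      by (rule smooth_around_compose[where g="X j" and f="\<lambda>p. (c * fst p, dilation w d (snd p))"], (rule smooth_around_dilation smooth_intros)+)
         (simp add: scaled_frame_smooth[OF X])
    show "smooth_around (0, x) ?F" by (rule smooth_around_scaleR smooth_around_const 1)+
    show "smooth_around (0, x) ?F'" by (rule smooth_around_dilation smooth_around_const 1)+
    have e: "\<forall>\<^sub>F p in nhds (0, x). (c * fst p) ^ w j *\<^sub>R b j (dilation w (c * fst p) (dilation w d (snd p)))
        = dilation w (c * fst p) (X j (c * fst p, dilation w d (snd p)))" for c d
      using eventually_compose_filterlim[OF scaled_frame_eq[OF X, of j "dilation w d x"] tendsto_nhds_dilation[of c d x]] by simp
    show "\<forall>\<^sub>F p in nhds (0, x). fst p \<noteq> 0 \<longrightarrow> ?F p = ?F' p"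
      using e[of 1 s] e[of s 1]
    proof eventually_elim
      case (elim p)
      show ?case
      proof
        assume t: "fst p \<noteq> 0"
        have "dilation w (fst p) (?F p) = s ^ w j *\<^sub>R dilation w (fst p) (X j (fst p, dilation w s (snd p)))"
          using linear_scale[OF bounded_linear.linear[OF bounded_linear_dilation[of w "fst p"]]] by simp
        also have "\<dots> = (s * fst p) ^ w j *\<^sub>R b j (dilation w (s * fst p) (snd p))"
          using elim(1) by (simp add: dilation_dilation power_mult_distrib mult.commute[of s] scaleR_left_commute flip: scaleR_scaleR)
        also have "\<dots> = dilation w (fst p) (?F' p)"
          using elim(2) by (simp add: dilation_dilation mult.commute[of s])
        finally show "?F p = ?F' p" by (rule dilation_cancel[OF t])
      qed
    qed
  qed
  then show ?thesis by simp
qed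

text \<open>The value at the origin follows from
  \<open>t ^ w j * b j 0 $ k = t ^ w k * X j (t, 0) $ k\<close>: a surplus power of \<open>t\<close>
  kills components of lower weight, those of higher weight vanish in \<open>b j 0\<close>, and for
  equal weights the powers cancel. So only the diagonal blocks of the frame at \<open>0\<close>
  matter, and the limit is normalised even where the frame is not.\<close>

lemma good_homogeneous_frame:
  assumes b: "good_frame b" and X: "scaled_frame b X"
  shows "homogeneous_frame (\<lambda>j x. X j (0, x))"
  unfolding homogeneous_frame_def
proof (intro conjI allI)
  show "smooth_around x (\<lambda>x. X j (0, x))" for j x by (rule smooth_around_slice[OF scaled_frame_smooth[OF X]])
  show "s ^ w j *\<^sub>R X j (0, dilation w s x) = dilation w s (X j (0, x))" for s j x by (rule scaled_homogeneous[OF X])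
  fix j
  have e: "\<forall>\<^sub>F t in at 0. t ^ w j *\<^sub>R b j 0 = dilation w t (X j (t, 0))"
    using eventually_slice[OF scaled_frame_eq[OF X, of j 0]] by simp
  have "X j (0, 0) $ k = axis j 1 $ k" for k
  proof (rule tendsto_unique[of "at 0"])
    show "((\<lambda>t. X j (t, 0) $ k) \<longlongrightarrow> X j (0, 0) $ k) (at 0)"
      by (rule tendsto_vec_nth[OF tendsto_slice[OF scaled_frame_smooth[OF X]]])
    have e': "\<forall>\<^sub>F t in at 0. t \<noteq> 0 \<and> t ^ w j * b j 0 $ k = t ^ w k * X j (t, 0) $ k"
      using e eventually_at_neq_0 by eventually_elim (simp add: vec_eq_iff)
    consider "w k < w j" | "w k = w j" | "w k > w j" by linarith
    then show "((\<lambda>t. X j (t, 0) $ k) \<longlongrightarrow> axis j 1 $ k) (at 0)"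
    proof cases
      case 1
      have "((\<lambda>t. t ^ (w j - w k) * b j 0 $ k) \<longlongrightarrow> 0 ^ (w j - w k) * b j 0 $ k) (at 0)" by (intro tendsto_intros)
      moreover have "\<forall>\<^sub>F t in at 0. t ^ (w j - w k) * b j 0 $ k = X j (t, 0) $ k" using e'
      proof eventually_elim
        case (elim t)
        have "t ^ w j = t ^ w k * t ^ (w j - w k)" using 1 by (simp add: power_add[symmetric])
        then show ?case using elim by auto
      qed
      ultimately have "((\<lambda>t. X j (t, 0) $ k) \<longlongrightarrow> 0 ^ (w j - w k) * b j 0 $ k) (at 0)" using tendsto_cong by fast
      then show ?thesis using 1 by (auto simp: zero_power axis_def)
    next
      case 2
      have "\<forall>\<^sub>F t in at 0. axis j 1 $ k = X j (t, 0) $ k" using e'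
        by eventually_elim (use 2 good_diag[OF b, of j k] in \<open>auto simp: axis_def split: if_splits\<close>)
      then show ?thesis by (rule Lim_transform_eventually[OF tendsto_const])
    next
      case 3
      have b0: "b j 0 $ k = 0" using good_word_coefficient[OF b, of "[]" k j] 3 by simp
      have "\<forall>\<^sub>F t in at 0. axis j 1 $ k = X j (t, 0) $ k" using e'
        by eventually_elim (use 3 b0 in \<open>auto simp: axis_def\<close>)
      then show ?thesis by (rule Lim_transform_eventually[OF tendsto_const])
    qed
  qed simp
  then show "X j (0, 0) = axis j 1" by (simp add: vec_eq_iff)
qed

lemma
  assumes "homogeneous_frame Y"
  shows homogeneous_smooth: "smooth_around x (Y j)"
    and homogeneous_eq: "s ^ w j *\<^sub>R Y j (dilation w s x) = dilation w s (Y j x)"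
    and homogeneous_0: "Y j 0 = axis j 1"
  using assms unfolding homogeneous_frame_def by auto

text \<open>This partial derivative is homogeneous of degree \<open>w k - w i - w j\<close>, which
  is negative, and continuous at \<open>0\<close>; hence it vanishes.\<close>

lemma homogeneous_triangular:
  assumes Y: "homogeneous_frame Y" and less: "w k < w i + w j"
  shows "frechet_derivative (Y j) (at x) (axis i 1) $ k = 0"
proof -
  let ?h = "\<lambda>x. Y j x $ k"
  let ?d = "\<lambda>x. frechet_derivative ?h (at x) (axis i 1)"
  have sh: "smooth_around x ?h" for x by (rule smooth_around_vec_nth[OF homogeneous_smooth[OF Y]])
  have eq: "s ^ (w i + w j) * ?d (dilation w s x) = s ^ w k * ?d x" for s x
  proof -
    have "(\<lambda>x. s ^ w j * ?h (dilation w s x)) = (\<lambda>x. s ^ w k * ?h x)"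
      using homogeneous_eq[OF Y, of s j] by (auto simp: vec_eq_iff)
    then have "frechet_derivative (\<lambda>x. s ^ w j * ?h (dilation w s x)) (at x) (axis i 1) = frechet_derivative (\<lambda>x. s ^ w k * ?h x) (at x) (axis i 1)" by simp
    moreover have "frechet_derivative (\<lambda>x. s ^ w k * ?h x) (at x) (axis i 1) = s ^ w k * ?d x"
      by (subst frechet_derivativeI[OF has_derivative_mult_right[OF smooth_around_has_derivative[OF sh]]]) simp
    moreover have "frechet_derivative (\<lambda>x. s ^ w j * ?h (dilation w s x)) (at x) (axis i 1) = s ^ w j * (s ^ w i * ?d (dilation w s x))"
    proof -
      have s': "smooth_around x (\<lambda>x. ?h (dilation w s x))"
        by (rule smooth_around_compose[where g="?h" and f="dilation w s"]) (rule sh smooth_around_dilation smooth_intros)+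
      have "frechet_derivative (\<lambda>x. s ^ w j * ?h (dilation w s x)) (at x) (axis i 1) = s ^ w j * frechet_derivative (\<lambda>x. ?h (dilation w s x)) (at x) (axis i 1)"
        by (subst frechet_derivativeI[OF has_derivative_mult_right[OF smooth_around_has_derivative[OF s']]]) simp
      also have "frechet_derivative (\<lambda>x. ?h (dilation w s x)) (at x) (axis i 1) = s ^ w i * ?d (dilation w s x)"
        using frechet_compose_dilation[OF sh] linear_scale[OF smooth_around_linear_frechet[OF sh]] by (simp add: dilation_axis)
      finally show ?thesis .
    qed
    ultimately show ?thesis by (simp add: power_add mult_ac)
  qed
  define m where "m = w i + w j - w k"
  have m: "w i + w j = m + w k" "m > 0" using less by (auto simp: m_def)
  have "?d x = 0"
  proof (rule tendsto_unique[of "at 0"])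
    have "((\<lambda>s. s ^ m * ?d (dilation w s x)) \<longlongrightarrow> 0 ^ m * ?d 0) (at 0)"
      by (intro tendsto_intros tendsto_compose_dilation smooth_around_frechet sh)
    then show "((\<lambda>s. s ^ m * ?d (dilation w s x)) \<longlongrightarrow> 0) (at 0)" using m by (simp add: zero_power)
    have "\<forall>\<^sub>F s in at 0. ?d x = s ^ m * ?d (dilation w s x)"
      using eventually_at_neq_0
    proof eventually_elim
      case (elim s) then show ?case using eq[of s x] m by (simp add: power_add mult_ac)
    qed
    then show "((\<lambda>s. s ^ m * ?d (dilation w s x)) \<longlongrightarrow> ?d x) (at 0)" by (rule Lim_transform_eventually[OF tendsto_const])
  qed simp
  then show ?thesis using frechet_vec_nth_vec[OF homogeneous_smooth[OF Y]] by metis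
qed

text \<open>By \<open>homogeneous_triangular\<close> the component is constant along the segment
  from \<open>x\<close> to \<open>y\<close>. As \<open>w j\<close> is positive, component
  \<open>k\<close> only sees variables of weight below \<open>w k\<close>; uniqueness of flows and
  termination of Picard iteration rest on this.\<close>

lemma homogeneous_depends:
  assumes Y: "homogeneous_frame Y" and "\<And>i. w i + w j \<le> w k \<Longrightarrow> x $ i = y $ i"
  shows "Y j x $ k = Y j y $ k"
proof -
  let ?c = "\<lambda>s. x + s *\<^sub>R (y - x)"
  have "((\<lambda>s. Y j (?c s) $ k) has_derivative (\<lambda>h. 0)) (at s)" for s
  proof -
    have "(?c has_derivative (\<lambda>h. h *\<^sub>R (y - x))) (at s)"
      by (rule has_derivative_eq_rhs[OF has_derivative_add[OF has_derivative_const
        has_derivative_scaleR_left[OF has_derivative_ident]]]) auto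
    from bounded_linear.has_derivative[OF bounded_linear_vec_nth has_derivative_compose[OF this smooth_around_has_derivative[OF homogeneous_smooth[OF Y]]]]
    have "((\<lambda>s. Y j (?c s) $ k) has_derivative (\<lambda>h. frechet_derivative (Y j) (at (?c s)) (h *\<^sub>R (y - x)) $ k)) (at s)" .
    moreover have "frechet_derivative (Y j) (at z) v $ k = 0" if "\<And>i. w i + w j \<le> w k \<Longrightarrow> v $ i = 0" for z v
    proof -
      have "frechet_derivative (Y j) (at z) v $ k = (\<Sum>i\<in>UNIV. v $ i * frechet_derivative (Y j) (at z) (axis i 1) $ k)"
        using arg_cong[OF linear_axis_expand[OF smooth_around_linear_frechet[OF homogeneous_smooth[OF Y]], of j z v], of "\<lambda>u. u $ k"] by simp
      also have "\<dots> = 0"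
      proof (rule sum.neutral, rule ballI)
        fix i
        show "v $ i * frechet_derivative (Y j) (at z) (axis i 1) $ k = 0"
          using that[of i] homogeneous_triangular[OF Y, of k i j z] by (cases "w i + w j \<le> w k") auto
      qed
      finally show ?thesis .
    qed
    ultimately show ?thesis using assms(2) by (simp add: has_derivative_eq_rhs)
  qed
  then obtain c where "\<And>s. Y j (?c s) $ k = c"
    using has_derivative_zero_constant[of UNIV "\<lambda>s. Y j (?c s) $ k"] by auto
  from this[of 0] this[of 1] show ?thesis by simp
qed

text \<open>Words are natural under \<open>\<Phi>\<close>, and those of small weight in
  \<open>b'\<close> kill the coordinates, so component \<open>k\<close> of \<open>\<Phi>\<close> has
  order \<open>w k\<close>; this is where \<open>G\<close> comes from. The intertwining is the chain
  rule off the slice, where dilations can be cancelled.\<close>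

theorem transition_limit:
  assumes b: "good_frame b" "scaled_frame b X" and b': "good_frame b'" "scaled_frame b' X'"
    and \<Phi>: "smooth_around 0 \<Phi>" "\<Phi> 0 = 0"
    and tr: "\<forall>\<^sub>F x in nhds 0. \<forall>j. frechet_derivative \<Phi> (at x) (b j x) = b' j (\<Phi> x)"
  obtains G where "slice_smooth G"
    "\<And>x. \<forall>\<^sub>F p in nhds (0, x). \<Phi> (dilation w (fst p) (snd p)) = dilation w (fst p) (G p)"
    "\<And>j x. frechet_derivative (\<lambda>x. G (0, x)) (at x) (X j (0, x)) = X' j (0, G (0, x))"
proof -
  have wo: "worder w (w k) (\<lambda>x. \<Phi> x $ k)" for k
  proof (rule frame_order_imp_worder[OF b(1)])
    show "smooth_around 0 (\<lambda>x. \<Phi> x $ k)" by (rule smooth_around_vec_nth[OF \<Phi>(1)])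
    fix I assume I: "wt w I < w k"
    have "\<forall>\<^sub>F x in nhds 0. word_op b I (\<lambda>x. \<Phi> x $ k) x = word_op b' I (\<lambda>x. x $ k) (\<Phi> x)"
      by (rule word_op_transition[where f="\<lambda>x. x $ k", OF \<Phi>(1) _ _ tr])
         (use good_smooth[OF b'(1)] \<Phi>(2) in \<open>auto intro: smooth_around_vec_nth\<close>)
    from eventually_nhds_x_imp_x[OF this] show "word_op b I (\<lambda>x. \<Phi> x $ k) 0 = 0"
      using good_order[OF b'(1) I] \<Phi>(2) by simp
  qed
  obtain G where G: "slice_smooth G" "\<And>x. \<forall>\<^sub>F p in nhds (0, x). \<Phi> (dilation w (fst p) (snd p)) = dilation w (fst p) (G p)"
    by (rule worder_vec[of \<Phi>, OF wo]) blast
  have "frechet_derivative (\<lambda>x. G (0, x)) (at x) (X j (0, x)) = X' j (0, G (0, x))" for j x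
  proof -
    let ?F = "\<lambda>p. frechet_derivative G (at p) (0, X j p)"
    let ?F' = "\<lambda>p. X' j (fst p, G p)"
    have "?F (0, x) = ?F' (0, x)"
    proof (rule eq_at_slice)
      show "smooth_around (0, x) ?F"
        by (rule smooth_around_frechet_compose[where f="\<lambda>p. p"])
           (rule smooth_around_Pair smooth_around_const smooth_around_ident slice_smoothD[OF G(1)] scaled_frame_smooth[OF b(2)])+
      show "smooth_around (0, x) ?F'"
        by (rule smooth_around_compose[where g="X' j" and f="\<lambda>p. (fst p, G p)"], (rule smooth_intros slice_smoothD[OF G(1)])+)
           (simp add: scaled_frame_smooth[OF b'(2)])
      have c: "((\<lambda>p. (fst p, G p)) \<longlongrightarrow> (0, G (0, x))) (nhds (0, x))"
      proof -
        have "smooth_around (0, x) (\<lambda>p. (fst p, G p))" by (rule smooth_intros slice_smoothD[OF G(1)])+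
        from smooth_around_imp_continuous[OF this, unfolded isCont_def, THEN tendsto_at_iff_tendsto_nhds[THEN iffD1]]
        show ?thesis by simp
      qed
      have ev: "\<forall>\<^sub>F p in nhds (0, x). \<forall>\<^sub>F q in nhds p. \<Phi> (dilation w (fst q) (snd q)) = dilation w (fst q) (G q)"
        using G(2) by (simp add: eventually_eventually)
      have s\<Phi>: "\<forall>\<^sub>F p in nhds (0, x). smooth_around (dilation w (fst p) (snd p)) \<Phi>"
        by (rule eventually_dilation[OF smooth_around_eventually[OF \<Phi>(1)]])
      have e': "\<forall>\<^sub>F p in nhds (0, x). fst p ^ w j *\<^sub>R b' j (dilation w (fst p) (G p)) = dilation w (fst p) (X' j (fst p, G p))"
        using eventually_compose_filterlim[OF scaled_frame_eq[OF b'(2), of j "G (0, x)"] c] by simp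
      have tr': "\<forall>\<^sub>F p in nhds (0, x). \<forall>j. frechet_derivative \<Phi> (at (dilation w (fst p) (snd p))) (b j (dilation w (fst p) (snd p))) = b' j (\<Phi> (dilation w (fst p) (snd p)))"
        by (rule eventually_dilation[OF tr])
      show "\<forall>\<^sub>F p in nhds (0, x). fst p \<noteq> 0 \<longrightarrow> ?F p = ?F' p"
        using ev s\<Phi> e' tr' scaled_frame_eq[OF b(2), of j x] G(2)[of x] smooth_around_eventually[OF slice_smoothD[OF G(1), of x]]
      proof eventually_elim
        case (elim p)
        obtain t y where p: "p = (t, y)" by (cases p)
        have "((\<lambda>z. (t, z)) \<longlongrightarrow> (t, y)) (nhds y)" by (intro tendsto_Pair tendsto_const filterlim_ident)
        then have ez: "\<forall>\<^sub>F z in nhds y. \<Phi> (dilation w t z) = dilation w t (G (t, z))"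
          using eventually_compose_filterlim[OF elim(1)[unfolded p]] by force
        have sm: "smooth_around (t, y) G" using elim(7) p by simp
        show ?case
        proof
          assume "fst p \<noteq> 0"
          then have t: "t \<noteq> 0" by (simp add: p)
          have "dilation w t (?F p) = dilation w t (frechet_derivative (\<lambda>z. G (t, z)) (at y) (X j p))"
            using frechet_slice[OF sm] p by simp
          also have "\<dots> = frechet_derivative (\<lambda>z. dilation w t (G (t, z))) (at y) (X j p)"
            by (subst frechet_derivativeI[OF bounded_linear.has_derivative[OF bounded_linear_dilation smooth_around_has_derivative[OF smooth_around_slice[OF sm]]]]) simp
          also have "\<dots> = frechet_derivative (\<lambda>z. \<Phi> (dilation w t z)) (at y) (X j p)"
            by (rule fun_cong[OF frechet_derivative_cong_nhds[OF ez], symmetric])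
          also have "\<dots> = frechet_derivative \<Phi> (at (dilation w t y)) (dilation w t (X j p))"
            using frechet_compose_dilation[of t y \<Phi>] elim(2) p by simp
          also have "\<dots> = frechet_derivative \<Phi> (at (dilation w t y)) (t ^ w j *\<^sub>R b j (dilation w t y))"
            using elim(5) p by simp
          also have "\<dots> = t ^ w j *\<^sub>R b' j (dilation w t (G p))"
            using elim(2,4,6) p linear_scale[OF smooth_around_linear_frechet, of "dilation w t y" \<Phi>] by simp
          also have "\<dots> = dilation w t (?F' p)" using elim(3) p by simp
          finally show "?F p = ?F' p" by (rule dilation_cancel[OF t])
        qed
      qed
    qed
    then show ?thesis using frechet_slice[OF slice_smoothD[OF G(1)]] by simp
  qed
  with G show thesis by (rule that)
qed

text \<open>Rescaling gives \<open>L i j x $ k\<close> the factor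
  \<open>t ^ (w i + w j - w k)\<close>. The term disappears in the limit for smaller weights, only
  the value at \<open>0\<close> survives for equal weights, and larger weights are excluded by the
  filtration. The model fields thus satisfy the bracket relations of the graded Lie algebra.\<close>

theorem bracket_limit:
  assumes b: "good_frame b" "scaled_frame b X"
    and br: "\<forall>\<^sub>F x in nhds 0. frechet_derivative (b j) (at x) (b i x) - frechet_derivative (b i) (at x) (b j x) = (\<Sum>k\<in>UNIV. L x $ k *\<^sub>R b k x)"
    and L: "smooth_around 0 L" "\<And>k. w i + w j < w k \<Longrightarrow> \<forall>\<^sub>F x in nhds 0. L x $ k = 0"
  shows "frechet_derivative (\<lambda>x. X j (0, x)) (at x) (X i (0, x)) - frechet_derivative (\<lambda>x. X i (0, x)) (at x) (X j (0, x))
     = (\<Sum>k\<in>UNIV. (if w k = w i + w j then L 0 $ k else 0) *\<^sub>R X k (0, x))"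
proof -
  let ?F = "\<lambda>p. frechet_derivative (X j) (at p) (0, X i p) - frechet_derivative (X i) (at p) (0, X j p)"
  let ?F' = "\<lambda>p. \<Sum>k\<in>UNIV. (if w k \<le> w i + w j then fst p ^ (w i + w j - w k) * L (dilation w (fst p) (snd p)) $ k else 0) *\<^sub>R X k p"
  have "?F (0, x) = ?F' (0, x)"
  proof (rule eq_at_slice)
    have "smooth_around (0, x) (\<lambda>p. frechet_derivative (X j) (at p) (0, X i p))" for i j :: 'n
      by (rule smooth_around_frechet_compose[where f="\<lambda>p. p"])
         (rule smooth_around_Pair smooth_around_const smooth_around_ident scaled_frame_smooth[OF b(2)])+
    then show "smooth_around (0, x) ?F" by (intro smooth_around_diff)
    show "smooth_around (0, x) ?F'"
    proof (rule smooth_around_sum, rule smooth_around_scaleR)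
      fix k
      have "smooth_around (0, x) (\<lambda>p. fst p ^ (w i + w j - w k) * L (dilation w (fst p) (snd p)) $ k)"
        by (rule smooth_intros slice_smoothD[OF slice_smooth_dilation[OF L(1)]])+
      then show "smooth_around (0, x) (\<lambda>p. if w k \<le> w i + w j then fst p ^ (w i + w j - w k) * L (dilation w (fst p) (snd p)) $ k else 0)"
        by (cases "w k \<le> w i + w j") simp_all
      show "smooth_around (0, x) (X k)" by (rule scaled_frame_smooth[OF b(2)])
    qed
    have L0: "\<forall>\<^sub>F p in nhds (0, x). \<forall>k. w i + w j < w k \<longrightarrow> L (dilation w (fst p) (snd p)) $ k = 0"
      using eventually_dilation[OF L(2)] by (intro eventually_all_finite) (auto simp: eventually_mono)
    have ev: "\<forall>\<^sub>F p in nhds (0, x). \<forall>\<^sub>F q in nhds p. \<forall>k. fst q ^ w k *\<^sub>R b k (dilation w (fst q) (snd q)) = dilation w (fst q) (X k q)"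
      using scaled_frame_eq[OF b(2)] by (simp add: eventually_eventually eventually_all_finite)
    have sb: "\<forall>\<^sub>F p in nhds (0, x). \<forall>k. smooth_around (dilation w (fst p) (snd p)) (b k)"
      by (rule eventually_dilation) (intro eventually_all_finite smooth_around_eventually good_smooth[OF b(1)])
    have sX: "\<forall>\<^sub>F p in nhds (0, x). \<forall>k. smooth_around p (X k)"
      by (intro eventually_all_finite smooth_around_eventually scaled_frame_smooth[OF b(2)])
    show "\<forall>\<^sub>F p in nhds (0, x). fst p \<noteq> 0 \<longrightarrow> ?F p = ?F' p"
      using ev sb sX L0 eventually_dilation[OF br, of x]
    proof eventually_elim
      case (elim p)
      obtain t y where p: "p = (t, y)" by (cases p)
      let ?z = "dilation w t y"
      have eq: "t ^ w k *\<^sub>R b k ?z = dilation w t (X k p)" for k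
        using eventually_nhds_x_imp_x[OF elim(1)] p by simp
      have "((\<lambda>z. (t, z)) \<longlongrightarrow> (t, y)) (nhds y)" by (intro tendsto_Pair tendsto_const filterlim_ident)
      from eventually_compose_filterlim[OF elim(1)[unfolded p] this]
      have ez: "\<forall>\<^sub>F z in nhds y. t ^ w k *\<^sub>R b k (dilation w t z) = dilation w t (X k (t, z))" for k
        by (rule eventually_mono) simp
      have sm: "smooth_around (t, y) (X k)" for k using elim(3) p by simp
      have sbz: "smooth_around ?z (b k)" for k using elim(2) p by simp
      have half: "dilation w t (frechet_derivative (X j) (at p) (0, X i p)) = t ^ (w i + w j) *\<^sub>R frechet_derivative (b j) (at ?z) (b i ?z)" for i j
      proof -
        have sbd: "smooth_around y (\<lambda>z. b j (dilation w t z))"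
          by (rule smooth_around_compose[where g="b j" and f="dilation w t"]) (rule sbz smooth_around_dilation smooth_intros)+
        have "dilation w t (frechet_derivative (X j) (at p) (0, X i p)) = dilation w t (frechet_derivative (\<lambda>z. X j (t, z)) (at y) (X i p))"
          using frechet_slice[OF sm] p by simp
        also have "\<dots> = frechet_derivative (\<lambda>z. dilation w t (X j (t, z))) (at y) (X i p)"
          by (subst frechet_derivativeI[OF bounded_linear.has_derivative[OF bounded_linear_dilation smooth_around_has_derivative[OF smooth_around_slice[OF sm]]]]) simp
        also have "\<dots> = frechet_derivative (\<lambda>z. t ^ w j *\<^sub>R b j (dilation w t z)) (at y) (X i p)"
          by (rule fun_cong[OF frechet_derivative_cong_nhds[OF ez], symmetric])
        also have "\<dots> = t ^ w j *\<^sub>R frechet_derivative (\<lambda>z. b j (dilation w t z)) (at y) (X i p)"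
          by (subst frechet_derivativeI[OF has_derivative_scaleR_right[OF smooth_around_has_derivative[OF sbd]]]) simp
        also have "\<dots> = t ^ w j *\<^sub>R frechet_derivative (b j) (at ?z) (t ^ w i *\<^sub>R b i ?z)"
          using frechet_compose_dilation[OF sbz] eq by simp
        also have "\<dots> = t ^ (w i + w j) *\<^sub>R frechet_derivative (b j) (at ?z) (b i ?z)"
          using linear_scale[OF smooth_around_linear_frechet[OF sbz]] by (simp add: power_add mult.commute)
        finally show ?thesis .
      qed
      show ?case
      proof
        assume "fst p \<noteq> 0"
        then have t: "t \<noteq> 0" by (simp add: p)
        note ld = bounded_linear.linear[OF bounded_linear_dilation[of w t]]
        have "dilation w t (?F p) = t ^ (w i + w j) *\<^sub>R frechet_derivative (b j) (at ?z) (b i ?z) - t ^ (w j + w i) *\<^sub>R frechet_derivative (b i) (at ?z) (b j ?z)"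
          unfolding linear_diff[OF ld] half ..
        also have "\<dots> = t ^ (w i + w j) *\<^sub>R (\<Sum>k\<in>UNIV. L ?z $ k *\<^sub>R b k ?z)"
          using elim(5) p by (simp add: add.commute flip: scaleR_diff_right)
        also have "\<dots> = (\<Sum>k\<in>UNIV. (if w k \<le> w i + w j then t ^ (w i + w j - w k) * L ?z $ k else 0) *\<^sub>R dilation w t (X k p))"
          unfolding scaleR_sum_right
        proof (rule sum.cong[OF refl])
          fix k
          show "t ^ (w i + w j) *\<^sub>R L ?z $ k *\<^sub>R b k ?z = (if w k \<le> w i + w j then t ^ (w i + w j - w k) * L ?z $ k else 0) *\<^sub>R dilation w t (X k p)"
          proof (cases "w k \<le> w i + w j")
            case True
            then have "t ^ (w i + w j) = t ^ (w i + w j - w k) * t ^ w k" by (simp flip: power_add)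
            then show ?thesis using True by (simp flip: eq)
          next
            case False
            then show ?thesis using elim(4) p by simp
          qed
        qed
        also have "\<dots> = dilation w t (?F' p)"
          unfolding p fst_conv snd_conv dilation_sum linear_scale[OF ld] ..
        finally show "?F p = ?F' p" by (rule dilation_cancel[OF t])
      qed
    qed
  qed
  moreover have "?F' (0, x) = (\<Sum>k\<in>UNIV. (if w k = w i + w j then L 0 $ k else 0) *\<^sub>R X k (0, x))"
    by (rule sum.cong) (auto simp: power_0_left)
  ultimately show ?thesis using frechet_slice[OF scaled_frame_smooth[OF b(2)]] by simp
qed

end

subsection \<open>Uniform convergence of derivatives and weighted asymptotics\<close>

lemma slice_smooth_iterated:
  fixes X :: "real \<times> 'a::euclidean_space \<Rightarrow> 'b::real_normed_vector"
  assumes "slice_smooth X" shows "slice_smooth (iterated_derivative (map (Pair 0) vs) X)"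
  by (induction vs) (use assms in \<open>auto simp: slice_smooth_def intro: smooth_around_frechet\<close>)

lemma iterated_derivative_slice:
  fixes X :: "real \<times> 'a::euclidean_space \<Rightarrow> 'b::real_normed_vector"
  assumes "slice_smooth X"
  shows "iterated_derivative vs (\<lambda>x. X (0, x)) = (\<lambda>x. iterated_derivative (map (Pair 0) vs) X (0, x))"
  by (induction vs) (simp_all add: frechet_slice[OF slice_smoothD[OF slice_smooth_iterated[OF assms]]])

text \<open>The condition \<open>fst p \<noteq> 0\<close> is there because the dilation pullback
  divides by powers of \<open>t\<close> and takes a meaningless default value at
  \<open>t = 0\<close>. Derivatives are in \<open>x\<close> only, hence the directions
  \<open>(0, v)\<close>.\<close>

lemma iterated_derivative_family:
  fixes X :: "real \<times> 'a::euclidean_space \<Rightarrow> 'b::real_normed_vector"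
  assumes X: "slice_smooth X" and F: "\<And>x. \<forall>\<^sub>F p in nhds (0, x). fst p \<noteq> 0 \<longrightarrow> F (fst p) (snd p) = X p"
  shows "\<forall>\<^sub>F p in nhds (0, x). fst p \<noteq> 0 \<longrightarrow>
    iterated_derivative vs (F (fst p)) (snd p) = iterated_derivative (map (Pair 0) vs) X p"
proof (induction vs)
  case Nil show ?case using F by simp
next
  case (Cons v vs)
  let ?I = "iterated_derivative (map (Pair 0) vs) X"
  have "\<forall>\<^sub>F p in nhds (0, x). \<forall>\<^sub>F q in nhds p. fst q \<noteq> 0 \<longrightarrow> iterated_derivative vs (F (fst q)) (snd q) = ?I q"
    using Cons by (simp add: eventually_eventually)
  with smooth_around_eventually[OF slice_smoothD[OF slice_smooth_iterated[OF X, of vs], of x]] show ?case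
  proof eventually_elim
    case (elim p)
    obtain t y where p: "p = (t, y)" by (cases p)
    show ?case
    proof
      assume "fst p \<noteq> 0"
      then have t: "t \<noteq> 0" using p by simp
      have "((\<lambda>z. (t, z)) \<longlongrightarrow> (t, y)) (nhds y)" by (intro tendsto_Pair tendsto_const filterlim_ident)
      from eventually_compose_filterlim[OF elim(2)[unfolded p] this]
      have "\<forall>\<^sub>F z in nhds y. iterated_derivative vs (F t) z = ?I (t, z)"
        by (rule eventually_mono) (simp add: t)
      from fun_cong[OF frechet_derivative_cong_nhds[OF this], of v]
      show "iterated_derivative (v # vs) (F (fst p)) (snd p) = iterated_derivative (map (Pair 0) (v # vs)) X p"
        using frechet_slice[of t y ?I v] elim(1) p by simp
    qed
  qed
qed

lemma uniform_limit_iterated_derivative: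
  fixes X :: "real \<times> 'a::euclidean_space \<Rightarrow> 'b::real_normed_vector"
  assumes X: "slice_smooth X" and F: "\<And>x. \<forall>\<^sub>F p in nhds (0, x). fst p \<noteq> 0 \<longrightarrow> F (fst p) (snd p) = X p"
    and K: "compact K"
  shows "uniform_limit K (\<lambda>t. iterated_derivative vs (F t)) (iterated_derivative vs (\<lambda>x. X (0, x))) (at 0)"
  unfolding uniform_limit_iff
proof (intro allI impI)
  fix e :: real assume e: "e > 0"
  let ?I = "iterated_derivative (map (Pair 0) vs) X"
  let ?P = "\<lambda>p. (fst p \<noteq> 0 \<longrightarrow> iterated_derivative vs (F (fst p)) (snd p) = ?I p) \<and> dist (?I p) (?I (0, snd p)) < e"
  have sI: "smooth_around (0, x) ?I" for x by (rule slice_smoothD[OF slice_smooth_iterated[OF X]])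
  have ev: "\<forall>\<^sub>F q in nhds (u, 0). ?P (snd q, fst q)" for u
  proof -
    have "smooth_around (0, u) (\<lambda>p. ?I p - ?I (0, snd p))"
      by (rule smooth_around_diff[OF sI smooth_around_compose[where g="?I" and f="\<lambda>p. (0, snd p)"]], (rule smooth_intros)+) (simp add: sI)
    from smooth_around_imp_continuous[OF this, unfolded isCont_def, THEN tendsto_at_iff_tendsto_nhds[THEN iffD1]]
    have "((\<lambda>p. ?I p - ?I (0, snd p)) \<longlongrightarrow> 0) (nhds (0, u))" by simp
    from tendstoD[OF this e] have "\<forall>\<^sub>F p in nhds (0, u). dist (?I p) (?I (0, snd p)) < e"
      by (rule eventually_mono) (simp add: dist_norm)
    then have "\<forall>\<^sub>F p in nhds (0, u). ?P p"
      by (rule eventually_conj[OF iterated_derivative_family[OF X F]])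
    moreover have "((\<lambda>q. (snd q, fst q)) \<longlongrightarrow> (0, u)) (nhds (u, 0::real))"
    proof -
      have "smooth_around (u, 0::real) (\<lambda>q. (snd q, fst q))" by (rule smooth_intros)+
      from smooth_around_imp_continuous[OF this, unfolded isCont_def, THEN tendsto_at_iff_tendsto_nhds[THEN iffD1]]
      show ?thesis by simp
    qed
    ultimately show ?thesis by (rule eventually_compose_filterlim)
  qed
  have "\<forall>\<^sub>F p in nhds (0::real, u). ?P p" if "u \<in> K" for u
  proof -
    have "((\<lambda>p. (snd p, fst p)) \<longlongrightarrow> (u, 0)) (nhds (0::real, u))"
    proof -
      have "smooth_around (0::real, u) (\<lambda>q. (snd q, fst q))" by (rule smooth_intros)+
      from smooth_around_imp_continuous[OF this, unfolded isCont_def, THEN tendsto_at_iff_tendsto_nhds[THEN iffD1]]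
      show ?thesis by simp
    qed
    from eventually_compose_filterlim[OF ev this] show ?thesis by simp
  qed
  then obtain d where d: "d > 0" "\<And>t u. t \<in> ball 0 d \<Longrightarrow> u \<in> K \<Longrightarrow> ?P (t, u)"
    using tube_ball[OF K, where ?z0.0="0::real" and P="?P"] by blast
  have "\<forall>\<^sub>F t in at (0::real). t \<in> ball 0 d"
    using d(1) by (intro eventually_at_in_open') auto
  with eventually_at_neq_0
  show "\<forall>\<^sub>F t in at 0. \<forall>x\<in>K. dist (iterated_derivative vs (F t) x) (iterated_derivative vs (\<lambda>x. X (0, x)) x) < e"
  proof eventually_elim
    case (elim t)
    show ?case using d(2)[OF elim(2)] elim(1) by (simp add: iterated_derivative_slice[OF X])
  qed
qed

section \<open>Weighted order against the pseudo-norm, and frames under perturbation\<close>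

context weights begin

text \<open>The bound gives \<open>f (\<delta>_t x) = O(t^M)\<close> for each fixed
  \<open>x\<close>, so the limits that \<open>worder_SucI\<close> asks for vanish at all orders
  below \<open>M\<close>.\<close>

lemma bigo_imp_worder:
  assumes N: "pseudo_norm w N" and f: "smooth_around 0 f" "f \<in> O[nhds 0](\<lambda>x. N x ^ M)"
  shows "worder w M f"
proof -
  obtain c where c: "c > 0" "\<forall>\<^sub>F x in nhds 0. norm (f x) \<le> c * norm (N x ^ M)"
    using landau_o.bigE[OF f(2)] by blast
  have N': "N (dilation w t x) = \<bar>t\<bar> * N x" for t x using N by (simp add: pseudo_norm_def)
  have "worder w m f" if "m \<le> M" for m
    using that
  proof (induction m)
    case 0 show ?case by (rule worder_0[OF f(1)])
  next
    case (Suc m)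
    show ?case
    proof (rule worder_SucI)
      show "worder w m f" using Suc by simp
      fix x
      show "((\<lambda>t. f (dilation w t x) / t ^ m) \<longlongrightarrow> 0) (at 0)"
      proof (rule Lim_null_comparison)
        have "((\<lambda>t. c * \<bar>N x\<bar> ^ M * \<bar>t\<bar> ^ (M - m)) \<longlongrightarrow> c * \<bar>N x\<bar> ^ M * \<bar>0\<bar> ^ (M - m)) (at 0)" by (intro tendsto_intros)
        then show "((\<lambda>t::real. c * \<bar>N x\<bar> ^ M * \<bar>t\<bar> ^ (M - m)) \<longlongrightarrow> 0) (at 0)" using Suc.prems by (simp add: zero_power)
        show "\<forall>\<^sub>F t in at 0. norm (f (dilation w t x) / t ^ m) \<le> c * \<bar>N x\<bar> ^ M * \<bar>t\<bar> ^ (M - m)"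
          using eventually_compose_filterlim[OF c(2) tendsto_dilation_at[of x]] eventually_at_neq_0
        proof eventually_elim
          case (elim t)
          have "\<bar>f (dilation w t x)\<bar> \<le> c * (\<bar>t\<bar> * \<bar>N x\<bar>) ^ M" using elim(1) by (simp add: N' abs_mult power_abs)
          also have "\<dots> = c * \<bar>N x\<bar> ^ M * \<bar>t\<bar> ^ (M - m) * \<bar>t\<bar> ^ m"
            using Suc.prems by (simp add: power_mult_distrib mult.assoc flip: power_add)
          finally show ?case using elim(2) by (simp add: abs_divide power_abs divide_le_eq)
        qed
      qed
    qed
  qed
  then show ?thesis by simp
qed

text \<open>The quotient \<open>G\<close> is bounded near a compact set of representatives for the
  dilations, and every small \<open>x \<noteq> 0\<close> is a dilate \<open>\<delta>_s z\<close> of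
  such a \<open>z\<close>; \<open>s\<close> is then at most a constant times
  \<open>N x\<close>.\<close>

lemma worder_imp_bigo:
  assumes N: "pseudo_norm w N" and f: "worder w M f"
  shows "f \<in> O[nhds 0](\<lambda>x. N x ^ M)"
proof -
  obtain G where G: "slice_smooth G" "\<And>x. \<forall>\<^sub>F p in nhds (0, x). f (dilation w (fst p) (snd p)) = fst p ^ M * G p"
    by (rule worderE[OF f]) blast
  have N': "N (dilation w t x) = \<bar>t\<bar> * N x" for t x using N by (simp add: pseudo_norm_def)
  have Npos: "x \<noteq> 0 \<Longrightarrow> 0 < N x" for x using N by (simp add: pseudo_norm_def)
  have Nc: "continuous_on S N" for S using N continuous_on_subset by (auto simp: pseudo_norm_def)
  have N0: "N 0 = 0" using N'[of 0 0] by simp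
  \<comment> \<open>The boundary of the cube is used instead of the unit sphere of \<open>N\<close>,
    whose compactness is not at hand. It misses \<open>0\<close>, so \<open>N\<close> has a positive
    minimum on it.\<close>
  define S where "S = {z :: real ^ 'n. (\<forall>j. \<bar>z $ j\<bar> \<le> 1) \<and> (\<exists>j. \<bar>z $ j\<bar> = 1)}"
  have S_eq: "S = (\<Inter>j. {z. \<bar>z $ j\<bar> \<le> 1}) \<inter> (\<Union>j. {z. \<bar>z $ j\<bar> = 1})" unfolding S_def by auto
  have "closed S" unfolding S_eq
    by (intro closed_Int closed_INT closed_UN ballI closed_Collect_le closed_Collect_eq finite_class.finite_UNIV continuous_intros)
  moreover have "bounded S"
  proof (rule boundedI)
    fix z assume "z \<in> S"
    have "norm z \<le> (\<Sum>j\<in>UNIV. \<bar>z $ j\<bar>)" by (rule norm_le_l1_cart)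
    also have "\<dots> \<le> (\<Sum>j\<in>(UNIV::'n set). 1)" by (rule sum_mono) (use \<open>z \<in> S\<close> in \<open>simp add: S_def\<close>)
    finally show "norm z \<le> real CARD('n)" by simp
  qed
  ultimately have cS: "compact S" by (simp add: compact_eq_bounded_closed)
  have neS: "S \<noteq> {}"
  proof -
    have "(\<chi> j. 1) \<in> S" by (simp add: S_def)
    then show ?thesis by blast
  qed
  have S0: "0 \<notin> S" by (simp add: S_def)
  obtain z0 where z0: "z0 \<in> S" "\<And>z. z \<in> S \<Longrightarrow> N z0 \<le> N z"
    using continuous_attains_inf[OF cS neS Nc] by blast
  define c where "c = N z0"
  have c: "c > 0" unfolding c_def using Npos z0(1) S0 by metis
  have "continuous_on S (\<lambda>z. G (0, z))"
    by (intro continuous_at_imp_continuous_on ballI smooth_around_imp_continuous smooth_around_slice slice_smoothD G(1))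
  then have "bounded ((\<lambda>z. G (0, z)) ` S)" using cS compact_continuous_image compact_imp_bounded by blast
  then obtain B where B: "\<And>z. z \<in> S \<Longrightarrow> \<bar>G (0, z)\<bar> \<le> B" unfolding bounded_iff by auto
  let ?P = "\<lambda>p. f (dilation w (fst p) (snd p)) = fst p ^ M * G p \<and> \<bar>G p\<bar> \<le> B + 1"
  have "\<forall>\<^sub>F p in nhds (0, u). ?P p" if "u \<in> S" for u
  proof -
    have "(G \<longlongrightarrow> G (0, u)) (nhds (0, u))"
      using smooth_around_imp_continuous[OF slice_smoothD[OF G(1)], of u] by (simp add: isCont_def tendsto_at_iff_tendsto_nhds)
    from tendstoD[OF this, of 1] have "\<forall>\<^sub>F p in nhds (0, u). \<bar>G p\<bar> \<le> B + 1"
      by (rule eventually_mono[OF _ _]) (use B[OF that] in \<open>auto simp: dist_real_def\<close>)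
    with G(2)[of u] show ?thesis by (rule eventually_conj)
  qed
  then obtain d where d: "d > 0" "\<And>t u. t \<in> ball 0 d \<Longrightarrow> u \<in> S \<Longrightarrow> ?P (t, u)"
    using tube_ball[OF cS, where ?z0.0="0::real" and P="?P"] by blast
  have bnd: "\<bar>f (dilation w t z)\<bar> \<le> \<bar>t\<bar> ^ M * (B + 1)" if "\<bar>t\<bar> < d" "z \<in> S" for t z
  proof -
    have "t \<in> ball 0 d" using that by (simp add: dist_real_def)
    from d(2)[OF this that(2)] show ?thesis by (simp add: abs_mult power_abs mult_left_mono)
  qed
  have B1: "B + 1 \<ge> 0" using B[OF z0(1)] by linarith
  have small: "\<forall>\<^sub>F x in nhds (0::real ^ 'n). \<forall>j. \<bar>x $ j\<bar> < (d / 2) ^ w j"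
  proof (rule eventually_all_finite)
    fix j
    have "((\<lambda>x::real ^ 'n. \<bar>x $ j\<bar>) \<longlongrightarrow> \<bar>0 $ j\<bar>) (nhds 0)" by (intro tendsto_intros filterlim_ident)
    moreover have "0 < (d / 2) ^ w j" using d(1) by simp
    ultimately show "\<forall>\<^sub>F x in nhds (0::real ^ 'n). \<bar>x $ j\<bar> < (d / 2) ^ w j"
      using order_tendstoD(2) by (metis abs_zero zero_index)
  qed
  have "\<forall>\<^sub>F x in nhds 0. norm (f x) \<le> ((B + 1) / c ^ M) * norm (N x ^ M)"
    using small
  proof eventually_elim
    case (elim x)
    show ?case
    proof (cases "x = 0")
      case True
      then show ?thesis using bnd[of 0 z0] d(1) z0(1) B1 c N0 by (cases "M = 0") (auto simp: zero_power)
    next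
      case False
      \<comment> \<open>The scale \<open>s\<close> is the homogeneous norm
        \<open>max_j |x_j|^(1 / w_j)\<close>; dividing it out by a dilation puts \<open>x\<close> on
        the boundary of the cube, and the bounds in \<open>small\<close> force
        \<open>s < d\<close>.\<close>
      define \<rho> where "\<rho> = (\<lambda>j. root (w j) \<bar>x $ j\<bar>)"
      define s where "s = Max (range \<rho>)"
      have wp: "0 < w j" for j using w_pos[of j] by simp
      have \<rho>s: "\<rho> j \<le> s" for j unfolding s_def by (intro Max_ge) auto
      have "s \<in> range \<rho>" unfolding s_def by (intro Max_in) auto
      then obtain j0 where j0: "s = \<rho> j0" by blast
      have pw: "\<rho> j ^ w j = \<bar>x $ j\<bar>" for j unfolding \<rho>_def using wp[of j] by simp
      have \<rho>0: "0 \<le> \<rho> j" for j unfolding \<rho>_def using wp[of j] by simp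
      obtain j1 where "x $ j1 \<noteq> 0" using False by (auto simp: vec_eq_iff)
      then have "0 < \<rho> j1" unfolding \<rho>_def using wp[of j1] by simp
      then have s: "0 < s" using \<rho>s[of j1] by linarith
      have "s < d"
      proof (rule ccontr)
        assume "\<not> s < d"
        then have "(d / 2) ^ w j0 \<le> \<rho> j0 ^ w j0" using d(1) j0 by (intro power_mono) auto
        then show False using spec[OF elim, of j0] pw[of j0] by simp
      qed
      define z where "z = dilation w (1 / s) x"
      have xz: "x = dilation w s z" unfolding z_def dilation_dilation using s by simp
      have zj: "\<bar>z $ j\<bar> = \<rho> j ^ w j / s ^ w j" for j
        unfolding z_def using s by (simp add: abs_mult pw power_divide)
      have zS: "z \<in> S"
        unfolding S_def
      proof (intro CollectI conjI allI exI)
        fix j have "\<rho> j ^ w j \<le> s ^ w j" by (intro power_mono \<rho>s \<rho>0)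
        then show "\<bar>z $ j\<bar> \<le> 1" unfolding zj using s by simp
      next
        show "\<bar>z $ j0\<bar> = 1" unfolding zj using s j0 by simp
      qed
      have "N x = s * N z" using N'[of s z] xz s by simp
      then have "s * c \<le> N x" using z0(2)[OF zS] s by (simp add: c_def)
      then have le: "s ^ M \<le> N x ^ M / c ^ M"
        using power_mono[of "s * c" "N x" M] s c by (simp add: power_mult_distrib pos_le_divide_eq)
      have "\<bar>f x\<bar> \<le> s ^ M * (B + 1)" using bnd[of s z, OF _ zS] s \<open>s < d\<close> xz by simp
      also have "\<dots> \<le> (N x ^ M / c ^ M) * (B + 1)" by (intro mult_right_mono le B1)
      finally show ?thesis using Npos[OF False] by (simp add: mult_ac)
    qed
  qed
  then show ?thesis by (rule bigoI)
qed

lemma weighted_O_iff: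
  assumes "pseudo_norm w N" "smooth_around 0 \<Theta>"
  shows "weighted_O w N m \<Theta> \<longleftrightarrow> (\<forall>k. worder w (w k + m) (\<lambda>x. \<Theta> x $ k))"
  unfolding weighted_O_def
  using bigo_imp_worder[OF assms(1) smooth_around_vec_nth[OF assms(2)]] worder_imp_bigo[OF assms(1)] by blast

text \<open>Words of \<open>b'\<close> on a coordinate at \<open>0\<close> are words of
  \<open>b\<close> on the corresponding component of \<open>\<Phi>\<close>, which has enough order
  to be killed. The diagonal blocks are not controlled by the order and are assumed
  separately.\<close>

lemma good_transition:
  assumes b: "good_frame b" and b': "\<And>j. smooth_around 0 (b' j)"
    and diag: "\<And>j k. w j = w k \<Longrightarrow> b' j 0 $ k = (if j = k then 1 else 0)"
    and \<Phi>: "smooth_around 0 \<Phi>" "\<Phi> 0 = 0" "\<And>k. worder w (w k) (\<lambda>x. \<Phi> x $ k)"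
    and tr: "\<forall>\<^sub>F x in nhds 0. \<forall>j. frechet_derivative \<Phi> (at x) (b j x) = b' j (\<Phi> x)"
  shows "good_frame b'"
  unfolding good_frame_def
proof (intro conjI allI impI)
  fix k I assume I: "wt w I < w k"
  have "\<forall>\<^sub>F x in nhds 0. word_op b I (\<lambda>x. \<Phi> x $ k) x = word_op b' I (\<lambda>x. x $ k) (\<Phi> x)"
    by (rule word_op_transition[where f="\<lambda>x. x $ k", OF \<Phi>(1) _ _ tr])
       (use b' \<Phi>(2) in \<open>auto intro: smooth_around_vec_nth\<close>)
  from eventually_nhds_x_imp_x[OF this] show "word_op b' I (\<lambda>x. x $ k) 0 = 0"
    using worder_imp_frame_order[OF b \<Phi>(3) I] \<Phi>(2) by simp
qed (use b' diag in auto)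

text \<open>A term of order \<open>w k + 1\<close> is annihilated at \<open>0\<close> by every
  one-letter word of weight \<open>w k\<close>, so the diagonal blocks are unchanged; and it
  disappears under rescaling, so the limit \<open>G (0, x)\<close> is \<open>x\<close> and the model
  fields coincide.\<close>

lemma good_perturbation:
  assumes b: "good_frame b" and b': "\<And>j. smooth_around 0 (b' j)"
    and \<Phi>: "smooth_around 0 \<Phi>" "\<And>k. worder w (w k + 1) (\<lambda>x. \<Phi> x $ k - x $ k)"
    and tr: "\<forall>\<^sub>F x in nhds 0. \<forall>j. frechet_derivative \<Phi> (at x) (b j x) = b' j (\<Phi> x)"
  shows "good_frame b'" "scaled_frame b X \<Longrightarrow> scaled_frame b' X' \<Longrightarrow> X' j (0, x) = X j (0, x)"
proof -
  have \<Phi>0: "\<Phi> 0 = 0" using worder_at_0[OF \<Phi>(2)] by (simp add: vec_eq_iff)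
  have wo: "worder w (w k) (\<lambda>x. \<Phi> x $ k)" for k
    using worder_add[OF worder_mono[OF \<Phi>(2)[of k]] worder_coord[of k]] by simp
  show g': "good_frame b'"
  proof (rule good_transition[OF b b' _ \<Phi>(1) \<Phi>0 wo tr])
    fix j k assume jk: "w j = w k"
    have "b' j 0 $ k = frechet_derivative \<Phi> (at 0) (b j 0) $ k"
      using eventually_nhds_x_imp_x[OF tr] \<Phi>0 by simp
    also have "\<dots> = frechet_derivative (\<lambda>x. \<Phi> x $ k - x $ k) (at 0) (b j 0) + b j 0 $ k"
      by (subst frechet_derivativeI[OF has_derivative_diff[OF bounded_linear.has_derivative[OF bounded_linear_vec_nth
        smooth_around_has_derivative[OF \<Phi>(1)]] bounded_linear.has_derivative[OF bounded_linear_vec_nth has_derivative_ident]]]) simp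
    also have "frechet_derivative (\<lambda>x. \<Phi> x $ k - x $ k) (at 0) (b j 0) = 0"
      using worder_imp_frame_order[OF b \<Phi>(2)[of k], of "[j]"] jk by (simp add: frame_op_def)
    finally show "b' j 0 $ k = (if j = k then 1 else 0)" using good_diag[OF b jk] by simp
  qed
  assume X: "scaled_frame b X" and X': "scaled_frame b' X'"
  obtain G where G: "slice_smooth G" "\<And>x. \<forall>\<^sub>F p in nhds (0, x). \<Phi> (dilation w (fst p) (snd p)) = dilation w (fst p) (G p)"
    "\<And>j x. frechet_derivative (\<lambda>x. G (0, x)) (at x) (X j (0, x)) = X' j (0, G (0, x))"
    by (rule transition_limit[OF b X g' X' \<Phi>(1) \<Phi>0 tr]) blast
  have Gid: "G (0, x) = x" for x
  proof -
    have "G (0, x) $ k = x $ k" for k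
    proof (rule tendsto_unique[of "at 0"])
      show "((\<lambda>t. G (t, x) $ k) \<longlongrightarrow> G (0, x) $ k) (at 0)" by (rule tendsto_vec_nth[OF tendsto_slice[OF slice_smoothD[OF G(1)]]])
      have "((\<lambda>t. (\<Phi> (dilation w t x) $ k - dilation w t x $ k) / t ^ w k + x $ k) \<longlongrightarrow> 0 + x $ k) (at 0)"
        by (intro tendsto_add tendsto_const worder_tendsto_0[OF \<Phi>(2)]) simp
      then have "((\<lambda>t. (\<Phi> (dilation w t x) $ k - dilation w t x $ k) / t ^ w k + x $ k) \<longlongrightarrow> x $ k) (at 0)" by simp
      moreover have "\<forall>\<^sub>F t in at 0. (\<Phi> (dilation w t x) $ k - dilation w t x $ k) / t ^ w k + x $ k = G (t, x) $ k"
        using eventually_slice[OF G(2)[of x]] eventually_at_neq_0 by eventually_elim (simp add: field_simps)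
      ultimately show "((\<lambda>t. G (t, x) $ k) \<longlongrightarrow> x $ k) (at 0)" by (rule Lim_transform_eventually)
    qed simp
    then show ?thesis by (simp add: vec_eq_iff)
  qed
  show "X' j (0, x) = X j (0, x)"
    using G(3)[of x j] unfolding Gid by (simp add: frechet_derivativeI[OF has_derivative_ident])
qed

end

subsection \<open>The exponential map of a homogeneous frame\<close>

text \<open>Writing the antiderivative as an integral over \<open>[0, 1]\<close> covers both signs
  of \<open>t\<close> and matches the form in which smoothness in the parameters is
  available.\<close>

lemma antiderivative_real_line:
  fixes q :: "real \<Rightarrow> 'b::euclidean_space"
  assumes "\<And>s. isCont q s"
  shows "((\<lambda>t. integral {0..1} (\<lambda>u. t *\<^sub>R q (u * t))) has_vector_derivative q t) (at t)"
proof -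
  define T where "T = \<bar>t\<bar> + 1"
  have T: "t \<in> {-T<..<T}" "0 \<in> {-T..T}" unfolding T_def by auto
  have "continuous_on {-T..T} q" by (intro continuous_at_imp_continuous_on ballI assms)
  then obtain B where B: "\<And>s. s \<in> {-T..T} \<Longrightarrow> (B has_vector_derivative q s) (at s within {-T..T})"
    by (rule antiderivative_continuous) blast
  have eq: "integral {0..1} (\<lambda>u. s *\<^sub>R q (u * s)) = B s - B 0" if s: "s \<in> {-T..T}" for s
  proof -
    have "((\<lambda>u. B (u * s)) has_vector_derivative s *\<^sub>R q (u * s)) (at u within {0..1})" if u: "u \<in> {0..1}" for u
    proof -
      have us: "u * s \<in> {-T..T}" if "u \<in> {0..1}" for u
      proof -
        have "\<bar>u * s\<bar> \<le> 1 * \<bar>s\<bar>" unfolding abs_mult using that by (intro mult_right_mono) auto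
        then show ?thesis using s by auto
      qed
      have "((\<lambda>u. u * s) has_vector_derivative s) (at u within {0..1})"
        unfolding has_vector_derivative_def
        by (rule has_derivative_eq_rhs[OF has_derivative_mult_left[OF has_derivative_ident]]) auto
      moreover have "(B has_vector_derivative q (u * s)) (at (u * s) within (\<lambda>u. u * s) ` {0..1})"
        by (rule has_vector_derivative_within_subset[OF B[OF us[OF u]]]) (use us in auto)
      ultimately show ?thesis using vector_diff_chain_within[of "\<lambda>u. u * s" s u "{0..1}" B "q (u * s)"] by (simp add: o_def)
    qed
    from fundamental_theorem_of_calculus[OF _ this] have "((\<lambda>u. s *\<^sub>R q (u * s)) has_integral B (1 * s) - B (0 * s)) {0..1}" by simp
    from integral_unique[OF this] show ?thesis by simp
  qed
  have "(B has_vector_derivative q t) (at t within {-T..T})" using B T by auto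
  then have "(B has_vector_derivative q t) (at t within {-T<..<T})"
    by (rule has_vector_derivative_within_subset) auto
  then have "(B has_vector_derivative q t) (at t)" using at_within_open[OF T(1)] by simp
  then have d: "((\<lambda>s. B s - B 0) has_vector_derivative q t) (at t)" by (simp add: has_vector_derivative_diff_const)
  have ev: "\<forall>\<^sub>F s in nhds t. B s - B 0 = integral {0..1} (\<lambda>u. s *\<^sub>R q (u * s))"
    by (rule eventually_mono[OF eventually_nhds_in_open[OF open_greaterThanLessThan T(1)]]) (rule eq[symmetric], auto)
  show ?thesis unfolding has_vector_derivative_def
    by (rule iffD1[OF has_derivative_cong_nhds[OF ev] d[unfolded has_vector_derivative_def]])
qed

lemma vector_derivative_zero_const:
  fixes f :: "real \<Rightarrow> real"
  assumes "\<And>s. s \<in> {0..1} \<Longrightarrow> (f has_vector_derivative 0) (at s within {0..1})" "t \<in> {0..1}"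
  shows "f t = f 0"
proof -
  obtain c where "\<And>x. x \<in> {0..1} \<Longrightarrow> f x = c"
    using has_derivative_zero_constant[of "{0..1}" f] assms(1) by (auto simp: has_vector_derivative_def)
  then show ?thesis using assms(2) by auto
qed

context weights begin

definition combination :: "('n \<Rightarrow> real ^ 'n \<Rightarrow> real ^ 'n) \<Rightarrow> real ^ 'n \<Rightarrow> real ^ 'n \<Rightarrow> real ^ 'n" where
  "combination Y x z = (\<Sum>j\<in>UNIV. x $ j *\<^sub>R Y j z)"

text \<open>The derivative of component \<open>k\<close> depends only on components of smaller
  weight (\<open>homogeneous_depends\<close>), which agree by induction; so the difference has
  derivative \<open>0\<close>.\<close>

lemma homogeneous_ode_unique:
  assumes Y: "homogeneous_frame Y"
    and \<gamma>: "\<And>t. t \<in> {0..1} \<Longrightarrow> (\<gamma> has_vector_derivative combination Y x (\<gamma> t)) (at t within {0..1})"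
    and \<delta>: "\<And>t. t \<in> {0..1} \<Longrightarrow> (\<delta> has_vector_derivative combination Y x (\<delta> t)) (at t within {0..1})"
    and "\<gamma> 0 = \<delta> 0" and t: "t \<in> {0..1}"
  shows "\<gamma> t = \<delta> t"
proof -
  have "\<forall>t\<in>{0..1}. \<gamma> t $ k = \<delta> t $ k" for k
  proof (induction "w k" arbitrary: k rule: less_induct)
    case less
    have "((\<lambda>t. \<gamma> t $ k - \<delta> t $ k) has_vector_derivative 0) (at s within {0..1})" if s: "s \<in> {0..1}" for s
    proof -
      have "Y j (\<gamma> s) $ k = Y j (\<delta> s) $ k" for j
        by (rule homogeneous_depends[OF Y]) (use less s w_pos[of j] in fastforce)
      then have "combination Y x (\<gamma> s) $ k = combination Y x (\<delta> s) $ k" by (simp add: combination_def)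
      moreover have "((\<lambda>t. \<gamma> t $ k - \<delta> t $ k) has_vector_derivative (combination Y x (\<gamma> s) $ k - combination Y x (\<delta> s) $ k)) (at s within {0..1})"
        by (intro has_vector_derivative_diff bounded_linear.has_vector_derivative[OF bounded_linear_vec_nth] \<gamma> \<delta> s)
      ultimately show ?thesis by simp
    qed
    then show ?case using vector_derivative_zero_const[of "\<lambda>t. \<gamma> t $ k - \<delta> t $ k"] \<open>\<gamma> 0 = \<delta> 0\<close> by fastforce
  qed
  then show ?thesis using t by (simp add: vec_eq_iff)
qed

text \<open>Picard iteration terminates: by triangularity the components of weight at most \<open>m\<close> are
  stationary after \<open>m\<close> steps.\<close>

primrec picard :: "('n \<Rightarrow> real ^ 'n \<Rightarrow> real ^ 'n) \<Rightarrow> nat \<Rightarrow> real \<times> (real ^ 'n) \<Rightarrow> real ^ 'n" where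
  "picard Y 0 = (\<lambda>p. 0)"
| "picard Y (Suc m) = (\<lambda>p. integral {0..1} (\<lambda>u. fst p *\<^sub>R combination Y (snd p) (picard Y m (u * fst p, snd p))))"

lemma smooth_around_combination:
  fixes f g :: "'a::real_normed_vector \<Rightarrow> real ^ 'n"
  assumes Y: "homogeneous_frame Y" and f: "smooth_around z f" and g: "smooth_around z g"
  shows "smooth_around z (\<lambda>p. combination Y (f p) (g p))"
  unfolding combination_def
proof (rule smooth_around_sum, rule smooth_around_scaleR)
  fix j
  show "smooth_around z (\<lambda>p. f p $ j)" by (rule smooth_around_vec_nth[OF f])
  show "smooth_around z (\<lambda>p. Y j (g p))" by (rule smooth_around_compose[OF g homogeneous_smooth[OF Y]])
qed

lemma smooth_around_picard:
  assumes Y: "homogeneous_frame Y"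
  shows "smooth_around p (picard Y m)"
proof (induction m arbitrary: p)
  case (Suc m)
  let ?h = "\<lambda>q. fst (fst q) *\<^sub>R combination Y (snd (fst q)) (picard Y m (snd q * fst (fst q), snd (fst q)))"
  have "smooth_around (p, u) ?h" for u
  proof (rule smooth_around_scaleR)
    show "smooth_around (p, u) (\<lambda>q. fst (fst q))" by (rule smooth_intros)+
    show "smooth_around (p, u) (\<lambda>q. combination Y (snd (fst q)) (picard Y m (snd q * fst (fst q), snd (fst q))))"
    proof (rule smooth_around_combination[OF Y])
      show "smooth_around (p, u) (\<lambda>q. snd (fst q))" by (rule smooth_intros)+
      show "smooth_around (p, u) (\<lambda>q. picard Y m (snd q * fst (fst q), snd (fst q)))"
        by (rule smooth_around_compose[where g="picard Y m" and f="\<lambda>q. (snd q * fst (fst q), snd (fst q))"], (rule smooth_intros)+) (rule Suc)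
    qed
  qed
  from smooth_around_integral[of p ?h, OF this] show ?case by simp
qed simp

lemma picard_stationary:
  assumes Y: "homogeneous_frame Y"
  shows "w k \<le> m \<Longrightarrow> picard Y (Suc m) p $ k = picard Y m p $ k"
proof (induction m arbitrary: k p)
  case 0 then show ?case using w_pos[of k] by simp
next
  case (Suc m)
  have int: "(\<lambda>u. fst p *\<^sub>R combination Y (snd p) (picard Y m (u * fst p, snd p))) integrable_on {0..1}" for m
  proof (rule integrable_continuous_real, intro continuous_at_imp_continuous_on ballI smooth_around_imp_continuous)
    fix u :: real
    have "smooth_around u (\<lambda>u. picard Y m (u * fst p, snd p))"
      by (rule smooth_around_compose[where g="picard Y m" and f="\<lambda>u. (u * fst p, snd p)"], (rule smooth_intros)+) (rule smooth_around_picard[OF Y])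
    then show "smooth_around u (\<lambda>u. fst p *\<^sub>R combination Y (snd p) (picard Y m (u * fst p, snd p)))"
      by (intro smooth_around_scaleR smooth_around_const smooth_around_combination[OF Y])
  qed
  have "picard Y (Suc (Suc m)) p $ k = integral {0..1} (\<lambda>u. (fst p *\<^sub>R combination Y (snd p) (picard Y (Suc m) (u * fst p, snd p))) $ k)"
    unfolding picard.simps(2)[of Y "Suc m"] by (rule integral_linear[OF int bounded_linear_vec_nth, unfolded o_def, symmetric])
  also have "\<dots> = integral {0..1} (\<lambda>u. (fst p *\<^sub>R combination Y (snd p) (picard Y m (u * fst p, snd p))) $ k)"
  proof (rule integral_cong)
    fix u :: real
    have "Y j (picard Y (Suc m) (u * fst p, snd p)) $ k = Y j (picard Y m (u * fst p, snd p)) $ k" for j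
      by (rule homogeneous_depends[OF Y]) (rule Suc.IH, use Suc.prems w_pos[of j] in linarith)
    then show "(fst p *\<^sub>R combination Y (snd p) (picard Y (Suc m) (u * fst p, snd p))) $ k = (fst p *\<^sub>R combination Y (snd p) (picard Y m (u * fst p, snd p))) $ k"
      by (simp add: combination_def del: picard.simps)
  qed
  also have "\<dots> = picard Y (Suc m) p $ k"
    unfolding picard.simps(2)[of Y m] by (rule integral_linear[OF int bounded_linear_vec_nth, unfolded o_def])
  finally show ?case .
qed

text \<open>After as many Picard steps as the largest weight the iterate solves the integral
  equation exactly, so the flow exists for all times and is jointly smooth because each iterate
  is.\<close>

lemma homogeneous_flow:
  assumes Y: "homogeneous_frame Y"
  obtains \<gamma> where "\<And>p. smooth_around p \<gamma>" "\<And>x. \<gamma> (0, x) = 0"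
    "\<And>t x. ((\<lambda>t. \<gamma> (t, x)) has_vector_derivative combination Y x (\<gamma> (t, x))) (at t)"
proof -
  define m where "m = Max (range w)"
  have wm: "w k \<le> m" for k unfolding m_def by (intro Max_ge) auto
  define \<gamma> where "\<gamma> = picard Y m"
  have fix_eq: "\<gamma> p = integral {0..1} (\<lambda>u. fst p *\<^sub>R combination Y (snd p) (\<gamma> (u * fst p, snd p)))" for p
  proof -
    have "picard Y (Suc m) p = picard Y m p" unfolding vec_eq_iff using picard_stationary[OF Y wm] by blast
    then show ?thesis unfolding \<gamma>_def by simp
  qed
  show thesis
  proof (rule that)
    show sm: "smooth_around p \<gamma>" for p unfolding \<gamma>_def by (rule smooth_around_picard[OF Y])
    show "\<gamma> (0, x) = 0" for x by (subst fix_eq) simp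
    fix t x
    have "isCont (\<lambda>s. combination Y x (\<gamma> (s, x))) s" for s
    proof (rule smooth_around_imp_continuous, rule smooth_around_combination[OF Y])
      show "smooth_around s (\<lambda>s. \<gamma> (s, x))"
        by (rule smooth_around_compose[where g=\<gamma> and f="\<lambda>s. (s, x)"], (rule smooth_intros)+) (rule sm)
    qed simp
    from antiderivative_real_line[of "\<lambda>s. combination Y x (\<gamma> (s, x))", OF this]
    have "((\<lambda>t. integral {0..1} (\<lambda>u. t *\<^sub>R combination Y x (\<gamma> (u * t, x)))) has_vector_derivative combination Y x (\<gamma> (t, x))) (at t)" .
    moreover have "integral {0..1} (\<lambda>u. t *\<^sub>R combination Y x (\<gamma> (u * t, x))) = \<gamma> (t, x)" for t
      using fix_eq[of "(t, x)"] by simp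
    ultimately show "((\<lambda>t. \<gamma> (t, x)) has_vector_derivative combination Y x (\<gamma> (t, x))) (at t)" by simp
  qed
qed

lemma exp_map_eqI:
  assumes Y: "homogeneous_frame Y" and "\<gamma> 0 = 0"
    and \<gamma>: "\<And>t. t \<in> {0..1} \<Longrightarrow> (\<gamma> has_vector_derivative combination Y x (\<gamma> t)) (at t within {0..1})"
  shows "exp_map Y x = \<gamma> 1"
  unfolding exp_map_def
proof (rule the_equality)
  show "\<exists>\<gamma>'. \<gamma>' 0 = 0 \<and> \<gamma>' 1 = \<gamma> 1 \<and> (\<forall>t\<in>{0..1}. (\<gamma>' has_vector_derivative (\<Sum>j\<in>UNIV. x $ j *\<^sub>R Y j (\<gamma>' t))) (at t within {0..1}))"
    using assms by (intro exI[of _ \<gamma>]) (simp add: combination_def)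
  fix z
  assume "\<exists>\<gamma>. \<gamma> 0 = 0 \<and> \<gamma> 1 = z \<and> (\<forall>t\<in>{0..1}. (\<gamma> has_vector_derivative (\<Sum>j\<in>UNIV. x $ j *\<^sub>R Y j (\<gamma> t))) (at t within {0..1}))"
  then obtain \<delta> where \<delta>: "\<delta> 0 = 0" "\<delta> 1 = z" "\<And>t. t \<in> {0..1} \<Longrightarrow> (\<delta> has_vector_derivative combination Y x (\<delta> t)) (at t within {0..1})"
    unfolding combination_def by blast
  have "\<delta> 1 = \<gamma> 1" by (rule homogeneous_ode_unique[OF Y \<delta>(3) \<gamma>]) (use \<delta> assms in auto)
  then show "z = \<gamma> 1" using \<delta> by simp
qed

lemma exp_map_flow:
  assumes Y: "homogeneous_frame Y" and "\<And>x. \<gamma> (0, x) = 0"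
    "\<And>t x. ((\<lambda>t. \<gamma> (t, x)) has_vector_derivative combination Y x (\<gamma> (t, x))) (at t)"
  shows "exp_map Y x = \<gamma> (1, x)"
  by (rule exp_map_eqI[OF Y, of "\<lambda>t. \<gamma> (t, x)"]) (use assms in \<open>auto intro: has_vector_derivative_at_within\<close>)

lemma smooth_around_exp_map:
  assumes Y: "homogeneous_frame Y" shows "smooth_around x (exp_map Y)"
proof -
  obtain \<gamma> where \<gamma>: "\<And>p. smooth_around p \<gamma>" "\<And>x. \<gamma> (0, x) = 0"
    "\<And>t x. ((\<lambda>t. \<gamma> (t, x)) has_vector_derivative combination Y x (\<gamma> (t, x))) (at t)"
    by (rule homogeneous_flow[OF Y]) blast
  have "exp_map Y = (\<lambda>x. \<gamma> (1, x))" using exp_map_flow[OF Y \<gamma>(2,3)] by auto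
  then show ?thesis using smooth_around_slice[OF \<gamma>(1)] by simp
qed

text \<open>The dilate of an integral curve is an integral curve of the combination with dilated
  coefficients, by homogeneity of \<open>Y\<close>; uniqueness identifies the endpoints.\<close>

lemma exp_map_homogeneous:
  assumes Y: "homogeneous_frame Y" shows "exp_map Y (dilation w s x) = dilation w s (exp_map Y x)"
proof -
  obtain \<gamma> where \<gamma>: "\<And>p. smooth_around p \<gamma>" "\<And>x. \<gamma> (0, x) = 0"
    "\<And>t x. ((\<lambda>t. \<gamma> (t, x)) has_vector_derivative combination Y x (\<gamma> (t, x))) (at t)"
    by (rule homogeneous_flow[OF Y]) blast
  have "exp_map Y (dilation w s x) = dilation w s (\<gamma> (1, x))"
  proof (rule exp_map_eqI[OF Y, of "\<lambda>t. dilation w s (\<gamma> (t, x))"])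
    show "dilation w s (\<gamma> (0, x)) = 0" using \<gamma> by simp
    fix t :: real
    have "dilation w s (combination Y x (\<gamma> (t, x))) = combination Y (dilation w s x) (dilation w s (\<gamma> (t, x)))"
      unfolding combination_def dilation_sum
      by (simp add: linear_scale[OF bounded_linear.linear[OF bounded_linear_dilation]] flip: homogeneous_eq[OF Y]) (simp add: mult_ac)
    then show "((\<lambda>t. dilation w s (\<gamma> (t, x))) has_vector_derivative combination Y (dilation w s x) (dilation w s (\<gamma> (t, x)))) (at t within {0..1})"
      using bounded_linear.has_vector_derivative[OF bounded_linear_dilation has_vector_derivative_at_within[OF \<gamma>(3)], of w s x t "{0..1}"] by simp
  qed
  then show ?thesis using exp_map_flow[OF Y \<gamma>(2,3)] by simp
qed

text \<open>The inverse function theorem gives a local inverse at \<open>0\<close>. A dilation with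
  a small factor moves any point into its domain, and equivariance carries the result back, so the
  local inverse determines a global smooth one.\<close>

lemma homogeneous_map_bij:
  assumes E: "smooth_around 0 E" "inj (frechet_derivative E (at 0))" and h: "\<And>s x. E (dilation w s x) = dilation w s (E x)"
  shows "bij E" "smooth_around y (inv E)"
proof -
  have E0: "E 0 = 0" using h[of 0 0] by simp
  obtain U V g where UV: "open U" "0 \<in> U" "open V" "E 0 \<in> V" "homeomorphism U V E g"
    and sg: "\<And>y. y \<in> V \<Longrightarrow> smooth_around y g"
    by (rule smooth_inverse_function[OF E]) blast
  have small: "\<forall>\<^sub>F s in at (0::real). dilation w s x \<in> W" if "open W" "0 \<in> W" for x W
    by (rule eventually_compose_filterlim[OF eventually_nhds_in_open[OF that] tendsto_dilation_at])
  have V0: "0 \<in> V" using UV(4) E0 by simp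
  have gE: "g (E x) = x" if "x \<in> U" for x using UV(5) that by (simp add: homeomorphism_def)
  have Eg: "E (g y) = y" if "y \<in> V" for y using UV(5) that by (simp add: homeomorphism_def)
  have inj: "inj E"
  proof (rule injI)
    fix x y assume eq: "E x = E y"
    have "\<forall>\<^sub>F s in at (0::real). s \<noteq> 0 \<and> dilation w s x \<in> U \<and> dilation w s y \<in> U"
      by (intro eventually_conj eventually_at_neq_0 small UV)
    then obtain s where s: "s \<noteq> 0" "dilation w s x \<in> U" "dilation w s y \<in> U"
      using eventually_happens'[of "at (0::real)"] by (metis (mono_tags, lifting) trivial_limit_at)
    have "dilation w s x = dilation w s y" using gE[OF s(2)] gE[OF s(3)] h eq by metis
    then show "x = y" by (rule dilation_cancel[OF s(1)])
  qed
  have scale: "\<exists>s. s \<noteq> 0 \<and> dilation w s y \<in> V" for y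
  proof -
    have "\<forall>\<^sub>F s in at (0::real). s \<noteq> 0 \<and> dilation w s y \<in> V"
      by (intro eventually_conj eventually_at_neq_0 small UV V0)
    then show ?thesis using eventually_happens'[of "at (0::real)"] by (metis (mono_tags, lifting) trivial_limit_at)
  qed
  have pre: "E (dilation w (1 / s) (g (dilation w s y))) = y" if "s \<noteq> 0" "dilation w s y \<in> V" for s y
    using Eg[OF that(2)] that(1) by (simp add: h dilation_dilation)
  have "surj E" using scale pre by (metis surjI surj_def)
  with inj show bij: "bij E" by (simp add: bij_def)
  obtain s where s: "s \<noteq> 0" "dilation w s y \<in> V" using scale by blast
  have sm: "smooth_around y (\<lambda>y. dilation w (1 / s) (g (dilation w s y)))"
    by (rule smooth_around_dilation smooth_intros smooth_around_compose[where g=g and f="dilation w s"] sg s(2))+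
  have "((\<lambda>z. dilation w s z) \<longlongrightarrow> dilation w s y) (nhds y)"
  proof -
    have "smooth_around y (\<lambda>z. dilation w s z)" by (rule smooth_around_dilation smooth_intros)+
    from smooth_around_imp_continuous[OF this] show ?thesis by (simp add: isCont_def tendsto_at_iff_tendsto_nhds)
  qed
  from eventually_compose_filterlim[OF eventually_nhds_in_open[OF UV(3) s(2)] this]
  have "\<forall>\<^sub>F z in nhds y. dilation w (1 / s) (g (dilation w s z)) = inv E z"
    by (rule eventually_mono) (metis pre[OF s(1)] inj inv_f_f)
  then show "smooth_around y (inv E)" by (rule smooth_around_cong[OF _ sm])
qed

text \<open>\<open>t x\<close> and \<open>g (t x)\<close> are integral curves of \<open>\<Sum> x_j Z_j\<close> issuing from \<open>0\<close>.\<close>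

lemma homogeneous_intertwiner_id:
  assumes Z: "homogeneous_frame Z" and Zx: "\<And>s x. combination Z x (s *\<^sub>R x) = x"
    and g: "\<And>x. smooth_around x g" "g 0 = 0" "\<And>j x. frechet_derivative g (at x) (Z j x) = Z j (g x)"
  shows "g x = x"
proof -
  have "g (1 *\<^sub>R x) = 1 *\<^sub>R x"
  proof (rule homogeneous_ode_unique[OF Z, of "\<lambda>t. g (t *\<^sub>R x)" x "\<lambda>t. t *\<^sub>R x"])
    fix t :: real
    have d: "((\<lambda>t. t *\<^sub>R x) has_derivative (\<lambda>h. h *\<^sub>R x)) (at t within {0..1})"
      by (rule has_derivative_scaleR_left[OF has_derivative_ident])
    then show "((\<lambda>t. t *\<^sub>R x) has_vector_derivative combination Z x (t *\<^sub>R x)) (at t within {0..1})"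
      by (simp add: Zx has_vector_derivative_def)
    note lin = smooth_around_linear_frechet[OF g(1), of "t *\<^sub>R x"]
    have "frechet_derivative g (at (t *\<^sub>R x)) x = frechet_derivative g (at (t *\<^sub>R x)) (combination Z x (t *\<^sub>R x))" by (simp add: Zx)
    also have "\<dots> = combination Z x (g (t *\<^sub>R x))"
      unfolding combination_def by (simp add: linear_sum[OF lin] linear_scale[OF lin] g(3))
    finally have "frechet_derivative g (at (t *\<^sub>R x)) x = combination Z x (g (t *\<^sub>R x))" .
    moreover have "((\<lambda>t. g (t *\<^sub>R x)) has_derivative (\<lambda>h. frechet_derivative g (at (t *\<^sub>R x)) (h *\<^sub>R x))) (at t within {0..1})"
      by (rule has_derivative_compose[OF d smooth_around_has_derivative[OF g(1)]])
    ultimately show "((\<lambda>t. g (t *\<^sub>R x)) has_vector_derivative combination Z x (g (t *\<^sub>R x))) (at t within {0..1})"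
      by (simp add: has_vector_derivative_def linear_scale[OF lin])
  qed (simp_all add: g)
  then show ?thesis by simp
qed

end

section \<open>Graded brackets and the differential of the exponential map\<close>

definition algebra_bracket :: "('n::finite \<Rightarrow> 'n \<Rightarrow> real ^ 'n) \<Rightarrow> real ^ 'n \<Rightarrow> real ^ 'n \<Rightarrow> real ^ 'n" where
  "algebra_bracket c u v = (\<Sum>i\<in>UNIV. \<Sum>j\<in>UNIV. (u $ i * v $ j) *\<^sub>R c i j)"

lemma linear_algebra_bracket_right: "linear (algebra_bracket c u)"
  unfolding algebra_bracket_def
  by (rule linearI) (simp_all add: algebra_simps sum.distrib scaleR_sum_right)

lemma linear_algebra_bracket_left: "linear (\<lambda>u. algebra_bracket c u v)"
  unfolding algebra_bracket_def
  by (rule linearI) (simp_all add: algebra_simps sum.distrib scaleR_sum_right)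

lemma bounded_bilinear_algebra_bracket: "bounded_bilinear (algebra_bracket c)"
  unfolding bilinear_conv_bounded_bilinear[symmetric] bilinear_def
  by (simp add: linear_algebra_bracket_left linear_algebra_bracket_right)

lemma algebra_bracket_antisym:
  assumes "\<And>i j. c i j = - c j i"
  shows "algebra_bracket c u v = - algebra_bracket c v u"
proof -
  have "algebra_bracket c u v = (\<Sum>i\<in>UNIV. \<Sum>j\<in>UNIV. - ((v $ j * u $ i) *\<^sub>R c j i))"
    unfolding algebra_bracket_def
  proof (intro sum.cong refl)
    fix i j show "(u $ i * v $ j) *\<^sub>R c i j = - ((v $ j * u $ i) *\<^sub>R c j i)"
      by (subst assms) (simp add: mult.commute)
  qed
  also have "\<dots> = - algebra_bracket c v u"
    unfolding algebra_bracket_def by (subst sum.swap) (simp add: sum_negf)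
  finally show ?thesis .
qed

lemma algebra_bracket_self:
  assumes "\<And>i j. c i j = - c j i" shows "algebra_bracket c u u = 0"
  using algebra_bracket_antisym[of c u u, OF assms] by (simp add: vec_eq_iff)

lemma has_vector_derivative_slice:
  fixes G :: "real \<times> 'a::euclidean_space \<Rightarrow> 'b::real_normed_vector"
  assumes "smooth_around (t, y) G"
  shows "((\<lambda>t. G (t, y)) has_vector_derivative frechet_derivative G (at (t, y)) (1, 0)) (at t)"
proof -
  have d: "((\<lambda>t. (t, y)) has_derivative (\<lambda>h. (h, 0))) (at t)"
    by (rule has_derivative_Pair[OF has_derivative_ident has_derivative_const])
  have l: "frechet_derivative G (at (t, y)) (h, 0) = h *\<^sub>R frechet_derivative G (at (t, y)) (1, 0)" for h
    using linear_scale[OF smooth_around_linear_frechet[OF assms], of h "(1, 0)"] by simp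
  show ?thesis unfolding has_vector_derivative_def
    by (rule has_derivative_eq_rhs[OF has_derivative_compose[OF d smooth_around_has_derivative[OF assms]]]) (rule ext, rule l)
qed

context weights begin

definition graded :: "('n \<Rightarrow> 'n \<Rightarrow> real ^ 'n) \<Rightarrow> bool" where
  "graded c \<longleftrightarrow> (\<forall>i j k. w k \<noteq> w i + w j \<longrightarrow> c i j $ k = 0)"

text \<open>Every bracket with \<open>x\<close> raises the weight by at least \<open>1\<close>, so
  after \<open>m\<close> of them nothing of weight \<open>m\<close> or less is left.\<close>

lemma ad_pow_vanish:
  assumes "graded c"
  shows "w k \<le> m \<Longrightarrow> (algebra_bracket c x ^^ m) v $ k = 0"
proof (induction m arbitrary: k)
  case 0 then show ?case using w_pos[of k] by simp
next
  case (Suc m)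
  let ?u = "(algebra_bracket c x ^^ m) v"
  have "(x $ i * ?u $ j) * c i j $ k = 0" for i j
  proof (cases "w k = w i + w j")
    case True then show ?thesis using Suc w_pos[of i] by simp
  next
    case False then show ?thesis using assms by (simp add: graded_def)
  qed
  then have "algebra_bracket c x ?u $ k = 0"
    unfolding algebra_bracket_def[of c x ?u] by (simp only: sum_component vector_scaleR_component real_scaleR_def sum.neutral_const)
  then show ?case by simp
qed

lemma ad_pow_nilpotent:
  assumes "graded c" "\<And>k. w k \<le> R" "R \<le> m"
  shows "(algebra_bracket c x ^^ m) v = 0"
  using ad_pow_vanish[OF assms(1)] assms(2,3) by (simp add: vec_eq_iff) (meson order_trans)

lemma linear_ad_pow: "linear (algebra_bracket c x ^^ m)"
proof (induction m)
  case (Suc m)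
  show ?case using linear_compose[OF Suc linear_algebra_bracket_right[of c x]] by (simp add: o_def)
qed (simp add: linear_id[unfolded id_def])

lemma linear_combination: "linear (\<lambda>u. combination Y u z)"
  unfolding combination_def by (rule linearI) (simp_all add: algebra_simps sum.distrib scaleR_sum_right)

lemma combination_axis: "combination Y (axis j 1) z = Y j z"
proof -
  have "combination Y (axis j 1) z = (\<Sum>i\<in>UNIV. if i = j then Y i z else 0)"
    unfolding combination_def by (rule sum.cong) (auto simp: axis_def)
  then show ?thesis by simp
qed

text \<open>The series \<open>(1 - e^{-ad x}) / ad x\<close> of the differential of the exponential
  map; cutting it at \<open>R\<close> is exact once the power \<open>R\<close> of
  \<open>ad x\<close> vanishes.\<close>

definition right_log :: "('n \<Rightarrow> 'n \<Rightarrow> real ^ 'n) \<Rightarrow> nat \<Rightarrow> real ^ 'n \<Rightarrow> real ^ 'n \<Rightarrow> real ^ 'n" where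
  "right_log c R x v = (\<Sum>k<R. ((-1) ^ k / fact (Suc k)) *\<^sub>R (algebra_bracket c x ^^ k) v)"

text \<open>Along the curve the derivative \<open>J\<close> of the flow in the direction
  \<open>v\<close> solves the linearised equation. \<open>combination Y (m t)\<close> solves the
  same equation, the bracket relations turning the commutator of the fields into
  \<open>ad x\<close>. The difference \<open>K\<close> then obeys a homogeneous triangular linear
  equation with \<open>K 0 = 0\<close>.\<close>

theorem exp_map_derivative:
  assumes Y: "homogeneous_frame Y" and c: "graded c" and R: "\<And>k. w k \<le> R"
    and br: "\<And>i j z. frechet_derivative (Y j) (at z) (Y i z) - frechet_derivative (Y i) (at z) (Y j z) = combination Y (c i j) z"
  shows "frechet_derivative (exp_map Y) (at x) v = combination Y (right_log c R x v) (exp_map Y x)"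
proof -
  let ?ad = "algebra_bracket c x"
  obtain \<gamma> where \<gamma>: "\<And>p. smooth_around p \<gamma>" "\<And>x. \<gamma> (0, x) = 0"
    "\<And>t x. ((\<lambda>t. \<gamma> (t, x)) has_vector_derivative combination Y x (\<gamma> (t, x))) (at t)"
    by (rule homogeneous_flow[OF Y]) blast
  define J where "J = (\<lambda>t. frechet_derivative \<gamma> (at (t, x)) (0, v))"
  \<comment> \<open>The solution of \<open>m' + ad x m = v\<close>, \<open>m 0 = 0\<close>, in
    closed form; \<open>m 1\<close> is \<open>right_log\<close>.\<close>
  define m where "m = (\<lambda>t. \<Sum>k<R. ((-1) ^ k * t ^ Suc k / fact (Suc k)) *\<^sub>R (?ad ^^ k) v)"
  define m' where "m' = (\<lambda>t. \<Sum>k<R. ((-1) ^ k * t ^ k / fact k) *\<^sub>R (?ad ^^ k) v)"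
  define K where "K = (\<lambda>t. J t - combination Y (m t) (\<gamma> (t, x)))"
  let ?g = "\<lambda>t. \<gamma> (t, x)"
  let ?D = "\<lambda>t u. \<Sum>j\<in>UNIV. x $ j *\<^sub>R frechet_derivative (Y j) (at (?g t)) u"
  note sY = homogeneous_smooth[OF Y]
  note linY = smooth_around_linear_frechet[OF sY]
  have dm: "(m has_vector_derivative m' t) (at t)" for t
  proof -
    have "((\<lambda>t. ((-1) ^ k * t ^ Suc k / fact (Suc k)) *\<^sub>R (?ad ^^ k) v) has_vector_derivative ((-1) ^ k * t ^ k / fact k) *\<^sub>R (?ad ^^ k) v) (at t)" for k
    proof -
      have "((\<lambda>t. (-1) ^ k * t ^ Suc k / fact (Suc k)) has_field_derivative (-1) ^ k * (real (Suc k) * t ^ k) / fact (Suc k)) (at t)"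
        using DERIV_cmult[OF DERIV_pow[of "Suc k" t], of "(-1) ^ k / fact (Suc k)"] by (simp del: fact_Suc of_nat_Suc)
      moreover have "(-1) ^ k * (real (Suc k) * t ^ k) / fact (Suc k) = (-1) ^ k * t ^ k / fact k"
        by (simp add: fact_Suc del: of_nat_Suc)
      ultimately have "((\<lambda>t. (-1) ^ k * t ^ Suc k / fact (Suc k)) has_field_derivative (-1) ^ k * t ^ k / fact k) (at t)" by simp
      from has_vector_derivative_scaleR[OF this has_vector_derivative_const] show ?thesis by simp
    qed
    then show ?thesis unfolding m_def m'_def by (rule has_vector_derivative_sum)
  qed
  have mv: "m' t + algebra_bracket c x (m t) = v" for t
  proof -
    define a where "a = (\<lambda>k. ((-1) ^ k * t ^ k / fact k) *\<^sub>R (?ad ^^ k) v)"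
    have "algebra_bracket c x (m t) = - (\<Sum>k<R. a (Suc k))"
      unfolding m_def linear_sum[OF linear_algebra_bracket_right] linear_scale[OF linear_algebra_bracket_right] a_def
      unfolding sum_negf[symmetric] by (rule sum.cong) (simp_all del: fact_Suc)
    moreover have "m' t = (\<Sum>k<R. a k)" by (simp add: m'_def a_def)
    ultimately have "m' t + algebra_bracket c x (m t) = (\<Sum>k<R. a k - a (Suc k))"
      by (simp add: sum_subtractf)
    \<comment> \<open>The telescoping remainder \<open>a R\<close> contains the power
      \<open>R\<close> of \<open>ad x\<close> and vanishes by nilpotency.\<close>
    also have "\<dots> = a 0 - a R" by (rule sum_lessThan_telescope')
    also have "\<dots> = v" using ad_pow_nilpotent[OF c R order_refl] by (simp add: a_def)
    finally show ?thesis .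
  qed
  have dt: "frechet_derivative \<gamma> (at p) (1, 0) = combination Y (snd p) (\<gamma> p)" for p
  proof -
    obtain t y where p: "p = (t, y)" by (cases p)
    from vector_derivative_unique_at[OF has_vector_derivative_slice[OF \<gamma>(1)] \<gamma>(3)] show ?thesis by (simp add: p)
  qed
  \<comment> \<open>The flow equation \<open>dt\<close> is differentiated in the parameter; the
    mixed second derivatives of \<open>\<gamma>\<close> are exchanged to reach the time derivative
    of \<open>J\<close>.\<close>
  have dJ: "(J has_vector_derivative (combination Y v (?g t) + ?D t (J t))) (at t)" for t
  proof -
    let ?P = "\<lambda>p. frechet_derivative \<gamma> (at p) (0, v)"
    have "(J has_vector_derivative frechet_derivative ?P (at (t, x)) (1, 0)) (at t)"
      unfolding J_def by (rule has_vector_derivative_slice[OF smooth_around_frechet[OF \<gamma>(1)]])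
    moreover have "frechet_derivative ?P (at (t, x)) (1, 0) = frechet_derivative (\<lambda>p. combination Y (snd p) (\<gamma> p)) (at (t, x)) (0, v)"
      using frechet_derivative_commute[OF \<gamma>(1), where u="(0, v)" and v="(1, 0)" and x="(t, x)"] unfolding dt .
    moreover have hd: "((\<lambda>p. combination Y (snd p) (\<gamma> p)) has_derivative
        (\<lambda>h. \<Sum>j\<in>UNIV. x $ j *\<^sub>R frechet_derivative (Y j) (at (?g t)) (frechet_derivative \<gamma> (at (t, x)) h) + snd h $ j *\<^sub>R Y j (?g t))) (at (t, x))"
      unfolding combination_def
    proof (rule has_derivative_sum)
      fix j
      have f1: "((\<lambda>p. snd p $ j) has_derivative (\<lambda>h. snd h $ j)) (at (t, x))"
        by (rule bounded_linear.has_derivative[OF bounded_linear_vec_nth has_derivative_snd[OF has_derivative_ident]])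
      have f2: "((\<lambda>p. Y j (\<gamma> p)) has_derivative (\<lambda>h. frechet_derivative (Y j) (at (?g t)) (frechet_derivative \<gamma> (at (t, x)) h))) (at (t, x))"
        by (rule has_derivative_compose[OF smooth_around_has_derivative[OF \<gamma>(1)] smooth_around_has_derivative[OF sY]])
      show "((\<lambda>p. snd p $ j *\<^sub>R Y j (\<gamma> p)) has_derivative
          (\<lambda>h. x $ j *\<^sub>R frechet_derivative (Y j) (at (?g t)) (frechet_derivative \<gamma> (at (t, x)) h) + snd h $ j *\<^sub>R Y j (?g t))) (at (t, x))"
        using has_derivative_scaleR[OF f1 f2] by simp
    qed
    moreover have "frechet_derivative (\<lambda>p. combination Y (snd p) (\<gamma> p)) (at (t, x)) (0, v) = combination Y v (?g t) + ?D t (J t)"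
      unfolding frechet_derivativeI[OF hd] by (simp add: J_def combination_def sum.distrib add.commute)
    ultimately show ?thesis by simp
  qed
  have dC: "((\<lambda>t. combination Y (m t) (?g t)) has_vector_derivative
      (combination Y (m' t) (?g t) + (\<Sum>j\<in>UNIV. m t $ j *\<^sub>R frechet_derivative (Y j) (at (?g t)) (combination Y x (?g t))))) (at t)" for t
  proof -
    have "((\<lambda>t. m t $ j *\<^sub>R Y j (?g t)) has_vector_derivative
        (m t $ j *\<^sub>R frechet_derivative (Y j) (at (?g t)) (combination Y x (?g t)) + m' t $ j *\<^sub>R Y j (?g t))) (at t)" for j
    proof (rule has_vector_derivative_scaleR)
      show "((\<lambda>t. m t $ j) has_field_derivative m' t $ j) (at t)"
        using bounded_linear.has_vector_derivative[OF bounded_linear_vec_nth dm] by (simp add: has_real_derivative_iff_has_vector_derivative)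
      show "((\<lambda>t. Y j (?g t)) has_vector_derivative frechet_derivative (Y j) (at (?g t)) (combination Y x (?g t))) (at t)"
        using has_derivative_compose[OF \<gamma>(3)[unfolded has_vector_derivative_def] smooth_around_has_derivative[OF sY]]
        by (simp add: has_vector_derivative_def linear_scale[OF linY])
    qed
    then have "((\<lambda>t. combination Y (m t) (?g t)) has_vector_derivative
      (\<Sum>j\<in>UNIV. m t $ j *\<^sub>R frechet_derivative (Y j) (at (?g t)) (combination Y x (?g t)) + m' t $ j *\<^sub>R Y j (?g t))) (at t)"
      unfolding combination_def by (rule has_vector_derivative_sum)
    then show ?thesis by (simp add: combination_def sum.distrib add.commute)
  qed
  \<comment> \<open>Exchanging which of the two fields is differentiated costs their bracket, which
    is \<open>algebra_bracket c x (m t)\<close> by \<open>br\<close>.\<close>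
  have swap: "(\<Sum>j\<in>UNIV. m t $ j *\<^sub>R frechet_derivative (Y j) (at (?g t)) (combination Y x (?g t)))
      = ?D t (combination Y (m t) (?g t)) + combination Y (algebra_bracket c x (m t)) (?g t)" for t
  proof -
    let ?z = "?g t"
    have "(\<Sum>j\<in>UNIV. m t $ j *\<^sub>R frechet_derivative (Y j) (at ?z) (combination Y x ?z))
        = (\<Sum>j\<in>UNIV. \<Sum>i\<in>UNIV. (x $ i * m t $ j) *\<^sub>R frechet_derivative (Y j) (at ?z) (Y i ?z))"
      unfolding combination_def by (simp add: linear_sum[OF linY] linear_scale[OF linY] scaleR_sum_right mult.commute)
    also have "\<dots> = (\<Sum>i\<in>UNIV. \<Sum>j\<in>UNIV. (x $ i * m t $ j) *\<^sub>R frechet_derivative (Y j) (at ?z) (Y i ?z))"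
      by (rule sum.swap)
    also have "\<dots> = (\<Sum>i\<in>UNIV. \<Sum>j\<in>UNIV. (x $ i * m t $ j) *\<^sub>R frechet_derivative (Y i) (at ?z) (Y j ?z) + (x $ i * m t $ j) *\<^sub>R combination Y (c i j) ?z)"
      by (simp add: br[symmetric] algebra_simps)
    also have "\<dots> = ?D t (combination Y (m t) ?z) + (\<Sum>i\<in>UNIV. \<Sum>j\<in>UNIV. (x $ i * m t $ j) *\<^sub>R combination Y (c i j) ?z)"
      by (simp add: sum.distrib combination_def[of _ "m t"] linear_sum[OF linY] linear_scale[OF linY] scaleR_sum_right)
    also have "(\<Sum>i\<in>UNIV. \<Sum>j\<in>UNIV. (x $ i * m t $ j) *\<^sub>R combination Y (c i j) ?z) = combination Y (algebra_bracket c x (m t)) ?z"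
      unfolding algebra_bracket_def by (simp add: linear_sum[OF linear_combination] linear_scale[OF linear_combination])
    finally show ?thesis .
  qed
  have dK: "(K has_vector_derivative ?D t (K t)) (at t)" for t
  proof -
    have "(K has_vector_derivative (combination Y v (?g t) + ?D t (J t) -
        (combination Y (m' t) (?g t) + (?D t (combination Y (m t) (?g t)) + combination Y (algebra_bracket c x (m t)) (?g t))))) (at t)"
      unfolding K_def using has_vector_derivative_diff[OF dJ dC] unfolding swap .
    moreover have "combination Y v (?g t) = combination Y (m' t) (?g t) + combination Y (algebra_bracket c x (m t)) (?g t)"
      by (simp add: mv flip: linear_add[OF linear_combination])
    moreover have "?D t (K t) = ?D t (J t) - ?D t (combination Y (m t) (?g t))"
      unfolding K_def by (simp add: linear_diff[OF linY] scaleR_diff_right sum_subtractf)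
    ultimately show ?thesis by simp
  qed
  have K0: "K 0 = 0"
  proof -
    have "frechet_derivative (\<lambda>y. \<gamma> (0, y)) (at x) v = 0"
      unfolding \<gamma>(2) by (simp add: frechet_derivativeI[OF has_derivative_const])
    then have "J 0 = 0" unfolding J_def using frechet_slice[OF \<gamma>(1)] by simp
    moreover have "m 0 = 0" unfolding m_def by simp
    ultimately show ?thesis unfolding K_def by (simp add: combination_def)
  qed
  \<comment> \<open>Induction on the weight: in component \<open>k\<close> of the right-hand side
    only components of \<open>K\<close> of smaller weight occur.\<close>
  have "\<forall>t\<in>{0..1}. K t $ k = 0" for k
  proof (induction "w k" arbitrary: k rule: less_induct)
    case less
    have "((\<lambda>t. K t $ k) has_vector_derivative 0) (at s within {0..1})" if s: "s \<in> {0..1}" for s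
    proof -
      have "frechet_derivative (Y j) (at (?g s)) (K s) $ k = 0" for j
      proof -
        have "frechet_derivative (Y j) (at (?g s)) (K s) $ k = (\<Sum>i\<in>UNIV. K s $ i * frechet_derivative (Y j) (at (?g s)) (axis i 1) $ k)"
          using arg_cong[OF linear_axis_expand[OF linY, of j "?g s" "K s"], of "\<lambda>u. u $ k"] by simp
        also have "\<dots> = 0"
        proof (rule sum.neutral, rule ballI)
          fix i
          show "K s $ i * frechet_derivative (Y j) (at (?g s)) (axis i 1) $ k = 0"
            using less[of i] s w_pos[of j] homogeneous_triangular[OF Y, of k i j "?g s"] by (cases "w i + w j \<le> w k") auto
        qed
        finally show ?thesis .
      qed
      then have z: "?D s (K s) $ k = 0" by simp
      have "((\<lambda>t. K t $ k) has_vector_derivative ?D s (K s) $ k) (at s within {0..1})"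
        by (rule has_vector_derivative_at_within[OF bounded_linear.has_vector_derivative[OF bounded_linear_vec_nth dK]])
      then show ?thesis unfolding z .
    qed
    then show ?case using vector_derivative_zero_const[of "\<lambda>t. K t $ k"] K0 by fastforce
  qed
  then have "K 1 = 0" by (simp add: vec_eq_iff)
  moreover have "m 1 = right_log c R x v" unfolding m_def right_log_def by simp
  moreover have "exp_map Y = (\<lambda>x. \<gamma> (1, x))" using exp_map_flow[OF Y \<gamma>(2,3)] by auto
  ultimately show ?thesis unfolding K_def J_def using frechet_slice[OF \<gamma>(1), of 1 x v] by simp
qed

definition ad_series :: "(nat \<Rightarrow> real) \<Rightarrow> ('n \<Rightarrow> 'n \<Rightarrow> real ^ 'n) \<Rightarrow> nat \<Rightarrow> real ^ 'n \<Rightarrow> real ^ 'n \<Rightarrow> real ^ 'n" where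
  "ad_series f c R x v = (\<Sum>k<R. f k *\<^sub>R (algebra_bracket c x ^^ k) v)"

text \<open>The condition on \<open>f\<close> says that it is the reciprocal of the series in
  \<open>right_log\<close>. The product of the truncated series reduces to the Cauchy product
  because all terms of total degree \<open>R\<close> or more vanish by nilpotency.\<close>

lemma right_log_ad_series:
  assumes c: "graded c" and R: "\<And>k. w k \<le> R"
    and f: "\<And>k. (\<Sum>i\<le>k. ((-1) ^ i / fact (Suc i)) * f (k - i)) = (if k = 0 then 1 else 0)"
  shows "right_log c R x (ad_series f c R x v) = v"
proof -
  let ?a = "\<lambda>i. ((-1) ^ i / fact (Suc i)) :: real"
  let ?T = "\<lambda>i k. (?a i * f k) *\<^sub>R (algebra_bracket c x ^^ (i + k)) v"
  have R1: "0 < R" using R w_pos by (metis less_le_trans zero_less_one)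
  have "right_log c R x (ad_series f c R x v) = (\<Sum>i<R. \<Sum>k<R. ?T i k)"
    unfolding right_log_def ad_series_def
    by (simp add: linear_sum[OF linear_ad_pow] linear_scale[OF linear_ad_pow] scaleR_sum_right funpow_add del: fact_Suc)
  also have "\<dots> = (\<Sum>(i, k)\<in>{..<R} \<times> {..<R}. ?T i k)" by (simp add: sum.cartesian_product)
  also have "\<dots> = (\<Sum>(i, k)\<in>{(i, k). i + k < R}. ?T i k)"
  proof (rule sum.mono_neutral_right)
    show "\<forall>p\<in>{..<R} \<times> {..<R} - {(i, k). i + k < R}. (case p of (i, k) \<Rightarrow> ?T i k) = 0"
      using ad_pow_nilpotent[OF c R] by (auto simp: not_less) (meson not_le)
  qed auto
  also have "\<dots> = (\<Sum>m<R. \<Sum>i\<le>m. ?T i (m - i))" by (rule sum.triangle_reindex)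
  also have "\<dots> = (\<Sum>m<R. (if m = 0 then 1 else 0) *\<^sub>R (algebra_bracket c x ^^ m) v)"
    by (intro sum.cong refl) (simp add: f[symmetric] scaleR_sum_left del: fact_Suc)
  also have "\<dots> = (\<Sum>m<R. if m = 0 then v else 0)"
    by (intro sum.cong) auto
  also have "\<dots> = v" using R1 by simp
  finally show ?thesis .
qed

text \<open>As \<open>ad (s x)\<close> kills \<open>x\<close>, only the constant term of the series
  survives. It follows that \<open>s x\<close> is an integral curve of the combination with
  coefficients \<open>x\<close>.\<close>

lemma combination_ad_series:
  assumes c: "\<And>i j. c i j = - c j i" and "0 < R" "f 0 = 1"
  shows "combination (\<lambda>j x. ad_series f c R x (axis j 1)) x (s *\<^sub>R x) = x"
proof -
  have z: "(algebra_bracket c (s *\<^sub>R x) ^^ Suc k) x = 0" for k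
  proof (induction k)
    case 0
    show ?case using linear_scale[OF linear_algebra_bracket_left, of c s x x] algebra_bracket_self[OF c] by simp
  next
    case (Suc k)
    then show ?case using linear_0[OF linear_algebra_bracket_right] by simp
  qed
  have lin: "linear (ad_series f c R (s *\<^sub>R x))"
    unfolding ad_series_def by (intro linear_compose_sum linear_compose_scale_right linear_ad_pow ballI)
  have "combination (\<lambda>j x. ad_series f c R x (axis j 1)) x (s *\<^sub>R x) = ad_series f c R (s *\<^sub>R x) x"
    unfolding combination_def using linear_axis_expand[OF lin, of x] by simp
  also have "\<dots> = (\<Sum>k<R. if k = 0 then x else 0)"
    unfolding ad_series_def
  proof (rule sum.cong[OF refl])
    fix k
    show "f k *\<^sub>R (algebra_bracket c (s *\<^sub>R x) ^^ k) x = (if k = 0 then x else 0)"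
      using z[of "k - 1"] assms(3) by (cases k) auto
  qed
  also have "\<dots> = x" using assms(2) by simp
  finally show ?thesis .
qed

end

subsection \<open>The part of the Dynkin series linear in the second factor\<close>

definition compositions :: "nat \<Rightarrow> nat list set" where
  "compositions n = {ps. (\<forall>i\<in>set ps. 1 \<le> i) \<and> sum_list ps = n}"

lemma length_composition: "ps \<in> compositions n \<Longrightarrow> length ps \<le> n"
proof -
  have "(\<forall>i\<in>set ps. 1 \<le> i) \<Longrightarrow> length ps \<le> sum_list ps" by (induction ps) auto
  then show "ps \<in> compositions n \<Longrightarrow> length ps \<le> n" by (auto simp: compositions_def)
qed

lemma finite_compositions: "finite (compositions n)"
proof (rule finite_subset)
  show "compositions n \<subseteq> {ps. set ps \<subseteq> {..n} \<and> length ps \<le> n}"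
    using length_composition member_le_sum_list by (fastforce simp: compositions_def)
qed (simp add: finite_lists_length_le)

definition inverse_facts :: "nat list \<Rightarrow> real" where
  "inverse_facts ps = (\<Prod>i\<leftarrow>ps. 1 / fact i)"

text \<open>A power of \<open>e^X - 1\<close> multiplies out into the ways to write \<open>n\<close>
  as an ordered sum of \<open>j\<close> positive parts; the induction splits off the first
  part.\<close>

lemma power_exp_minus_1_nth:
  "fps_nth ((fps_exp (1::real) - 1) ^ j) n = (\<Sum>ps\<in>{ps\<in>compositions n. length ps = j}. inverse_facts ps)"
proof (induction j arbitrary: n)
  case 0
  have "{ps \<in> compositions n. length ps = 0} = (if n = 0 then {[]} else {})"
    by (auto simp: compositions_def)
  then show ?case by (simp add: inverse_facts_def)
next
  case (Suc j)
  let ?S = "\<lambda>i. {ps \<in> compositions (n - i). length ps = j}"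
  have eq: "{ps \<in> compositions n. length ps = Suc j} = (\<lambda>(i, ps). i # ps) ` (SIGMA i:{1..n}. ?S i)"
  proof (intro set_eqI iffI)
    fix ps assume "ps \<in> {ps \<in> compositions n. length ps = Suc j}"
    then obtain i qs where "ps = i # qs" "1 \<le> i" "\<forall>k\<in>set qs. 1 \<le> k" "i + sum_list qs = n" "length qs = j"
      by (auto simp: compositions_def length_Suc_conv)
    then show "ps \<in> (\<lambda>(i, ps). i # ps) ` (SIGMA i:{1..n}. ?S i)"
      by (intro image_eqI[of _ _ "(i, qs)"]) (auto simp: compositions_def)
  qed (auto simp: compositions_def)
  have "(\<Sum>ps\<in>{ps\<in>compositions n. length ps = Suc j}. inverse_facts ps) = (\<Sum>(i, ps)\<in>(SIGMA i:{1..n}. ?S i). inverse_facts (i # ps))"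
    unfolding eq by (subst sum.reindex) (auto simp: inj_on_def intro!: sum.cong)
  also have "\<dots> = (\<Sum>i\<in>{1..n}. \<Sum>ps\<in>?S i. inverse_facts (i # ps))"
    by (rule sum.Sigma[symmetric]) (simp_all add: finite_compositions)
  also have "\<dots> = (\<Sum>i\<in>{1..n}. 1 / fact i * fps_nth ((fps_exp 1 - 1) ^ j) (n - i))"
    unfolding Suc by (simp add: inverse_facts_def sum_distrib_left)
  also have "\<dots> = (\<Sum>i\<in>{0..n}. fps_nth (fps_exp 1 - 1) i * fps_nth ((fps_exp 1 - 1) ^ j) (n - i))"
  proof (rule sum.mono_neutral_cong_left)
    show "\<forall>i\<in>{0..n} - {1..n}. fps_nth (fps_exp (1::real) - 1) i * fps_nth ((fps_exp 1 - 1) ^ j) (n - i) = 0"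
    proof
      fix i assume "i \<in> {0..n} - {1..n}"
      then have "i = 0" by (cases i) auto
      then show "fps_nth (fps_exp (1::real) - 1) i * fps_nth ((fps_exp 1 - 1) ^ j) (n - i) = 0" by simp
    qed
  qed auto
  finally show ?case by (simp add: fps_mult_nth)
qed

text \<open>The exponents of \<open>x\<close> in a word of Dynkin's series up to its single
  \<open>y\<close>: \<open>ps\<close> lists the blocks before it, which are non-empty and hence have
  positive exponents, and \<open>p\<close> is the exponent in the block of \<open>y\<close>, where
  it may be \<open>0\<close>.\<close>

definition split_compositions :: "nat \<Rightarrow> (nat list \<times> nat) set" where
  "split_compositions n = {(ps, p). (\<forall>i\<in>set ps. 1 \<le> i) \<and> sum_list ps + p = n}"

definition word_coefficient :: "(nat \<Rightarrow> real) \<Rightarrow> nat \<Rightarrow> real" where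
  "word_coefficient h n = (\<Sum>(ps, p)\<in>split_compositions n. h (length ps) * inverse_facts ps / fact p)"

lemma split_compositions_Sigma: "split_compositions n = (\<lambda>(p, ps). (ps, p)) ` (SIGMA p:{..n}. compositions (n - p))"
  by (auto simp: split_compositions_def compositions_def image_iff)

lemma finite_split_compositions: "finite (split_compositions n)"
  unfolding split_compositions_Sigma by (intro finite_imageI finite_SigmaI) (simp_all add: finite_compositions)

text \<open>Summing over the blocks before \<open>y\<close> gives powers of \<open>e^X - 1\<close>,
  weighted by \<open>h\<close> through their number and hence a composition; the free exponent
  \<open>p\<close> contributes the factor \<open>e^X\<close>.\<close>

lemma fps_word_coefficient:
  "Abs_fps (word_coefficient h) = (Abs_fps h oo (fps_exp 1 - 1)) * fps_exp 1"
proof (rule fps_ext)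
  fix n
  have nth: "fps_nth (Abs_fps h oo (fps_exp 1 - 1)) m = (\<Sum>ps\<in>compositions m. h (length ps) * inverse_facts ps)" for m
  proof -
    have "fps_nth (Abs_fps h oo (fps_exp 1 - 1)) m = (\<Sum>j\<in>{0..m}. \<Sum>ps\<in>{ps\<in>compositions m. length ps = j}. h (length ps) * inverse_facts ps)"
      unfolding fps_compose_nth power_exp_minus_1_nth by (simp add: sum_distrib_left)
    also have "\<dots> = (\<Sum>ps\<in>compositions m. h (length ps) * inverse_facts ps)"
      by (rule sum.group) (auto simp: finite_compositions length_composition)
    finally show ?thesis .
  qed
  have "word_coefficient h n = (\<Sum>(p, ps)\<in>(SIGMA p:{..n}. compositions (n - p)). h (length ps) * inverse_facts ps / fact p)"
    unfolding word_coefficient_def split_compositions_Sigma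
    by (subst sum.reindex) (auto simp: inj_on_def intro!: sum.cong)
  also have "\<dots> = (\<Sum>p\<le>n. \<Sum>ps\<in>compositions (n - p). h (length ps) * inverse_facts ps / fact p)"
    by (rule sum.Sigma[symmetric]) (simp_all add: finite_compositions)
  also have "\<dots> = (\<Sum>p\<in>{0..n}. fps_nth (fps_exp 1) p * fps_nth (Abs_fps h oo (fps_exp 1 - 1)) (n - p))"
    unfolding nth by (simp add: sum_divide_distrib atMost_atLeast0)
  finally show "fps_nth (Abs_fps (word_coefficient h)) n = fps_nth ((Abs_fps h oo (fps_exp 1 - 1)) * fps_exp 1) n"
    by (simp add: fps_mult_nth mult.commute[of _ "fps_exp 1"])
qed

text \<open>The coefficient of \<open>(ad x)^m y\<close> in the part of Dynkin's series that is linear in \<open>y\<close>: the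
  first summand collects the words \<open>x^m y\<close>, the second one the words \<open>x^(m-1) y x\<close>.\<close>

definition dynkin_coefficient :: "nat \<Rightarrow> real" where
  "dynkin_coefficient m =
     (word_coefficient (\<lambda>j. (-1) ^ j / real (j + 1)) m -
      (if m = 0 then 0 else word_coefficient (\<lambda>j. (-1) ^ Suc j / real (j + 2)) (m - 1))) / real (m + 1)"

text \<open>The reciprocal of \<open>(1 - e^{-X}) / X\<close> is \<open>X e^X / (e^X - 1)\<close>.
  With \<open>u = e^X - 1\<close> and the logarithm series \<open>a = X / u\<close> this is
  \<open>a e^X\<close>, and the point is that the generating function \<open>f\<close> of the
  coefficients equals it.\<close>

theorem dynkin_coefficient_inverse:
  "(\<Sum>i\<le>k. ((-1) ^ i / fact (Suc i)) * dynkin_coefficient (k - i)) = (if k = 0 then 1 else 0)"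
proof -
  define E :: "real fps" where "E = fps_exp 1"
  define E' :: "real fps" where "E' = fps_exp (-1)"
  define u where "u = E - 1"
  \<comment> \<open>\<open>hA\<close> is the coefficient sequence of \<open>ln (1 + u) / u\<close>,
    and \<open>hB\<close> that of \<open>(ln (1 + u) / u - 1) / u\<close>. They are the factors
    \<open>(-1)^(l-1) / l\<close> of Dynkin's series for words with \<open>l = j + 1\<close> and
    \<open>l = j + 2\<close> blocks.\<close>
  define hA where "hA = (\<lambda>j::nat. (-1) ^ j / real (j + 1))"
  define hB where "hB = (\<lambda>j::nat. (-1) ^ Suc j / real (j + 2))"
  define a where "a = Abs_fps hA oo u"
  define b where "b = Abs_fps hB oo u"
  have u0: "fps_nth u 0 = 0" by (simp add: u_def E_def)
  have u1: "fps_nth u 1 \<noteq> 0" by (simp add: u_def E_def)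
  then have un: "u \<noteq> 0" by auto
  have EE: "E * E' = 1" unfolding E_def E'_def using fps_exp_add_mult[of 1 "-1::real"] by simp
  have XA: "fps_X * Abs_fps hA = fps_ln 1"
    by (rule fps_ext) (auto simp: fps_ln_nth hA_def)
  have XB: "fps_X * Abs_fps hB = Abs_fps hA - 1"
  proof (rule fps_ext)
    fix n show "fps_nth (fps_X * Abs_fps hB) n = fps_nth (Abs_fps hA - 1) n"
      by (cases n) (simp_all add: hA_def hB_def)
  qed
  have ua: "u * a = fps_X"
  proof -
    have "u * a = (fps_X * Abs_fps hA) oo u" unfolding a_def fps_compose_mult_distrib[OF u0] using u0 by simp
    also have "\<dots> = fps_inv u oo u" unfolding XA u_def E_def by (simp add: fps_ln_fps_exp_inv)
    also have "\<dots> = fps_X" by (rule fps_inv[OF u0 u1])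
    finally show ?thesis .
  qed
  have ub: "u * b = a - 1"
  proof -
    have "u * b = (fps_X * Abs_fps hB) oo u" unfolding b_def fps_compose_mult_distrib[OF u0] using u0 by simp
    also have "\<dots> = a - 1" unfolding XB a_def by (simp add: fps_compose_sub_distrib)
    finally show ?thesis .
  qed
  have dE: "fps_deriv E = E" by (simp add: E_def)
  define f where "f = Abs_fps dynkin_coefficient"
  define G where "G = a * E"
  \<comment> \<open>Multiplying by \<open>X\<close> and differentiating clears the factor
    \<open>1 / (m + 1)\<close>, the reciprocal word length, from the coefficients.\<close>
  have df: "fps_deriv (fps_X * f) = a * E - fps_X * (b * E)"
  proof (rule fps_ext)
    fix n
    have "fps_nth (a * E) n = word_coefficient hA n" "fps_nth (b * E) m = word_coefficient hB m" for m
      using fps_word_coefficient[of hA] fps_word_coefficient[of hB]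
      unfolding a_def b_def u_def E_def by (metis fps_nth_Abs_fps)+
    moreover have "fps_nth (fps_deriv (fps_X * f)) n = real (n + 1) * dynkin_coefficient n"
      by (simp add: f_def algebra_simps)
    moreover have "real (n + 1) * dynkin_coefficient n = word_coefficient hA n - (if n = 0 then 0 else word_coefficient hB (n - 1))"
      unfolding dynkin_coefficient_def hA_def hB_def by (simp del: of_nat_Suc)
    ultimately show "fps_nth (fps_deriv (fps_X * f)) n = fps_nth (a * E - fps_X * (b * E)) n"
      by simp
  qed
  have da: "E * a + u * fps_deriv a = 1"
  proof -
    have "fps_deriv (u * a) = 1" unfolding ua by simp
    then show ?thesis by (simp add: u_def dE algebra_simps)
  qed
  \<comment> \<open>Comes from differentiating \<open>u * a = X\<close> with
    \<open>u' = u + 1\<close>. It makes \<open>a E - X b E\<close> the derivative of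
    \<open>X a E\<close>, so that \<open>f = a E\<close>.\<close>
  have "fps_deriv a + a = - b"
  proof -
    have *: "u * (fps_deriv a + a) = u * (- b)" using da ub by (simp add: u_def algebra_simps)
    show ?thesis by (rule iffD1[OF mult_left_cancel[OF un] *])
  qed
  then have bb: "b = - (fps_deriv a + a)" by simp
  have "fps_deriv (fps_X * f) = fps_deriv (fps_X * G)"
    unfolding df G_def by (subst bb) (simp add: dE algebra_simps)
  then have "fps_X * f = fps_X * G" unfolding fps_deriv_eq_iff by simp
  then have fG: "f = G" by simp
  define M where "M = Abs_fps (\<lambda>i. (-1) ^ i / fact (Suc i) :: real)"
  have XM: "fps_X * M = 1 - E'"
  proof (rule fps_ext)
    fix n show "fps_nth (fps_X * M) n = fps_nth (1 - E') n"
      by (cases n) (simp_all add: M_def E'_def del: fact_Suc)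
  qed
  have "fps_X * (M * f) = fps_X * 1"
  proof -
    have "fps_X * (M * f) = (1 - E') * (a * E)" unfolding fG G_def XM[symmetric] by (simp add: mult.assoc)
    also have "\<dots> = a * (E - E * E')" by (simp add: algebra_simps)
    also have "\<dots> = fps_X" unfolding EE using ua by (simp add: u_def mult.commute)
    finally show ?thesis by simp
  qed
  then have "M * f = 1" by simp
  then have "fps_nth (M * f) k = fps_nth 1 k" by simp
  then show ?thesis by (simp add: fps_mult_nth M_def f_def atMost_atLeast0 del: fact_Suc)
qed

lemma dynkin_coefficient_0: "dynkin_coefficient 0 = 1"
  using dynkin_coefficient_inverse[of 0] by simp

text \<open>\<open>True\<close> marks the places of \<open>y\<close>. Separating the shape of a word
  from its letters makes it possible to differentiate in \<open>y\<close> by counting the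
  marks.\<close>

definition pattern_bracket :: "('v \<Rightarrow> 'v \<Rightarrow> 'v) \<Rightarrow> 'v \<Rightarrow> 'v \<Rightarrow> bool list \<Rightarrow> 'v::real_normed_vector" where
  "pattern_bracket br x y bs = iterated_bracket br (map (\<lambda>b. if b then y else x) bs)"

lemma pattern_bracket_Cons:
  "bs \<noteq> [] \<Longrightarrow> pattern_bracket br x y (b # bs) = br (if b then y else x) (pattern_bracket br x y bs)"
  by (cases bs) (simp_all add: pattern_bracket_def)

lemma pattern_bracket_zero:
  assumes "bounded_bilinear br" "True \<in> set bs" shows "pattern_bracket br x 0 bs = 0"
  using assms(2)
proof (induction bs)
  case (Cons b bs)
  interpret bounded_bilinear br by fact
  show ?case
  proof (cases "bs = []")
    case True then show ?thesis using Cons by (simp add: pattern_bracket_def)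
  next
    case False then show ?thesis using Cons by (auto simp: pattern_bracket_Cons zero_left zero_right)
  qed
qed simp

lemma pattern_bracket_const: "True \<notin> set bs \<Longrightarrow> pattern_bracket br x y bs = pattern_bracket br x z bs"
  unfolding pattern_bracket_def by (rule arg_cong[of _ _ "iterated_bracket br"]) auto

text \<open>The bracket is multilinear in its letters, hence homogeneous in \<open>y\<close> of
  degree the number of marks; only words of degree \<open>1\<close> have a derivative at
  \<open>y = 0\<close> that is not identically \<open>0\<close>.\<close>

lemma pattern_bracket_derivative:
  assumes "bounded_bilinear br"
  shows "((\<lambda>y. pattern_bracket br x y bs) has_derivative
    (\<lambda>v. if count_list bs True = 1 then pattern_bracket br x v bs else 0)) (at 0)"
proof (induction bs)
  case Nil then show ?case by (simp add: pattern_bracket_def)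
next
  case (Cons b bs)
  interpret bounded_bilinear br by fact
  show ?case
  proof (cases "bs = []")
    case True then show ?thesis by (cases b) (simp_all add: pattern_bracket_def)
  next
    case False
    show ?thesis
    proof (cases b)
      case True
      have "((\<lambda>y. br y (pattern_bracket br x y bs)) has_derivative
         (\<lambda>v. br 0 (if count_list bs True = 1 then pattern_bracket br x v bs else 0) + br v (pattern_bracket br x 0 bs))) (at 0)"
        by (rule FDERIV[OF has_derivative_ident Cons])
      moreover have "br 0 (if count_list bs True = 1 then pattern_bracket br x v bs else 0) + br v (pattern_bracket br x 0 bs)
          = (if count_list bs True = 0 then br v (pattern_bracket br x v bs) else 0)" for v
        using pattern_bracket_zero[OF assms, of bs x] pattern_bracket_const[of bs br x 0 v]
        by (auto simp: zero_left zero_right count_list_0_iff)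
      ultimately show ?thesis using True False by (simp add: pattern_bracket_Cons cong: if_cong)
    next
      case b: False
      have "((\<lambda>y. br x (pattern_bracket br x y bs)) has_derivative
         (\<lambda>v. br x (if count_list bs True = 1 then pattern_bracket br x v bs else 0))) (at 0)"
        by (rule bounded_linear.has_derivative[OF bounded_linear_right Cons])
      moreover have "br x (if count_list bs True = 1 then pattern_bracket br x v bs else 0)
          = (if count_list bs True = 1 then br x (pattern_bracket br x v bs) else 0)" for v
        by (simp add: zero_right)
      ultimately show ?thesis using b False by (simp add: pattern_bracket_Cons cong: if_cong)
    qed
  qed
qed

text \<open>A tail of two or more letters \<open>x\<close> ends in \<open>[x, x] = 0\<close>. A tail
  consisting of a single \<open>x\<close> need not vanish, which is why words \<open>x^n y x\<close>
  also count.\<close>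

lemma pattern_bracket_replicate:
  assumes "bounded_bilinear br" "br x x = 0"
  shows "bs \<noteq> [] \<Longrightarrow> pattern_bracket br x y (replicate n False @ bs) = (br x ^^ n) (pattern_bracket br x y bs)"
    and "pattern_bracket br x y (replicate (Suc (Suc n)) False) = 0"
proof -
  interpret bounded_bilinear br by fact
  show 1: "bs \<noteq> [] \<Longrightarrow> pattern_bracket br x y (replicate n False @ bs) = (br x ^^ n) (pattern_bracket br x y bs)" for n bs
    by (induction n) (simp_all add: pattern_bracket_Cons)
  have "(br x ^^ n) 0 = 0" by (induction n) (simp_all add: zero_right)
  moreover have "replicate (Suc (Suc n)) False = replicate n False @ [False, False]"
    by (metis replicate_Suc replicate_0 replicate_append_same append.assoc append_Cons append_Nil)
  ultimately show "pattern_bracket br x y (replicate (Suc (Suc n)) False) = 0"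
    using 1[of "[False, False]" n] assms(2) by (simp add: pattern_bracket_def)
qed

definition dynkin_words :: "nat \<Rightarrow> (nat \<times> nat) list set" where
  "dynkin_words r = {s. s \<noteq> [] \<and> (\<forall>(p, q)\<in>set s. 0 < p + q) \<and> (\<Sum>(p, q)\<leftarrow>s. p + q) \<le> r}"

definition dynkin_weight :: "(nat \<times> nat) list \<Rightarrow> real" where
  "dynkin_weight s = (-1) ^ (length s - 1) /
     (real (length s) * real (\<Sum>(p, q)\<leftarrow>s. p + q) * (\<Prod>(p, q)\<leftarrow>s. fact p * fact q))"

definition dynkin_pattern :: "(nat \<times> nat) list \<Rightarrow> bool list" where
  "dynkin_pattern s = concat (map (\<lambda>(p, q). replicate p False @ replicate q True) s)"

lemma dynkin_product_pattern:
  "dynkin_product br r x y = (\<Sum>s\<in>dynkin_words r. dynkin_weight s *\<^sub>R pattern_bracket br x y (dynkin_pattern s))"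
proof -
  have "map (\<lambda>b. if b then y else x) (dynkin_pattern s) = concat (map (\<lambda>(p, q). replicate p x @ replicate q y) s)" for s
    by (induction s) (auto simp: dynkin_pattern_def)
  then show ?thesis
    unfolding dynkin_product_def dynkin_words_def dynkin_weight_def pattern_bracket_def by simp
qed

lemma finite_dynkin_words: "finite (dynkin_words r)"
proof (rule finite_subset)
  have len: "(\<forall>(p, q)\<in>set s. 0 < p + q) \<Longrightarrow> length s \<le> (\<Sum>(p, q)\<leftarrow>s. p + q)" for s :: "(nat \<times> nat) list"
    by (induction s) auto
  have el: "(p, q) \<in> set s \<Longrightarrow> p + q \<le> (\<Sum>(p, q)\<leftarrow>s. p + q)" for p q and s :: "(nat \<times> nat) list"
    by (induction s) auto
  show "dynkin_words r \<subseteq> {s. set s \<subseteq> {..r} \<times> {..r} \<and> length s \<le> r}"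
  proof
    fix s assume "s \<in> dynkin_words r"
    then have s: "\<forall>(p, q)\<in>set s. 0 < p + q" "(\<Sum>(p, q)\<leftarrow>s. p + q) \<le> r" by (auto simp: dynkin_words_def)
    then show "s \<in> {s. set s \<subseteq> {..r} \<times> {..r} \<and> length s \<le> r}"
      using len[OF s(1)] el[of _ _ s] by fastforce
  qed
qed (simp add: finite_lists_length_le)

abbreviation pure_x :: "nat list \<Rightarrow> (nat \<times> nat) list" where
  "pure_x ps \<equiv> map (\<lambda>i. (i, 0)) ps"

lemma dynkin_pattern_append: "dynkin_pattern (s @ t) = dynkin_pattern s @ dynkin_pattern t"
  by (simp add: dynkin_pattern_def)

lemma dynkin_pattern_Cons: "dynkin_pattern ((p, q) # t) = replicate p False @ replicate q True @ dynkin_pattern t"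
  by (simp add: dynkin_pattern_def)

lemma dynkin_pattern_pure: "dynkin_pattern (pure_x ps) = replicate (sum_list ps) False"
  by (induction ps) (simp_all add: dynkin_pattern_def replicate_add)

lemma linear_word_form:
  assumes "\<forall>(p, q)\<in>set s. 0 < p + q" "count_list (dynkin_pattern s) True = 1"
  obtains ps p qs where "s = pure_x ps @ (p, 1) # pure_x qs" "\<forall>i\<in>set ps. 1 \<le> i" "\<forall>i\<in>set qs. 1 \<le> i"
proof -
  have rep: "count_list (replicate n b) True = (if b then n else 0)" for n b by (induction n) auto
  have pure: "\<exists>qs. s = pure_x qs \<and> (\<forall>i\<in>set qs. 1 \<le> i)"
    if "\<forall>(p, q)\<in>set s. 0 < p + q" "count_list (dynkin_pattern s) True = 0" for s :: "(nat \<times> nat) list"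
    using that
  proof (induction s)
    case (Cons pq s)
    obtain p q where pq: "pq = (p, q)" by (cases pq)
    have q: "q = 0" and "count_list (dynkin_pattern s) True = 0" using Cons.prems by (simp_all add: pq dynkin_pattern_Cons rep)
    then obtain qs where "s = pure_x qs" "\<forall>i\<in>set qs. 1 \<le> i" using Cons by auto
    then show ?case using Cons.prems pq q by (intro exI[of _ "p # qs"]) auto
  qed simp
  have "\<exists>ps p qs. s = pure_x ps @ (p, 1) # pure_x qs \<and> (\<forall>i\<in>set ps. 1 \<le> i) \<and> (\<forall>i\<in>set qs. 1 \<le> i)"
    using assms
  proof (induction s)
    case Nil then show ?case by (simp add: dynkin_pattern_def)
  next
    case (Cons pq s)
    obtain p q where pq: "pq = (p, q)" by (cases pq)
    have c: "q + count_list (dynkin_pattern s) True = 1" using Cons.prems by (simp add: pq dynkin_pattern_Cons rep)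
    show ?case
    proof (cases "q = 0")
      case True
      then obtain ps p' qs where "s = pure_x ps @ (p', 1) # pure_x qs" "\<forall>i\<in>set ps. 1 \<le> i" "\<forall>i\<in>set qs. 1 \<le> i"
        using Cons c by auto
      then show ?thesis using Cons.prems pq True by (intro exI[of _ "p # ps"] exI[of _ p'] exI[of _ qs]) auto
    next
      case False
      then have "q = 1" "count_list (dynkin_pattern s) True = 0" using c by auto
      then obtain qs where "s = pure_x qs" "\<forall>i\<in>set qs. 1 \<le> i" using pure[of s] Cons.prems by auto
      then show ?thesis using pq \<open>q = 1\<close> by (intro exI[of _ "[]"] exI[of _ p] exI[of _ qs]) auto
    qed
  qed
  then show thesis using that by blast
qed

lemma pure_x_sum: "(\<Sum>(p, q)\<leftarrow>pure_x ps @ t. p + q) = sum_list ps + (\<Sum>(p, q)\<leftarrow>t. p + q)"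
  and pure_x_prod: "(\<Prod>(p, q)\<leftarrow>pure_x ps @ t. fact p * fact q) = (\<Prod>(p, q)\<leftarrow>t. fact p * fact q) / inverse_facts ps"
  by (induction ps) (simp_all add: inverse_facts_def)

lemma pure_x_split: "pure_x ps @ (p, 1) # t = pure_x ps' @ (p', 1) # t' \<Longrightarrow> ps = ps' \<and> p = p' \<and> t = t'"
proof (induction ps arbitrary: ps')
  case Nil then show ?case by (cases ps') auto
next
  case (Cons i ps) then show ?case by (cases ps') auto
qed

text \<open>Only words with a single \<open>y\<close> survive differentiation at \<open>0\<close>,
  and of these only the ones in which at most one \<open>x\<close> follows \<open>y\<close>. The
  words \<open>x^n y\<close> give \<open>(ad x)^n\<close>, the words \<open>x^n y x\<close> give
  \<open>- (ad x)^(n+1)\<close>, and adding the two families produces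
  \<open>dynkin_coefficient\<close>.\<close>

theorem dynkin_product_derivative:
  fixes br :: "'v::real_normed_vector \<Rightarrow> 'v \<Rightarrow> 'v"
  assumes br: "bounded_bilinear br" and anti: "\<And>u v. br u v = - br v u"
  shows "((\<lambda>y. dynkin_product br r x y) has_derivative
    (\<lambda>v. \<Sum>k<r. dynkin_coefficient k *\<^sub>R (br x ^^ k) v)) (at 0)"
proof -
  interpret bounded_bilinear br by fact
  have self: "br x x = 0" using anti[of x x] by (simp add: eq_neg_iff_add_eq_0 flip: scaleR_2)
  define T where "T = (\<lambda>v s. dynkin_weight s *\<^sub>R (if count_list (dynkin_pattern s) True = 1 then pattern_bracket br x v (dynkin_pattern s) else 0))"
  have "((\<lambda>y. dynkin_product br r x y) has_derivative (\<lambda>v. \<Sum>s\<in>dynkin_words r. T v s)) (at 0)"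
    unfolding dynkin_product_pattern T_def
    by (intro has_derivative_sum has_derivative_scaleR_right pattern_bracket_derivative br)
  moreover have "(\<Sum>s\<in>dynkin_words r. T v s) = (\<Sum>k<r. dynkin_coefficient k *\<^sub>R (br x ^^ k) v)" for v
  proof -
    \<comment> \<open>The triples carry the number \<open>n\<close> of letters \<open>x\<close> in
      front of \<open>y\<close>, so that the sum over words can be grouped by degree.
      \<open>hA\<close> lists the words \<open>x^n y\<close>, \<open>hB\<close> the words
      \<open>x^n y x\<close>; as these have \<open>n + 1\<close> and \<open>n + 2\<close> letters,
      \<open>n\<close> runs below \<open>r\<close> and below \<open>r - 1\<close>.\<close>
    define hA where "hA = (\<lambda>(n::nat, ps, p::nat). pure_x ps @ [(p, 1)])"
    define hB where "hB = (\<lambda>(n::nat, ps, p::nat). pure_x ps @ [(p, 1), (1, 0)])"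
    define PA where "PA = (SIGMA n:{..<r}. split_compositions n)"
    define PB where "PB = (SIGMA n:{..<r - 1}. split_compositions n)"
    have injA: "inj_on hA PA"
      by (auto simp: inj_on_def hA_def PA_def split_compositions_def dest!: pure_x_split[where t="[]" and t'="[]", simplified])
    have injB: "inj_on hB PB"
      by (auto simp: inj_on_def hB_def PB_def split_compositions_def dest!: pure_x_split[where t="[(1, 0)]" and t'="[(1, 0)]", simplified])
    have disj: "hA ` PA \<inter> hB ` PB = {}"
    proof (rule ccontr)
      assume "hA ` PA \<inter> hB ` PB \<noteq> {}"
      then obtain ps p ps' p' where "pure_x ps @ [(p, 1)] = pure_x ps' @ [(p', 1), (1, 0)]"
        by (auto simp: hA_def hB_def)
      from pure_x_split[OF this] show False by simp
    qed
    have sub: "hA ` PA \<union> hB ` PB \<subseteq> dynkin_words r"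
      by (auto simp: hA_def hB_def PA_def PB_def split_compositions_def dynkin_words_def o_def Suc_le_eq)
    have patA: "dynkin_pattern (pure_x ps @ [(p, 1)]) = replicate (sum_list ps + p) False @ [True]" for ps p
      by (simp add: dynkin_pattern_append dynkin_pattern_Cons dynkin_pattern_pure replicate_add) (simp add: dynkin_pattern_def)
    have patG: "dynkin_pattern (pure_x ps @ (p, 1) # pure_x qs) = replicate (sum_list ps + p) False @ True # replicate (sum_list qs) False" for ps p qs
      by (simp add: dynkin_pattern_append dynkin_pattern_Cons dynkin_pattern_pure replicate_add)
    have patB: "dynkin_pattern (pure_x ps @ [(p, 1), (1, 0)]) = replicate (sum_list ps + p) False @ [True, False]" for ps p
      using patG[of ps p "[1]"] by simp
    have rep: "count_list (replicate n False) True = 0" for n by (induction n) auto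
    have "T v s = 0" if s: "s \<in> dynkin_words r" "s \<notin> hA ` PA \<union> hB ` PB" for s
    proof (cases "count_list (dynkin_pattern s) True = 1")
      case False then show ?thesis by (simp add: T_def)
    next
      case True
      obtain ps p qs where f: "s = pure_x ps @ (p, 1) # pure_x qs" "\<forall>i\<in>set ps. 1 \<le> i" "\<forall>i\<in>set qs. 1 \<le> i"
        by (rule linear_word_form[OF _ True]) (use s(1) in \<open>auto simp: dynkin_words_def\<close>)
      have le: "sum_list ps + p + 1 + sum_list qs \<le> r" using s(1) by (simp add: f(1) dynkin_words_def o_def)
      have "qs \<noteq> []"
      proof
        assume "qs = []"
        then have "s = hA (sum_list ps + p, ps, p)" "(sum_list ps + p, ps, p) \<in> PA"
          using f le by (auto simp: hA_def PA_def split_compositions_def)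
        then show False using s(2) by blast
      qed
      moreover have "sum_list qs \<noteq> 1"
      proof
        assume 1: "sum_list qs = 1"
        then obtain i qs' where qs: "qs = i # qs'" using \<open>qs \<noteq> []\<close> by (cases qs) auto
        have "1 \<le> i" "i + sum_list qs' = 1" using f(3) 1 qs by simp_all
        then have "i = 1" "sum_list qs' = 0" by linarith+
        moreover have "qs' = []" using \<open>sum_list qs' = 0\<close> f(3) qs by (cases qs') auto
        ultimately have "s = hB (sum_list ps + p, ps, p)" "(sum_list ps + p, ps, p) \<in> PB"
          using f le qs by (auto simp: hB_def PB_def split_compositions_def)
        then show False using s(2) by blast
      qed
      moreover have "sum_list qs \<noteq> 0" using \<open>qs \<noteq> []\<close> f(3) by (cases qs) auto
      ultimately obtain m where m: "sum_list qs = Suc (Suc m)" by (metis One_nat_def not0_implies_Suc)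
      have z: "pattern_bracket br x v (True # replicate (Suc (Suc m)) False) = 0"
        using pattern_bracket_replicate(2)[OF br self, of v m] by (subst pattern_bracket_Cons) (simp_all add: zero_right)
      have ad0: "(br x ^^ N) 0 = 0" for N by (induction N) (simp_all add: zero_right)
      have "pattern_bracket br x v (replicate N False @ True # replicate (Suc (Suc m)) False) = 0" for N
        using pattern_bracket_replicate(1)[OF br self, of "True # replicate (Suc (Suc m)) False" v N] unfolding z ad0 by simp
      then have "pattern_bracket br x v (dynkin_pattern s) = 0" unfolding f(1) patG m .
      then show ?thesis by (simp add: T_def)
    qed
    then have "(\<Sum>s\<in>dynkin_words r. T v s) = (\<Sum>s\<in>hA ` PA \<union> hB ` PB. T v s)"
      by (intro sum.mono_neutral_right finite_dynkin_words sub) auto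
    also have "\<dots> = (\<Sum>s\<in>hA ` PA. T v s) + (\<Sum>s\<in>hB ` PB. T v s)"
      using finite_subset[OF sub finite_dynkin_words] disj by (intro sum.union_disjoint) auto
    also have "(\<Sum>s\<in>hA ` PA. T v s) = (\<Sum>n<r. (word_coefficient (\<lambda>j. (-1) ^ j / real (j + 1)) n / real (n + 1)) *\<^sub>R (br x ^^ n) v)"
    proof -
      have TA: "T v (hA (n, ps, p)) = (((-1) ^ length ps / real (length ps + 1) * inverse_facts ps / fact p) / real (n + 1)) *\<^sub>R (br x ^^ n) v"
        if "(ps, p) \<in> split_compositions n" for n ps p
      proof -
        have n: "sum_list ps + p = n" using that by (simp add: split_compositions_def)
        have "pattern_bracket br x v (replicate n False @ [True]) = (br x ^^ n) v"
          using pattern_bracket_replicate(1)[OF br self, of "[True]" v n] by (simp add: pattern_bracket_def)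
        moreover have "dynkin_weight (pure_x ps @ [(p, 1)]) = ((-1) ^ length ps / real (length ps + 1) * inverse_facts ps / fact p) / real (n + 1)"
          unfolding dynkin_weight_def pure_x_sum pure_x_prod using n by (simp add: mult_ac add_ac)
        ultimately show ?thesis unfolding T_def hA_def prod.case patA n by (simp add: rep)
      qed
      have "(\<Sum>s\<in>hA ` PA. T v s) = (\<Sum>(n, pp)\<in>PA. T v (hA (n, pp)))"
        by (subst sum.reindex[OF injA]) (auto intro!: sum.cong)
      also have "\<dots> = (\<Sum>n<r. \<Sum>pp\<in>split_compositions n. T v (hA (n, pp)))"
        unfolding PA_def by (rule sum.Sigma[symmetric]) (simp_all add: finite_split_compositions)
      also have "\<dots> = (\<Sum>n<r. (word_coefficient (\<lambda>j. (-1) ^ j / real (j + 1)) n / real (n + 1)) *\<^sub>R (br x ^^ n) v)"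
        unfolding word_coefficient_def sum_divide_distrib scaleR_sum_left
        by (intro sum.cong refl) (auto simp: TA simp del: of_nat_Suc of_nat_add)
      finally show ?thesis .
    qed
    also have "(\<Sum>s\<in>hB ` PB. T v s) = (\<Sum>n<r - 1. - ((word_coefficient (\<lambda>j. (-1) ^ Suc j / real (j + 2)) n / real (n + 2)) *\<^sub>R (br x ^^ Suc n) v))"
    proof -
      have TB: "T v (hB (n, ps, p)) = - ((((-1) ^ Suc (length ps) / real (length ps + 2) * inverse_facts ps / fact p) / real (n + 2)) *\<^sub>R (br x ^^ Suc n) v)"
        if "(ps, p) \<in> split_compositions n" for n ps p
      proof -
        have n: "sum_list ps + p = n" using that by (simp add: split_compositions_def)
        have "(br x ^^ n) (- u) = - (br x ^^ n) u" for u by (induction n) (simp_all add: minus_right)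
        then have "pattern_bracket br x v (replicate n False @ [True, False]) = - (br x ^^ Suc n) v"
          using pattern_bracket_replicate(1)[OF br self, of "[True, False]" v n] anti[of v x]
          by (simp add: pattern_bracket_def funpow_swap1)
        moreover have "dynkin_weight (pure_x ps @ [(p, 1), (1, 0)]) = ((-1) ^ Suc (length ps) / real (length ps + 2) * inverse_facts ps / fact p) / real (n + 2)"
          unfolding dynkin_weight_def pure_x_sum pure_x_prod using n by (simp add: mult_ac add_ac)
        ultimately show ?thesis unfolding T_def hB_def prod.case patB n by (simp add: rep)
      qed
      have "(\<Sum>s\<in>hB ` PB. T v s) = (\<Sum>(n, pp)\<in>PB. T v (hB (n, pp)))"
        by (subst sum.reindex[OF injB]) (auto intro!: sum.cong)
      also have "\<dots> = (\<Sum>n<r - 1. \<Sum>pp\<in>split_compositions n. T v (hB (n, pp)))"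
        unfolding PB_def by (rule sum.Sigma[symmetric]) (simp_all add: finite_split_compositions)
      also have "\<dots> = (\<Sum>n<r - 1. - ((word_coefficient (\<lambda>j. (-1) ^ Suc j / real (j + 2)) n / real (n + 2)) *\<^sub>R (br x ^^ Suc n) v))"
        unfolding word_coefficient_def sum_divide_distrib scaleR_sum_left sum_negf[symmetric]
        by (intro sum.cong refl) (auto simp: TB simp del: of_nat_Suc of_nat_add power_Suc)
      finally show ?thesis .
    qed
    \<comment> \<open>The second family contributes to the power \<open>n + 1\<close> of
      \<open>ad x\<close>, so its index is shifted by one; its denominator \<open>n + 2\<close> then
      agrees with that of the first.\<close>
    also have "(\<Sum>n<r. (word_coefficient (\<lambda>j. (-1) ^ j / real (j + 1)) n / real (n + 1)) *\<^sub>R (br x ^^ n) v) + (\<Sum>n<r - 1. - ((word_coefficient (\<lambda>j. (-1) ^ Suc j / real (j + 2)) n / real (n + 2)) *\<^sub>R (br x ^^ Suc n) v))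
       = (\<Sum>k<r. dynkin_coefficient k *\<^sub>R (br x ^^ k) v)"
    proof (cases r)
      case (Suc r')
      have d: "dynkin_coefficient k *\<^sub>R u = (word_coefficient (\<lambda>j. (-1) ^ j / real (j + 1)) k / real (k + 1)) *\<^sub>R u +
         (if k = 0 then 0 else - ((word_coefficient (\<lambda>j. (-1) ^ Suc j / real (j + 2)) (k - 1) / real (k + 1)) *\<^sub>R u))" for k and u :: 'v
        unfolding dynkin_coefficient_def by (simp add: diff_divide_distrib scaleR_diff_left del: of_nat_Suc of_nat_add power_Suc)
      show ?thesis unfolding d sum.distrib Suc
        by (subst (3) sum.lessThan_Suc_shift) (simp add: add.commute del: of_nat_Suc power_Suc)
    qed simp
    finally show ?thesis .
  qed
  ultimately show ?thesis by simp
qed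

lemma frame_op_frame_op:
  fixes \<alpha> :: "real ^ 'n \<Rightarrow> real ^ 'n" and f :: "real ^ 'n \<Rightarrow> real"
  assumes f: "smooth_around x f" and \<alpha>: "smooth_around x \<alpha>"
  shows "frechet_derivative (\<lambda>y. frechet_derivative f (at y) (\<alpha> y)) (at x) v =
    frechet_derivative f (at x) (frechet_derivative \<alpha> (at x) v) +
    (\<Sum>k\<in>UNIV. \<alpha> x $ k * frechet_derivative (\<lambda>y. frechet_derivative f (at y) (axis k 1)) (at x) v)"
proof -
  have ev: "\<forall>\<^sub>F y in nhds x. frechet_derivative f (at y) (\<alpha> y) = (\<Sum>k\<in>UNIV. \<alpha> y $ k * frechet_derivative f (at y) (axis k 1))"
    using smooth_around_eventually[OF f]
  proof eventually_elim
    case (elim y) show ?case using linear_axis_expand[OF smooth_around_linear_frechet[OF elim], of "\<alpha> y"] by simp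
  qed
  have hd: "((\<lambda>y. \<Sum>k\<in>UNIV. \<alpha> y $ k * frechet_derivative f (at y) (axis k 1)) has_derivative
     (\<lambda>v. \<Sum>k\<in>UNIV. \<alpha> x $ k * frechet_derivative (\<lambda>y. frechet_derivative f (at y) (axis k 1)) (at x) v
        + frechet_derivative \<alpha> (at x) v $ k * frechet_derivative f (at x) (axis k 1))) (at x)"
    by (intro has_derivative_sum has_derivative_mult bounded_linear.has_derivative[OF bounded_linear_vec_nth]
        smooth_around_has_derivative smooth_around_frechet f \<alpha>)
  have "frechet_derivative (\<lambda>y. frechet_derivative f (at y) (\<alpha> y)) (at x) v =
      (\<Sum>k\<in>UNIV. \<alpha> x $ k * frechet_derivative (\<lambda>y. frechet_derivative f (at y) (axis k 1)) (at x) v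
        + frechet_derivative \<alpha> (at x) v $ k * frechet_derivative f (at x) (axis k 1))"
    unfolding frechet_derivative_cong_nhds[OF ev] frechet_derivativeI[OF hd] ..
  then show ?thesis
    using linear_axis_expand[OF smooth_around_linear_frechet[OF f], of "frechet_derivative \<alpha> (at x) v"]
    by (simp add: sum.distrib)
qed

subsection \<open>Reordering words in the frame, and the map \<open>\<psi>\<close>\<close>

text \<open>In each of the two second derivatives the Hessian of \<open>f\<close> is paired with
  \<open>\<alpha> x\<close> and \<open>\<beta> x\<close>; these terms cancel by symmetry and only
  first derivatives of \<open>f\<close> remain.\<close>

lemma commutator_derivative:
  fixes \<alpha> \<beta> :: "real ^ 'n \<Rightarrow> real ^ 'n" and f :: "real ^ 'n \<Rightarrow> real"
  assumes f: "smooth_around x f" and \<alpha>: "smooth_around x \<alpha>" and \<beta>: "smooth_around x \<beta>"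
  shows "frechet_derivative (\<lambda>y. frechet_derivative f (at y) (\<beta> y)) (at x) (\<alpha> x)
       - frechet_derivative (\<lambda>y. frechet_derivative f (at y) (\<alpha> y)) (at x) (\<beta> x)
     = frechet_derivative f (at x) (frechet_derivative \<beta> (at x) (\<alpha> x) - frechet_derivative \<alpha> (at x) (\<beta> x))"
proof -
  let ?H = "\<lambda>k l. frechet_derivative (\<lambda>y. frechet_derivative f (at y) (axis k 1)) (at x) (axis l 1)"
  have expand: "frechet_derivative (\<lambda>y. frechet_derivative f (at y) (axis k 1)) (at x) v = (\<Sum>l\<in>UNIV. v $ l * ?H k l)" for k v
    using linear_axis_expand[OF smooth_around_linear_frechet[OF smooth_around_frechet[OF f]], of "axis k 1" v] by simp
  have "(\<Sum>k\<in>UNIV. \<beta> x $ k * (\<Sum>l\<in>UNIV. \<alpha> x $ l * ?H k l)) = (\<Sum>k\<in>UNIV. \<alpha> x $ k * (\<Sum>l\<in>UNIV. \<beta> x $ l * ?H k l))"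
  proof -
    have "(\<Sum>k\<in>UNIV. \<beta> x $ k * (\<Sum>l\<in>UNIV. \<alpha> x $ l * ?H k l)) = (\<Sum>k\<in>UNIV. \<Sum>l\<in>UNIV. \<beta> x $ k * \<alpha> x $ l * ?H l k)"
      by (simp add: sum_distrib_left mult.assoc frechet_derivative_commute[OF f])
    also have "\<dots> = (\<Sum>l\<in>UNIV. \<Sum>k\<in>UNIV. \<beta> x $ k * \<alpha> x $ l * ?H l k)" by (rule sum.swap)
    finally show ?thesis by (simp add: sum_distrib_left mult_ac)
  qed
  then show ?thesis
    unfolding frame_op_frame_op[OF f \<alpha>] frame_op_frame_op[OF f \<beta>] expand[of _ "\<alpha> x"] expand[of _ "\<beta> x"]
    by (simp add: linear_diff[OF smooth_around_linear_frechet[OF f]])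
qed

lemma frame_op_add:
  fixes b :: "'n::finite \<Rightarrow> real ^ 'n \<Rightarrow> real ^ 'n"
  assumes "smooth_around x f" "smooth_around x g"
  shows "frame_op b j (\<lambda>x. f x + g x) x = frame_op b j f x + frame_op b j g x"
  unfolding frame_op_def
  by (subst frechet_derivativeI[OF has_derivative_add[OF smooth_around_has_derivative[OF assms(1)] smooth_around_has_derivative[OF assms(2)]]]) simp

lemma frame_op_mult:
  fixes b :: "'n::finite \<Rightarrow> real ^ 'n \<Rightarrow> real ^ 'n"
  assumes "smooth_around x f" "smooth_around x g"
  shows "frame_op b j (\<lambda>x. f x * g x) x = frame_op b j f x * g x + f x * frame_op b j g x"
  unfolding frame_op_def
  by (subst frechet_derivativeI[OF has_derivative_mult[OF smooth_around_has_derivative[OF assms(1)] smooth_around_has_derivative[OF assms(2)]]]) simp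

lemma word_op_add:
  fixes b :: "'n::finite \<Rightarrow> real ^ 'n \<Rightarrow> real ^ 'n"
  assumes b: "\<And>j. smooth_around a (b j)" and f: "smooth_around a f" "smooth_around a g"
  shows "\<forall>\<^sub>F x in nhds a. word_op b I (\<lambda>x. f x + g x) x = word_op b I f x + word_op b I g x"
proof (induction I)
  case (Cons j I)
  from frame_op_cong[OF Cons, of b j] smooth_around_eventually[OF smooth_around_word_op[where b=b and I=I, OF b f(1)]]
    smooth_around_eventually[OF smooth_around_word_op[where b=b and I=I, OF b f(2)]]
  show ?case by eventually_elim (simp add: frame_op_add)
qed simp

lemma word_op_sum:
  fixes b :: "'n::finite \<Rightarrow> real ^ 'n \<Rightarrow> real ^ 'n"
  assumes b: "\<And>j. smooth_around a (b j)" and f: "\<And>i. i \<in> S \<Longrightarrow> smooth_around a (f i)"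
  shows "word_op b I (\<lambda>x. \<Sum>i\<in>S. f i x) a = (\<Sum>i\<in>S. word_op b I (f i) a)"
proof -
  have z: "word_op b I (\<lambda>x. 0) = (\<lambda>x. 0)"
    by (induction I) (auto simp: frame_op_def frechet_derivativeI[OF has_derivative_const])
  show ?thesis using f
  proof (induction S rule: infinite_finite_induct)
    case (insert i S)
    have "word_op b I (\<lambda>x. f i x + (\<Sum>i\<in>S. f i x)) a = word_op b I (f i) a + word_op b I (\<lambda>x. \<Sum>i\<in>S. f i x) a"
      by (rule eventually_nhds_x_imp_x[OF word_op_add[OF b]]) (use insert in \<open>auto intro: smooth_around_sum\<close>)
    then show ?case using insert by simp
  qed (simp_all add: z)
qed

lemma word_op_cmult:
  fixes b :: "'n::finite \<Rightarrow> real ^ 'n \<Rightarrow> real ^ 'n"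
  assumes b: "\<And>j. smooth_around a (b j)" and f: "smooth_around a f"
  shows "word_op b I (\<lambda>x. c * f x) a = c * word_op b I f a"
proof -
  have "\<forall>\<^sub>F x in nhds a. word_op b I (\<lambda>x. c * f x) x = c * word_op b I f x"
  proof (induction I)
    case (Cons j I)
    from frame_op_cong[OF Cons, of b j] smooth_around_eventually[OF smooth_around_word_op[where b=b and I=I, OF b f]]
    show ?case
    proof eventually_elim
      case (elim x)
      have "frame_op b j (\<lambda>x. c * word_op b I f x) x = c * frame_op b j (word_op b I f) x"
        using frame_op_mult[of x "\<lambda>_. c" "word_op b I f" b j] elim(2)
        by (simp add: frame_op_def[of _ _ "\<lambda>_. c"] frechet_derivativeI[OF has_derivative_const])
      then show ?case using elim by simp
    qed
  qed simp
  from eventually_nhds_x_imp_x[OF this] show ?thesis .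
qed

text \<open>By the product rule the letters of \<open>I\<close> are distributed between
  \<open>L\<close> and \<open>h\<close>; those that fall on \<open>h\<close> form a word that is
  neither longer nor heavier than \<open>I\<close>.\<close>

lemma word_op_mult_vanish:
  fixes b :: "'n::finite \<Rightarrow> real ^ 'n \<Rightarrow> real ^ 'n"
  assumes b: "\<And>j. smooth_around a (b j)" and L: "smooth_around a L" and h: "smooth_around a h"
    and "\<And>J. length J \<le> length I \<Longrightarrow> wt w J \<le> wt w I \<Longrightarrow> word_op b J h a = 0"
  shows "word_op b I (\<lambda>x. L x * h x) a = 0"
  using L h assms(4)
proof (induction I arbitrary: L h rule: rev_induct)
  case Nil then show ?case by simp
next
  case (snoc i I)
  note sL = smooth_around_frame_op[where b=b and j=i, OF b snoc.prems(1)] and sh = smooth_around_frame_op[where b=b and j=i, OF b snoc.prems(2)]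
  have "\<forall>\<^sub>F x in nhds a. frame_op b i (\<lambda>x. L x * h x) x = frame_op b i L x * h x + L x * frame_op b i h x"
    using smooth_around_eventually[OF snoc.prems(1)] smooth_around_eventually[OF snoc.prems(2)]
    by eventually_elim (rule frame_op_mult)
  from eventually_nhds_x_imp_x[OF word_op_cong[OF this]]
  have "word_op b (I @ [i]) (\<lambda>x. L x * h x) a = word_op b I (\<lambda>x. frame_op b i L x * h x + L x * frame_op b i h x) a"
    by (simp add: word_op_append)
  also have "\<dots> = word_op b I (\<lambda>x. frame_op b i L x * h x) a + word_op b I (\<lambda>x. L x * frame_op b i h x) a"
    by (rule eventually_nhds_x_imp_x[OF word_op_add[OF b]]) (intro smooth_around_mult sL sh snoc.prems)+
  also have "word_op b I (\<lambda>x. frame_op b i L x * h x) a = 0"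
    by (rule snoc.IH[OF sL snoc.prems(2)], rule snoc.prems(3)) auto
  also have "word_op b I (\<lambda>x. L x * frame_op b i h x) a = 0"
  proof (rule snoc.IH[OF snoc.prems(1) sh])
    fix J assume "length J \<le> length I" "wt w J \<le> wt w I"
    then show "word_op b J (frame_op b i h) a = 0"
      using snoc.prems(3)[of "J @ [i]"] by (simp add: word_op_append)
  qed
  finally show ?case by simp
qed

locale filtered_frame = weights w for w :: "'n::{finite,linorder} \<Rightarrow> nat" +
  fixes b :: "'n::{finite,linorder} \<Rightarrow> (real, 'n) vec \<Rightarrow> (real, 'n) vec"
    and L :: "'n::{finite,linorder} \<Rightarrow> 'n \<Rightarrow> (real, 'n) vec \<Rightarrow> (real, 'n) vec"
  assumes b_smooth: "smooth_around 0 (b j)"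
    and L_smooth: "smooth_around 0 (L i j)"
    and L_graded: "w i + w j < w k \<Longrightarrow> \<forall>\<^sub>F x in nhds 0. L i j x $ k = 0"
    and b_bracket: "\<forall>\<^sub>F x in nhds 0. frechet_derivative (b j) (at x) (b i x) - frechet_derivative (b i) (at x) (b j x) = (\<Sum>k\<in>UNIV. L i j x $ k *\<^sub>R b k x)"
begin

lemma frame_op_commutator:
  assumes f: "smooth_around 0 f"
  shows "\<forall>\<^sub>F x in nhds 0. frame_op b i (frame_op b j f) x = frame_op b j (frame_op b i f) x + (\<Sum>k\<in>UNIV. L i j x $ k * frame_op b k f x)"
  using b_bracket[of j i] smooth_around_eventually[OF f] smooth_around_eventually[OF b_smooth[of i]] smooth_around_eventually[OF b_smooth[of j]]
proof eventually_elim
  case (elim x)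
  note lin = smooth_around_linear_frechet[OF elim(2)]
  have "frame_op b i (frame_op b j f) x - frame_op b j (frame_op b i f) x = frechet_derivative f (at x) (\<Sum>k\<in>UNIV. L i j x $ k *\<^sub>R b k x)"
    unfolding frame_op_def[abs_def] using commutator_derivative[OF elim(2,3,4)] elim(1) by simp
  also have "\<dots> = (\<Sum>k\<in>UNIV. L i j x $ k * frame_op b k f x)"
    by (simp add: linear_sum[OF lin] linear_scale[OF lin] frame_op_def)
  finally show ?case by simp
qed

text \<open>Exchanging two neighbouring letters leaves a term in which they are replaced by a single
  letter of weight at most \<open>w i + w j\<close>, with a function as coefficient. That word is
  shorter, so the hypothesis on short words removes it.\<close>

lemma word_op_swap:
  assumes f: "smooth_around 0 f" and N: "wt w (P @ i # j # Q) < N"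
    and IH: "\<And>J. length J < length (P @ i # j # Q) \<Longrightarrow> wt w J < N \<Longrightarrow> word_op b J f 0 = 0"
  shows "word_op b (P @ i # j # Q) f 0 = word_op b (P @ j # i # Q) f 0"
proof -
  let ?g = "word_op b Q f"
  have g: "smooth_around 0 ?g" by (rule smooth_around_word_op[where b=b, OF b_smooth f])
  have sm: "smooth_around 0 (\<lambda>x. L i j x $ k * frame_op b k ?g x)" for k
    by (intro smooth_around_mult smooth_around_vec_nth L_smooth smooth_around_frame_op b_smooth g)
  have z: "word_op b P (\<lambda>x. L i j x $ k * frame_op b k ?g x) 0 = 0" for k
  proof (cases "w i + w j < w k")
    case True
    have "\<forall>\<^sub>F x in nhds 0. L i j x $ k * frame_op b k ?g x = 0 * frame_op b k ?g x"
      using L_graded[OF True] by eventually_elim simp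
    from eventually_nhds_x_imp_x[OF word_op_cong[OF this]]
    show ?thesis using word_op_cmult[where b=b and I=P and c=0, OF b_smooth smooth_around_frame_op[where b=b and j=k, OF b_smooth g]] by simp
  next
    case False
    show ?thesis
    proof (rule word_op_mult_vanish[where b=b, OF b_smooth])
      fix J assume J: "length J \<le> length P" "wt w J \<le> wt w P"
      have "word_op b (J @ k # Q) f 0 = 0" by (rule IH) (use J False N in auto)
      then show "word_op b J (frame_op b k ?g) 0 = 0" by (simp add: word_op_append)
    qed (intro smooth_around_vec_nth L_smooth smooth_around_frame_op b_smooth g)+
  qed
  have "word_op b (P @ i # j # Q) f 0 = word_op b P (\<lambda>x. frame_op b j (frame_op b i ?g) x + (\<Sum>k\<in>UNIV. L i j x $ k * frame_op b k ?g x)) 0"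
    using eventually_nhds_x_imp_x[OF word_op_cong[OF frame_op_commutator[OF g, of i j], of b P]] by (simp add: word_op_append)
  also have "\<dots> = word_op b P (frame_op b j (frame_op b i ?g)) 0 + word_op b P (\<lambda>x. \<Sum>k\<in>UNIV. L i j x $ k * frame_op b k ?g x) 0"
    by (rule eventually_nhds_x_imp_x[OF word_op_add[where b=b, OF b_smooth]]) (intro smooth_around_sum sm smooth_around_frame_op b_smooth g)+
  also have "word_op b P (\<lambda>x. \<Sum>k\<in>UNIV. L i j x $ k * frame_op b k ?g x) 0 = 0"
    unfolding word_op_sum[where b=b, OF b_smooth sm] by (simp add: z)
  finally show ?thesis by (simp add: word_op_append)
qed

lemma word_op_insort:
  assumes f: "smooth_around 0 f"
    and IH: "\<And>J. length J < m \<Longrightarrow> wt w J < N \<Longrightarrow> word_op b J f 0 = 0"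
  shows "length (P @ x # ys) = m \<Longrightarrow> wt w (P @ x # ys) < N \<Longrightarrow> word_op b (P @ x # ys) f 0 = word_op b (P @ insort x ys) f 0"
proof (induction ys arbitrary: P)
  case (Cons y ys)
  have "word_op b (P @ x # y # ys) f 0 = word_op b ((P @ [y]) @ x # ys) f 0"
    using word_op_swap[where P=P and i=x and j=y and Q=ys and N=N, OF f] IH Cons.prems by simp
  also have "\<dots> = word_op b ((P @ [y]) @ insort x ys) f 0"
    by (rule Cons.IH) (use Cons.prems in auto)
  finally show ?case by simp
qed simp

lemma word_op_sort:
  assumes f: "smooth_around 0 f"
    and IH: "\<And>J. length J < m \<Longrightarrow> wt w J < N \<Longrightarrow> word_op b J f 0 = 0"
  shows "length (P @ I) = m \<Longrightarrow> wt w (P @ I) < N \<Longrightarrow> word_op b (P @ I) f 0 = word_op b (P @ sort I) f 0"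
proof (induction I arbitrary: P)
  case (Cons x I)
  have s: "wt w (sort I) = wt w I"
  proof -
    have "mset (map w (sort I)) = mset (map w I)" by simp
    then show ?thesis by (metis sum_mset_sum_list)
  qed
  have "word_op b (P @ x # I) f 0 = word_op b ((P @ [x]) @ sort I) f 0"
    using Cons.IH[of "P @ [x]"] Cons.prems by simp
  also have "\<dots> = word_op b (P @ insort x (sort I)) f 0"
    using word_op_insort[where P=P and x=x and ys="sort I" and N=N and m=m, OF f IH] Cons.prems s by simp
  finally show ?case by simp
qed simp

text \<open>The argument of Poincare, Birkhoff and Witt: sorting a word changes it only by shorter
  words of no larger weight, which vanish by induction on the length.\<close>

theorem sorted_words_suffice:
  assumes f: "smooth_around 0 f" and s: "\<And>I. sorted I \<Longrightarrow> wt w I < N \<Longrightarrow> word_op b I f 0 = 0"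
  shows "wt w I < N \<Longrightarrow> word_op b I f 0 = 0"
proof (induction "length I" arbitrary: I rule: less_induct)
  case less
  have "wt w (sort I) = wt w I"
  proof -
    have "mset (map w (sort I)) = mset (map w I)" by simp
    then show ?thesis by (metis sum_mset_sum_list)
  qed
  moreover have "word_op b ([] @ I) f 0 = word_op b ([] @ sort I) f 0"
    by (rule word_op_sort[where m="length I" and N=N, OF f]) (use less in auto)
  ultimately show ?case using s[of "sort I"] less.prems by simp
qed

end

text \<open>Off the diagonal \<open>A \<alpha> \<beta>\<close> can be non-zero only for
  \<open>\<rho> \<beta> < \<rho> \<alpha>\<close>. Existence removes an index of maximal
  \<open>\<rho>\<close>, whose unknown enters no other equation; uniqueness proceeds upwards in
  \<open>\<rho>\<close>.\<close>

lemma triangular_system: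
  fixes A :: "'i \<Rightarrow> 'i \<Rightarrow> real" and \<rho> :: "'i \<Rightarrow> nat"
  assumes "finite S"
    and "\<And>\<alpha> \<beta>. \<alpha> \<in> S \<Longrightarrow> \<beta> \<in> S \<Longrightarrow> \<rho> \<alpha> \<le> \<rho> \<beta> \<Longrightarrow> \<alpha> \<noteq> \<beta> \<Longrightarrow> A \<alpha> \<beta> = 0"
    and "\<And>\<alpha>. \<alpha> \<in> S \<Longrightarrow> A \<alpha> \<alpha> \<noteq> 0"
  shows "\<exists>c. \<forall>\<alpha>\<in>S. (\<Sum>\<beta>\<in>S. A \<alpha> \<beta> * c \<beta>) = d \<alpha>"
    and "(\<And>\<alpha>. \<alpha> \<in> S \<Longrightarrow> (\<Sum>\<beta>\<in>S. A \<alpha> \<beta> * c \<beta>) = 0) \<Longrightarrow> \<alpha> \<in> S \<Longrightarrow> c \<alpha> = 0"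
proof -
  show "\<exists>c. \<forall>\<alpha>\<in>S. (\<Sum>\<beta>\<in>S. A \<alpha> \<beta> * c \<beta>) = d \<alpha>"
    using assms
  proof (induction "card S" arbitrary: S)
    case 0 then show ?case by simp
  next
    case (Suc n)
    then have "S \<noteq> {}" by auto
    then have "Max (\<rho> ` S) \<in> \<rho> ` S" using Suc.prems(1) by (intro Max_in) auto
    then obtain m where m': "m \<in> S" "Max (\<rho> ` S) = \<rho> m" by blast
    have m: "m \<in> S" "\<And>\<alpha>. \<alpha> \<in> S \<Longrightarrow> \<rho> \<alpha> \<le> \<rho> m"
      using m' Max_ge[of "\<rho> ` S"] Suc.prems(1) by auto
    let ?S = "S - {m}"
    have "n = card ?S" using Suc.hyps(2) m(1) Suc.prems(1) by simp
    then have "\<exists>c. \<forall>\<alpha>\<in>?S. (\<Sum>\<beta>\<in>?S. A \<alpha> \<beta> * c \<beta>) = d \<alpha>"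
      by (rule Suc.hyps(1)) (use Suc.prems in auto)
    then obtain c where c: "\<And>\<alpha>. \<alpha> \<in> ?S \<Longrightarrow> (\<Sum>\<beta>\<in>?S. A \<alpha> \<beta> * c \<beta>) = d \<alpha>" by blast
    define c' where "c' = c(m := (d m - (\<Sum>\<beta>\<in>?S. A m \<beta> * c \<beta>)) / A m m)"
    have "(\<Sum>\<beta>\<in>S. A \<alpha> \<beta> * c' \<beta>) = d \<alpha>" if "\<alpha> \<in> S" for \<alpha>
    proof -
      have "(\<Sum>\<beta>\<in>S. A \<alpha> \<beta> * c' \<beta>) = A \<alpha> m * c' m + (\<Sum>\<beta>\<in>?S. A \<alpha> \<beta> * c' \<beta>)"
        by (rule sum.remove[OF Suc.prems(1) m(1)])
      also have "(\<Sum>\<beta>\<in>?S. A \<alpha> \<beta> * c' \<beta>) = (\<Sum>\<beta>\<in>?S. A \<alpha> \<beta> * c \<beta>)"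
        by (rule sum.cong) (auto simp: c'_def)
      finally show ?thesis
        using c[of \<alpha>] that m Suc.prems(2)[of \<alpha> m] Suc.prems(3)[OF m(1)] by (cases "\<alpha> = m") (auto simp: c'_def)
    qed
    then show ?case by blast
  qed
next
  assume c: "\<And>\<alpha>. \<alpha> \<in> S \<Longrightarrow> (\<Sum>\<beta>\<in>S. A \<alpha> \<beta> * c \<beta>) = 0" and "\<alpha> \<in> S"
  then show "c \<alpha> = 0"
  proof (induction "\<rho> \<alpha>" arbitrary: \<alpha> rule: less_induct)
    case less
    have "(\<Sum>\<beta>\<in>S. A \<alpha> \<beta> * c \<beta>) = (\<Sum>\<beta>\<in>S. if \<beta> = \<alpha> then A \<alpha> \<alpha> * c \<alpha> else 0)"
    proof (rule sum.cong[OF refl])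
      fix \<beta> assume \<beta>: "\<beta> \<in> S"
      show "A \<alpha> \<beta> * c \<beta> = (if \<beta> = \<alpha> then A \<alpha> \<alpha> * c \<alpha> else 0)"
        using less.hyps[of \<beta>] assms(2)[of \<alpha> \<beta>] less.prems \<beta> by (cases "\<rho> \<beta> < \<rho> \<alpha>") (auto simp: not_less)
    qed
    then show ?case using c[OF less.prems(2)] assms(1,3) less.prems by simp
  qed
qed

section \<open>Words against monomials, and the polynomial change of coordinates\<close>

definition monomial_fun :: "('n::finite \<Rightarrow> nat) \<Rightarrow> real ^ 'n \<Rightarrow> real" where
  "monomial_fun \<beta> x = (\<Prod>j\<in>UNIV. x $ j ^ \<beta> j)"

abbreviation coordinate_frame :: "'n \<Rightarrow> real ^ 'n \<Rightarrow> real ^ 'n" where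
  "coordinate_frame \<equiv> (\<lambda>j x. axis j 1)"

text \<open>With all weights equal to \<open>1\<close>, \<open>worder\<close> is the usual order of
  vanishing, and the earlier results compare words of a frame with iterated partial
  derivatives.\<close>

interpretation unit_weights: weights "\<lambda>_::'n::finite. 1"
  by unfold_locales simp

lemma unit_good_frame:
  fixes b :: "'n::finite \<Rightarrow> real ^ 'n \<Rightarrow> real ^ 'n"
  assumes "\<And>j. smooth_around 0 (b j)" "\<And>j. b j 0 = axis j 1"
  shows "unit_weights.good_frame b"
  unfolding unit_weights.good_frame_def
proof (intro conjI allI impI)
  fix k :: 'n and I :: "'n list" assume "wt (\<lambda>_. 1) I < 1"
  then have "I = []" by (cases I) auto
  then show "word_op b I (\<lambda>x. x $ k) 0 = 0" by simp
qed (use assms in \<open>auto simp: axis_def\<close>)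

lemma unit_good_coordinate_frame: "unit_weights.good_frame coordinate_frame"
  by (rule unit_good_frame) simp_all

lemma smooth_around_monomial_fun: "smooth_around x (monomial_fun \<beta>)"
  unfolding monomial_fun_def by (rule smooth_intros)+

text \<open>The field \<open>b j\<close> and the \<open>j\<close>-th coordinate field agree at
  \<open>0\<close>. Their difference has order \<open>1\<close> and makes up for the order lost in
  one differentiation.\<close>

lemma frame_op_difference:
  fixes b :: "'n::finite \<Rightarrow> real ^ 'n \<Rightarrow> real ^ 'n"
  assumes b: "\<And>j. smooth_around 0 (b j)" "\<And>j. b j 0 = axis j 1" and f: "worder (\<lambda>_. 1) N f"
  shows "worder (\<lambda>_. 1) N (\<lambda>x. frame_op b j f x - frame_op coordinate_frame j f x)"
proof (rule unit_weights.worder_cong)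
  note sf = unit_weights.worder_smooth[OF f]
  show "\<forall>\<^sub>F x in nhds 0. (\<Sum>k\<in>UNIV. (b j x $ k - axis j 1 $ k) * frechet_derivative f (at x) (axis k 1)) = frame_op b j f x - frame_op coordinate_frame j f x"
    using smooth_around_eventually[OF sf]
    by eventually_elim (simp add: frame_op_expand left_diff_distrib sum_subtractf)
  show "worder (\<lambda>_. 1) N (\<lambda>x. \<Sum>k\<in>UNIV. (b j x $ k - axis j 1 $ k) * frechet_derivative f (at x) (axis k 1))"
  proof (rule unit_weights.worder_sum)
    fix k
    have "worder (\<lambda>_. 1) 1 (\<lambda>x. b j x $ k - axis j 1 $ k)"
    proof (rule unit_weights.frame_order_imp_worder[OF unit_good_coordinate_frame])
      show "smooth_around 0 (\<lambda>x. b j x $ k - axis j 1 $ k)" by (rule smooth_intros b(1))+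
      fix I :: "'n list" assume "wt (\<lambda>_. 1) I < 1"
      then have "I = []" by (cases I) auto
      then show "word_op coordinate_frame I (\<lambda>x. b j x $ k - axis j 1 $ k) 0 = 0" by (simp add: b(2))
    qed
    from unit_weights.worder_mult[OF this unit_weights.worder_partial[OF f]]
    show "worder (\<lambda>_. 1) N (\<lambda>x. (b j x $ k - axis j 1 $ k) * frechet_derivative f (at x) (axis k 1))"
      by (rule unit_weights.worder_mono) simp
  qed
qed

text \<open>Replacing the innermost letter by the coordinate field changes the function by a term of
  order larger than the number of letters still to be applied.\<close>

lemma word_op_leading:
  fixes b :: "'n::finite \<Rightarrow> real ^ 'n \<Rightarrow> real ^ 'n"
  assumes b: "\<And>j. smooth_around 0 (b j)" "\<And>j. b j 0 = axis j 1"
  shows "worder (\<lambda>_. 1) (length I) f \<Longrightarrow> word_op b I f 0 = word_op coordinate_frame I f 0"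
proof (induction I arbitrary: f rule: rev_induct)
  case (snoc j I)
  let ?d = "\<lambda>x. frame_op b j f x - frame_op coordinate_frame j f x"
  let ?c = "frame_op coordinate_frame j f"
  note g = unit_good_frame[of b, OF b]
  have d: "worder (\<lambda>_. 1) (Suc (length I)) ?d" using frame_op_difference[OF b snoc.prems, of j] by simp
  have c: "worder (\<lambda>_. 1) (length I) ?c"
    using unit_weights.worder_frame_op[OF unit_good_coordinate_frame snoc.prems, of j] by simp
  have "word_op b (I @ [j]) f 0 = word_op b I (\<lambda>x. ?d x + ?c x) 0" by (simp add: word_op_append)
  also have "\<dots> = word_op b I ?d 0 + word_op b I ?c 0"
    by (rule eventually_nhds_x_imp_x[OF word_op_add[OF b(1)]]) (rule unit_weights.worder_smooth[OF d] unit_weights.worder_smooth[OF c])+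
  also have "word_op b I ?d 0 = 0"
    by (rule unit_weights.worder_imp_frame_order[OF g d]) (simp add: sum_list_triv)
  also have "word_op b I ?c 0 = word_op coordinate_frame I ?c 0" by (rule snoc.IH[OF c])
  finally show ?case by (simp add: word_op_append)
qed simp

lemma worder_monomial_fun:
  fixes \<beta> :: "'n::finite \<Rightarrow> nat"
  shows "worder (\<lambda>_. 1) (\<Sum>j\<in>UNIV. \<beta> j) (monomial_fun \<beta>)"
proof -
  have pw: "worder (\<lambda>_. 1) n (\<lambda>x::real ^ 'n. x $ j ^ n)" for j n
  proof (induction n)
    case 0 show ?case using unit_weights.worder_0[OF smooth_around_const] by simp
  next
    case (Suc n)
    from unit_weights.worder_mult[OF unit_weights.worder_coord[of j] this] show ?case by simp
  qed
  have "finite J \<Longrightarrow> worder (\<lambda>_. 1) (\<Sum>j\<in>J. \<beta> j) (\<lambda>x::real ^ 'n. \<Prod>j\<in>J. x $ j ^ \<beta> j)" for J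
  proof (induction J rule: finite_induct)
    case empty show ?case using unit_weights.worder_0[OF smooth_around_const] by simp
  next
    case (insert j J)
    from unit_weights.worder_mult[OF pw[of "\<beta> j" j] insert.IH] show ?case using insert by simp
  qed
  from this[of UNIV] show ?thesis unfolding monomial_fun_def by simp
qed

lemma frame_op_monomial_fun:
  fixes \<beta> :: "'n::finite \<Rightarrow> nat"
  shows "frame_op coordinate_frame j (monomial_fun \<beta>) = (\<lambda>x. real (\<beta> j) * monomial_fun (\<beta>(j := \<beta> j - 1)) x)"
proof
  fix x :: "real ^ 'n"
  let ?r = "\<lambda>x::real ^ 'n. \<Prod>i\<in>UNIV - {j}. x $ i ^ \<beta> i"
  have sp: "smooth_around x (\<lambda>x. \<Prod>i\<in>J. x $ i ^ \<beta> i)" for J by (rule smooth_intros)+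
  have r0: "finite J \<Longrightarrow> j \<notin> J \<Longrightarrow> frechet_derivative (\<lambda>x::real ^ 'n. \<Prod>i\<in>J. x $ i ^ \<beta> i) (at x) (axis j 1) = 0" for J
  proof (induction J rule: finite_induct)
    case empty show ?case by (simp add: frechet_derivativeI[OF has_derivative_const])
  next
    case (insert i J)
    have p: "((\<lambda>x::real ^ 'n. x $ i ^ \<beta> i) has_derivative (\<lambda>v. v $ i * (real (\<beta> i) * x $ i ^ (\<beta> i - 1)))) (at x)"
      by (rule has_derivative_eq_rhs[OF has_derivative_power[OF bounded_linear.has_derivative[OF bounded_linear_vec_nth has_derivative_ident]]]) auto
    have "frechet_derivative (\<lambda>x::real ^ 'n. x $ i ^ \<beta> i * (\<Prod>i\<in>J. x $ i ^ \<beta> i)) (at x) (axis j 1) = 0"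
      by (subst frechet_derivativeI[OF has_derivative_mult[OF p smooth_around_has_derivative[OF sp]]]) (use insert in \<open>auto simp: axis_def\<close>)
    then show ?case using insert by simp
  qed
  have split: "monomial_fun \<gamma> y = y $ j ^ \<gamma> j * (\<Prod>i\<in>UNIV - {j}. y $ i ^ \<gamma> i)" for \<gamma> y
    unfolding monomial_fun_def by (rule prod.remove) auto
  have p: "((\<lambda>x::real ^ 'n. x $ j ^ \<beta> j) has_derivative (\<lambda>v. v $ j * (real (\<beta> j) * x $ j ^ (\<beta> j - 1)))) (at x)"
    by (rule has_derivative_eq_rhs[OF has_derivative_power[OF bounded_linear.has_derivative[OF bounded_linear_vec_nth has_derivative_ident]]]) auto
  have "frechet_derivative (monomial_fun \<beta>) (at x) (axis j 1) = frechet_derivative (\<lambda>x. x $ j ^ \<beta> j * ?r x) (at x) (axis j 1)"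
    unfolding split[abs_def] ..
  also have "\<dots> = real (\<beta> j) * x $ j ^ (\<beta> j - 1) * ?r x"
    by (subst frechet_derivativeI[OF has_derivative_mult[OF p smooth_around_has_derivative[OF sp]]]) (simp add: r0)
  also have "\<dots> = real (\<beta> j) * monomial_fun (\<beta>(j := \<beta> j - 1)) x"
  proof -
    have "(\<Prod>i\<in>UNIV - {j}. x $ i ^ (\<beta>(j := \<beta> j - 1)) i) = ?r x" by (rule prod.cong) auto
    then show ?thesis unfolding split by simp
  qed
  finally show "frame_op coordinate_frame j (monomial_fun \<beta>) x = real (\<beta> j) * monomial_fun (\<beta>(j := \<beta> j - 1)) x"
    by (simp add: frame_op_def)
qed

text \<open>The value is the product of the factorials of the exponents if the word contains each
  letter as often as the monomial, and \<open>0\<close> otherwise; only the non-vanishing is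
  recorded.\<close>

lemma word_op_coordinate_monomial:
  "length I = (\<Sum>j\<in>UNIV. \<beta> j) \<Longrightarrow> word_op coordinate_frame I (monomial_fun \<beta>) 0 \<noteq> 0 \<longleftrightarrow> count_list I = \<beta>"
proof (induction I arbitrary: \<beta> rule: rev_induct)
  case Nil
  then have "\<beta> = (\<lambda>_. 0)" by auto
  then show ?case by (auto simp: monomial_fun_def)
next
  case (snoc j I)
  let ?\<beta> = "\<beta>(j := \<beta> j - 1)"
  have eq: "word_op coordinate_frame (I @ [j]) (monomial_fun \<beta>) 0 = real (\<beta> j) * word_op coordinate_frame I (monomial_fun ?\<beta>) 0"
    unfolding word_op_append word_op_Cons word_op_Nil frame_op_monomial_fun
    by (rule word_op_cmult) (simp_all add: smooth_around_monomial_fun)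
  have cnt: "count_list (I @ [j]) = (\<lambda>i. count_list I i + (if i = j then 1 else 0))" by auto
  show ?case
  proof (cases "\<beta> j = 0")
    case True
    then have "count_list (I @ [j]) \<noteq> \<beta>" unfolding cnt by (auto simp: fun_eq_iff intro!: exI[of _ j])
    moreover have "word_op coordinate_frame (I @ [j]) (monomial_fun \<beta>) 0 = 0" using eq True by simp
    ultimately show ?thesis by blast
  next
    case False
    have "(\<Sum>i\<in>UNIV. \<beta> i) = \<beta> j + (\<Sum>i\<in>UNIV - {j}. \<beta> i)" "(\<Sum>i\<in>UNIV. ?\<beta> i) = (\<beta> j - 1) + (\<Sum>i\<in>UNIV - {j}. \<beta> i)"
      using sum.remove[of UNIV j \<beta>] sum.remove[of UNIV j ?\<beta>] by simp_all
    then have "length I = (\<Sum>i\<in>UNIV. ?\<beta> i)" using snoc.prems False by simp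
    from snoc.IH[OF this] have "word_op coordinate_frame I (monomial_fun ?\<beta>) 0 \<noteq> 0 \<longleftrightarrow> count_list I = ?\<beta>" .
    moreover have "count_list I = ?\<beta> \<longleftrightarrow> count_list (I @ [j]) = \<beta>"
      unfolding cnt fun_eq_iff using False by (auto split: if_splits)
    moreover have "word_op coordinate_frame (I @ [j]) (monomial_fun \<beta>) 0 \<noteq> 0 \<longleftrightarrow> word_op coordinate_frame I (monomial_fun ?\<beta>) 0 \<noteq> 0"
      using eq False by simp
    ultimately show ?thesis by blast
  qed
qed

text \<open>A word shorter than the degree leaves a positive order of vanishing, and a word of the
  same length acts like a partial derivative. This is the triangularity of the linear system for the
  coefficients of the polynomial.\<close>

lemma word_op_monomial:
  fixes b :: "'n::finite \<Rightarrow> real ^ 'n \<Rightarrow> real ^ 'n"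
  assumes b: "\<And>j. smooth_around 0 (b j)" "\<And>j. b j 0 = axis j 1" and le: "length I \<le> (\<Sum>j\<in>UNIV. \<beta> j)"
  shows "word_op b I (monomial_fun \<beta>) 0 \<noteq> 0 \<longleftrightarrow> length I = (\<Sum>j\<in>UNIV. \<beta> j) \<and> count_list I = \<beta>"
proof (cases "length I = (\<Sum>j\<in>UNIV. \<beta> j)")
  case True
  have "worder (\<lambda>_. 1) (length I) (monomial_fun \<beta>)" using worder_monomial_fun[of \<beta>] True by simp
  from word_op_leading[OF b this] show ?thesis using word_op_coordinate_monomial[OF True] True by simp
next
  case False
  have "word_op b I (monomial_fun \<beta>) 0 = 0"
    by (rule unit_weights.worder_imp_frame_order[OF unit_good_frame[of b, OF b] worder_monomial_fun])
       (use le False in \<open>simp add: sum_list_triv\<close>)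
  then show ?thesis using False by simp
qed

lemma wt_count_list: "wt w I = (\<Sum>j\<in>UNIV. w j * count_list I (j::'n::finite))"
proof (induction I)
  case (Cons i I)
  have "(\<Sum>j\<in>UNIV. w j * count_list (i # I) j) = (\<Sum>j\<in>UNIV. w j * count_list I j + (if j = i then w j else 0))"
    by (rule sum.cong) auto
  then show ?case using Cons by (simp add: sum.distrib)
qed simp

lemma length_count_list: "length I = (\<Sum>j\<in>UNIV. count_list I (j::'n::finite))"
  using wt_count_list[of "\<lambda>_. 1" I] by (simp add: sum_list_triv)

text \<open>The sorted word with letter multiplicities \<open>\<alpha>\<close>.
  \<open>Abs_multiset\<close> is meaningful for every \<open>\<alpha>\<close> because the index type
  is finite.\<close>

definition word_of :: "('n::{finite,linorder} \<Rightarrow> nat) \<Rightarrow> 'n list" where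
  "word_of \<alpha> = sorted_list_of_multiset (Abs_multiset \<alpha>)"

lemma count_word_of: "count_list (word_of \<alpha>) = \<alpha>"
proof
  fix i
  have "count (mset (word_of \<alpha>)) i = \<alpha> i" unfolding word_of_def by (simp add: count_Abs_multiset)
  then show "count_list (word_of \<alpha>) i = \<alpha> i" by (simp add: count_mset)
qed

lemma sorted_word_of:
  assumes "sorted I" shows "I = word_of (count_list I)"
proof -
  have "Abs_multiset (count_list I) = mset I" by (rule multiset_eqI) (simp add: count_mset count_Abs_multiset)
  then show ?thesis unfolding word_of_def using assms by (simp add: sorted_sort_id)
qed

definition (in weights) psi_indices :: "'n \<Rightarrow> ('n \<Rightarrow> nat) set" where
  "psi_indices k = {\<alpha>. (\<Sum>j\<in>UNIV. w j * \<alpha> j) < w k \<and> 2 \<le> (\<Sum>j\<in>UNIV. \<alpha> j)}"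

lemma (in weights) finite_psi_indices: "finite (psi_indices k)"
proof (rule finite_subset)
  show "psi_indices k \<subseteq> (UNIV \<rightarrow>\<^sub>E {..w k})"
  proof
    fix \<alpha> assume "\<alpha> \<in> psi_indices k"
    have "\<alpha> j \<le> w k" for j
    proof -
      have "\<alpha> j \<le> w j * \<alpha> j" using w_pos[of j] by simp
      also have "\<dots> \<le> (\<Sum>j\<in>UNIV. w j * \<alpha> j)" by (rule member_le_sum) auto
      finally show ?thesis using \<open>\<alpha> \<in> psi_indices k\<close> by (simp add: psi_indices_def)
    qed
    then show "\<alpha> \<in> (UNIV \<rightarrow>\<^sub>E {..w k})" by auto
  qed
qed (intro finite_PiE, auto)

context weights begin

lemma psi_hat_form_iff:
  "psi_hat_form w P \<longleftrightarrow> (\<exists>c. \<forall>k. (\<lambda>y. P y $ k) = (\<lambda>y. y $ k + (\<Sum>\<alpha>\<in>psi_indices k. c k \<alpha> * monomial_fun \<alpha> y)))"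
  unfolding psi_hat_form_def psi_indices_def monomial_fun_def by (simp add: fun_eq_iff) blast

lemma psi_hat_form_smooth:
  assumes "psi_hat_form w P" shows "smooth_around x P"
proof (rule smooth_around_vec)
  fix k
  obtain c where c: "\<And>k. (\<lambda>y. P y $ k) = (\<lambda>y. y $ k + (\<Sum>\<alpha>\<in>psi_indices k. c k \<alpha> * monomial_fun \<alpha> y))"
    using assms unfolding psi_hat_form_iff by blast
  show "smooth_around x (\<lambda>y. P y $ k)" unfolding c by (rule smooth_intros smooth_around_monomial_fun)+
qed

text \<open>All monomials in the correction have degree at least \<open>2\<close>, so the change of
  coordinates is tangent to the identity and preserves linear adaptedness.\<close>

lemma psi_hat_form_derivative:
  assumes "psi_hat_form w P" shows "P 0 = 0" "frechet_derivative P (at 0) v = v"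
proof -
  obtain c where c: "\<And>k. (\<lambda>y. P y $ k) = (\<lambda>y. y $ k + (\<Sum>\<alpha>\<in>psi_indices k. c k \<alpha> * monomial_fun \<alpha> y))"
    using assms unfolding psi_hat_form_iff by blast
  have wo: "worder (\<lambda>_. 1) 2 (monomial_fun \<alpha>)" if "\<alpha> \<in> psi_indices k" for \<alpha> k
    by (rule unit_weights.worder_mono[OF worder_monomial_fun]) (use that in \<open>simp add: psi_indices_def\<close>)
  have m0: "monomial_fun \<alpha> 0 = 0" if "\<alpha> \<in> psi_indices k" for \<alpha> k
    using unit_weights.worder_at_0[OF wo[OF that]] by simp
  have d0: "frechet_derivative (monomial_fun \<alpha>) (at 0) v = 0" if "\<alpha> \<in> psi_indices k" for \<alpha> k v
  proof -
    have "frechet_derivative (monomial_fun \<alpha>) (at 0) (axis j 1) = 0" for j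
      using unit_weights.worder_imp_frame_order[OF unit_good_coordinate_frame wo[OF that], of "[j]"] by (simp add: frame_op_def)
    then show ?thesis using linear_axis_expand[OF smooth_around_linear_frechet[OF smooth_around_monomial_fun[of 0 \<alpha>]], of v] by simp
  qed
  show "P 0 = 0"
  proof -
    have "P 0 $ k = 0" for k using fun_cong[OF c[of k], of 0] by (simp add: m0)
    then show ?thesis by (simp add: vec_eq_iff)
  qed
  have "frechet_derivative P (at 0) v $ k = v $ k" for k
  proof -
    have hd: "((\<lambda>y. y $ k + (\<Sum>\<alpha>\<in>psi_indices k. c k \<alpha> * monomial_fun \<alpha> y)) has_derivative
       (\<lambda>v. v $ k + (\<Sum>\<alpha>\<in>psi_indices k. c k \<alpha> * frechet_derivative (monomial_fun \<alpha>) (at 0) v))) (at 0)"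
      by (intro has_derivative_add has_derivative_sum has_derivative_mult_right bounded_linear.has_derivative[OF bounded_linear_vec_nth has_derivative_ident]
          smooth_around_has_derivative smooth_around_monomial_fun)
    have "frechet_derivative P (at 0) v $ k = frechet_derivative (\<lambda>y. P y $ k) (at 0) v"
      using frechet_vec_nth_vec[OF psi_hat_form_smooth[OF assms]] by simp
    then show ?thesis unfolding c frechet_derivativeI[OF hd] by (simp add: d0)
  qed
  then show "frechet_derivative P (at 0) v = v" by (simp add: vec_eq_iff)
qed

end

text \<open>It suffices to kill the sorted words, and the matrix of sorted words against monomials is
  triangular with nonzero diagonal.\<close>

theorem (in filtered_frame) psi_hat_ex1:
  assumes b0: "\<And>j. b j 0 = axis j 1"
  shows "\<exists>!P. psi_hat_form w P \<and> (\<forall>k I. wt w I < w k \<longrightarrow> word_op b I (\<lambda>x. P x $ k) 0 = 0)"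
proof -
  \<comment> \<open>Rows are sorted words, columns monomials, both indexed by exponents;
    \<open>\<rho>\<close> is the degree, which orders the system.\<close>
  define A where "A = (\<lambda>\<alpha> \<beta>. word_op b (word_of \<alpha>) (monomial_fun \<beta>) 0)"
  define \<rho> where "\<rho> = (\<lambda>\<alpha> :: 'n \<Rightarrow> nat. \<Sum>j\<in>UNIV. \<alpha> j)"
  have len: "length (word_of \<alpha>) = \<rho> \<alpha>" for \<alpha> unfolding \<rho>_def length_count_list count_word_of ..
  have wtw: "wt w (word_of \<alpha>) = (\<Sum>j\<in>UNIV. w j * \<alpha> j)" for \<alpha> unfolding wt_count_list count_word_of ..
  have tri: "A \<alpha> \<beta> = 0" if "\<rho> \<alpha> \<le> \<rho> \<beta>" "\<alpha> \<noteq> \<beta>" for \<alpha> \<beta>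
    using word_op_monomial[of b "word_of \<alpha>" \<beta>, OF b_smooth b0] that unfolding A_def count_word_of len \<rho>_def by blast
  have diag: "A \<alpha> \<alpha> \<noteq> 0" for \<alpha>
    using word_op_monomial[of b "word_of \<alpha>" \<alpha>, OF b_smooth b0] unfolding A_def count_word_of len \<rho>_def by blast
  have expand: "word_op b I (\<lambda>y. y $ k + (\<Sum>\<alpha>\<in>psi_indices k. c \<alpha> * monomial_fun \<alpha> y)) 0
      = word_op b I (\<lambda>y. y $ k) 0 + (\<Sum>\<alpha>\<in>psi_indices k. word_op b I (monomial_fun \<alpha>) 0 * c \<alpha>)" for I k c
  proof -
    have s: "smooth_around 0 (\<lambda>y. c \<alpha> * monomial_fun \<alpha> y)" for \<alpha> by (rule smooth_intros smooth_around_monomial_fun)+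
    have "word_op b I (\<lambda>y. y $ k + (\<Sum>\<alpha>\<in>psi_indices k. c \<alpha> * monomial_fun \<alpha> y)) 0
      = word_op b I (\<lambda>y. y $ k) 0 + word_op b I (\<lambda>y. \<Sum>\<alpha>\<in>psi_indices k. c \<alpha> * monomial_fun \<alpha> y) 0"
      by (rule eventually_nhds_x_imp_x[OF word_op_add[OF b_smooth]]) (rule smooth_intros s)+
    then show ?thesis unfolding word_op_sum[OF b_smooth s]
      by (simp add: word_op_cmult[OF b_smooth smooth_around_monomial_fun] mult.commute)
  qed
  show ?thesis
  proof (rule ex_ex1I)
    have "\<exists>c. \<forall>\<alpha>\<in>psi_indices k. (\<Sum>\<beta>\<in>psi_indices k. A \<alpha> \<beta> * c \<beta>) = - word_op b (word_of \<alpha>) (\<lambda>y. y $ k) 0" for k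
      by (rule triangular_system(1)[where \<rho>=\<rho>]) (auto simp: finite_psi_indices tri diag)
    then have "\<forall>k. \<exists>c. \<forall>\<alpha>\<in>psi_indices k. (\<Sum>\<beta>\<in>psi_indices k. A \<alpha> \<beta> * c \<beta>) = - word_op b (word_of \<alpha>) (\<lambda>y. y $ k) 0" by blast
    from choice[OF this] obtain c where c: "\<And>k \<alpha>. \<alpha> \<in> psi_indices k \<Longrightarrow> (\<Sum>\<beta>\<in>psi_indices k. A \<alpha> \<beta> * c k \<beta>) = - word_op b (word_of \<alpha>) (\<lambda>y. y $ k) 0" by blast
    define P where "P = (\<lambda>y. \<chi> k. y $ k + (\<Sum>\<alpha>\<in>psi_indices k. c k \<alpha> * monomial_fun \<alpha> y))"
    have Pf: "psi_hat_form w P" unfolding psi_hat_form_iff by (rule exI[of _ c]) (simp add: P_def)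
    have Pk: "(\<lambda>y. P y $ k) = (\<lambda>y. y $ k + (\<Sum>\<alpha>\<in>psi_indices k. c k \<alpha> * monomial_fun \<alpha> y))" for k by (simp add: P_def)
    have sP: "smooth_around 0 (\<lambda>y. P y $ k)" for k by (rule smooth_around_vec_nth[OF psi_hat_form_smooth[OF Pf]])
    have "word_op b I (\<lambda>x. P x $ k) 0 = 0" if "wt w I < w k" for k I
    proof (rule sorted_words_suffice[OF sP _ that])
      fix I assume I: "sorted I" "wt w I < w k"
      define \<alpha> where "\<alpha> = count_list I"
      have I\<alpha>: "I = word_of \<alpha>" unfolding \<alpha>_def by (rule sorted_word_of[OF I(1)])
      show "word_op b I (\<lambda>x. P x $ k) 0 = 0"
      proof (cases "2 \<le> \<rho> \<alpha>")
        case True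
        then have "\<alpha> \<in> psi_indices k" using I(2) unfolding I\<alpha> wtw by (simp add: psi_indices_def \<rho>_def)
        then show ?thesis unfolding Pk expand I\<alpha> using c[of \<alpha> k] by (simp add: A_def)
      next
        \<comment> \<open>Words of at most one letter have no coefficient to adjust. They are
          handled by the value and the derivative of \<open>P\<close> at \<open>0\<close>: a letter
          \<open>j\<close> with \<open>w j < w k\<close> differs from \<open>k\<close>.\<close>
        case False
        then have "length I \<le> 1" using len[of \<alpha>] I\<alpha> by simp
        then consider "I = []" | j where "I = [j]" by (cases I) auto
        then show ?thesis
        proof cases
          case 1 then show ?thesis using psi_hat_form_derivative(1)[OF Pf] by simp
        next
          case 2
          then have "j \<noteq> k" using I(2) by auto
          then show ?thesis using 2 psi_hat_form_derivative(2)[OF Pf] frechet_vec_nth_vec[OF psi_hat_form_smooth[OF Pf]] b0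
            by (simp add: frame_op_def axis_def)
        qed
      qed
    qed
    with Pf show "\<exists>P. psi_hat_form w P \<and> (\<forall>k I. wt w I < w k \<longrightarrow> word_op b I (\<lambda>x. P x $ k) 0 = 0)" by blast
  next
    fix P P'
    assume P: "psi_hat_form w P \<and> (\<forall>k I. wt w I < w k \<longrightarrow> word_op b I (\<lambda>x. P x $ k) 0 = 0)"
      and P': "psi_hat_form w P' \<and> (\<forall>k I. wt w I < w k \<longrightarrow> word_op b I (\<lambda>x. P' x $ k) 0 = 0)"
    obtain c where c: "\<And>k. (\<lambda>y. P y $ k) = (\<lambda>y. y $ k + (\<Sum>\<alpha>\<in>psi_indices k. c k \<alpha> * monomial_fun \<alpha> y))"
      using P unfolding psi_hat_form_iff by blast
    obtain c' where c': "\<And>k. (\<lambda>y. P' y $ k) = (\<lambda>y. y $ k + (\<Sum>\<alpha>\<in>psi_indices k. c' k \<alpha> * monomial_fun \<alpha> y))"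
      using P' unfolding psi_hat_form_iff by blast
    have "c k \<alpha> - c' k \<alpha> = 0" if "\<alpha> \<in> psi_indices k" for k \<alpha>
    proof (rule triangular_system(2)[where \<rho>=\<rho> and S="psi_indices k" and A=A and c="\<lambda>\<alpha>. c k \<alpha> - c' k \<alpha>"])
      fix \<alpha> assume \<alpha>: "\<alpha> \<in> psi_indices k"
      then have "wt w (word_of \<alpha>) < w k" unfolding wtw by (simp add: psi_indices_def)
      then have "word_op b (word_of \<alpha>) (\<lambda>x. P x $ k) 0 = 0" "word_op b (word_of \<alpha>) (\<lambda>x. P' x $ k) 0 = 0" using P P' by auto
      then show "(\<Sum>\<beta>\<in>psi_indices k. A \<alpha> \<beta> * (c k \<beta> - c' k \<beta>)) = 0"
        unfolding c c' expand by (simp add: A_def right_diff_distrib sum_subtractf)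
    qed (use that finite_psi_indices tri diag in auto)
    then have "(\<lambda>y. P y $ k) = (\<lambda>y. P' y $ k)" for k
      unfolding c c' by (intro ext arg_cong2[where f="(+)"] sum.cong refl) simp
    then show "P = P'" by (auto simp: fun_eq_iff vec_eq_iff)
  qed
qed

subsection \<open>Charts and frames on the manifold\<close>

lemma topological_chartD:
  assumes "topological_chart (U, \<kappa>)"
  shows "open U" "open (\<kappa> ` U)" "homeomorphism U (\<kappa> ` U) \<kappa> (inv_into U \<kappa>)" "inj_on \<kappa> U" "continuous_on U \<kappa>"
proof -
  show h: "open U" "open (\<kappa> ` U)" "homeomorphism U (\<kappa> ` U) \<kappa> (inv_into U \<kappa>)" using assms by (auto simp: topological_chart_def)
  then show "inj_on \<kappa> U" "continuous_on U \<kappa>" unfolding homeomorphism_def by (auto intro: inj_on_inverseI)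
qed

lemma chart_open_image:
  assumes "topological_chart (U, \<kappa>)" "open S" "S \<subseteq> U"
  shows "open (\<kappa> ` S)"
proof -
  note c = topological_chartD[OF assms(1)]
  have "openin (top_of_set U) S" using assms c(1) by (simp add: openin_open_eq)
  from homeomorphism_imp_open_map[OF c(3) this] show ?thesis using c(2) openin_open_trans by blast
qed

lemma eventually_chart_image:
  assumes "topological_chart (U, \<kappa>)" "p \<in> U" "\<forall>\<^sub>F q in nhds p. P q"
  shows "\<forall>\<^sub>F x in nhds (\<kappa> p). P (inv_into U \<kappa> x) \<and> inv_into U \<kappa> x \<in> U \<and> \<kappa> (inv_into U \<kappa> x) = x"
proof -
  note c = topological_chartD[OF assms(1)]
  obtain S where S: "open S" "p \<in> S" "\<And>q. q \<in> S \<Longrightarrow> P q" using assms(3) unfolding eventually_nhds by blast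
  have o: "open (\<kappa> ` (S \<inter> U))" using S c(1) by (intro chart_open_image[OF assms(1)]) auto
  show ?thesis
  proof (rule eventually_mono[OF eventually_nhds_in_open[OF o]])
    show "\<kappa> p \<in> \<kappa> ` (S \<inter> U)" using S assms by auto
    fix x assume "x \<in> \<kappa> ` (S \<inter> U)"
    then obtain q where "q \<in> S" "q \<in> U" "x = \<kappa> q" by auto
    then show "P (inv_into U \<kappa> x) \<and> inv_into U \<kappa> x \<in> U \<and> \<kappa> (inv_into U \<kappa> x) = x"
      using S(3) c(4) by simp
  qed
qed

lemma chartsD:
  assumes "(U, \<kappa>) \<in> charts A"
  shows "topological_chart (U, \<kappa>)" "d \<in> A \<Longrightarrow> smoothly_compatible (U, \<kappa>) d"
  using assms by (auto simp: charts_def)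

lemma smoothly_compatibleD:
  assumes "smoothly_compatible (U, \<kappa>) (V, \<mu>)" "topological_chart (U, \<kappa>)" "topological_chart (V, \<mu>)" "p \<in> U" "p \<in> V"
  shows "smooth_around (\<kappa> p) (\<mu> \<circ> inv_into U \<kappa>)" "smooth_around (\<mu> p) (\<kappa> \<circ> inv_into V \<mu>)"
proof -
  have o: "open (U \<inter> V)" using topological_chartD(1)[OF assms(2)] topological_chartD(1)[OF assms(3)] by auto
  have "smooth_on (\<kappa> ` (U \<inter> V)) (\<mu> \<circ> inv_into U \<kappa>)" "smooth_on (\<mu> ` (U \<inter> V)) (\<kappa> \<circ> inv_into V \<mu>)"
    using assms(1) by (auto simp: smoothly_compatible_def)
  moreover have "open (\<kappa> ` (U \<inter> V))" by (rule chart_open_image[OF assms(2) o]) auto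
  moreover have "open (\<mu> ` (U \<inter> V))" by (rule chart_open_image[OF assms(3) o]) auto
  ultimately show "smooth_around (\<kappa> p) (\<mu> \<circ> inv_into U \<kappa>)" "smooth_around (\<mu> p) (\<kappa> \<circ> inv_into V \<mu>)"
    using assms(4,5) by (simp_all add: smooth_on_iff)
qed

lemma smooth_atlasE:
  assumes "smooth_atlas A"
  obtains C \<xi> where "(C, \<xi>) \<in> A" "p \<in> C" "topological_chart (C, \<xi>)"
proof -
  have "p \<in> (\<Union>c\<in>A. fst c)" using assms by (simp add: smooth_atlas_def)
  then obtain c where "c \<in> A" "p \<in> fst c" by blast
  then show thesis using assms that[of "fst c" "snd c"] by (auto simp: smooth_atlas_def)
qed

lemma smooth_change_of_chart:
  assumes V: "topological_chart (V, \<mu>)" "p \<in> V" and U: "topological_chart (U, \<kappa>)" "p \<in> U"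
    and f: "smooth_around (\<mu> p) (f \<circ> inv_into V \<mu>)" and t: "smooth_around (\<kappa> p) (\<mu> \<circ> inv_into U \<kappa>)"
  shows "smooth_around (\<kappa> p) (f \<circ> inv_into U \<kappa>)"
proof -
  have p: "inv_into U \<kappa> (\<kappa> p) = p" using topological_chartD(4)[OF U(1)] U(2) by simp
  have "smooth_around (\<kappa> p) (\<lambda>x. (f \<circ> inv_into V \<mu>) ((\<mu> \<circ> inv_into U \<kappa>) x))"
    by (rule smooth_around_compose[where g="f \<circ> inv_into V \<mu>", OF t]) (unfold o_apply[of \<mu>] p, rule f)
  moreover have "\<forall>\<^sub>F x in nhds (\<kappa> p). (f \<circ> inv_into V \<mu>) ((\<mu> \<circ> inv_into U \<kappa>) x) = (f \<circ> inv_into U \<kappa>) x"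
    using eventually_chart_image[OF U eventually_nhds_in_open[OF topological_chartD(1)[OF V(1)] V(2)]]
    by eventually_elim (use topological_chartD(4)[OF V(1)] in simp)
  ultimately show ?thesis by (rule smooth_around_cong[rotated])
qed

text \<open>Compatibility of a chart is only required with the members of \<open>A\<close>, so two
  charts are compared through a member of \<open>A\<close> around \<open>p\<close>.\<close>

lemma chart_transition:
  assumes A: "smooth_atlas A" and U: "(U, \<kappa>) \<in> charts A" "p \<in> U" and V: "(V, \<mu>) \<in> charts A" "p \<in> V"
  shows "smooth_around (\<kappa> p) (\<mu> \<circ> inv_into U \<kappa>)"
proof -
  obtain C \<xi> where C: "(C, \<xi>) \<in> A" "p \<in> C" "topological_chart (C, \<xi>)" by (rule smooth_atlasE[OF A])
  note tU = chartsD(1)[OF U(1)] and tV = chartsD(1)[OF V(1)]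
  show ?thesis
    by (rule smooth_change_of_chart[OF C(3,2) tU U(2)
        smoothly_compatibleD(2)[OF chartsD(2)[OF V(1) C(1)] tV C(3) V(2) C(2)]
        smoothly_compatibleD(1)[OF chartsD(2)[OF U(1) C(1)] tU C(3) U(2) C(2)]])
qed

lemma chart_compose:
  assumes A: "smooth_atlas A" and U: "(U, \<kappa>) \<in> charts A" and W: "open W" "W \<subseteq> \<kappa> ` U" and V: "open V"
    and hom: "homeomorphism W V g h" and g: "\<And>x. x \<in> W \<Longrightarrow> smooth_around x g" and h: "\<And>y. y \<in> V \<Longrightarrow> smooth_around y h"
    and U': "U' = {p \<in> U. \<kappa> p \<in> W}" and \<phi>: "\<And>p. p \<in> U' \<Longrightarrow> \<phi> p = g (\<kappa> p)"
  shows "(U', \<phi>) \<in> charts A"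
proof -
  note tU = chartsD(1)[OF U]
  note c = topological_chartD[OF tU]
  have hg: "h (g x) = x" if "x \<in> W" for x using hom that by (simp add: homeomorphism_def)
  have gh: "g (h y) = y" "h y \<in> W" if "y \<in> V" for y using hom that by (auto simp: homeomorphism_def)
  have gW: "g ` W = V" using hom by (simp add: homeomorphism_def)
  have U'D: "p \<in> U" "\<kappa> p \<in> W" if "p \<in> U'" for p using that U' by auto
  have h\<phi>: "h (\<phi> p) = \<kappa> p" if "p \<in> U'" for p unfolding \<phi>[OF that] by (rule hg[OF U'D(2)[OF that]])
  have oU': "open U'"
  proof -
    have "U' = U \<inter> \<kappa> -` W" using U' by auto
    then show ?thesis using continuous_open_preimage[OF c(5,1) W(1)] by simp
  qed
  have kU': "\<kappa> ` U' = W" using W(2) U' by auto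
  have im: "\<phi> ` U' = V"
  proof -
    have "\<phi> ` U' = g ` (\<kappa> ` U')" unfolding image_image by (rule image_cong[OF refl \<phi>])
    then show ?thesis unfolding kU' gW .
  qed
  have inj: "inj_on \<phi> U'"
  proof (rule inj_onI)
    fix p q assume pq: "p \<in> U'" "q \<in> U'" "\<phi> p = \<phi> q"
    then have "\<kappa> p = \<kappa> q" using h\<phi>[OF pq(1)] h\<phi>[OF pq(2)] by simp
    then show "p = q" using inj_onD[OF c(4) _ U'D(1)[OF pq(1)] U'D(1)[OF pq(2)]] by blast
  qed
  have inv: "inv_into U' \<phi> y = inv_into U \<kappa> (h y)" if y: "y \<in> V" for y
  proof -
    obtain p where p: "p \<in> U'" "y = \<phi> p" using y unfolding im[symmetric] by blast
    have "inv_into U' \<phi> y = p" unfolding p(2) by (rule inv_into_f_f[OF inj p(1)])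
    moreover have "inv_into U \<kappa> (h y) = p" unfolding p(2) h\<phi>[OF p(1)] by (rule inv_into_f_f[OF c(4) U'D(1)[OF p(1)]])
    ultimately show ?thesis by simp
  qed
  have hc: "continuous_on V h" "continuous_on W g" using hom by (simp_all add: homeomorphism_def)
  have ic: "continuous_on (\<kappa> ` U) (inv_into U \<kappa>)" using c(3) by (simp add: homeomorphism_def)
  have top: "topological_chart (U', \<phi>)"
    unfolding topological_chart_def prod.case im
  proof (intro conjI oU' V)
    show "homeomorphism U' V \<phi> (inv_into U' \<phi>)"
      unfolding homeomorphism_def
    proof (intro conjI ballI im)
      show "continuous_on U' \<phi>"
      proof (rule continuous_on_eq)
        have "continuous_on U' \<kappa>" by (rule continuous_on_subset[OF c(5)]) (use U'D in blast)
        then show "continuous_on U' (\<lambda>p. g (\<kappa> p))" by (rule continuous_on_compose2[OF hc(2)]) (use U'D in blast)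
      qed (rule \<phi>[symmetric])
      show "continuous_on V (inv_into U' \<phi>)"
      proof (rule continuous_on_eq)
        show "continuous_on V (\<lambda>y. inv_into U \<kappa> (h y))"
          by (rule continuous_on_compose2[OF ic hc(1)]) (use gh(2) W(2) in blast)
      qed (rule inv[symmetric])
      show "inv_into U' \<phi> ` V = U'" unfolding im[symmetric] using inj by (simp add: inv_into_image_cancel)
      fix p assume "p \<in> U'" then show "inv_into U' \<phi> (\<phi> p) = p" using inj by simp
    next
      fix y assume "y \<in> V" then show "\<phi> (inv_into U' \<phi> y) = y" using im by (metis f_inv_into_f)
    qed
  qed
  have "smoothly_compatible (U', \<phi>) d" if dA: "d \<in> A" for d
  proof -
    obtain D \<delta> where d: "d = (D, \<delta>)" by (cases d)
    have tD: "topological_chart (D, \<delta>)" using A dA d by (auto simp: smooth_atlas_def)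
    have oD: "open D" by (rule topological_chartD(1)[OF tD])
    have o: "open (U' \<inter> D)" using oU' oD by auto
    have o1: "open (\<phi> ` (U' \<inter> D))" by (rule chart_open_image[OF top o]) auto
    have o2: "open (\<delta> ` (U' \<inter> D))" by (rule chart_open_image[OF tD o]) auto
    have "smooth_around (\<phi> p) (\<delta> \<circ> inv_into U' \<phi>) \<and> smooth_around (\<delta> p) (\<phi> \<circ> inv_into D \<delta>)" if p: "p \<in> U'" "p \<in> D" for p
    proof
      note pU = U'D[OF p(1)]
      note cmp = smoothly_compatibleD[OF chartsD(2)[OF U dA, unfolded d] tU tD pU(1) p(2)]
      have fpV: "\<phi> p \<in> V" using im p by blast
      note hp = h\<phi>[OF p(1)]
      have "smooth_around (\<phi> p) (\<lambda>y. (\<delta> \<circ> inv_into U \<kappa>) (h y))"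
        by (rule smooth_around_compose[where g="\<delta> \<circ> inv_into U \<kappa>", OF h[OF fpV]]) (unfold hp, rule cmp(1))
      moreover have "\<forall>\<^sub>F y in nhds (\<phi> p). (\<delta> \<circ> inv_into U \<kappa>) (h y) = (\<delta> \<circ> inv_into U' \<phi>) y"
        by (rule eventually_mono[OF eventually_nhds_in_open[OF V fpV]]) (simp only: o_apply inv)
      ultimately show "smooth_around (\<phi> p) (\<delta> \<circ> inv_into U' \<phi>)" by (rule smooth_around_cong[rotated])
      have dp: "inv_into D \<delta> (\<delta> p) = p" using topological_chartD(4)[OF tD] p by simp
      have "smooth_around (\<delta> p) (\<lambda>x. g ((\<kappa> \<circ> inv_into D \<delta>) x))"
        by (rule smooth_around_compose[where g=g, OF cmp(2)]) (unfold o_apply dp, rule g[OF pU(2)])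
      moreover have "\<forall>\<^sub>F x in nhds (\<delta> p). g ((\<kappa> \<circ> inv_into D \<delta>) x) = (\<phi> \<circ> inv_into D \<delta>) x"
        using eventually_chart_image[OF tD p(2) eventually_nhds_in_open[OF oU' p(1)]]
        by eventually_elim (simp only: o_apply \<phi>)
      ultimately show "smooth_around (\<delta> p) (\<phi> \<circ> inv_into D \<delta>)" by (rule smooth_around_cong[rotated])
    qed
    then show ?thesis unfolding d smoothly_compatible_def prod.case
      by (auto simp: smooth_on_iff[OF o1] smooth_on_iff[OF o2])
  qed
  with top show ?thesis by (simp add: charts_def)
qed

lemma chart_restrict:
  assumes A: "smooth_atlas A" and U: "(U, \<kappa>) \<in> charts A" and S: "open S" "S \<subseteq> U" and "\<And>p. p \<in> S \<Longrightarrow> \<phi> p = \<kappa> p"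
  shows "(S, \<phi>) \<in> charts A"
proof (rule chart_compose[OF A U, where W="\<kappa> ` S" and V="\<kappa> ` S" and g="\<lambda>x. x" and h="\<lambda>x. x"])
  note c = topological_chartD[OF chartsD(1)[OF U]]
  show "open (\<kappa> ` S)" by (rule chart_open_image[OF chartsD(1)[OF U] S])
  then show "open (\<kappa> ` S)" .
  show "S = {p \<in> U. \<kappa> p \<in> \<kappa> ` S}" using S c(4) by (auto dest: inj_onD)
qed (use S assms(5) in \<open>auto simp: homeomorphism_def\<close>)

lemma local_chart_compose:
  assumes A: "smooth_atlas A" and \<kappa>: "local_chart A a \<kappa>"
    and g: "smooth_around (\<kappa> a) g" "inj (frechet_derivative g (at (\<kappa> a)))"
    and \<phi>: "\<forall>\<^sub>F p in nhds a. \<phi> p = g (\<kappa> p)"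
  shows "local_chart A a \<phi>"
proof -
  obtain U where U: "a \<in> U" "(U, \<kappa>) \<in> charts A" using \<kappa> by (auto simp: local_chart_def)
  note tU = chartsD(1)[OF U(2)]
  note c = topological_chartD[OF tU]
  obtain S where S: "open S" "a \<in> S" "\<And>p. p \<in> S \<Longrightarrow> \<phi> p = g (\<kappa> p)" using \<phi> unfolding eventually_nhds by blast
  obtain U1 V1 h where UV: "open U1" "\<kappa> a \<in> U1" "open V1" "g (\<kappa> a) \<in> V1" "homeomorphism U1 V1 g h"
    and sm: "\<And>x. x \<in> U1 \<Longrightarrow> smooth_around x g" "\<And>y. y \<in> V1 \<Longrightarrow> smooth_around y h"
    by (rule smooth_inverse_function[OF g]) blast
  define W where "W = U1 \<inter> \<kappa> ` (U \<inter> S)"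
  have o: "open (\<kappa> ` (U \<inter> S))" using c(1) S(1) by (intro chart_open_image[OF tU]) auto
  have oW: "open W" unfolding W_def using UV(1) o by auto
  have oV: "open (g ` W)"
  proof -
    have "openin (top_of_set U1) W" using oW UV(1) by (auto simp: W_def openin_open_eq)
    from homeomorphism_imp_open_map[OF UV(5) this] show ?thesis using UV(3) openin_open_trans by blast
  qed
  have hom: "homeomorphism W (g ` W) g h"
    by (rule homeomorphism_of_subsets[OF UV(5)]) (auto simp: W_def)
  have gV: "g ` W \<subseteq> V1" using UV(5) by (auto simp: W_def homeomorphism_def)
  have "({p \<in> U. \<kappa> p \<in> W}, \<phi>) \<in> charts A"
  proof (rule chart_compose[OF A U(2) oW _ oV hom])
    show "W \<subseteq> \<kappa> ` U" by (auto simp: W_def)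
    fix p assume "p \<in> {p \<in> U. \<kappa> p \<in> W}"
    then obtain q where "p \<in> U" "q \<in> U" "q \<in> S" "\<kappa> p = \<kappa> q" by (auto simp: W_def)
    then have "p \<in> S" using c(4) by (auto dest: inj_onD)
    then show "\<phi> p = g (\<kappa> p)" by (rule S(3))
  next
    fix y assume "y \<in> g ` W"
    then have "y \<in> V1" using gV by blast
    then show "smooth_around y h" by (rule sm(2))
  next
    fix x assume "x \<in> W"
    then show "smooth_around x g" by (intro sm(1)) (simp add: W_def)
  qed simp
  moreover have "a \<in> {p \<in> U. \<kappa> p \<in> W}" using U(1) UV(2) S(2) by (auto simp: W_def)
  ultimately show ?thesis unfolding local_chart_def by (intro exI[of _ "{p \<in> U. \<kappa> p \<in> W}"] conjI)
qed

text \<open>\<open>smooth_near\<close> asks for smoothness on the whole image of some chart, which a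
  condition at one point provides after shrinking the domain of \<open>\<kappa>\<close>.\<close>

lemma smooth_near_iff:
  assumes A: "smooth_atlas A" and U: "(U, \<kappa>) \<in> charts A" "p \<in> U"
  shows "smooth_near A p f \<longleftrightarrow> smooth_around (\<kappa> p) (f \<circ> inv_into U \<kappa>)"
proof
  assume "smooth_near A p f"
  then obtain V \<mu> where V: "(V, \<mu>) \<in> charts A" "p \<in> V" "smooth_on (\<mu> ` V) (f \<circ> inv_into V \<mu>)"
    by (auto simp: smooth_near_def)
  note tV = chartsD(1)[OF V(1)]
  have "smooth_around (\<mu> p) (f \<circ> inv_into V \<mu>)"
    using V(2,3) smooth_on_iff[OF topological_chartD(2)[OF tV]] by blast
  then show "smooth_around (\<kappa> p) (f \<circ> inv_into U \<kappa>)"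
    by (rule smooth_change_of_chart[OF tV V(2) chartsD(1)[OF U(1)] U(2) _ chart_transition[OF A U V(1,2)]])
next
  assume f: "smooth_around (\<kappa> p) (f \<circ> inv_into U \<kappa>)"
  note tU = chartsD(1)[OF U(1)]
  note c = topological_chartD[OF tU]
  obtain W where W: "open W" "\<kappa> p \<in> W" "\<And>x. x \<in> W \<Longrightarrow> smooth_around x (f \<circ> inv_into U \<kappa>)"
    using smooth_around_eventually[OF f] unfolding eventually_nhds by blast
  define S where "S = U \<inter> \<kappa> -` W"
  have oS: "open S" unfolding S_def by (rule continuous_open_preimage[OF c(5,1) W(1)])
  have ch: "(S, \<kappa>) \<in> charts A" by (rule chart_restrict[OF A U(1) oS]) (auto simp: S_def)
  have oi: "open (\<kappa> ` S)" by (rule topological_chartD(2)[OF chartsD(1)[OF ch]])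
  have "smooth_on (\<kappa> ` S) (f \<circ> inv_into S \<kappa>)"
    unfolding smooth_on_iff[OF oi]
  proof
    fix x assume x: "x \<in> \<kappa> ` S"
    then have "smooth_around x (f \<circ> inv_into U \<kappa>)" using W(3) by (auto simp: S_def)
    moreover have "\<forall>\<^sub>F y in nhds x. (f \<circ> inv_into U \<kappa>) y = (f \<circ> inv_into S \<kappa>) y"
    proof (rule eventually_mono[OF eventually_nhds_in_open[OF oi x]])
      fix y assume "y \<in> \<kappa> ` S"
      then obtain q where "q \<in> S" "y = \<kappa> q" by auto
      then show "(f \<circ> inv_into U \<kappa>) y = (f \<circ> inv_into S \<kappa>) y"
        using c(4) inj_on_subset[OF c(4), of S] by (auto simp: S_def)
    qed
    ultimately show "smooth_around x (f \<circ> inv_into S \<kappa>)" by (rule smooth_around_cong[rotated])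
  qed
  moreover have "p \<in> S" using U(2) W(2) by (simp add: S_def)
  ultimately show "smooth_near A p f" unfolding smooth_near_def by (intro bexI[OF _ ch]) (simp only: prod.case simp_thms)
qed

lemma smooth_near_coordinate:
  assumes A: "smooth_atlas A" and U: "(U, \<kappa>) \<in> charts A" "p \<in> U"
  shows "smooth_near A p (\<lambda>q. \<kappa> q $ k)"
proof -
  note tU = chartsD(1)[OF U(1)]
  have "\<forall>\<^sub>F x in nhds (\<kappa> p). x $ k = ((\<lambda>q. \<kappa> q $ k) \<circ> inv_into U \<kappa>) x"
    using eventually_chart_image[OF tU U(2), of "\<lambda>_. True"] by (auto elim: eventually_mono)
  from smooth_around_cong[OF this smooth_around_vec_nth[OF smooth_around_ident]] show ?thesis
    unfolding smooth_near_iff[OF A U] .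
qed

text \<open>The vector \<open>u\<close> that represents \<open>v\<close> in one chart is carried to
  another chart by the differential of the transition map, and applying \<open>v\<close> to the
  coordinate functions identifies the result with the components. So \<open>v\<close> is determined
  by its components in any chart.\<close>

lemma tangent_space_eval:
  assumes A: "smooth_atlas A" and U: "(U, \<phi>) \<in> charts A" "p \<in> U" and v: "v \<in> tangent_space A p"
  shows "v f = (if smooth_near A p f then frechet_derivative (f \<circ> inv_into U \<phi>) (at (\<phi> p)) (components \<phi> v) else 0)"
proof -
  obtain V \<mu> u where V: "(V, \<mu>) \<in> charts A" "p \<in> V"
    and u: "\<And>f. v f = (if smooth_near A p f then frechet_derivative (f \<circ> inv_into V \<mu>) (at (\<mu> p)) u else 0)"
    using v unfolding tangent_space_def by blast
  note tU = chartsD(1)[OF U(1)] and tV = chartsD(1)[OF V(1)]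
  let ?t = "\<phi> \<circ> inv_into V \<mu>"
  have st: "smooth_around (\<mu> p) ?t" by (rule chart_transition[OF A V U])
  have tp: "?t (\<mu> p) = \<phi> p" using topological_chartD(4)[OF tV] V(2) by simp
  have ev: "frechet_derivative (f \<circ> inv_into V \<mu>) (at (\<mu> p)) u = frechet_derivative (f \<circ> inv_into U \<phi>) (at (\<phi> p)) (frechet_derivative ?t (at (\<mu> p)) u)"
    if f: "smooth_near A p f" for f
  proof -
    have sf: "smooth_around (\<phi> p) (f \<circ> inv_into U \<phi>)" using f smooth_near_iff[OF A U] by blast
    have "\<forall>\<^sub>F x in nhds (\<mu> p). (f \<circ> inv_into V \<mu>) x = (f \<circ> inv_into U \<phi>) (?t x)"
      using eventually_chart_image[OF tV V(2) eventually_nhds_in_open[OF topological_chartD(1)[OF tU] U(2)]]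
      by eventually_elim (use topological_chartD(4)[OF tU] in simp)
    from fun_cong[OF frechet_derivative_cong_nhds[OF this]]
    show ?thesis by (rule trans[OF _ frechet_derivative_compose_smooth[OF st sf[folded tp], of u, unfolded tp]])
  qed
  have "components \<phi> v = frechet_derivative ?t (at (\<mu> p)) u"
    unfolding components_def vec_eq_iff vec_lambda_beta
  proof
    fix k
    have "((\<lambda>q. \<phi> q $ k) \<circ> inv_into V \<mu>) = (\<lambda>x. ?t x $ k)" by auto
    then show "v (\<lambda>p. \<phi> p $ k) = frechet_derivative ?t (at (\<mu> p)) u $ k"
      unfolding u using smooth_near_coordinate[OF A U] frechet_vec_nth_vec[OF st] by simp
  qed
  then show ?thesis unfolding u using ev by simp
qed

text \<open>A chart centred at \<open>a\<close> on whose domain the fields are a smooth frame; it is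
  the interface through which statements about the manifold become statements about the fields
  \<open>b j\<close> near \<open>0\<close>.\<close>

locale framed_chart =
  fixes A :: "('m::{t2_space, second_countable_topology}, 'n::{finite, linorder}) chart set"
    and X :: "'n::{finite, linorder} \<Rightarrow> 'm::{t2_space, second_countable_topology} vfield"
    and a :: "'m::{t2_space, second_countable_topology}"
    and U :: "'m::{t2_space, second_countable_topology} set"
    and \<phi> :: "'m::{t2_space, second_countable_topology} \<Rightarrow> (real, 'n::{finite, linorder}) vec"
  assumes atlas: "smooth_atlas A" and chart: "(U, \<phi>) \<in> charts A" and a: "a \<in> U" and \<phi>a: "\<phi> a = 0"
    and tangent: "p \<in> U \<Longrightarrow> X j p \<in> tangent_space A p"
    and smooth_field: "p \<in> U \<Longrightarrow> smooth_near A p f \<Longrightarrow> smooth_near A p (\<lambda>q. X j q f)"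
    and basis: "p \<in> U \<Longrightarrow> is_basis UNIV (\<lambda>j. X j p) (tangent_space A p)"
begin

abbreviation \<psi> :: "(real, 'n) vec \<Rightarrow> 'm" where "\<psi> \<equiv> inv_into U \<phi>"

definition b :: "'n \<Rightarrow> (real, 'n) vec \<Rightarrow> (real, 'n) vec" where "b j = field_in_chart (U, \<phi>) (X j)"

lemma b_eq: "b j x = components \<phi> (X j (\<psi> x))"
  by (simp add: b_def field_in_chart_def)

lemma top: "topological_chart (U, \<phi>)" by (rule chartsD(1)[OF chart])

lemma \<psi>\<phi>: "p \<in> U \<Longrightarrow> \<psi> (\<phi> p) = p" using topological_chartD(4)[OF top] by simp

lemma \<psi>0: "\<psi> 0 = a" using \<psi>\<phi>[OF a] \<phi>a by simp

lemma near0: "\<forall>\<^sub>F p in nhds a. P p \<Longrightarrow> \<forall>\<^sub>F x in nhds 0. P (\<psi> x) \<and> \<psi> x \<in> U \<and> \<phi> (\<psi> x) = x"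
  using eventually_chart_image[OF top a, of P] \<phi>a by simp

lemma near_iff: "p \<in> U \<Longrightarrow> smooth_near A p f \<longleftrightarrow> smooth_around (\<phi> p) (f \<circ> \<psi>)"
  by (rule smooth_near_iff[OF atlas chart])

lemma near_iff_a: "smooth_near A a f \<longleftrightarrow> smooth_around 0 (f \<circ> \<psi>)"
  using near_iff[OF a] \<phi>a by simp

lemma coordinate_near: "p \<in> U \<Longrightarrow> smooth_near A p (\<lambda>q. \<phi> q $ k)"
  by (rule smooth_near_coordinate[OF atlas chart])

lemma tangent_eval: "p \<in> U \<Longrightarrow> v \<in> tangent_space A p \<Longrightarrow>
    v f = (if smooth_near A p f then frechet_derivative (f \<circ> \<psi>) (at (\<phi> p)) (components \<phi> v) else 0)"
  by (rule tangent_space_eval[OF atlas chart])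

lemma X_eval: "p \<in> U \<Longrightarrow> X j p f = (if smooth_near A p f then frechet_derivative (f \<circ> \<psi>) (at (\<phi> p)) (b j (\<phi> p)) else 0)"
  using tangent_eval[OF _ tangent] by (simp add: b_eq \<psi>\<phi>)

lemma b_smooth_at:
  assumes "p \<in> U" shows "smooth_around (\<phi> p) (b j)"
proof (rule smooth_around_vec)
  fix k
  have "smooth_around (\<phi> p) ((\<lambda>q. X j q (\<lambda>q. \<phi> q $ k)) \<circ> \<psi>)"
    using smooth_field[OF assms coordinate_near[OF assms]] near_iff[OF assms] by blast
  moreover have "((\<lambda>q. X j q (\<lambda>q. \<phi> q $ k)) \<circ> \<psi>) = (\<lambda>x. b j x $ k)"
    by (auto simp: b_eq components_def)
  ultimately show "smooth_around (\<phi> p) (\<lambda>x. b j x $ k)" by simp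
qed

lemma b_smooth: "smooth_around 0 (b j)"
  using b_smooth_at[OF a] \<phi>a by simp

lemma frame_word_eval:
  assumes f: "smooth_near A a f"
  shows "\<forall>\<^sub>F x in nhds 0. frame_word X I f (\<psi> x) = word_op b I (f \<circ> \<psi>) x"
proof (induction I)
  case Nil then show ?case by (simp add: frame_word_def)
next
  case (Cons i I)
  let ?g = "frame_word X I f" and ?h = "word_op b I (f \<circ> \<psi>)"
  have sh: "smooth_around 0 ?h" by (rule smooth_around_word_op[where b=b, OF b_smooth]) (use f near_iff_a in simp)
  have ev: "\<forall>\<^sub>F x in nhds 0. \<forall>\<^sub>F y in nhds x. ?h y = (?g \<circ> \<psi>) y"
    unfolding eventually_eventually
    by (rule eventually_mono[OF Cons]) (unfold o_apply[of "frame_word X I f"], rule sym)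
  show ?case
    using ev smooth_around_eventually[OF sh] near0[of "\<lambda>_. True", simplified]
  proof eventually_elim
    case (elim x)
    have sx: "smooth_around x (?g \<circ> \<psi>)" by (rule smooth_around_cong[OF elim(1,2)])
    \<comment> \<open>Tangent vectors are set to \<open>0\<close> on functions that are not smooth
      near the point, so smoothness of the inner word has to be known at each
      \<open>\<psi> x\<close>, not only at \<open>a\<close>.\<close>
    have near: "smooth_near A (\<psi> x) ?g" using near_iff[of "\<psi> x" ?g] elim(3) sx by simp
    have "frame_word X (i # I) f (\<psi> x) = X i (\<psi> x) ?g" by (simp add: frame_word_def)
    also have "\<dots> = frechet_derivative (?g \<circ> \<psi>) (at x) (b i x)"
      using X_eval[of "\<psi> x" i ?g] near elim(3) by simp
    also have "\<dots> = frechet_derivative ?h (at x) (b i x)"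
      by (rule fun_cong[OF frechet_derivative_cong_nhds[OF elim(1)], symmetric])
    finally show ?case unfolding word_op_Cons frame_op_def .
  qed
qed

lemma frame_word_at: "smooth_near A a f \<Longrightarrow> frame_word X I f a = word_op b I (f \<circ> \<psi>) 0"
  using eventually_nhds_x_imp_x[OF frame_word_eval] \<psi>0 by simp

lemma frame_word_coordinate: "frame_word X I (\<lambda>p. \<phi> p $ k) a = word_op b I (\<lambda>x. x $ k) 0"
proof -
  have "\<forall>\<^sub>F x in nhds 0. ((\<lambda>p. \<phi> p $ k) \<circ> \<psi>) x = x $ k"
    using near0[of "\<lambda>_. True", simplified] by eventually_elim simp
  from eventually_nhds_x_imp_x[OF word_op_cong[OF this]] show ?thesis
    by (rule trans[OF frame_word_at[OF coordinate_near[OF a]]])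
qed

lemma components_at: "components \<phi> (X j a) = b j 0"
  by (simp add: b_eq \<psi>0)

lemma combination_eval:
  assumes "p \<in> U"
  shows "(\<Sum>j\<in>UNIV. c j * X j p f) = (if smooth_near A p f then frechet_derivative (f \<circ> \<psi>) (at (\<phi> p)) (\<Sum>j\<in>UNIV. c j *\<^sub>R b j (\<phi> p)) else 0)"
proof (cases "smooth_near A p f")
  case True
  then have "linear (frechet_derivative (f \<circ> \<psi>) (at (\<phi> p)))" using near_iff[OF assms] smooth_around_linear_frechet by blast
  then show ?thesis using True by (simp add: X_eval[OF assms] linear_sum linear_scale)
qed (simp add: X_eval[OF assms])

lemma b_independent:
  assumes p: "p \<in> U" and z: "(\<Sum>j\<in>UNIV. c j *\<^sub>R b j (\<phi> p)) = 0" shows "c j = 0"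
proof -
  have "\<forall>f. (\<Sum>j\<in>UNIV. c j * X j p f) = 0"
  proof
    fix f
    show "(\<Sum>j\<in>UNIV. c j * X j p f) = 0"
    proof (cases "smooth_near A p f")
      case True
      then have "linear (frechet_derivative (f \<circ> \<psi>) (at (\<phi> p)))" using near_iff[OF p] smooth_around_linear_frechet by blast
      then show ?thesis unfolding combination_eval[OF p] z by (simp add: linear_0)
    next
      case False then show ?thesis unfolding combination_eval[OF p] by simp
    qed
  qed
  then show ?thesis using basis[OF p] unfolding is_basis_def by blast
qed

definition B :: "(real, 'n) vec \<Rightarrow> ((real, 'n) vec, 'n) vec" where "B x = (\<chi> i j. b j x $ i)"

lemma B_mult: "B x *v c = (\<Sum>j\<in>UNIV. c $ j *\<^sub>R b j x)"
  by (simp add: B_def matrix_vector_mult_def vec_eq_iff mult.commute)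

lemma det_B:
  assumes p: "p \<in> U" shows "det (B (\<phi> p)) \<noteq> 0"
proof -
  have "inj ((*v) (B (\<phi> p)))"
  proof (rule injI)
    fix x y assume "B (\<phi> p) *v x = B (\<phi> p) *v y"
    then have "(\<Sum>j\<in>UNIV. (x - y) $ j *\<^sub>R b j (\<phi> p)) = 0"
      unfolding B_mult[symmetric] by (simp add: matrix_vector_mult_diff_distrib)
    from b_independent[OF p this] show "x = y" by (simp add: vec_eq_iff)
  qed
  then show ?thesis using matrix_left_invertible_injective invertible_left_inverse invertible_det_nz by metis
qed

definition bracket :: "'n \<Rightarrow> 'n \<Rightarrow> (real, 'n) vec \<Rightarrow> (real, 'n) vec" where
  "bracket i j x = frechet_derivative (b j) (at x) (b i x) - frechet_derivative (b i) (at x) (b j x)"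

text \<open>The structure functions in coordinates, obtained by Cramer's rule from the matrix
  \<open>B\<close> whose columns are the fields; their smoothness is then immediate.\<close>

definition L :: "'n \<Rightarrow> 'n \<Rightarrow> (real, 'n) vec \<Rightarrow> (real, 'n) vec" where
  "L i j x = cramer_solution (B x) (bracket i j x)"

lemma bracket_L:
  assumes p: "p \<in> U" shows "bracket i j (\<phi> p) = (\<Sum>k\<in>UNIV. L i j (\<phi> p) $ k *\<^sub>R b k (\<phi> p))"
  using cramer_solution_iff[OF det_B[OF p], of "L i j (\<phi> p)" "bracket i j (\<phi> p)"] by (simp add: L_def B_mult)

lemma eventually_chart:
  assumes "\<And>p. p \<in> U \<Longrightarrow> Q (\<phi> p)" shows "\<forall>\<^sub>F x in nhds 0. Q x"
  using near0[of "\<lambda>_. True", simplified]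
proof eventually_elim
  case (elim x) then show ?case using assms[of "\<psi> x"] by simp
qed

lemma bracket_near: "\<forall>\<^sub>F x in nhds 0. frechet_derivative (b j) (at x) (b i x) - frechet_derivative (b i) (at x) (b j x) = (\<Sum>k\<in>UNIV. L i j x $ k *\<^sub>R b k x)"
  unfolding bracket_def[symmetric] by (rule eventually_chart) (rule bracket_L)

lemma L_smooth: "smooth_around 0 (L i j)"
  unfolding L_def[abs_def]
proof (rule smooth_around_cramer_solution)
  show "smooth_around 0 (\<lambda>x. B x $ i $ j)" for i j
    unfolding B_def vec_lambda_beta by (rule smooth_around_vec_nth[OF b_smooth])
  have "smooth_around 0 (\<lambda>x. frechet_derivative (b j) (at x) (b i x))" for i j
    by (rule smooth_around_frechet_compose[where f="\<lambda>x. x"]) (simp_all add: b_smooth)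
  then show "smooth_around 0 (\<lambda>x. bracket i j x $ k)" for k
    unfolding bracket_def by (intro smooth_around_vec_nth smooth_around_diff)
  show "det (B 0) \<noteq> 0" using det_B[OF a] \<phi>a by simp
qed

lemma lie_bracket_eval:
  assumes p: "p \<in> U"
  shows "lie_bracket A (X i) (X j) p f = (if smooth_near A p f then frechet_derivative (f \<circ> \<psi>) (at (\<phi> p)) (bracket i j (\<phi> p)) else 0)"
proof (cases "smooth_near A p f")
  case True
  have sf: "smooth_around (\<phi> p) (f \<circ> \<psi>)" using True near_iff[OF p] by blast
  have half: "X i p (\<lambda>q. X j q f) = frechet_derivative (\<lambda>y. frechet_derivative (f \<circ> \<psi>) (at y) (b j y)) (at (\<phi> p)) (b i (\<phi> p))" for i j
  proof -
    have "\<forall>\<^sub>F x in nhds (\<phi> p). \<psi> x \<in> U \<and> \<phi> (\<psi> x) = x"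
      using eventually_chart_image[OF top p, of "\<lambda>_. True"] by simp
    then have "\<forall>\<^sub>F x in nhds (\<phi> p). ((\<lambda>q. X j q f) \<circ> \<psi>) x = frechet_derivative (f \<circ> \<psi>) (at x) (b j x)"
      using smooth_around_eventually[OF sf]
    proof eventually_elim
      case (elim x)
      have "smooth_near A (\<psi> x) f" using near_iff[of "\<psi> x" f] elim by simp
      then show ?case using X_eval[of "\<psi> x" j f] elim by simp
    qed
    note ev = this
    have "X i p (\<lambda>q. X j q f) = frechet_derivative ((\<lambda>q. X j q f) \<circ> \<psi>) (at (\<phi> p)) (b i (\<phi> p))"
      by (simp only: X_eval[OF p, of i "\<lambda>q. X j q f"] smooth_field[OF p True, of j] if_True)
    then show ?thesis by (rule trans[OF _ fun_cong[OF frechet_derivative_cong_nhds[OF ev]]])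
  qed
  show ?thesis unfolding lie_bracket_def half using True
    commutator_derivative[OF sf b_smooth_at[OF p] b_smooth_at[OF p], of j i] by (simp add: bracket_def)
qed (simp add: lie_bracket_def)

lemma lie_bracket_L:
  assumes p: "p \<in> U"
  shows "lie_bracket A (X i) (X j) p f = (\<Sum>k\<in>UNIV. L i j (\<phi> p) $ k * X k p f)"
  unfolding lie_bracket_eval[OF p] combination_eval[OF p] bracket_L[OF p] ..

lemma lie_bracket_unique:
  assumes p: "p \<in> U" and c: "\<And>f. lie_bracket A (X i) (X j) p f = (\<Sum>k\<in>UNIV. c $ k * X k p f)"
  shows "c = L i j (\<phi> p)"
proof -
  have "\<forall>f. (\<Sum>k\<in>UNIV. (c $ k - L i j (\<phi> p) $ k) * X k p f) = 0"
    using c lie_bracket_L[OF p, of i j] by (simp add: left_diff_distrib sum_subtractf)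
  moreover have "(\<forall>f. (\<Sum>k\<in>UNIV. (c $ k - L i j (\<phi> p) $ k) * X k p f) = 0) \<longrightarrow> (\<forall>k\<in>UNIV. c $ k - L i j (\<phi> p) $ k = 0)"
    using basis[OF p] unfolding is_basis_def by (elim conjE allE)
  ultimately show ?thesis by (simp add: vec_eq_iff)
qed

lemma structure_function_L: "structure_function A X i j a = L i j 0"
  unfolding structure_function_def
proof (rule the_equality)
  show "\<forall>f. lie_bracket A (X i) (X j) a f = (\<Sum>k\<in>UNIV. L i j 0 $ k * X k a f)"
    using lie_bracket_L[OF a] \<phi>a by simp
  fix c :: "(real, 'n) vec" assume "\<forall>f. lie_bracket A (X i) (X j) a f = (\<Sum>k\<in>UNIV. c $ k * X k a f)"
  then show "c = L i j 0" using lie_bracket_unique[OF a, of i j c] \<phi>a by simp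
qed

lemma structure_function_antisym: "structure_function A X i j a = - structure_function A X j i a"
proof -
  have "- L j i (\<phi> a) = L i j (\<phi> a)"
  proof (rule lie_bracket_unique[OF a])
    fix f
    have "lie_bracket A (X i) (X j) a f = - lie_bracket A (X j) (X i) a f" by (simp add: lie_bracket_def)
    then show "lie_bracket A (X i) (X j) a f = (\<Sum>k\<in>UNIV. (- L j i (\<phi> a)) $ k * X k a f)"
      unfolding lie_bracket_L[OF a, of j i] by (simp add: sum_negf)
  qed
  then show ?thesis by (simp add: structure_function_L \<phi>a)
qed

end

lemma frame_transition:
  assumes 1: "framed_chart A X a U \<phi>" and 2: "framed_chart A X a U' \<phi>'"
  defines "\<Phi> \<equiv> \<phi>' \<circ> inv_into U \<phi>"
  shows "smooth_around 0 \<Phi>" "\<Phi> 0 = 0"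
    "\<forall>\<^sub>F x in nhds 0. \<forall>j. frechet_derivative \<Phi> (at x) (framed_chart.b X U \<phi> j x) = framed_chart.b X U' \<phi>' j (\<Phi> x)"
proof -
  interpret c1: framed_chart A X a U \<phi> by fact
  interpret c2: framed_chart A X a U' \<phi>' by fact
  show s: "smooth_around 0 \<Phi>"
    unfolding \<Phi>_def using chart_transition[OF c1.atlas c1.chart c1.a c2.chart c2.a] c1.\<phi>a by simp
  show "\<Phi> 0 = 0" unfolding \<Phi>_def by (simp add: c1.\<psi>0 c2.\<phi>a)
  show "\<forall>\<^sub>F x in nhds 0. \<forall>j. frechet_derivative \<Phi> (at x) (c1.b j x) = c2.b j (\<Phi> x)"
    using c1.near0[OF eventually_nhds_in_open[OF topological_chartD(1)[OF c2.top] c2.a]] smooth_around_eventually[OF s]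
  proof eventually_elim
    case (elim x)
    have "frechet_derivative \<Phi> (at x) (c1.b j x) $ k = c2.b j (\<Phi> x) $ k" for j k
    proof -
      have "c2.b j (\<Phi> x) $ k = X j (c1.\<psi> x) (\<lambda>q. \<phi>' q $ k)"
        using elim(1) by (simp add: \<Phi>_def c2.b_eq c2.\<psi>\<phi> components_def)
      also have "\<dots> = frechet_derivative ((\<lambda>q. \<phi>' q $ k) \<circ> c1.\<psi>) (at x) (c1.b j x)"
        using c1.X_eval[of "c1.\<psi> x" j "\<lambda>q. \<phi>' q $ k"] c2.coordinate_near[of "c1.\<psi> x" k] elim(1) by simp
      also have "((\<lambda>q. \<phi>' q $ k) \<circ> c1.\<psi>) = (\<lambda>x. \<Phi> x $ k)" by (auto simp: \<Phi>_def)
      also have "frechet_derivative (\<lambda>x. \<Phi> x $ k) (at x) (c1.b j x) = frechet_derivative \<Phi> (at x) (c1.b j x) $ k"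
        by (rule frechet_vec_nth_vec[OF elim(2)])
      finally show ?thesis by simp
    qed
    then show ?case by (simp add: vec_eq_iff)
  qed
qed

section \<open>Ranks of subbundles, weights and the filtration\<close>

lemma family_span:
  fixes x :: "'i \<Rightarrow> 'v::real_vector"
  assumes "finite I"
  shows "range (\<lambda>c. \<Sum>i\<in>I. c i *\<^sub>R x i) = span (x ` I)"
proof
  show "range (\<lambda>c. \<Sum>i\<in>I. c i *\<^sub>R x i) \<subseteq> span (x ` I)"
    by (auto intro!: span_sum intro: span_scale span_base)
  show "span (x ` I) \<subseteq> range (\<lambda>c. \<Sum>i\<in>I. c i *\<^sub>R x i)"
  proof
    fix y assume "y \<in> span (x ` I)"
    then show "y \<in> range (\<lambda>c. \<Sum>i\<in>I. c i *\<^sub>R x i)"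
    proof (induction rule: span_induct_alt)
      case base show ?case by (rule range_eqI[of _ _ "\<lambda>_. 0"]) simp
    next
      case (step k y z)
      obtain i where i: "i \<in> I" "y = x i" using step by blast
      obtain c where c: "z = (\<Sum>i\<in>I. c i *\<^sub>R x i)" using step by blast
      have "(\<Sum>j\<in>I. (if j = i then k else 0) *\<^sub>R x j) = k *\<^sub>R y"
        using i assms by (simp add: if_distrib[of "\<lambda>c. c *\<^sub>R _"] sum.delta cong: if_cong)
      then have "k *\<^sub>R y + z = (\<Sum>j\<in>I. ((if j = i then k else 0) + c j) *\<^sub>R x j)"
        by (simp add: c scaleR_add_left sum.distrib)
      then show ?case by (rule range_eqI[where f="\<lambda>c. \<Sum>i\<in>I. c i *\<^sub>R x i"])
    qed
  qed
qed

lemma family_independent: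
  fixes x :: "'i \<Rightarrow> 'v::real_vector"
  assumes I: "finite I" and ind: "\<And>c. (\<Sum>i\<in>I. c i *\<^sub>R x i) = 0 \<Longrightarrow> \<forall>i\<in>I. c i = 0"
  shows "inj_on x I" "independent (x ` I)"
proof -
  show inj: "inj_on x I"
  proof (rule inj_onI, rule ccontr)
    fix i j assume ij: "i \<in> I" "j \<in> I" "x i = x j" "i \<noteq> j"
    let ?c = "\<lambda>l. (if l = i then 1 else 0) - (if l = j then 1 else 0 :: real)"
    have "(\<Sum>l\<in>I. ?c l *\<^sub>R x l) = x i - x j"
      using ij I by (simp add: scaleR_left_diff_distrib sum_subtractf if_distrib[of "\<lambda>c. c *\<^sub>R _"] sum.delta cong: if_cong)
    then have "\<forall>l\<in>I. ?c l = 0" using ind[of ?c] ij(3) by simp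
    then have "?c i = 0" using ij(1) by blast
    then show False using ij(4) by simp
  qed
  show "independent (x ` I)"
  proof (rule independent_if_scalars_zero)
    fix f y assume f: "(\<Sum>y\<in>x ` I. f y *\<^sub>R y) = 0" and y: "y \<in> x ` I"
    have "(\<Sum>i\<in>I. f (x i) *\<^sub>R x i) = 0" using f by (simp add: sum.reindex[OF inj])
    from ind[OF this] y show "f y = 0" by blast
  qed (use I in simp)
qed

lemma family_dim:
  fixes x :: "'i \<Rightarrow> 'v::euclidean_space"
  assumes I: "finite I" and ind: "\<And>c. (\<Sum>i\<in>I. c i *\<^sub>R x i) = 0 \<Longrightarrow> \<forall>i\<in>I. c i = 0"
  shows "dim (span (x ` I)) = card I"
proof -
  have "inj_on x I" "independent (x ` I)" using family_independent[OF I, of x] ind by blast+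
  then show ?thesis by (simp add: dim_eq_card_independent card_image)
qed

lemma components_sum:
  "components \<phi> (\<lambda>f. \<Sum>j\<in>I. c j * v j f) = (\<Sum>j\<in>I. c j *\<^sub>R components \<phi> (v j))"
  by (simp add: components_def vec_eq_iff)

lemma tangent_components_independent:
  assumes A: "smooth_atlas A" and U: "(U, \<phi>) \<in> charts A" "p \<in> U" and v: "\<And>i. i \<in> I \<Longrightarrow> v i \<in> tangent_space A p"
    and bs: "is_basis I v E" and z: "(\<Sum>i\<in>I. c i *\<^sub>R components \<phi> (v i)) = 0"
  shows "\<forall>i\<in>I. c i = 0"
proof -
  have "(\<Sum>i\<in>I. c i * v i f) = 0" for f
  proof (cases "smooth_near A p f")
    case True
    then have l: "linear (frechet_derivative (f \<circ> inv_into U \<phi>) (at (\<phi> p)))"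
      using smooth_near_iff[OF A U] smooth_around_linear_frechet by blast
    have "(\<Sum>i\<in>I. c i * v i f) = frechet_derivative (f \<circ> inv_into U \<phi>) (at (\<phi> p)) (\<Sum>i\<in>I. c i *\<^sub>R components \<phi> (v i))"
      using tangent_space_eval[OF A U v, of _ f] True by (simp add: linear_sum[OF l] linear_scale[OF l])
    then show ?thesis by (simp add: z linear_0[OF l])
  next
    case False
    then show ?thesis using tangent_space_eval[OF A U v, of _ f] by simp
  qed
  then show ?thesis using bs unfolding is_basis_def by blast
qed

lemma components_basis:
  assumes A: "smooth_atlas A" and U: "(U, \<phi>) \<in> charts A" "p \<in> U" and v: "\<And>i. i \<in> I \<Longrightarrow> v i \<in> tangent_space A p"
    and bs: "is_basis I v E" and I: "finite I"
  shows "components \<phi> ` E = span ((\<lambda>i. components \<phi> (v i)) ` I)" "dim (components \<phi> ` E) = card I"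
proof -
  have "components \<phi> ` E = range (\<lambda>c. \<Sum>i\<in>I. c i *\<^sub>R components \<phi> (v i))"
  proof -
    have "E = range (\<lambda>c f. \<Sum>i\<in>I. c i * v i f)" using bs by (auto simp: is_basis_def)
    then show ?thesis by (simp add: image_image components_sum)
  qed
  then show e: "components \<phi> ` E = span ((\<lambda>i. components \<phi> (v i)) ` I)" unfolding family_span[OF I] .
  show "dim (components \<phi> ` E) = card I" unfolding e
    by (rule family_dim[OF I]) (rule tangent_components_independent[OF A U v bs])
qed

lemma atlas_chart:
  assumes A: "smooth_atlas A" obtains U \<phi> where "(U, \<phi>) \<in> charts A" "p \<in> U"
proof -
  obtain C \<xi> where C: "(C, \<xi>) \<in> A" "p \<in> C" "topological_chart (C, \<xi>)" by (rule smooth_atlasE[OF A])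
  then have "(C, \<xi>) \<in> charts A" using A by (auto simp: charts_def smooth_atlas_def)
  then show thesis using that C by blast
qed

lemma subbundle_components:
  assumes A: "smooth_atlas A" and U: "(U, \<phi>) \<in> charts A" "p \<in> U" and s: "subbundle A E d"
  shows "dim (components \<phi> ` E p) = d" "subspace (components \<phi> ` E p)"
proof -
  obtain V Y where V: "p \<in> V" "\<forall>i<d. smooth_vfield A V (Y i)" "\<forall>q\<in>V. is_basis {..<d} (\<lambda>i. Y i q) (E q)"
    using s unfolding subbundle_def by blast
  have t: "i \<in> {..<d} \<Longrightarrow> Y i p \<in> tangent_space A p" for i using V by (simp add: smooth_vfield_def)
  have bs: "is_basis {..<d} (\<lambda>i. Y i p) (E p)" using V by blast
  show "dim (components \<phi> ` E p) = d" using components_basis(2)[OF A U t bs finite_lessThan] by simp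
  have "components \<phi> ` E p = span ((\<lambda>i. components \<phi> (Y i p)) ` {..<d})"
    by (rule components_basis(1)[OF A U t bs finite_lessThan])
  then show "subspace (components \<phi> ` E p)" using subspace_span by simp
qed

lemma bundle_rank_eq:
  fixes A :: "('m::topological_space, 'n::finite) chart set"
  assumes A: "smooth_atlas A" and s: "subbundle A E d"
  shows "bundle_rank A E = d"
  unfolding bundle_rank_def
proof (rule the_equality)
  show "subbundle A E d" by fact
next
  fix d' assume s': "subbundle A E d'"
  \<comment> \<open>The rank can be read off at any point; \<open>undefined\<close> provides one, as
    types are non-empty.\<close>
  obtain U \<phi> where U: "(U, \<phi>) \<in> charts A" "(undefined::'m) \<in> U" by (rule atlas_chart[OF A])
  show "d' = d" using subbundle_components(1)[OF A U s] subbundle_components(1)[OF A U s'] by simp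
qed

text \<open>The positions \<open>card {..k}\<close> run through \<open>1, ..., n\<close> without
  repetition, because initial segments of a linear order grow strictly.\<close>

lemma card_position:
  fixes d :: nat
  assumes "d \<le> CARD('n::{finite,linorder})"
  shows "card {k::'n. card {..k} \<le> d} = d"
proof -
  let ?f = "\<lambda>k::'n. card {..k}"
  have inj: "inj ?f"
  proof (rule linorder_inj_onI')
    fix i j :: 'n assume "i < j"
    then have "{..i} \<subset> {..j}" by auto
    from psubset_card_mono[OF _ this] show "card {..i} \<noteq> card {..j}" by simp
  qed
  have "?f k \<in> {1..CARD('n)}" for k :: 'n
    using card_mono[of "UNIV::'n set" "{..k}"] card_gt_0_iff[of "{..k}"] by (auto simp: Suc_le_eq)
  then have "range ?f \<subseteq> {1..CARD('n)}" by blast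
  then have im: "range ?f = {1..CARD('n)}"
    by (rule card_subset_eq[rotated]) (simp_all add: card_image[OF inj])
  have "?f ` {k. ?f k \<le> d} = {1..d}"
  proof
    show "?f ` {k. ?f k \<le> d} \<subseteq> {1..d}" using im by auto
    show "{1..d} \<subseteq> ?f ` {k. ?f k \<le> d}"
    proof
      fix i assume i: "i \<in> {1..d}"
      then have "i \<in> range ?f" using im assms by auto
      then show "i \<in> ?f ` {k. ?f k \<le> d}" using i by auto
    qed
  qed
  then have "card (?f ` {k. ?f k \<le> d}) = d" by simp
  then show ?thesis using card_image[OF inj_on_subset[OF inj]] by simp
qed

locale carnot_frame =
  fixes A :: "('m::{t2_space, second_countable_topology}, 'n::{finite, linorder}) chart set"
    and r :: nat and H :: "nat \<Rightarrow> 'm::{t2_space, second_countable_topology} \<Rightarrow> 'm::{t2_space, second_countable_topology} tangent_vector set"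
    and X :: "'n::{finite, linorder} \<Rightarrow> 'm::{t2_space, second_countable_topology} vfield"
    and a :: "'m::{t2_space, second_countable_topology}"
    and V :: "'m::{t2_space, second_countable_topology} set"
  assumes carnot: "carnot_manifold A r H"
    and V: "open V" "a \<in> V"
    and frame_section: "local_section A (H (weight A H j)) V (X j)"
    and basis: "q \<in> V \<Longrightarrow> is_basis UNIV (\<lambda>j. X j q) (tangent_space A q)"
begin

abbreviation w :: "'n \<Rightarrow> nat" where "w \<equiv> weight A H"

lemma atlas: "smooth_atlas A" and r1: "1 \<le> r"
  and subbundleE: "1 \<le> k \<Longrightarrow> k \<le> r \<Longrightarrow> \<exists>d. subbundle A (H k) d"
  and H_Suc: "1 \<le> k \<Longrightarrow> k < r \<Longrightarrow> H k p \<subseteq> H (Suc k) p"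
  and H_r: "H r p = tangent_space A p"
  using carnot by (auto simp: carnot_manifold_def)

lemma bracket_section: "1 \<le> k \<Longrightarrow> 1 \<le> k' \<Longrightarrow> k + k' \<le> r \<Longrightarrow> local_section A (H k) V Y \<Longrightarrow> local_section A (H k') V Z \<Longrightarrow>
    local_section A (H (k + k')) V (lie_bracket A Y Z)"
  using carnot V(1) unfolding carnot_manifold_def by (auto simp: Ball_def)

lemma tangent: "p \<in> V \<Longrightarrow> X j p \<in> tangent_space A p"
  using frame_section[of j] by (simp add: local_section_def smooth_vfield_def)

lemma smooth_field: "p \<in> V \<Longrightarrow> smooth_near A p f \<Longrightarrow> smooth_near A p (\<lambda>q. X j q f)"
  using frame_section[of j] by (simp add: local_section_def smooth_vfield_def)

lemma H_mono: "1 \<le> k \<Longrightarrow> k \<le> l \<Longrightarrow> l \<le> r \<Longrightarrow> H k p \<subseteq> H l p"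
proof (induction l)
  case (Suc l)
  show ?case
  proof (cases "k = Suc l")
    case False
    then show ?thesis using Suc H_Suc[of l p] by auto
  qed simp
qed simp

lemma rank_dim:
  assumes "1 \<le> k" "k \<le> r" and U: "(U, \<phi>) \<in> charts A" "p \<in> U"
  shows "dim (components \<phi> ` H k p) = bundle_rank A (H k)" "subspace (components \<phi> ` H k p)"
proof -
  obtain d where d: "subbundle A (H k) d" using subbundleE[OF assms(1,2)] by blast
  show "dim (components \<phi> ` H k p) = bundle_rank A (H k)" "subspace (components \<phi> ` H k p)"
    using subbundle_components[OF atlas U d] bundle_rank_eq[OF atlas d] by simp_all
qed

lemma rank_mono: "1 \<le> k \<Longrightarrow> k \<le> l \<Longrightarrow> l \<le> r \<Longrightarrow> bundle_rank A (H k) \<le> bundle_rank A (H l)"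
proof -
  assume kl: "1 \<le> k" "k \<le> l" "l \<le> r"
  obtain U \<phi> where U: "(U, \<phi>) \<in> charts A" "a \<in> U" by (rule atlas_chart[OF atlas])
  have "components \<phi> ` H k a \<subseteq> components \<phi> ` H l a" using H_mono[OF kl] by blast
  from dim_subset[OF this] show ?thesis using rank_dim(1)[OF _ _ U] kl by simp
qed

lemma rank_r: "bundle_rank A (H r) = CARD('n)"
proof -
  obtain U \<phi> where U: "(U, \<phi>) \<in> charts A" "a \<in> U" by (rule atlas_chart[OF atlas])
  show ?thesis
    using rank_dim(1)[OF r1 order_refl U] components_basis(2)[OF atlas U tangent[OF V(2)] basis[OF V(2)] finite]
    by (simp add: H_r)
qed

lemma weight_P: "1 \<le> w j \<and> card {..j} \<le> bundle_rank A (H (w j))"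
proof -
  have "card {..j} \<le> CARD('n)" by (rule card_mono) auto
  then have "1 \<le> r \<and> card {..j} \<le> bundle_rank A (H r)" using r1 rank_r by simp
  from LeastI[of "\<lambda>k. 1 \<le> k \<and> card {..j} \<le> bundle_rank A (H k)", OF this] show ?thesis
    unfolding weight_def .
qed

lemma weight_ge_1: "1 \<le> w j" using weight_P by blast

text \<open>The weight is the least admissible level; as ranks increase with the level, every level
  above it up to \<open>r\<close> is admissible too.\<close>

lemma weight_le_iff:
  assumes "1 \<le> k" "k \<le> r" shows "w j \<le> k \<longleftrightarrow> card {..j} \<le> bundle_rank A (H k)"
proof
  assume "w j \<le> k"
  from rank_mono[OF weight_ge_1 this assms(2)] weight_P[of j] show "card {..j} \<le> bundle_rank A (H k)" by simp
next
  assume "card {..j} \<le> bundle_rank A (H k)"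
  then show "w j \<le> k" unfolding weight_def using assms by (intro Least_le) simp
qed

lemma weight_le_r: "w j \<le> r"
proof -
  have "card {..j} \<le> CARD('n)" by (rule card_mono) auto
  then show ?thesis using weight_le_iff[OF r1 order_refl] rank_r by simp
qed

sublocale weights w by unfold_locales (use weight_ge_1 in \<open>simp add: Suc_le_eq\<close>)

lemma card_weight_le:
  assumes "1 \<le> k" "k \<le> r" shows "card {j. w j \<le> k} = bundle_rank A (H k)"
  unfolding weight_le_iff[OF assms] by (rule card_position) (use rank_mono[OF assms order_refl] rank_r in simp)

text \<open>The frame fields of weight at most \<open>k\<close> lie in \<open>H k p\<close>, and
  there are as many of them as the rank; hence they span \<open>H k p\<close>, and by independence
  \<open>v\<close> involves no others.\<close>

lemma H_coefficients:
  assumes k: "1 \<le> k" "k \<le> r" and p: "p \<in> V" and v: "v \<in> H k p" and c: "\<And>f. v f = (\<Sum>j\<in>UNIV. c j * X j p f)"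
    and j: "k < w j"
  shows "c j = 0"
proof -
  obtain U \<phi> where U: "(U, \<phi>) \<in> charts A" "p \<in> U" by (rule atlas_chart[OF atlas])
  let ?x = "\<lambda>j. components \<phi> (X j p)" and ?S = "{j. w j \<le> k}"
  note ind = tangent_components_independent[OF atlas U tangent[OF p] basis[OF p]]
  have indS: "\<forall>i\<in>?S. c i = 0" if "(\<Sum>i\<in>?S. c i *\<^sub>R ?x i) = 0" for c
  proof -
    have "(\<Sum>i\<in>UNIV. (if i \<in> ?S then c i else 0) *\<^sub>R ?x i) = (\<Sum>i\<in>?S. c i *\<^sub>R ?x i)"
      by (rule sum.mono_neutral_cong_right) auto
    then have "\<forall>i\<in>UNIV. (if i \<in> ?S then c i else 0) = 0" using that by (intro ind) simp
    then show ?thesis by (auto split: if_splits)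
  qed
  have sub: "span (?x ` ?S) \<subseteq> components \<phi> ` H k p"
  proof (rule span_minimal[OF _ rank_dim(2)[OF k U]])
    have "X j p \<in> H k p" if "w j \<le> k" for j
      using frame_section[of j] p H_mono[OF weight_ge_1 that k(2)] by (auto simp: local_section_def)
    then show "?x ` ?S \<subseteq> components \<phi> ` H k p" by blast
  qed
  have "span (?x ` ?S) = components \<phi> ` H k p"
  proof (rule subspace_dim_equal[OF subspace_span rank_dim(2)[OF k U] sub])
    show "dim (components \<phi> ` H k p) \<le> dim (span (?x ` ?S))"
      using rank_dim(1)[OF k U] card_weight_le[OF k] family_dim[of ?S ?x, OF finite indS] by simp
  qed
  then have "components \<phi> v \<in> range (\<lambda>c. \<Sum>i\<in>?S. c i *\<^sub>R ?x i)"
    unfolding family_span[of ?S ?x, OF finite] using v by simp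
  then obtain c' where c': "components \<phi> v = (\<Sum>i\<in>?S. c' i *\<^sub>R ?x i)" by (rule rangeE)
  have "v = (\<lambda>f. \<Sum>j\<in>UNIV. c j * X j p f)" by (rule ext) (rule c)
  then have "components \<phi> v = (\<Sum>j\<in>UNIV. c j *\<^sub>R ?x j)" using components_sum[of \<phi> c "\<lambda>j. X j p" UNIV] by simp
  moreover have "components \<phi> v = (\<Sum>i\<in>UNIV. (if i \<in> ?S then c' i else 0) *\<^sub>R ?x i)"
    unfolding c' by (rule sum.mono_neutral_cong_left) auto
  ultimately have "(\<Sum>j\<in>UNIV. (c j - (if j \<in> ?S then c' j else 0)) *\<^sub>R ?x j) = 0"
    by (simp add: scaleR_left_diff_distrib sum_subtractf)
  from ind[OF this] j show ?thesis by (auto simp: not_le[symmetric])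
qed

lemma framed_chartI:
  assumes U: "(U, \<phi>) \<in> charts A" "a \<in> U" "U \<subseteq> V" "\<phi> a = 0"
  shows "framed_chart A X a U \<phi>"
  using U atlas tangent smooth_field basis by unfold_locales auto

lemma local_chart_framed:
  assumes \<phi>: "local_chart A a \<phi>" "\<phi> a = 0"
  obtains U where "U \<subseteq> V" "framed_chart A X a U \<phi>"
proof -
  obtain U where U: "a \<in> U" "(U, \<phi>) \<in> charts A" using \<phi> by (auto simp: local_chart_def)
  have "open (U \<inter> V)" using topological_chartD(1)[OF chartsD(1)[OF U(2)]] V(1) by auto
  from chart_restrict[OF atlas U(2) this] have "(U \<inter> V, \<phi>) \<in> charts A" by auto
  from framed_chartI[OF this] show thesis using that[of "U \<inter> V"] U(1) V(2) \<phi>(2) by auto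
qed

lemma framed_chart_filtered:
  assumes "framed_chart A X a U \<phi>" "U \<subseteq> V"
  shows "filtered_frame w (framed_chart.b X U \<phi>) (framed_chart.L X U \<phi>)"
proof -
  interpret c: framed_chart A X a U \<phi> by fact
  show ?thesis
  proof unfold_locales
    show "smooth_around 0 (c.b j)" for j by (rule c.b_smooth)
    show "smooth_around 0 (c.L i j)" for i j by (rule c.L_smooth)
    show "\<forall>\<^sub>F x in nhds 0. c.L i j x $ k = 0" if "w i + w j < w k" for i j k
    proof (rule c.eventually_chart)
      fix p assume p: "p \<in> U"
      \<comment> \<open>The bracket condition is imposed only for \<open>w i + w j \<le> r\<close>;
        this holds here because the weight \<open>w k \<le> r\<close> is larger.\<close>
      have le: "w i + w j \<le> r" using that weight_le_r[of k] by simp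
      have "lie_bracket A (X i) (X j) p \<in> H (w i + w j) p"
        using bracket_section[OF weight_ge_1 weight_ge_1 le frame_section frame_section] p assms(2) by (auto simp: local_section_def)
      from H_coefficients[OF _ le _ this c.lie_bracket_L[OF p] that] p assms(2) weight_ge_1[of i]
      show "c.L i j (\<phi> p) $ k = 0" by auto
    qed
    show "\<forall>\<^sub>F x in nhds 0. frechet_derivative (c.b j) (at x) (c.b i x) - frechet_derivative (c.b i) (at x) (c.b j x) = (\<Sum>k\<in>UNIV. c.L i j x $ k *\<^sub>R c.b k x)" for i j
      by (rule c.bracket_near)
  qed
qed

end

section \<open>Privileged coordinates, model fields and the normalising maps on the manifold\<close>

context carnot_frame begin

abbreviation frame :: "'m set \<Rightarrow> ('m \<Rightarrow> (real, 'n) vec) \<Rightarrow> 'n \<Rightarrow> (real, 'n) vec \<Rightarrow> (real, 'n) vec" where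
  "frame U \<phi> \<equiv> framed_chart.b X U \<phi>"

abbreviation framed :: "'m set \<Rightarrow> ('m \<Rightarrow> (real, 'n) vec) \<Rightarrow> bool" where
  "framed U \<phi> \<equiv> U \<subseteq> V \<and> framed_chart A X a U \<phi>"

lemma good_has_order:
  assumes \<phi>: "framed_chart A X a U \<phi>" and g: "good_frame (frame U \<phi>)"
  shows "has_order w X a (\<lambda>p. \<phi> p $ k) (w k)"
proof -
  interpret c: framed_chart A X a U \<phi> by fact
  show ?thesis unfolding has_order_def c.frame_word_coordinate
  proof (intro conjI allI impI)
    show "\<And>I. wt w I < w k \<Longrightarrow> word_op c.b I (\<lambda>x. x $ k) 0 = 0" by (rule good_order[OF g])
    show "\<exists>I. wt w I = w k \<and> word_op c.b I (\<lambda>x. x $ k) 0 \<noteq> 0"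
      by (rule exI[of _ "[k]"]) (simp add: frame_op_coord good_diag[OF g])
  qed
qed

lemma has_order_good:
  assumes \<phi>: "framed_chart A X a U \<phi>" and o: "\<And>k. has_order w X a (\<lambda>p. \<phi> p $ k) (w k)"
    and d: "\<And>j k. w j = w k \<Longrightarrow> frame U \<phi> j 0 $ k = (if j = k then 1 else 0)"
  shows "good_frame (frame U \<phi>)"
proof -
  interpret c: framed_chart A X a U \<phi> by fact
  show ?thesis using o d c.b_smooth unfolding good_frame_def has_order_def c.frame_word_coordinate by blast
qed

lemma linearly_adapted_iff:
  assumes \<phi>: "framed_chart A X a U \<phi>"
  shows "linearly_adapted A X a \<phi> \<longleftrightarrow> (\<forall>j. frame U \<phi> j 0 = axis j 1)"
proof -
  interpret c: framed_chart A X a U \<phi> by fact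
  show ?thesis unfolding linearly_adapted_def local_chart_def c.components_at using c.chart c.a c.\<phi>a by blast
qed

text \<open>\<open>is_model_field\<close> may use any chart domain for \<open>\<phi>\<close>; near
  \<open>0\<close> the representation of a field does not depend on that choice.\<close>

lemma field_in_chart_germ:
  assumes \<phi>: "framed_chart A X a U \<phi>" and U': "(U', \<phi>) \<in> charts A" "a \<in> U'"
  shows "\<forall>\<^sub>F x in nhds 0. field_in_chart (U', \<phi>) Z x = field_in_chart (U, \<phi>) Z x"
proof -
  interpret c: framed_chart A X a U \<phi> by fact
  note t = topological_chartD[OF chartsD(1)[OF U'(1)]]
  show ?thesis
    using c.near0[OF eventually_nhds_in_open[OF t(1) U'(2)]]
  proof eventually_elim
    case (elim x)
    then have "inv_into U' \<phi> x = c.\<psi> x" using inv_into_f_f[OF t(4), of "c.\<psi> x"] by simp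
    then show ?case by (simp add: field_in_chart_def)
  qed
qed

lemma model_field_tendsto:
  assumes \<phi>: "framed_chart A X a U \<phi>" and m: "is_model_field A w a \<phi> m Z Y"
  shows "((\<lambda>t. t ^ m *\<^sub>R dilation_pullback w t (field_in_chart (U, \<phi>) Z) x) \<longlongrightarrow> Y x) (at 0)"
proof -
  obtain U' where U': "a \<in> U'" "(U', \<phi>) \<in> charts A"
    and u: "\<And>vs K. compact K \<Longrightarrow> uniform_limit K
             (\<lambda>t. iterated_derivative vs (\<lambda>x. t ^ m *\<^sub>R dilation_pullback w t (field_in_chart (U', \<phi>) Z) x))
             (iterated_derivative vs Y) (at 0)"
    using m unfolding is_model_field_def by blast
  have l: "((\<lambda>t. t ^ m *\<^sub>R dilation_pullback w t (field_in_chart (U', \<phi>) Z) x) \<longlongrightarrow> Y x) (at 0)"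
    using tendsto_uniform_limitI[OF u[of "{x}" "[]"], of x] by simp
  have "\<forall>\<^sub>F t in at 0. field_in_chart (U', \<phi>) Z (dilation w t x) = field_in_chart (U, \<phi>) Z (dilation w t x)"
    by (rule eventually_compose_filterlim[OF field_in_chart_germ[OF \<phi> U'(2,1)] tendsto_dilation_at])
  then have "\<forall>\<^sub>F t in at 0. t ^ m *\<^sub>R dilation_pullback w t (field_in_chart (U', \<phi>) Z) x
      = t ^ m *\<^sub>R dilation_pullback w t (field_in_chart (U, \<phi>) Z) x"
    by eventually_elim (simp add: dilation_pullback_def)
  from Lim_transform_eventually[OF l this] show ?thesis .
qed

lemma scaled_frame_is_model:
  assumes \<phi>: "framed_chart A X a U \<phi>" and S: "scaled_frame (frame U \<phi>) Y"
  shows "is_model_field A w a \<phi> (w j) (X j) (\<lambda>x. Y j (0, x))"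
proof -
  interpret c: framed_chart A X a U \<phi> by fact
  have sl: "slice_smooth (Y j)" using S by (simp add: scaled_frame_def)
  have F: "\<forall>\<^sub>F p in nhds (0, x). fst p \<noteq> 0 \<longrightarrow>
      fst p ^ w j *\<^sub>R dilation_pullback w (fst p) (field_in_chart (U, \<phi>) (X j)) (snd p) = Y j p" for x
    using scaled_frame_eq[OF S, where x=x and j=j]
  proof eventually_elim
    case (elim p)
    show ?case
    proof
      assume t: "fst p \<noteq> 0"
      have "fst p ^ w j * field_in_chart (U, \<phi>) (X j) (dilation w (fst p) (snd p)) $ k = fst p ^ w k * Y j p $ k" for k
        using arg_cong[OF elim, of "\<lambda>v. v $ k"] by (simp add: c.b_def)
      then show "fst p ^ w j *\<^sub>R dilation_pullback w (fst p) (field_in_chart (U, \<phi>) (X j)) (snd p) = Y j p"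
        using t by (simp add: dilation_pullback_def vec_eq_iff field_simps)
    qed
  qed
  show ?thesis unfolding is_model_field_def
  proof (intro conjI exI[of _ U] allI impI)
    show "smooth_on UNIV (\<lambda>x. Y j (0, x))"
      unfolding smooth_on_iff[OF open_UNIV] by (intro ballI smooth_around_slice slice_smoothD sl)
    fix vs :: "(real, 'n) vec list" and K :: "(real, 'n) vec set" assume K: "compact K"
    show "uniform_limit K
             (\<lambda>t. iterated_derivative vs (\<lambda>x. t ^ w j *\<^sub>R dilation_pullback w t (field_in_chart (U, \<phi>) (X j)) x))
             (iterated_derivative vs (\<lambda>x. Y j (0, x))) (at 0)"
      by (rule uniform_limit_iterated_derivative[where F="\<lambda>t x. t ^ w j *\<^sub>R dilation_pullback w t (field_in_chart (U, \<phi>) (X j)) x", OF sl F K])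
  qed (use c.a c.chart in auto)
qed

lemma model_unique:
  assumes \<phi>: "framed_chart A X a U \<phi>" and S: "scaled_frame (frame U \<phi>) Y"
    and m: "is_model_field A w a \<phi> (w j) (X j) Z"
  shows "Z x = Y j (0, x)"
  by (rule tendsto_unique[OF _ model_field_tendsto[OF \<phi> m] model_field_tendsto[OF \<phi> scaled_frame_is_model[OF \<phi> S]]]) simp

lemma model_field_eq:
  assumes \<phi>: "framed_chart A X a U \<phi>" and S: "scaled_frame (frame U \<phi>) Y"
  shows "model_field A H X a \<phi> = (\<lambda>j x. Y j (0, x))"
proof
  fix j show "model_field A H X a \<phi> j = (\<lambda>x. Y j (0, x))"
    unfolding model_field_def
  proof (rule the_equality)
    show "is_model_field A w a \<phi> (w j) (X j) (\<lambda>x. Y j (0, x))" by (rule scaled_frame_is_model[OF \<phi> S])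
    show "Z = (\<lambda>x. Y j (0, x))" if "is_model_field A w a \<phi> (w j) (X j) Z" for Z
      by (rule ext) (rule model_unique[OF \<phi> S that])
  qed
qed

text \<open>At the origin and for equal weights the rescaling factors cancel, so the component does
  not depend on \<open>t\<close> and is already its limit. The model fields thus give back the
  diagonal blocks of the frame even without linear adaptedness.\<close>

lemma model_diagonal:
  assumes \<phi>: "framed_chart A X a U \<phi>" and m: "is_model_field A w a \<phi> (w j) (X j) Y" and Y: "Y 0 = axis j 1" and jk: "w j = w k"
  shows "frame U \<phi> j 0 $ k = (if j = k then 1 else 0)"
proof -
  interpret c: framed_chart A X a U \<phi> by fact
  have "((\<lambda>t. (t ^ w j *\<^sub>R dilation_pullback w t (c.b j) 0) $ k) \<longlongrightarrow> Y 0 $ k) (at 0)"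
    unfolding c.b_def by (rule tendsto_vec_nth[OF model_field_tendsto[OF \<phi> m]])
  moreover have "\<forall>\<^sub>F t in at 0. (t ^ w j *\<^sub>R dilation_pullback w t (c.b j) 0) $ k = c.b j 0 $ k"
    using eventually_at_neq_0 by eventually_elim (simp add: dilation_pullback_def jk)
  ultimately have "((\<lambda>t::real. c.b j 0 $ k) \<longlongrightarrow> Y 0 $ k) (at 0)" by (rule Lim_transform_eventually)
  from tendsto_unique[OF _ tendsto_const this] show ?thesis by (simp add: Y axis_def)
qed

text \<open>The linear, polynomial, exponential and perturbing changes of coordinates below all
  enter through this lemma.\<close>

lemma chart_change:
  assumes \<kappa>: "framed_chart A X a U \<kappa>" and g: "smooth_around 0 g" "g 0 = 0" "inj (frechet_derivative g (at 0))"
    and \<phi>: "\<forall>\<^sub>F p in nhds a. \<phi> p = g (\<kappa> p)"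
  obtains U' where "framed U' \<phi>" "\<forall>\<^sub>F x in nhds 0. \<forall>j. frechet_derivative g (at x) (frame U \<kappa> j x) = frame U' \<phi> j (g x)"
proof -
  interpret c: framed_chart A X a U \<kappa> by fact
  have lc: "local_chart A a \<kappa>" unfolding local_chart_def using c.a c.chart by blast
  have lc': "local_chart A a \<phi>" by (rule local_chart_compose[OF atlas lc _ _ \<phi>]) (simp_all add: c.\<phi>a g)
  have \<phi>0: "\<phi> a = 0" using eventually_nhds_x_imp_x[OF \<phi>] by (simp add: c.\<phi>a g)
  obtain U' where U': "U' \<subseteq> V" "framed_chart A X a U' \<phi>" by (rule local_chart_framed[OF lc' \<phi>0])
  have "\<forall>\<^sub>F x in nhds 0. (\<phi> \<circ> c.\<psi>) x = g x" using c.near0[OF \<phi>] by eventually_elim simp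
  then have "\<forall>\<^sub>F x in nhds 0. \<forall>\<^sub>F y in nhds x. (\<phi> \<circ> c.\<psi>) y = g y" unfolding eventually_eventually .
  then have "\<forall>\<^sub>F x in nhds 0. \<forall>j. frechet_derivative g (at x) (c.b j x) = frame U' \<phi> j (g x)"
    using frame_transition(3)[OF \<kappa> U'(2)]
  proof eventually_elim
    case (elim x)
    show ?case using elim(2) eventually_nhds_x_imp_x[OF elim(1)] unfolding frechet_derivative_cong_nhds[OF elim(1)] by simp
  qed
  with U' show thesis using that by blast
qed

lemma chart_change_at_0:
  assumes "\<forall>\<^sub>F x in nhds 0. \<forall>j. frechet_derivative g (at x) (b j x) = b' j (g x)" "g 0 = 0"
  shows "frechet_derivative g (at 0) (b j 0) = b' j 0"
  using eventually_nhds_x_imp_x[OF assms(1)] assms(2) by simp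

text \<open>The map is the inverse of the matrix whose columns are the fields at \<open>0\<close>.
  The translation part vanishes because both charts are centred, and a linear map is fixed by its
  values on the frame.\<close>

lemma adapting_affine_map_eq:
  assumes \<kappa>: "framed_chart A X a U \<kappa>"
  obtains T where "linear T" "inj T" "adapting_affine_map A X a \<kappa> = T" "linearly_adapted A X a (T \<circ> \<kappa>)"
proof -
  interpret c: framed_chart A X a U \<kappa> by fact
  define B where "B = c.B 0"
  have "det B \<noteq> 0" using c.det_B[OF c.a] unfolding B_def c.\<phi>a .
  then have "invertible B" by (simp add: invertible_det_nz)
  then obtain C where BI: "B ** C = mat 1" "C ** B = mat 1" unfolding invertible_def by blast
  define T where "T = (*v) C"
  have lT: "linear T" unfolding T_def by simp
  have TB: "T (B *v x) = x" "B *v T x = x" for x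
    unfolding T_def by (simp_all add: matrix_vector_mul_assoc BI)
  have B_axis: "B *v axis j 1 = c.b j 0" for j
    unfolding B_def c.B_mult by (simp add: axis_def if_distrib[of "\<lambda>c. c *\<^sub>R _"] cong: if_cong)
  have iT: "inj T" by (rule inj_on_inverseI[of _ "(*v) B"]) (rule TB(2))
  have ad: "linearly_adapted A X a (T' \<circ> \<kappa>) \<longleftrightarrow> (\<forall>j. T' (c.b j 0) = axis j 1)" if T': "linear T'" "inj T'" for T'
  proof -
    have d: "frechet_derivative T' (at 0) = T'"
      by (rule frechet_derivativeI) (rule linear_imp_has_derivative[OF T'(1)])
    have bl: "bounded_linear T'" using T'(1) by (simp add: linear_linear)
    obtain U' where U': "framed U' (T' \<circ> \<kappa>)" "\<forall>\<^sub>F x in nhds 0. \<forall>j. frechet_derivative T' (at x) (c.b j x) = frame U' (T' \<circ> \<kappa>) j (T' x)"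
      by (rule chart_change[where \<phi>="T' \<circ> \<kappa>", OF \<kappa> smooth_around_bounded_linear[OF bl smooth_around_ident] linear_0[OF T'(1)]])
         (simp_all add: d T')
    have "T' (c.b j 0) = frame U' (T' \<circ> \<kappa>) j 0" for j
      using chart_change_at_0[OF U'(2) linear_0[OF T'(1)], of j] unfolding d .
    then show ?thesis using linearly_adapted_iff[of U' "T' \<circ> \<kappa>"] U'(1) by simp
  qed
  have Tad: "linearly_adapted A X a (T \<circ> \<kappa>)"
    unfolding ad[OF lT iT] using TB(1) by (simp add: B_axis[symmetric])
  have "adapting_affine_map A X a \<kappa> = T"
    unfolding adapting_affine_map_def
  proof (rule the_equality)
    show "(\<exists>B c. linear B \<and> T = (\<lambda>x. B x + c)) \<and> linearly_adapted A X a (T \<circ> \<kappa>)"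
      using lT Tad by (intro conjI exI[of _ T] exI[of _ 0]) simp_all
    fix T' assume T': "(\<exists>B c. linear B \<and> T' = (\<lambda>x. B x + c)) \<and> linearly_adapted A X a (T' \<circ> \<kappa>)"
    then obtain B' c' where B': "linear B'" "T' = (\<lambda>x. B' x + c')" by blast
    have ad': "linearly_adapted A X a (T' \<circ> \<kappa>)" using T' by blast
    then have "T' (\<kappa> a) = 0" by (simp add: linearly_adapted_def)
    then have "c' = 0" by (simp add: B'(2) c.\<phi>a linear_0[OF B'(1)])
    then have TB': "T' = B'" by (simp add: B'(2))
    have lc: "local_chart A a (T' \<circ> \<kappa>)" "(T' \<circ> \<kappa>) a = 0" using ad' by (simp_all add: linearly_adapted_def)
    \<comment> \<open>A competitor is not known to be injective in advance; that
      \<open>T' \<circ> \<kappa>\<close> is a chart is part of linear adaptedness, so the transition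
      between the two charts is differentiated instead.\<close>
    obtain U' where U': "U' \<subseteq> V" "framed_chart A X a U' (T' \<circ> \<kappa>)" by (rule local_chart_framed[OF lc])
    have ev: "\<forall>\<^sub>F x in nhds 0. (T' \<circ> \<kappa> \<circ> c.\<psi>) x = T' x"
      using c.near0[of "\<lambda>_. True", simplified] by eventually_elim simp
    have "frechet_derivative (T' \<circ> \<kappa> \<circ> c.\<psi>) (at 0) = B'"
      unfolding frechet_derivative_cong_nhds[OF ev] unfolding TB'
      by (rule frechet_derivativeI) (rule linear_imp_has_derivative[OF B'(1)])
    then have "B' (c.b j 0) = frame U' (T' \<circ> \<kappa>) j 0" for j
      using chart_change_at_0[OF frame_transition(3)[OF \<kappa> U'(2)] frame_transition(2)[OF \<kappa> U'(2)], of j] by (simp only:)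
    then have ax: "B' (c.b j 0) = axis j 1" for j using ad' linearly_adapted_iff[OF U'(2)] by simp
    have "B' (B *v x) = x" for x
    proof -
      have "B' (B *v x) = (\<Sum>j\<in>UNIV. x $ j *\<^sub>R B' (c.b j 0))"
        unfolding B_def c.B_mult by (simp add: linear_sum[OF B'(1)] linear_scale[OF B'(1)])
      then show ?thesis by (simp add: ax vec_axis_expand[symmetric])
    qed
    then have "B' x = T x" for x using TB(2)[of x] by metis
    then show "T' = T" unfolding TB' by auto
  qed
  with lT iT Tad show thesis using that by blast
qed

text \<open>Words in the new frame on the coordinates are words in the old frame on the components
  of \<open>P\<close>. Thus being privileged becomes the condition of \<open>psi_hat_ex1\<close>,
  and the definite description \<open>psi_hat\<close> denotes.\<close>

lemma psi_hat_eq: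
  assumes \<phi>: "framed U \<phi>" and ad: "\<And>j. frame U \<phi> j 0 = axis j 1"
  obtains U' where "framed U' (psi_hat A H X a \<phi> \<circ> \<phi>)" "good_frame (frame U' (psi_hat A H X a \<phi> \<circ> \<phi>))"
    "\<And>j. frame U' (psi_hat A H X a \<phi> \<circ> \<phi>) j 0 = axis j 1"
proof -
  have f: "framed_chart A X a U \<phi>" and UV: "U \<subseteq> V" using \<phi> by blast+
  interpret c: framed_chart A X a U \<phi> by fact
  interpret F: filtered_frame w c.b c.L by (rule framed_chart_filtered[OF f UV])
  have step: "\<exists>U'. framed U' (P \<circ> \<phi>) \<and> (\<forall>j. frame U' (P \<circ> \<phi>) j 0 = axis j 1) \<and>
      (\<forall>I k. word_op c.b I (\<lambda>x. P x $ k) 0 = word_op (frame U' (P \<circ> \<phi>)) I (\<lambda>x. x $ k) 0)"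
    if P: "psi_hat_form w P" for P
  proof -
    note s = psi_hat_form_smooth[OF P] and P0 = psi_hat_form_derivative(1)[OF P]
    have d: "frechet_derivative P (at 0) = (\<lambda>v. v)" by (rule ext) (rule psi_hat_form_derivative(2)[OF P])
    obtain U' where U': "framed U' (P \<circ> \<phi>)" "\<forall>\<^sub>F x in nhds 0. \<forall>j. frechet_derivative P (at x) (c.b j x) = frame U' (P \<circ> \<phi>) j (P x)"
      by (rule chart_change[where \<phi>="P \<circ> \<phi>", OF f s P0]) (simp_all add: d)
    have f': "framed_chart A X a U' (P \<circ> \<phi>)" using U' by blast
    interpret c': framed_chart A X a U' "P \<circ> \<phi>" by fact
    have "frame U' (P \<circ> \<phi>) j 0 = axis j 1" for j
      by (rule sym) (use chart_change_at_0[OF U'(2) P0, of j] in \<open>simp only: d ad\<close>)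
    moreover have "word_op c.b I (\<lambda>x. P x $ k) 0 = word_op c'.b I (\<lambda>x. x $ k) 0" for I k
    proof -
      have "\<forall>\<^sub>F x in nhds 0. word_op c.b I (\<lambda>x. P x $ k) x = word_op c'.b I (\<lambda>x. x $ k) (P x)"
        by (rule word_op_transition[where f="\<lambda>x. x $ k", OF s _ smooth_around_vec_nth[OF smooth_around_ident] U'(2)])
           (unfold P0, rule c'.b_smooth)
      from eventually_nhds_x_imp_x[OF this] show ?thesis unfolding P0 .
    qed
    ultimately show ?thesis using U'(1) by blast
  qed
  have iff: "privileged_coordinates A H X a (P \<circ> \<phi>) \<longleftrightarrow> (\<forall>k I. wt w I < w k \<longrightarrow> word_op c.b I (\<lambda>x. P x $ k) 0 = 0)"
    if P: "psi_hat_form w P" for P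
  proof -
    obtain U' where U': "framed U' (P \<circ> \<phi>)" "\<And>j. frame U' (P \<circ> \<phi>) j 0 = axis j 1"
      and wo: "\<And>I k. word_op c.b I (\<lambda>x. P x $ k) 0 = word_op (frame U' (P \<circ> \<phi>)) I (\<lambda>x. x $ k) 0"
      using step[OF P] by blast
    have f': "framed_chart A X a U' (P \<circ> \<phi>)" using U' by blast
    interpret c': framed_chart A X a U' "P \<circ> \<phi>" by fact
    have la: "linearly_adapted A X a (P \<circ> \<phi>)" using linearly_adapted_iff[OF f'] U'(2) by blast
    show ?thesis
    proof
      assume "privileged_coordinates A H X a (P \<circ> \<phi>)"
      then show "\<forall>k I. wt w I < w k \<longrightarrow> word_op c.b I (\<lambda>x. P x $ k) 0 = 0"
        unfolding privileged_coordinates_def has_order_def c'.frame_word_coordinate wo by blast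
    next
      assume o: "\<forall>k I. wt w I < w k \<longrightarrow> word_op c.b I (\<lambda>x. P x $ k) 0 = 0"
      have "good_frame c'.b" unfolding good_frame_def
        using o c'.b_smooth unfolding wo by (simp add: U'(2) axis_def)
      from la good_has_order[OF f' this] show "privileged_coordinates A H X a (P \<circ> \<phi>)"
        unfolding privileged_coordinates_def by blast
    qed
  qed
  have "\<exists>!P. psi_hat_form w P \<and> privileged_coordinates A H X a (P \<circ> \<phi>)"
    using F.psi_hat_ex1[OF ad] by (simp add: iff cong: conj_cong)
  from theI'[OF this] have P: "psi_hat_form w (psi_hat A H X a \<phi>)" "privileged_coordinates A H X a (psi_hat A H X a \<phi> \<circ> \<phi>)"
    unfolding psi_hat_def by blast+
  obtain U' where U': "framed U' (psi_hat A H X a \<phi> \<circ> \<phi>)" "\<And>j. frame U' (psi_hat A H X a \<phi> \<circ> \<phi>) j 0 = axis j 1"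
    using step[OF P(1)] by blast
  have "good_frame (frame U' (psi_hat A H X a \<phi> \<circ> \<phi>))"
    by (rule has_order_good) (use U' P(2) in \<open>simp_all add: privileged_coordinates_def axis_def\<close>)
  with U' show thesis using that by blast
qed

end

subsection \<open>Carnot coordinates\<close>

lemma (in weights) ad_series_at_0:
  assumes "0 < R" shows "ad_series f c R 0 v = f 0 *\<^sub>R v"
proof -
  obtain R' where R': "R = Suc R'" using assms by (cases R) auto
  have "algebra_bracket c 0 u = 0" for u by (simp add: algebra_bracket_def)
  then show ?thesis unfolding ad_series_def R' sum.lessThan_Suc_shift by simp
qed

lemma linear_axis_eqI:
  fixes L :: "real ^ 'n \<Rightarrow> real ^ 'n"
  assumes "linear L" "\<And>j. L (axis j 1) = axis j 1" shows "L v = v"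
  using linear_axis_expand[OF assms(1), of v] by (simp add: assms(2) vec_axis_expand[symmetric])

text \<open>The linear part of \<open>\<Theta>\<close> lowers weights strictly: its component
  \<open>k\<close> can contain \<open>x_j\<close> only if \<open>w j > w k\<close>. Hence it is
  nilpotent, and descending induction on the weight shows \<open>v = 0\<close>.\<close>

lemma (in weights) weighted_perturbation_inj:
  assumes \<Theta>: "smooth_around 0 \<Theta>" "\<And>k. worder w (w k + 1) (\<lambda>x. \<Theta> x $ k)"
    and v: "v + frechet_derivative \<Theta> (at 0) v = 0"
  shows "v = 0"
proof -
  have p0: "frechet_derivative \<Theta> (at 0) (axis j 1) $ k = 0" if "w j \<le> w k" for j k
  proof -
    have "frechet_derivative (\<lambda>x. \<Theta> x $ k) (at 0) (axis j 1) = 0"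
      by (rule worder_at_0[OF worder_partial[OF \<Theta>(2)]]) (use that in simp)
    then show ?thesis unfolding frechet_vec_nth_vec[OF \<Theta>(1)] .
  qed
  define R where "R = Max (range w)"
  have R: "w k \<le> R" for k unfolding R_def by (rule Max_ge) auto
  have "v $ k = 0" for k
  proof (induction "R - w k" arbitrary: k rule: less_induct)
    case less
    have "frechet_derivative \<Theta> (at 0) v $ k = (\<Sum>j\<in>UNIV. v $ j * frechet_derivative \<Theta> (at 0) (axis j 1) $ k)"
      using arg_cong[OF linear_axis_expand[OF smooth_around_linear_frechet[OF \<Theta>(1)], of v], of "\<lambda>u. u $ k"] by simp
    also have "\<dots> = 0"
    proof (rule sum.neutral, rule ballI)
      fix j
      show "v $ j * frechet_derivative \<Theta> (at 0) (axis j 1) $ k = 0"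
      proof (cases "w j \<le> w k")
        case True then show ?thesis using p0 by simp
      next
        case False
        then have "R - w j < R - w k" using R[of j] by linarith
        from less[OF this] show ?thesis by simp
      qed
    qed
    finally show ?case using arg_cong[OF v, of "\<lambda>u. u $ k"] by simp
  qed
  then show ?thesis by (simp add: vec_eq_iff)
qed

context carnot_frame begin

definition c\<^sub>a :: "'n \<Rightarrow> 'n \<Rightarrow> (real, 'n) vec" where
  "c\<^sub>a i j = (\<chi> k. if w k = w i + w j then structure_function A X i j a $ k else 0)"

lemma graded_c: "graded c\<^sub>a"
  by (simp add: graded_def c\<^sub>a_def)

lemma G_bracket_eq: "G_bracket A H X a = algebra_bracket c\<^sub>a"
  unfolding G_bracket_def algebra_bracket_def c\<^sub>a_def
  by (intro ext) (simp add: vec_eq_iff if_distrib[of "\<lambda>z. _ * z"] cong: if_cong)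

lemma framed_antisym:
  assumes "framed_chart A X a U \<phi>" shows "c\<^sub>a i j = - c\<^sub>a j i"
  using framed_chart.structure_function_antisym[OF assms, of i j]
  by (simp add: c\<^sub>a_def vec_eq_iff add.commute)

abbreviation Z :: "'n \<Rightarrow> (real, 'n) vec \<Rightarrow> (real, 'n) vec" where
  "Z \<equiv> left_invariant_field A r H X a"

lemma left_invariant_field_eq:
  assumes "framed_chart A X a U \<phi>"
  shows "Z j x = ad_series dynkin_coefficient c\<^sub>a r x (axis j 1)"
proof -
  have anti: "algebra_bracket c\<^sub>a u v = - algebra_bracket c\<^sub>a v u" for u v
    by (rule algebra_bracket_antisym[OF framed_antisym[OF assms]])
  show ?thesis unfolding left_invariant_field_def G_bracket_eq ad_series_def
    using frechet_derivativeI[OF dynkin_product_derivative[OF bounded_bilinear_algebra_bracket anti, where r=r and x=x]] by simp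
qed

lemma left_invariant_field_0:
  assumes "framed_chart A X a U \<phi>" shows "Z j 0 = axis j 1"
  unfolding left_invariant_field_eq[OF assms] using r1 by (simp add: ad_series_at_0 dynkin_coefficient_0)

lemma left_invariant_combination:
  assumes "framed_chart A X a U \<phi>" shows "combination Z x (s *\<^sub>R x) = x"
proof -
  have "combination (\<lambda>j x. ad_series dynkin_coefficient c\<^sub>a r x (axis j 1)) x (s *\<^sub>R x) = x"
    by (rule combination_ad_series[OF framed_antisym[OF assms]]) (use r1 in \<open>simp_all add: dynkin_coefficient_0\<close>)
  then show ?thesis by (simp only: combination_def left_invariant_field_eq[OF assms])
qed

text \<open>The differential of \<open>E\<close> in the frame is \<open>right_log\<close>, and the
  left-invariant fields are given by the reciprocal series, so \<open>E\<close> maps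
  \<open>Z j\<close> to the model field \<open>Y j\<close>. As \<open>E\<close> commutes with
  dilations, so does its inverse, which therefore equals its own rescaled limit and turns the model
  fields into \<open>Z j\<close>.\<close>

lemma exp_normal_coordinates:
  assumes \<phi>: "framed U \<phi>" and g: "good_frame (frame U \<phi>)" and ad: "\<And>j. frame U \<phi> j 0 = axis j 1"
  defines "E \<equiv> exp_map (model_field A H X a \<phi>)"
  obtains U' X' where "framed U' (inv E \<circ> \<phi>)" "good_frame (frame U' (inv E \<circ> \<phi>))"
    "\<And>j. frame U' (inv E \<circ> \<phi>) j 0 = axis j 1"
    "scaled_frame (frame U' (inv E \<circ> \<phi>)) X'" "\<And>j x. X' j (0, x) = Z j x"
proof -
  have f: "framed_chart A X a U \<phi>" and UV: "U \<subseteq> V" using \<phi> by blast+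
  interpret c: framed_chart A X a U \<phi> by fact
  interpret F: filtered_frame w c.b c.L by (rule framed_chart_filtered[OF f UV])
  obtain S where S: "scaled_frame c.b S" by (rule good_scaled_frame[OF g])
  define Y where "Y = (\<lambda>j x. S j (0, x))"
  have Yh: "homogeneous_frame Y" unfolding Y_def by (rule good_homogeneous_frame[OF g S])
  have EY: "E = exp_map Y" unfolding E_def model_field_eq[OF f S] Y_def ..
  have br: "frechet_derivative (Y j) (at z) (Y i z) - frechet_derivative (Y i) (at z) (Y j z) = combination Y (c\<^sub>a i j) z" for i j z
    using bracket_limit[OF g S F.b_bracket F.L_smooth F.L_graded, of i j z]
    by (simp add: Y_def combination_def c\<^sub>a_def c.structure_function_L cong: if_cong)
  have sE: "smooth_around x E" for x unfolding EY by (rule smooth_around_exp_map[OF Yh])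
  have hE: "E (dilation w s x) = dilation w s (E x)" for s x unfolding EY by (rule exp_map_homogeneous[OF Yh])
  have E0: "E 0 = 0" using hE[of 0 0] by simp
  have dE: "frechet_derivative E (at x) (Z j x) = Y j (E x)" for j x
    unfolding EY exp_map_derivative[OF Yh graded_c weight_le_r br] left_invariant_field_eq[OF f]
      right_log_ad_series[OF graded_c weight_le_r dynkin_coefficient_inverse] by (rule combination_axis)
  have dE0: "frechet_derivative E (at 0) v = v" for v
  proof (rule linear_axis_eqI[OF smooth_around_linear_frechet[OF sE]])
    fix j show "frechet_derivative E (at 0) (axis j 1) = axis j 1"
      using dE[of 0 j] unfolding left_invariant_field_0[OF f] E0 homogeneous_0[OF Yh] .
  qed
  have "inj (frechet_derivative E (at 0))" by (rule injI) (simp only: dE0)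
  note bij = homogeneous_map_bij[OF sE this hE]
  have IE: "inv E (E x) = x" "E (inv E x) = x" for x using bij(1) by (simp_all add: bij_is_inj bij_is_surj surj_f_inv_f)
  have I0: "inv E 0 = 0" using IE(1)[of 0] by (simp only: E0)
  have dI: "frechet_derivative (inv E) (at (E x)) (frechet_derivative E (at x) v) = v" for x v
  proof -
    have "frechet_derivative (\<lambda>x. inv E (E x)) (at x) v = v" unfolding IE by (simp add: frechet_derivativeI[OF has_derivative_ident])
    then show ?thesis using frechet_derivative_compose_smooth[OF sE bij(2), of x v] by simp
  qed
  have dI0: "frechet_derivative (inv E) (at 0) v = v" for v using dI[of 0 v] by (simp only: E0 dE0)
  have "inj (frechet_derivative (inv E) (at 0))" by (rule injI) (simp only: dI0)
  then obtain U' where U': "framed U' (inv E \<circ> \<phi>)"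
    and tr: "\<forall>\<^sub>F x in nhds 0. \<forall>j. frechet_derivative (inv E) (at x) (c.b j x) = frame U' (inv E \<circ> \<phi>) j (inv E x)"
    by (rule chart_change[where \<phi>="inv E \<circ> \<phi>", OF f bij(2) I0]) simp_all
  have f': "framed_chart A X a U' (inv E \<circ> \<phi>)" using U' by blast
  interpret c': framed_chart A X a U' "inv E \<circ> \<phi>" by fact
  have ad': "c'.b j 0 = axis j 1" for j using chart_change_at_0[OF tr I0, of j] by (simp only: dI0 ad)
  have hI: "inv E (dilation w s x) = dilation w s (inv E x)" for s x
    using hE[of s "inv E x"] IE by metis
  have g': "good_frame c'.b"
  proof (rule good_transition[OF g c'.b_smooth _ bij(2) I0 _ tr])
    show "c'.b j 0 $ k = (if j = k then 1 else 0)" for j k by (simp add: ad' axis_def)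
    show "worder w (w k) (\<lambda>x. inv E x $ k)" for k
      by (rule worderI[where G="\<lambda>p. inv E (snd p) $ k", OF smooth_around_vec_nth[OF bij(2)]
            smooth_around_vec_nth[OF smooth_around_compose[OF smooth_around_snd[OF smooth_around_ident] bij(2)]]])
         (simp add: hI)
  qed
  obtain S' where S': "scaled_frame c'.b S'" by (rule good_scaled_frame[OF g'])
  obtain G where G: "slice_smooth G"
    "\<And>x. \<forall>\<^sub>F p in nhds (0, x). inv E (dilation w (fst p) (snd p)) = dilation w (fst p) (G p)"
    "\<And>j x. frechet_derivative (\<lambda>x. G (0, x)) (at x) (S j (0, x)) = S' j (0, G (0, x))"
    by (rule transition_limit[OF g S g' S' bij(2) I0 tr]) blast
  have GI: "G (0, x) = inv E x" for x
  proof -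
    have ev: "\<forall>\<^sub>F p in nhds (0, x). fst p \<noteq> 0 \<longrightarrow> G p = inv E (snd p)"
      using G(2)[of x]
    proof eventually_elim
      case (elim p)
      show ?case using dilation_cancel[of "fst p" w "G p" "inv E (snd p)"] elim[symmetric] unfolding hI by blast
    qed
    have "smooth_around (0, x) (\<lambda>p. inv E (snd p))"
      by (rule smooth_around_compose[OF smooth_around_snd[OF smooth_around_ident] bij(2)])
    from eq_at_slice[OF slice_smoothD[OF G(1)] this ev] show ?thesis by simp
  qed
  have "S' j (0, x) = Z j x" for j x
    using G(3)[of "E x" j] dI[of x "Z j x"] unfolding GI IE dE Y_def by simp
  with U' g' ad' S' show thesis using that by blast
qed

lemma eps_coordinates:
  assumes \<kappa>: "local_chart A a \<kappa>" "\<kappa> a = 0"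
  obtains U S where "framed U (eps_map A H X a \<kappa> \<circ> \<kappa>)" "good_frame (frame U (eps_map A H X a \<kappa> \<circ> \<kappa>))"
    "\<And>j. frame U (eps_map A H X a \<kappa> \<circ> \<kappa>) j 0 = axis j 1"
    "scaled_frame (frame U (eps_map A H X a \<kappa> \<circ> \<kappa>)) S" "\<And>j x. S j (0, x) = Z j x"
proof -
  obtain U0 where "U0 \<subseteq> V" and U0: "framed_chart A X a U0 \<kappa>" by (rule local_chart_framed[OF \<kappa>])
  obtain T where T: "adapting_affine_map A X a \<kappa> = T" "linearly_adapted A X a (T \<circ> \<kappa>)"
    by (rule adapting_affine_map_eq[OF U0])
  have lc: "local_chart A a (T \<circ> \<kappa>)" "(T \<circ> \<kappa>) a = 0" using T(2) by (simp_all add: linearly_adapted_def)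
  obtain U1 where U1: "U1 \<subseteq> V" "framed_chart A X a U1 (T \<circ> \<kappa>)" by (rule local_chart_framed[OF lc])
  have ad: "frame U1 (T \<circ> \<kappa>) j 0 = axis j 1" for j using T(2) linearly_adapted_iff[OF U1(2)] by blast
  define \<phi> where "\<phi> = psi_hat A H X a (T \<circ> \<kappa>) \<circ> (T \<circ> \<kappa>)"
  obtain U2 where U2: "framed U2 \<phi>" "good_frame (frame U2 \<phi>)" "\<And>j. frame U2 \<phi> j 0 = axis j 1"
    unfolding \<phi>_def by (rule psi_hat_eq[OF conjI[OF U1] ad]) blast
  have "psi_map A H X a \<kappa> \<circ> \<kappa> = \<phi>" unfolding psi_map_def Let_def T(1) \<phi>_def by (simp add: comp_assoc)
  then have e: "eps_map A H X a \<kappa> \<circ> \<kappa> = inv (exp_map (model_field A H X a \<phi>)) \<circ> \<phi>"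
    unfolding eps_map_def Let_def comp_assoc by simp
  obtain U' S where "framed U' (inv (exp_map (model_field A H X a \<phi>)) \<circ> \<phi>)" "good_frame (frame U' (inv (exp_map (model_field A H X a \<phi>)) \<circ> \<phi>))"
    "\<And>j. frame U' (inv (exp_map (model_field A H X a \<phi>)) \<circ> \<phi>) j 0 = axis j 1"
    "scaled_frame (frame U' (inv (exp_map (model_field A H X a \<phi>)) \<circ> \<phi>)) S" "\<And>j x. S j (0, x) = Z j x"
    by (rule exp_normal_coordinates[OF U2]) blast
  then show thesis using that unfolding e by blast
qed

text \<open>Carnot coordinates without linear adaptedness.\<close>

definition carnot_at :: "('m \<Rightarrow> (real, 'n) vec) \<Rightarrow> bool" where
  "carnot_at \<phi> \<longleftrightarrow> local_chart A a \<phi> \<and> \<phi> a = 0 \<and> (\<forall>j. has_order w X a (\<lambda>p. \<phi> p $ j) (w j)) \<and>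
     (\<forall>j. is_model_field A w a \<phi> (w j) (X j) (Z j))"

lemma carnot_coordinates_iff:
  "carnot_coordinates A r H X a \<phi> \<longleftrightarrow> carnot_at \<phi> \<and> (\<forall>j. components \<phi> (X j a) = axis j 1)"
  unfolding carnot_coordinates_def privileged_coordinates_def linearly_adapted_def carnot_at_def by blast

text \<open>\<open>id + \<Theta>\<close> need not preserve the frame at \<open>0\<close>, but it
  changes neither orders nor models. If the derivative of \<open>\<Theta>\<close> vanishes, the
  frame at \<open>0\<close> is preserved as well.\<close>

lemma perturbation_carnot_at:
  assumes N: "pseudo_norm w N" and \<kappa>: "local_chart A a \<kappa>" "\<kappa> a = 0"
    and \<Theta>: "smooth_around 0 \<Theta>" "weighted_O w N 1 \<Theta>"
    and \<phi>: "\<forall>\<^sub>F p in nhds a. \<phi> p = ((\<lambda>x. x + \<Theta> x) \<circ> eps_map A H X a \<kappa> \<circ> \<kappa>) p"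
  shows "carnot_at \<phi>" "(\<Theta> has_derivative (\<lambda>_. 0)) (at 0) \<Longrightarrow> components \<phi> (X j a) = axis j 1"
proof -
  obtain U S where U: "framed U (eps_map A H X a \<kappa> \<circ> \<kappa>)" and gU: "good_frame (frame U (eps_map A H X a \<kappa> \<circ> \<kappa>))"
    and adU: "\<And>j. frame U (eps_map A H X a \<kappa> \<circ> \<kappa>) j 0 = axis j 1"
    and S: "scaled_frame (frame U (eps_map A H X a \<kappa> \<circ> \<kappa>)) S" "\<And>j x. S j (0, x) = Z j x"
    by (rule eps_coordinates[OF \<kappa>]) blast
  have f: "framed_chart A X a U (eps_map A H X a \<kappa> \<circ> \<kappa>)" using U by blast
  define g where "g = (\<lambda>x. x + \<Theta> x)"
  have wo: "worder w (w k + 1) (\<lambda>x. \<Theta> x $ k)" for k using \<Theta>(2) weighted_O_iff[OF N \<Theta>(1)] by blast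
  have "\<Theta> 0 $ k = 0" for k by (rule worder_at_0[OF wo]) simp
  then have g0: "g 0 = 0" by (simp add: g_def vec_eq_iff)
  have sg: "smooth_around 0 g" unfolding g_def by (rule smooth_around_add[OF smooth_around_ident \<Theta>(1)])
  have dg: "frechet_derivative g (at 0) v = v + frechet_derivative \<Theta> (at 0) v" for v
    unfolding g_def
    by (subst frechet_derivativeI[OF has_derivative_add[OF has_derivative_ident smooth_around_has_derivative[OF \<Theta>(1)]]]) simp
  have inj: "inj (frechet_derivative g (at 0))"
  proof (subst linear_injective_0[OF smooth_around_linear_frechet[OF sg]], intro allI impI)
    fix v assume v: "frechet_derivative g (at 0) v = 0"
    show "v = 0" by (rule weighted_perturbation_inj[OF \<Theta>(1) wo v[unfolded dg]])
  qed
  obtain U' where U': "framed U' \<phi>"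
    and tr: "\<forall>\<^sub>F x in nhds 0. \<forall>j. frechet_derivative g (at x) (frame U (eps_map A H X a \<kappa> \<circ> \<kappa>) j x) = frame U' \<phi> j (g x)"
    by (rule chart_change[OF f sg g0 inj, of \<phi>]) (use \<phi> in \<open>simp_all add: g_def\<close>)
  have f': "framed_chart A X a U' \<phi>" using U' by blast
  interpret c': framed_chart A X a U' \<phi> by fact
  have wg: "worder w (w k + 1) (\<lambda>x. g x $ k - x $ k)" for k using wo[of k] by (simp add: g_def)
  have g': "good_frame c'.b" by (rule good_perturbation(1)[OF gU c'.b_smooth sg wg tr])
  obtain S' where S': "scaled_frame c'.b S'" by (rule good_scaled_frame[OF g'])
  have "S' j (0, x) = Z j x" for j x
    using good_perturbation(2)[OF gU c'.b_smooth sg wg tr S(1) S', of j x] S(2) by simp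
  then have m: "is_model_field A w a \<phi> (w j) (X j) (Z j)" for j using scaled_frame_is_model[OF f' S', of j] by simp
  have "local_chart A a \<phi>" unfolding local_chart_def using c'.chart c'.a by blast
  then show "carnot_at \<phi>" unfolding carnot_at_def using c'.\<phi>a good_has_order[OF f' g'] m by blast
  assume "(\<Theta> has_derivative (\<lambda>_. 0)) (at 0)"
  from frechet_derivativeI[OF this] have "frechet_derivative g (at 0) v = v" for v by (simp add: dg)
  then show "components \<phi> (X j a) = axis j 1"
    unfolding c'.components_at using chart_change_at_0[OF tr g0, of j, unfolded adU] by simp
qed

text \<open>The chart \<open>\<kappa>\<close> is \<open>\<phi>\<close> itself. The transition from
  the \<open>\<epsilon>\<close>-Carnot coordinates built on \<open>\<phi>\<close> back to
  \<open>\<phi>\<close> has a rescaled limit that intertwines the left-invariant fields with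
  themselves, hence is the identity; so \<open>\<Theta>\<close>, the transition minus the identity,
  has one order more than the coordinates.\<close>

lemma carnot_at_perturbation:
  assumes N: "pseudo_norm w N" and \<phi>: "carnot_at \<phi>"
  obtains \<Theta> where "smooth_around 0 \<Theta>" "weighted_O w N 1 \<Theta>"
    "\<forall>\<^sub>F p in nhds a. \<phi> p = ((\<lambda>x. x + \<Theta> x) \<circ> eps_map A H X a \<phi> \<circ> \<phi>) p"
    "(\<And>j. components \<phi> (X j a) = axis j 1) \<Longrightarrow> (\<Theta> has_derivative (\<lambda>_. 0)) (at 0)"
proof -
  have lc: "local_chart A a \<phi>" "\<phi> a = 0" and o: "\<And>j. has_order w X a (\<lambda>p. \<phi> p $ j) (w j)"
    and m: "\<And>j. is_model_field A w a \<phi> (w j) (X j) (Z j)" using \<phi> unfolding carnot_at_def by blast+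
  obtain U' where U': "U' \<subseteq> V" "framed_chart A X a U' \<phi>" by (rule local_chart_framed[OF lc])
  interpret c': framed_chart A X a U' \<phi> by fact
  note Z0 = left_invariant_field_0[OF U'(2)]
  have g': "good_frame c'.b" by (rule has_order_good[OF U'(2) o model_diagonal[OF U'(2) m Z0]])
  obtain S' where S': "scaled_frame c'.b S'" by (rule good_scaled_frame[OF g'])
  have S'Z: "S' j (0, x) = Z j x" for j x by (rule model_unique[OF U'(2) S' m, symmetric])
  define \<phi>0 where "\<phi>0 = eps_map A H X a \<phi> \<circ> \<phi>"
  obtain U S where U: "framed U \<phi>0" and gU: "good_frame (frame U \<phi>0)"
    and adU: "\<And>j. frame U \<phi>0 j 0 = axis j 1"
    and S: "scaled_frame (frame U \<phi>0) S" "\<And>j x. S j (0, x) = Z j x"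
    unfolding \<phi>0_def by (rule eps_coordinates[OF lc]) blast
  have f: "framed_chart A X a U \<phi>0" using U by blast
  interpret c: framed_chart A X a U \<phi>0 by fact
  define \<Phi> where "\<Phi> = \<phi> \<circ> c.\<psi>"
  note tr = frame_transition[OF f U'(2), folded \<Phi>_def]
  obtain G where G: "slice_smooth G"
    "\<And>x. \<forall>\<^sub>F p in nhds (0, x). \<Phi> (dilation w (fst p) (snd p)) = dilation w (fst p) (G p)"
    "\<And>j x. frechet_derivative (\<lambda>x. G (0, x)) (at x) (S j (0, x)) = S' j (0, G (0, x))"
    by (rule transition_limit[OF gU S(1) g' S' tr]) blast
  \<comment> \<open>Homogeneity of the left-invariant fields is inherited from the model fields of
    the good frame in \<open>\<phi>\<close>, with which they coincide.\<close>
  have Zh: "homogeneous_frame Z" using good_homogeneous_frame[OF g' S'] unfolding S'Z .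
  have G0: "G (0, 0) = 0"
  proof -
    have "\<forall>\<^sub>F t in at 0. G (t, 0) = 0"
      using eventually_slice[OF G(2)[of 0]] eventually_at_neq_0
    proof eventually_elim
      case (elim t)
      then have "dilation w t 0 = dilation w t (G (t, 0))" by (simp add: tr(2))
      from dilation_cancel[OF elim(2) this] show ?case by simp
    qed
    from tendsto_unique[OF _ Lim_transform_eventually[OF tendsto_slice[OF slice_smoothD[OF G(1), of 0]] this] tendsto_const]
    show ?thesis by simp
  qed
  have Gx: "G (0, x) = x" for x
  proof (rule homogeneous_intertwiner_id[where g="\<lambda>x. G (0, x)", OF Zh left_invariant_combination[OF U'(2)]])
    show "smooth_around x (\<lambda>x. G (0, x))" for x by (rule smooth_around_slice[OF slice_smoothD[OF G(1)]])
    show "frechet_derivative (\<lambda>x. G (0, x)) (at x) (Z j x) = Z j (G (0, x))" for j x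
      using G(3)[of x j] unfolding S(2) S'Z .
  qed (rule G0)
  define \<Theta> where "\<Theta> = (\<lambda>x. \<Phi> x - x)"
  have s\<Theta>: "smooth_around 0 \<Theta>" unfolding \<Theta>_def by (rule smooth_around_diff[OF tr(1) smooth_around_ident])
  have wo: "worder w (w k + 1) (\<lambda>x. \<Theta> x $ k)" for k
  proof -
    let ?G = "\<lambda>p. G p $ k - snd p $ k"
    have sG: "slice_smooth ?G" unfolding slice_smooth_def
      by (intro allI smooth_around_diff smooth_around_vec_nth smooth_around_snd smooth_around_ident slice_smoothD G(1))
    have ev: "\<forall>\<^sub>F p in nhds (0, x). \<Theta> (dilation w (fst p) (snd p)) $ k = fst p ^ w k * ?G p" for x
      using G(2)[of x] by eventually_elim (simp add: \<Theta>_def right_diff_distrib)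
    have "worder w (w k) (\<lambda>x. \<Theta> x $ k)"
      by (rule worderI[where G="?G", OF smooth_around_vec_nth[OF s\<Theta>] slice_smoothD[OF sG] ev])
    \<comment> \<open>The limit is component \<open>k\<close> of \<open>G (0, x) - x\<close>, which
      is \<open>0\<close>; this gives the extra order.\<close>
    moreover have "((\<lambda>t. \<Theta> (dilation w t x) $ k / t ^ w k) \<longlongrightarrow> 0) (at 0)" for x
      using witness_tendsto[where f="\<lambda>x. \<Theta> x $ k" and N="w k", OF sG ev, of x] by (simp add: Gx)
    ultimately have "worder w (Suc (w k)) (\<lambda>x. \<Theta> x $ k)" by (rule worder_SucI)
    then show ?thesis by simp
  qed
  have "weighted_O w N 1 \<Theta>" using weighted_O_iff[OF N s\<Theta>] wo by blast
  moreover have "\<forall>\<^sub>F p in nhds a. \<phi> p = ((\<lambda>x. x + \<Theta> x) \<circ> eps_map A H X a \<phi> \<circ> \<phi>) p"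
    unfolding comp_assoc \<phi>0_def[symmetric]
  proof (rule eventually_mono[OF eventually_nhds_in_open[OF topological_chartD(1)[OF c.top] c.a]])
    fix p assume "p \<in> U"
    then show "\<phi> p = ((\<lambda>x. x + \<Theta> x) \<circ> \<phi>0) p" by (simp add: \<Theta>_def \<Phi>_def c.\<psi>\<phi>)
  qed
  moreover have "(\<Theta> has_derivative (\<lambda>_. 0)) (at 0)" if ad: "\<And>j. components \<phi> (X j a) = axis j 1"
  proof -
    have "frechet_derivative \<Phi> (at 0) v = v" for v
    proof (rule linear_axis_eqI[OF smooth_around_linear_frechet[OF tr(1)]])
      fix j show "frechet_derivative \<Phi> (at 0) (axis j 1) = axis j 1"
        using chart_change_at_0[OF tr(3,2), of j] unfolding adU c'.components_at[symmetric] ad .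
    qed
    then have "frechet_derivative \<Phi> (at 0) = (\<lambda>v. v)" by (rule ext)
    then have "(\<Phi> has_derivative (\<lambda>v. v)) (at 0)" using smooth_around_has_derivative[OF tr(1)] by simp
    from has_derivative_diff[OF this has_derivative_ident] show ?thesis by (simp add: \<Theta>_def)
  qed
  ultimately show thesis using that[of \<Theta>] s\<Theta> by blast
qed

end

text \<open>Carnot coordinates include linear adaptedness, while an
  \<open>O_w(\<parallel>x\<parallel>^{w+1})\<close> map may have a linear part that destroys it.
  Hence two exact equivalences: the first keeps linear adaptedness and asks that the derivative of
  \<open>\<Theta>\<close> at \<open>0\<close> vanish; the second leaves \<open>\<Theta>\<close> as
  it is and drops linear adaptedness from Carnot coordinates.\<close>

theorem corollary7p6:
  fixes A :: "('m::{t2_space, second_countable_topology}, 'n::{finite, linorder}) chart set"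
    and r :: nat
    and H :: "nat \<Rightarrow> 'm \<Rightarrow> 'm tangent_vector set"
    and a :: 'm
    and X :: "'n \<Rightarrow> 'm vfield"
    and N :: "(real, 'n) vec \<Rightarrow> real"
  assumes "carnot_manifold A r H"
    and "H_frame A H a X"
    and "pseudo_norm (weight A H) N"
  shows "(\<forall>\<phi>. carnot_coordinates A r H X a \<phi> \<longleftrightarrow>
           (\<exists>\<kappa> \<Theta>. local_chart A a \<kappa> \<and> \<kappa> a = 0 \<and>
              smooth_around 0 \<Theta> \<and> weighted_O (weight A H) N 1 \<Theta> \<and>
              (\<Theta> has_derivative (\<lambda>_. 0)) (at 0) \<and>
              (\<forall>\<^sub>F p in nhds a.
                 \<phi> p = ((\<lambda>x. x + \<Theta> x) \<circ> eps_map A H X a \<kappa> \<circ> \<kappa>) p))) \<and>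
         (\<forall>\<phi>. (local_chart A a \<phi> \<and> \<phi> a = 0 \<and>
              (\<forall>j. has_order (weight A H) X a (\<lambda>p. \<phi> p $ j) (weight A H j)) \<and>
              (\<forall>j. is_model_field A (weight A H) a \<phi> (weight A H j) (X j)
                     (left_invariant_field A r H X a j))) \<longleftrightarrow>
           (\<exists>\<kappa> \<Theta>. local_chart A a \<kappa> \<and> \<kappa> a = 0 \<and>
              smooth_around 0 \<Theta> \<and> weighted_O (weight A H) N 1 \<Theta> \<and>
              (\<forall>\<^sub>F p in nhds a.
                 \<phi> p = ((\<lambda>x. x + \<Theta> x) \<circ> eps_map A H X a \<kappa> \<circ> \<kappa>) p)))"
proof -
  obtain V where V: "open V" "a \<in> V" "\<And>j. local_section A (H (weight A H j)) V (X j)"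
    "\<And>q. q \<in> V \<Longrightarrow> is_basis UNIV (\<lambda>j. X j q) (tangent_space A q)"
    using assms(2) unfolding H_frame_def by blast
  interpret carnot_frame A r H X a V by unfold_locales (use assms(1) V in blast)+
  show ?thesis
    unfolding carnot_at_def[symmetric] carnot_coordinates_iff
  proof (intro conjI allI iffI)
    fix \<phi> assume \<phi>: "carnot_at \<phi> \<and> (\<forall>j. components \<phi> (X j a) = axis j 1)"
    then obtain \<Theta> where "smooth_around 0 \<Theta>" "weighted_O w N 1 \<Theta>"
      "\<forall>\<^sub>F p in nhds a. \<phi> p = ((\<lambda>x. x + \<Theta> x) \<circ> eps_map A H X a \<phi> \<circ> \<phi>) p"
      "(\<And>j. components \<phi> (X j a) = axis j 1) \<Longrightarrow> (\<Theta> has_derivative (\<lambda>_. 0)) (at 0)"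
      by (elim conjE) (rule carnot_at_perturbation[OF assms(3)], assumption, blast)
    then show "\<exists>\<kappa> \<Theta>. local_chart A a \<kappa> \<and> \<kappa> a = 0 \<and> smooth_around 0 \<Theta> \<and> weighted_O w N 1 \<Theta> \<and>
        (\<Theta> has_derivative (\<lambda>_. 0)) (at 0) \<and>
        (\<forall>\<^sub>F p in nhds a. \<phi> p = ((\<lambda>x. x + \<Theta> x) \<circ> eps_map A H X a \<kappa> \<circ> \<kappa>) p)"
      using \<phi> unfolding carnot_at_def by blast
  next
    fix \<phi> assume \<phi>: "carnot_at \<phi>"
    then obtain \<Theta> where "smooth_around 0 \<Theta>" "weighted_O w N 1 \<Theta>"
      "\<forall>\<^sub>F p in nhds a. \<phi> p = ((\<lambda>x. x + \<Theta> x) \<circ> eps_map A H X a \<phi> \<circ> \<phi>) p"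
      by (rule carnot_at_perturbation[OF assms(3)]) blast
    then show "\<exists>\<kappa> \<Theta>. local_chart A a \<kappa> \<and> \<kappa> a = 0 \<and> smooth_around 0 \<Theta> \<and> weighted_O w N 1 \<Theta> \<and>
        (\<forall>\<^sub>F p in nhds a. \<phi> p = ((\<lambda>x. x + \<Theta> x) \<circ> eps_map A H X a \<kappa> \<circ> \<kappa>) p)"
      using \<phi> unfolding carnot_at_def by blast
  next
    fix \<phi> assume "\<exists>\<kappa> \<Theta>. local_chart A a \<kappa> \<and> \<kappa> a = 0 \<and> smooth_around 0 \<Theta> \<and> weighted_O w N 1 \<Theta> \<and>
        (\<Theta> has_derivative (\<lambda>_. 0)) (at 0) \<and>
        (\<forall>\<^sub>F p in nhds a. \<phi> p = ((\<lambda>x. x + \<Theta> x) \<circ> eps_map A H X a \<kappa> \<circ> \<kappa>) p)"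
    then show "carnot_at \<phi>" by (elim exE conjE) (rule perturbation_carnot_at(1)[OF assms(3)], assumption+)
  next
    fix \<phi> j assume "\<exists>\<kappa> \<Theta>. local_chart A a \<kappa> \<and> \<kappa> a = 0 \<and> smooth_around 0 \<Theta> \<and> weighted_O w N 1 \<Theta> \<and>
        (\<Theta> has_derivative (\<lambda>_. 0)) (at 0) \<and>
        (\<forall>\<^sub>F p in nhds a. \<phi> p = ((\<lambda>x. x + \<Theta> x) \<circ> eps_map A H X a \<kappa> \<circ> \<kappa>) p)"
    then show "components \<phi> (X j a) = axis j 1" by (elim exE conjE) (rule perturbation_carnot_at(2)[OF assms(3)], assumption+)
  next
    fix \<phi> assume "\<exists>\<kappa> \<Theta>. local_chart A a \<kappa> \<and> \<kappa> a = 0 \<and> smooth_around 0 \<Theta> \<and> weighted_O w N 1 \<Theta> \<and>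
        (\<forall>\<^sub>F p in nhds a. \<phi> p = ((\<lambda>x. x + \<Theta> x) \<circ> eps_map A H X a \<kappa> \<circ> \<kappa>) p)"
    then show "carnot_at \<phi>" by (elim exE conjE) (rule perturbation_carnot_at(1)[OF assms(3)], assumption+)
  qed
qed

end
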